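(* Let $\Gamma$ be a countable discrete sofic group with sofic approximation $\Sigma$. Suppose that a probability measure-preserving action $\Gamma\curvearrowright(X,\mu)$ on a standard probability space has completely positive entropy with respect to $\Sigma$. Then the Koopman representation $\rho^0_{\Gamma\curvearrowright(X,\mu)}$ is embeddable into the infinite direct sum $\lambda_\Gamma^{\oplus\infty}$ of the left regular representation.
   Context: Representations. $\rho_{\Gamma\curvearrowright (X,\mu)}\colon\Gamma\to\mathcal{U}(L^2(X,\mu))$ is $(\rho_{\Gamma\curvearrowright (X,\mu)}(g)\xi)(x)=\xi(g^{-1}x)$; the Koopman representation $\rho^0_{\Gamma\curvearrowright(X,\mu)}$ is its restriction to $L^2(X,\mu)\ominus\mathbb{C}1$. $\lambda_\Gamma\colon\Gamma\to\mathcal{U}(\ell^2(\Gamma))$ is $(\lambda_\Gamma(g)f)(x)=f(g^{-1}x)$, and $\lambda_\Gamma^{\oplus\infty}$ is the direct sum of countably infinitely many copies of it. Sofic approximations. $u_d$ is the uniform probability measure on $\{1,\dots,d\}$ and $S_d$ is the symmetric group. A sofic approximation of a countable discrete group $\Gamma$ is a sequence $\Sigma=(\sigma_i\colon\Gamma\to S_{d_i})$ of functions (not assumed homomorphisms) such that $u_{d_i}(\{k:\sigma_i(g)\sigma_i(h)(k)=\sigma_i(gh)(k)\})\to1$ for all $g,h\in\Gamma$ and $u_{d_i}(\{k:\sigma_i(g)(k)\neq\sigma_i(h)(k)\})\to1$ for all $g\neq h$ in $\Gamma$. $\Gamma$ is sofic if it has a sofic approximation. Sofic measure entropy (Bowen,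 Kerr–Li; in Kerr's formulation). A finite observable on $X$ is a measurable map $\alpha\colon X\to A$ with $A$ finite. A finite observable $\beta\colon X\to B$ refines $\alpha$, written $\alpha\le\beta$, if there is $\pi\colon B\to A$ with $\pi(\beta(x))=\alpha(x)$ for a.e. $x$. For finite $F\subseteq\Gamma$, let $\widetilde{\beta}^{F}\colon X\to B^F$, $\widetilde\beta^F(x)(g)=\beta(g^{-1}x)$. For finite $F\subseteq \Gamma$ containing the identity $e$, $\delta>0$ and $\sigma\colon\Gamma\to S_d$, let $\mathrm{AP}(\beta,F,\delta,\sigma)$ be the set of all $\phi\colon\{1,\dots,d\}\to B^F$ with $$\sum_{b\in B^F}\left|u_d(\phi^{-1}(\{b\}))-\mu((\widetilde\beta^F)^{-1}(\{b\}))\right|<\delta,\qquad u_d(\{j:\phi(j)(g)\neq\phi(\sigma(g)^{-1}(j))(e)\})<\delta\ \text{ for all } g\in F.$$ Let $\pi^*\colon B^F\to A$, $\pi^*(b)=\pi(b(e))$. With $\log 0=-\infty$, put $$h_{\Sigma,\mu}(\alpha;\beta,F,\delta)=\limsup_{i\to\infty}\frac1{d_i}\log\left|\{\pi^*\circ\phi:\phi\in\mathrm{AP}(\beta,F,\delta,\sigma_i)\}\right|,\qquad h_{\Sigma,\mu}(\alpha;\beta)=\inf_{F,\delta}h_{\Sigma,\mu}(\alpha;\beta,F,\delta),$$ and $h_{\Sigma,\mu}(X,\Gamma)=\sup_\alpha\inf_{\beta\ge\alpha}h_{\Sigma,\mu}(\alpha;\beta)$, over all finite observables $\alpha$ and finite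 observables $\beta$ refining $\alpha$. Completely positive entropy. $\Gamma\curvearrowright(X,\mu)$ has completely positive entropy with respect to $\Sigma$ if for every factor $\Gamma\curvearrowright(Y,\nu)$ of $\Gamma\curvearrowright(X,\mu)$ such that $(Y,\nu)$ is not a one-atom space, $h_{\Sigma,\nu}(Y,\Gamma)>0$. *)

theory Defs
  imports "HOL-Probability.Probability" "HOL-Algebra.Group_Action"
begin

section \<open>Standard probability spaces and their actions\<close>

definition standard_borel :: "'x measure \<Rightarrow> bool" where
  "standard_borel M \<longleftrightarrow>
     (\<exists>T. completely_metrizable_space T \<and> second_countable T \<and> topspace T = space M \<and>
          sets M = sigma_sets (topspace T) {U. openin T U})"

definition standard_prob_space :: "'x measure \<Rightarrow> bool" where
  "standard_prob_space M \<longleftrightarrow> standard_borel M \<and> prob_space M"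

definition pmp_action ::
  "('g, 'm) monoid_scheme \<Rightarrow> 'x measure \<Rightarrow> ('g \<Rightarrow> 'x \<Rightarrow> 'x) \<Rightarrow> bool" where
  "pmp_action G M act \<longleftrightarrow>
     group_action G (space M) act \<and>
     (\<forall>g\<in>carrier G. act g \<in> measurable M M \<and> distr M M (act g) = M)"

definition factor_map ::
  "('g, 'm) monoid_scheme \<Rightarrow> 'x measure \<Rightarrow> ('g \<Rightarrow> 'x \<Rightarrow> 'x) \<Rightarrow>
   'y measure \<Rightarrow> ('g \<Rightarrow> 'y \<Rightarrow> 'y) \<Rightarrow> ('x \<Rightarrow> 'y) \<Rightarrow> bool" where
  "factor_map G M act N act' p \<longleftrightarrow>
     p \<in> measurable M N \<and> distr M N p = N \<and>
     (\<forall>g\<in>carrier G. AE x in M. p (act g x) = act' g (p x))"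

definition one_atom :: "'y measure \<Rightarrow> bool" where
  "one_atom N \<longleftrightarrow> (\<exists>y\<in>space N. measure N {y} = 1)"


section \<open>Sofic approximations\<close>

abbreviation unif :: "nat \<Rightarrow> nat measure" where
  "unif d \<equiv> uniform_count_measure {1..d}"

definition sofic_approximation ::
  "('g, 'm) monoid_scheme \<Rightarrow> (nat \<Rightarrow> nat) \<Rightarrow> (nat \<Rightarrow> 'g \<Rightarrow> nat \<Rightarrow> nat) \<Rightarrow> bool" where
  "sofic_approximation G d \<sigma> \<longleftrightarrow>
     (\<forall>i. 1 \<le> d i) \<and>
     (\<forall>i. \<forall>g\<in>carrier G. \<sigma> i g permutes {1..d i}) \<and>
     (\<forall>g\<in>carrier G. \<forall>h\<in>carrier G.
        (\<lambda>i. measure (unif (d i)) {k \<in> {1..d i}. \<sigma> i g (\<sigma> i h k) = \<sigma> i (g \<otimes>\<^bsub>G\<^esub> h) k})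
          \<longlonglongrightarrow> 1) \<and>
     (\<forall>g\<in>carrier G. \<forall>h\<in>carrier G. g \<noteq> h \<longrightarrow>
        (\<lambda>i. measure (unif (d i)) {k \<in> {1..d i}. \<sigma> i g k \<noteq> \<sigma> i h k}) \<longlonglongrightarrow> 1)"


section \<open>Sofic measure entropy\<close>

text \<open>Every finite set is in bijection with a finite set of natural numbers, so observables
  take values in finite subsets of \<^typ>\<open>nat\<close>; the codomain is part of the data.\<close>

definition finite_observable :: "'x measure \<Rightarrow> nat set \<Rightarrow> ('x \<Rightarrow> nat) \<Rightarrow> bool" where
  "finite_observable M A \<alpha> \<longleftrightarrow> finite A \<and> \<alpha> \<in> measurable M (count_space A)"

definition refines_via ::
  "'x measure \<Rightarrow> nat set \<Rightarrow> ('x \<Rightarrow> nat) \<Rightarrow> nat set \<Rightarrow> ('x \<Rightarrow> nat) \<Rightarrow> (nat \<Rightarrow> nat) \<Rightarrow> bool" where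
  "refines_via M A \<alpha> B \<beta> \<pi> \<longleftrightarrow> \<pi> \<in> B \<rightarrow> A \<and> (AE x in M. \<pi> (\<beta> x) = \<alpha> x)"

definition obs_name ::
  "('g, 'm) monoid_scheme \<Rightarrow> ('g \<Rightarrow> 'x \<Rightarrow> 'x) \<Rightarrow> ('x \<Rightarrow> nat) \<Rightarrow> 'g set \<Rightarrow> 'x \<Rightarrow> 'g \<Rightarrow> nat" where
  "obs_name G act \<beta> F x = (\<lambda>g\<in>F. \<beta> (act (inv\<^bsub>G\<^esub> g) x))"

text \<open>The set \<open>B\<^sup>F\<close> is the set \<open>F \<rightarrow>\<^sub>E B\<close> of extensional functions, and likewise
  for maps defined on \<open>{1..d}\<close>, so that equality and cardinality have their usual meaning.\<close>

definition AP ::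
  "('g, 'm) monoid_scheme \<Rightarrow> 'x measure \<Rightarrow> ('g \<Rightarrow> 'x \<Rightarrow> 'x) \<Rightarrow> nat set \<Rightarrow> ('x \<Rightarrow> nat) \<Rightarrow>
   'g set \<Rightarrow> real \<Rightarrow> nat \<Rightarrow> ('g \<Rightarrow> nat \<Rightarrow> nat) \<Rightarrow> (nat \<Rightarrow> 'g \<Rightarrow> nat) set" where
  "AP G M act B \<beta> F \<delta> d \<sigma> =
     {\<phi> \<in> {1..d} \<rightarrow>\<^sub>E (F \<rightarrow>\<^sub>E B).
        (\<Sum>b\<in>F \<rightarrow>\<^sub>E B. \<bar>measure (unif d) {j \<in> {1..d}. \<phi> j = b}
                        - measure M {x \<in> space M. obs_name G act \<beta> F x = b}\<bar>) < \<delta> \<and>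
        (\<forall>g\<in>F. measure (unif d) {j \<in> {1..d}. \<phi> j g \<noteq> \<phi> (inv_into UNIV (\<sigma> g) j) \<one>\<^bsub>G\<^esub>} < \<delta>)}"

definition log_card :: "'a set \<Rightarrow> ereal" where
  "log_card S = (if card S = 0 then -\<infinity> else ereal (ln (real (card S))))"

definition entropy_local ::
  "('g, 'm) monoid_scheme \<Rightarrow> (nat \<Rightarrow> nat) \<Rightarrow> (nat \<Rightarrow> 'g \<Rightarrow> nat \<Rightarrow> nat) \<Rightarrow>
   'x measure \<Rightarrow> ('g \<Rightarrow> 'x \<Rightarrow> 'x) \<Rightarrow> nat set \<Rightarrow> ('x \<Rightarrow> nat) \<Rightarrow> (nat \<Rightarrow> nat) \<Rightarrow>
   'g set \<Rightarrow> real \<Rightarrow> ereal" where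
  "entropy_local G d \<sigma> M act B \<beta> \<pi> F \<delta> =
     limsup (\<lambda>i. ereal (1 / real (d i)) *
       log_card ((\<lambda>\<phi>. \<lambda>j\<in>{1..d i}. \<pi> (\<phi> j \<one>\<^bsub>G\<^esub>)) ` AP G M act B \<beta> F \<delta> (d i) (\<sigma> i)))"

definition entropy_rel ::
  "('g, 'm) monoid_scheme \<Rightarrow> (nat \<Rightarrow> nat) \<Rightarrow> (nat \<Rightarrow> 'g \<Rightarrow> nat \<Rightarrow> nat) \<Rightarrow>
   'x measure \<Rightarrow> ('g \<Rightarrow> 'x \<Rightarrow> 'x) \<Rightarrow> nat set \<Rightarrow> ('x \<Rightarrow> nat) \<Rightarrow> (nat \<Rightarrow> nat) \<Rightarrow> ereal" where
  "entropy_rel G d \<sigma> M act B \<beta> \<pi> =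
     (INF (F, \<delta>) \<in> {(F, \<delta>). finite F \<and> F \<subseteq> carrier G \<and> \<one>\<^bsub>G\<^esub> \<in> F \<and> 0 < \<delta>}.
        entropy_local G d \<sigma> M act B \<beta> \<pi> F \<delta>)"

text \<open>The map \<open>\<pi>\<close> witnessing \<open>\<alpha> \<le> \<beta>\<close> is determined by \<open>\<alpha>\<close> and \<open>\<beta>\<close> only on the values that
  \<open>\<beta>\<close> takes with positive probability. The infimum over \<open>\<beta> \<ge> \<alpha>\<close> therefore ranges over \<open>\<beta>\<close>
  together with such a witness; as \<open>\<delta> \<rightarrow> 0\<close> the value of \<^const>\<open>entropy_rel\<close> does not
  depend on the choice of the witness.\<close>

definition sofic_entropy ::
  "('g, 'm) monoid_scheme \<Rightarrow> (nat \<Rightarrow> nat) \<Rightarrow> (nat \<Rightarrow> 'g \<Rightarrow> nat \<Rightarrow> nat) \<Rightarrow>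
   'x measure \<Rightarrow> ('g \<Rightarrow> 'x \<Rightarrow> 'x) \<Rightarrow> ereal" where
  "sofic_entropy G d \<sigma> M act =
     (SUP (A, \<alpha>) \<in> {(A, \<alpha>). finite_observable M A \<alpha>}.
        INF (B, \<beta>, \<pi>) \<in> {(B, \<beta>, \<pi>). finite_observable M B \<beta> \<and> refines_via M A \<alpha> B \<beta> \<pi>}.
          entropy_rel G d \<sigma> M act B \<beta> \<pi>)"

text \<open>Factors are taken on standard probability spaces whose points are real numbers, with an
  arbitrary standard Borel structure (not necessarily the one induced from the real line).
  A standard Borel space has at most continuum many points, so every factor is
  isomorphic to one of this form by transport of structure along an injection into the reals.\<close>

definition completely_positive_entropy ::
  "('g, 'm) monoid_scheme \<Rightarrow> (nat \<Rightarrow> nat) \<Rightarrow> (nat \<Rightarrow> 'g \<Rightarrow> nat \<Rightarrow> nat) \<Rightarrow>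
   'x measure \<Rightarrow> ('g \<Rightarrow> 'x \<Rightarrow> 'x) \<Rightarrow> bool" where
  "completely_positive_entropy G d \<sigma> M act \<longleftrightarrow>
     (\<forall>(N :: real measure) act' p.
        standard_prob_space N \<longrightarrow> pmp_action G N act' \<longrightarrow> factor_map G M act N act' p \<longrightarrow>
        \<not> one_atom N \<longrightarrow> 0 < sofic_entropy G d \<sigma> N act')"


section \<open>The complex Hilbert space of square-integrable functions\<close>

definition L2_fun :: "'x measure \<Rightarrow> ('x \<Rightarrow> complex) set" where
  "L2_fun M = {f \<in> borel_measurable M. integrable M (\<lambda>x. (cmod (f x))\<^sup>2)}"

definition L2_class :: "'x measure \<Rightarrow> ('x \<Rightarrow> complex) \<Rightarrow> ('x \<Rightarrow> complex) set" where
  "L2_class M f = {h \<in> L2_fun M. AE x in M. h x = f x}"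

definition L2 :: "'x measure \<Rightarrow> ('x \<Rightarrow> complex) set set" where
  "L2 M = L2_class M ` L2_fun M"

text \<open>Operations on classes are computed on chosen representatives; the lemmas below show
  that they do not depend on the choice.\<close>

definition L2_rep :: "('x \<Rightarrow> complex) set \<Rightarrow> 'x \<Rightarrow> complex" where
  "L2_rep \<xi> = (SOME f. f \<in> \<xi>)"

definition L2_add ::
  "'x measure \<Rightarrow> ('x \<Rightarrow> complex) set \<Rightarrow> ('x \<Rightarrow> complex) set \<Rightarrow> ('x \<Rightarrow> complex) set" where
  "L2_add M \<xi> \<eta> = L2_class M (\<lambda>x. L2_rep \<xi> x + L2_rep \<eta> x)"

definition L2_scale ::
  "'x measure \<Rightarrow> complex \<Rightarrow> ('x \<Rightarrow> complex) set \<Rightarrow> ('x \<Rightarrow> complex) set" where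
  "L2_scale M c \<xi> = L2_class M (\<lambda>x. c * L2_rep \<xi> x)"

definition L2_inner ::
  "'x measure \<Rightarrow> ('x \<Rightarrow> complex) set \<Rightarrow> ('x \<Rightarrow> complex) set \<Rightarrow> complex" where
  "L2_inner M \<xi> \<eta> = (LINT x|M. L2_rep \<xi> x * cnj (L2_rep \<eta> x))"

definition L2_translate ::
  "('g, 'm) monoid_scheme \<Rightarrow> 'x measure \<Rightarrow> ('g \<Rightarrow> 'x \<Rightarrow> 'x) \<Rightarrow>
   'g \<Rightarrow> ('x \<Rightarrow> complex) set \<Rightarrow> ('x \<Rightarrow> complex) set" where
  "L2_translate G M act g \<xi> = L2_class M (\<lambda>x. L2_rep \<xi> (act (inv\<^bsub>G\<^esub> g) x))"

lemma L2_rep_class: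
  assumes "f \<in> L2_fun M"
  shows "L2_rep (L2_class M f) \<in> L2_fun M" "AE x in M. L2_rep (L2_class M f) x = f x"
proof -
  have "f \<in> L2_class M f"
    using assms by (simp add: L2_class_def)
  then have "L2_rep (L2_class M f) \<in> L2_class M f"
    unfolding L2_rep_def by (rule someI[where P = "\<lambda>h. h \<in> L2_class M f"])
  then show "L2_rep (L2_class M f) \<in> L2_fun M" "AE x in M. L2_rep (L2_class M f) x = f x"
    by (auto simp: L2_class_def)
qed

lemma L2_class_cong:
  assumes "AE x in M. f x = g x"
  shows "L2_class M f = L2_class M g"
  unfolding L2_class_def
proof (intro Collect_cong conj_cong refl iffI)
  fix h
  show "AE x in M. h x = g x" if "AE x in M. h x = f x"
    using that assms by eventually_elim simp
  show "AE x in M. h x = f x" if "AE x in M. h x = g x"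
    using that assms by eventually_elim simp
qed

lemma L2_add_class:
  assumes "f \<in> L2_fun M" "g \<in> L2_fun M"
  shows "L2_add M (L2_class M f) (L2_class M g) = L2_class M (\<lambda>x. f x + g x)"
  unfolding L2_add_def
proof (rule L2_class_cong)
  show "AE x in M. L2_rep (L2_class M f) x + L2_rep (L2_class M g) x = f x + g x"
    using L2_rep_class(2)[OF assms(1)] L2_rep_class(2)[OF assms(2)] by eventually_elim simp
qed

lemma L2_scale_class:
  assumes "f \<in> L2_fun M"
  shows "L2_scale M c (L2_class M f) = L2_class M (\<lambda>x. c * f x)"
  unfolding L2_scale_def
proof (rule L2_class_cong)
  show "AE x in M. c * L2_rep (L2_class M f) x = c * f x"
    using L2_rep_class(2)[OF assms(1)] by eventually_elim simp
qed

lemma L2_inner_class: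
  assumes "f \<in> L2_fun M" "g \<in> L2_fun M"
  shows "L2_inner M (L2_class M f) (L2_class M g) = (LINT x|M. f x * cnj (g x))"
  unfolding L2_inner_def
proof (rule integral_cong_AE)
  have [measurable]: "f \<in> borel_measurable M" "g \<in> borel_measurable M"
      "L2_rep (L2_class M f) \<in> borel_measurable M" "L2_rep (L2_class M g) \<in> borel_measurable M"
    using assms L2_rep_class(1)[OF assms(1)] L2_rep_class(1)[OF assms(2)]
    by (auto simp: L2_fun_def)
  have [measurable]: "cnj \<in> borel_measurable borel"
    by (intro borel_measurable_continuous_onI continuous_intros)
  show "(\<lambda>x. L2_rep (L2_class M f) x * cnj (L2_rep (L2_class M g) x)) \<in> borel_measurable M"
    "(\<lambda>x. f x * cnj (g x)) \<in> borel_measurable M"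
    by measurable
  show "AE x in M. L2_rep (L2_class M f) x * cnj (L2_rep (L2_class M g) x) = f x * cnj (g x)"
    using L2_rep_class(2)[OF assms(1)] L2_rep_class(2)[OF assms(2)] by eventually_elim simp
qed

lemma L2_translate_class:
  assumes f: "f \<in> L2_fun M" and g: "g \<in> carrier G"
    and G: "group G" and act: "\<And>h. h \<in> carrier G \<Longrightarrow> act h \<in> measurable M M \<and> distr M M (act h) = M"
  shows "L2_translate G M act g (L2_class M f) = L2_class M (\<lambda>x. f (act (inv\<^bsub>G\<^esub> g) x))"
  unfolding L2_translate_def
proof (rule L2_class_cong)
  define h where "h = inv\<^bsub>G\<^esub> g"
  have h: "act h \<in> measurable M M" "distr M M (act h) = M"
    using act[of h] group.inv_closed[OF G g] by (auto simp: h_def)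
  have "AE x in distr M M (act h). L2_rep (L2_class M f) x = f x"
    unfolding h(2) by (rule L2_rep_class(2)[OF f])
  then have "AE x in M. L2_rep (L2_class M f) (act h x) = f (act h x)"
    by (rule AE_distrD[OF h(1)])
  then show "AE x in M. L2_rep (L2_class M f) (act (inv\<^bsub>G\<^esub> g) x) = f (act (inv\<^bsub>G\<^esub> g) x)"
    by (simp add: h_def)
qed


section \<open>Unitary representations\<close>

record ('g, 'v) unitary_rep =
  vectors :: "'v set"
  vadd :: "'v \<Rightarrow> 'v \<Rightarrow> 'v"
  vscale :: "complex \<Rightarrow> 'v \<Rightarrow> 'v"
  vinner :: "'v \<Rightarrow> 'v \<Rightarrow> complex"
  rho :: "'g \<Rightarrow> 'v \<Rightarrow> 'v"

definition translation_rep ::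
  "('g, 'm) monoid_scheme \<Rightarrow> 'x measure \<Rightarrow> ('g \<Rightarrow> 'x \<Rightarrow> 'x) \<Rightarrow>
   ('g, ('x \<Rightarrow> complex) set) unitary_rep" where
  "translation_rep G M act =
     \<lparr>vectors = L2 M, vadd = L2_add M, vscale = L2_scale M, vinner = L2_inner M,
      rho = L2_translate G M act\<rparr>"

definition koopman_rep ::
  "('g, 'm) monoid_scheme \<Rightarrow> 'x measure \<Rightarrow> ('g \<Rightarrow> 'x \<Rightarrow> 'x) \<Rightarrow>
   ('g, ('x \<Rightarrow> complex) set) unitary_rep" where
  "koopman_rep G M act =
     (translation_rep G M act)\<lparr>vectors := {\<xi> \<in> L2 M. L2_inner M \<xi> (L2_class M (\<lambda>_. 1)) = 0}\<rparr>"

text \<open>Here \<open>\<ell>\<^sup>2(\<Gamma>)\<close> is the space \<open>L\<^sup>2\<close> of counting measure on \<open>\<Gamma>\<close>.\<close>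

definition left_regular_rep ::
  "('g, 'm) monoid_scheme \<Rightarrow> ('g, ('g \<Rightarrow> complex) set) unitary_rep" where
  "left_regular_rep G =
     translation_rep G (count_space (carrier G)) (\<lambda>g. \<lambda>x\<in>carrier G. g \<otimes>\<^bsub>G\<^esub> x)"

definition infinite_multiple :: "('g, 'v) unitary_rep \<Rightarrow> ('g, nat \<Rightarrow> 'v) unitary_rep" where
  "infinite_multiple R =
     \<lparr>vectors = {v. (\<forall>n. v n \<in> vectors R) \<and> summable (\<lambda>n. Re (vinner R (v n) (v n)))},
      vadd = (\<lambda>v w n. vadd R (v n) (w n)),
      vscale = (\<lambda>c v n. vscale R c (v n)),
      vinner = (\<lambda>v w. \<Sum>n. vinner R (v n) (w n)),
      rho = (\<lambda>g v n. rho R g (v n))\<rparr>"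

text \<open>Embeddability means existence of a \<open>\<Gamma>\<close>-equivariant linear isometry; as the
  spaces are complete, this is unitary equivalence with a closed invariant subspace.\<close>

definition embeddable ::
  "('g, 'm) monoid_scheme \<Rightarrow> ('g, 'v) unitary_rep \<Rightarrow> ('g, 'w) unitary_rep \<Rightarrow> bool" where
  "embeddable G R S \<longleftrightarrow>
     (\<exists>T. T \<in> vectors R \<rightarrow> vectors S \<and>
        (\<forall>v\<in>vectors R. \<forall>w\<in>vectors R. T (vadd R v w) = vadd S (T v) (T w)) \<and>
        (\<forall>c. \<forall>v\<in>vectors R. T (vscale R c v) = vscale S c (T v)) \<and>
        (\<forall>v\<in>vectors R. \<forall>w\<in>vectors R. vinner S (T v) (T w) = vinner R v w) \<and>
        (\<forall>g\<in>carrier G. \<forall>v\<in>vectors R. T (rho R g v) = rho S g (T v)))"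

end

theory Submission
  imports Defs "HOL-Library.Function_Algebras" "HOL-Computational_Algebra.Formal_Power_Series"
begin

text \<open>Call \<open>z\<close> a Bessel vector of an orthogonal representation if \<open>u \<mapsto> (\<langle>u, g z\<rangle>)\<^sub>g\<close> is bounded into
  \<open>\<ell>\<^sup>2(\<Gamma>)\<close>. If the Bessel vectors are total, a countable Bessel system of translates can be
  tightened to a Parseval frame of translates, whose coefficient map is an equivariant isometry into
  \<open>\<lambda>\<^sub>\<Gamma>\<^sup>\<oplus>\<^sup>\<infinity>\<close>.

  If \<open>f\<close> is orthogonal to all Bessel vectors, then \<open>f\<close> is almost fixed by some \<open>a\<close> in \<open>\<real>\<Gamma>\<close> with
  small \<open>\<ell>\<^sup>2\<close>-norm. In a sofic model \<open>a\<close> acts as a matrix of small normalised Hilbert--Schmidt norm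
  that almost fixes every microstate of \<open>f\<close>; such vectors are determined up to a small error by a
  coarse rounding, so there are only subexponentially many. The factor generated by \<open>f\<close> therefore
  has no positive entropy, and completely positive entropy makes \<open>f\<close> constant. The argument is run over
  the real numbers, and real and imaginary parts are combined at the end.\<close>

text \<open>A vector orthogonal to all Bessel vectors is singular to the regular representation: the
  closed cyclic space of \<open>(f, \<delta>)\<close> contains \<open>(0, \<delta>)\<close>, so
  elements of the group ring that are close to the identity in l2 almost kill \<open>f\<close>.
  Subtracting such an element from the identity gives the small element that almost fixes
  \<open>f\<close>. The obstacle on the entropy side is that this element is small in l2 only and
  carries no operator norm bound, so it cannot be used to contract the distance between two
  microstates. It can, however, absorb a random rounding error: independent centred errors of mesh
  \<open>L\<close> are seen through its matrix with variance of order \<open>L^2\<close> times the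
  squared Hilbert--Schmidt norm. The mesh may therefore be huge, so that nearly all rounded
  coordinates vanish and the rounded vectors are few. This dictates the order of choices: the mesh
  comes from the entropy bound and the size of \<open>f\<close> alone, and only then is the group
  ring element chosen, small compared with the mesh.\<close>

instantiation "fun" :: (type, real_vector) real_vector
begin

text \<open>Pointwise scaling makes \<open>subspace\<close> and \<open>span\<close> available for
  sets of functions.\<close>

definition scaleR_fun :: "real \<Rightarrow> ('a \<Rightarrow> 'b) \<Rightarrow> 'a \<Rightarrow> 'b" where
  "scaleR_fun r f = (\<lambda>x. r *\<^sub>R f x)"

instance
  by standard (auto simp: scaleR_fun_def fun_eq_iff algebra_simps)

end

section \<open>Abstract theory: orthogonal representations, Bessel vectors and frames of
  translates\<close>

section \<open>Complete semi-inner product spaces\<close>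

text \<open>Vectors will be functions rather than classes modulo null sets, so the form is only
  semidefinite: \<open>ip u u = 0\<close> does not give \<open>u = 0\<close>, and identities between
  vectors are used in the weak form of equal inner products.\<close>

locale semi_inner =
  fixes V :: "'v::real_vector set" and ip :: "'v \<Rightarrow> 'v \<Rightarrow> real"
  assumes subspace_V: "subspace V"
    and ip_add: "\<lbrakk>u \<in> V; v \<in> V; w \<in> V\<rbrakk> \<Longrightarrow> ip (u + v) w = ip u w + ip v w"
    and ip_scale: "\<lbrakk>u \<in> V; w \<in> V\<rbrakk> \<Longrightarrow> ip (r *\<^sub>R u) w = r * ip u w"
    and ip_sym: "\<lbrakk>u \<in> V; v \<in> V\<rbrakk> \<Longrightarrow> ip u v = ip v u"
    and ip_nonneg: "u \<in> V \<Longrightarrow> 0 \<le> ip u u"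
begin

lemma V_zero [simp]: "0 \<in> V"
  using subspace_V by (rule subspace_0)

lemma V_add [simp]: "u \<in> V \<Longrightarrow> v \<in> V \<Longrightarrow> u + v \<in> V"
  using subspace_V by (rule subspace_add)

lemma V_scale [simp]: "u \<in> V \<Longrightarrow> r *\<^sub>R u \<in> V"
  using subspace_V by (rule subspace_scale)

lemma V_diff [simp]: "u \<in> V \<Longrightarrow> v \<in> V \<Longrightarrow> u - v \<in> V"
  using subspace_V by (rule subspace_diff)

lemma V_sum: "(\<And>i. i \<in> I \<Longrightarrow> u i \<in> V) \<Longrightarrow> sum u I \<in> V"
  using subspace_V by (rule subspace_sum)

lemma ip_add_right: "\<lbrakk>u \<in> V; v \<in> V; w \<in> V\<rbrakk> \<Longrightarrow> ip w (u + v) = ip w u + ip w v"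
  using ip_add[of u v w] by (simp add: ip_sym)

lemma ip_scale_right: "\<lbrakk>u \<in> V; w \<in> V\<rbrakk> \<Longrightarrow> ip w (r *\<^sub>R u) = r * ip w u"
  using ip_scale[of u w r] by (simp add: ip_sym)

lemma ip_diff: "\<lbrakk>u \<in> V; v \<in> V; w \<in> V\<rbrakk> \<Longrightarrow> ip (u - v) w = ip u w - ip v w"
  using ip_add[of "u - v" v w] by simp

lemma ip_diff_right: "\<lbrakk>u \<in> V; v \<in> V; w \<in> V\<rbrakk> \<Longrightarrow> ip w (u - v) = ip w u - ip w v"
  using ip_add_right[of "u - v" v w] by simp

lemma ip_zero [simp]: "w \<in> V \<Longrightarrow> ip 0 w = 0" "w \<in> V \<Longrightarrow> ip w 0 = 0"
  using ip_scale[of w w 0] ip_scale_right[of w w 0] by simp_all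

lemma ip_sum: "\<lbrakk>\<And>i. i \<in> I \<Longrightarrow> u i \<in> V; w \<in> V\<rbrakk> \<Longrightarrow> ip (sum u I) w = (\<Sum>i\<in>I. ip (u i) w)"
  by (induction I rule: infinite_finite_induct) (simp_all add: ip_add V_sum)

lemma ip_sum_right: "\<lbrakk>\<And>i. i \<in> I \<Longrightarrow> u i \<in> V; w \<in> V\<rbrakk> \<Longrightarrow> ip w (sum u I) = (\<Sum>i\<in>I. ip w (u i))"
  by (induction I rule: infinite_finite_induct) (simp_all add: ip_add_right V_sum)

lemmas ip_linear = ip_add ip_add_right ip_diff ip_diff_right ip_scale ip_scale_right

lemma ip_square_add: "\<lbrakk>u \<in> V; v \<in> V\<rbrakk> \<Longrightarrow> ip (u + v) (u + v) = ip u u + 2 * ip u v + ip v v"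
  by (simp add: ip_linear ip_sym)

lemma ip_square_diff: "\<lbrakk>u \<in> V; v \<in> V\<rbrakk> \<Longrightarrow> ip (u - v) (u - v) = ip u u - 2 * ip u v + ip v v"
  by (simp add: ip_linear ip_sym)

lemma ip_square_diff_commute: "\<lbrakk>u \<in> V; v \<in> V\<rbrakk> \<Longrightarrow> ip (u - v) (u - v) = ip (v - u) (v - u)"
  by (simp add: ip_square_diff ip_sym)

lemma quadratic_nonneg_imp_zero:
  fixes b c :: real
  assumes "\<And>t. 0 \<le> 2 * t * b + t\<^sup>2 * c" and "0 \<le> c"
  shows "b = 0"
proof (rule ccontr)
  assume "b \<noteq> 0"
  \<comment> \<open>Testing at \<open>t = - b / (c + 1)\<close> covers \<open>c = 0\<close> as
    well.\<close>
  define d where "d = c + 1"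
  have d: "d > 0" "c = d - 1" using assms(2) by (auto simp: d_def)
  have "0 \<le> (2 * (- b / d) * b + (- b / d)\<^sup>2 * c) * d\<^sup>2"
    by (intro mult_nonneg_nonneg assms(1)) auto
  also have "\<dots> = 2 * (- b / d * d) * b * d + (- b / d * d)\<^sup>2 * c"
    by (simp add: algebra_simps power2_eq_square)
  also have "\<dots> = - (b\<^sup>2 * (c + 2))"
  proof -
    have e: "- b / d * d = - b" using d by simp
    show ?thesis unfolding e unfolding d_def by (simp add: power2_eq_square algebra_simps)
  qed
  also have "\<dots> < 0"
    using \<open>b \<noteq> 0\<close> assms(2) by (auto intro!: mult_pos_pos)
  finally show False by simp
qed

lemma Cauchy_Schwarz: 
  assumes "u \<in> V" "v \<in> V"
  shows "(ip u v)\<^sup>2 \<le> ip u u * ip v v"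
proof (cases "ip v v = 0")
  case True
  \<comment> \<open>A null vector \<open>v\<close> need not be 0, but the quadratic in
    \<open>t\<close> degenerates to an affine function that is bounded below, so its slope
    vanishes.\<close>
  have "0 \<le> 2 * t * ip v u + t\<^sup>2 * 0 + ip u u" for t
  proof -
    have "0 \<le> ip (u + t *\<^sub>R v) (u + t *\<^sub>R v)" using assms by (intro ip_nonneg) auto
    then show ?thesis using True assms by (simp add: ip_linear ip_sym[of v u])
  qed
  note quad = this
  have "ip v u = 0"
  proof (rule ccontr)
    assume "ip v u \<noteq> 0"
    then have "2 * (- (ip u u + 1) / (2 * ip v u)) * ip v u = - (ip u u + 1)" by simp
    with quad[of "- (ip u u + 1) / (2 * ip v u)"] show False by simp
  qed
  then show ?thesis using assms True by (simp add: ip_sym[of v u])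
next
  case False
  then have pos: "0 < ip v v" using ip_nonneg[of v] assms by linarith
  have "0 \<le> ip (ip v v *\<^sub>R u - ip u v *\<^sub>R v) (ip v v *\<^sub>R u - ip u v *\<^sub>R v)"
    using assms by (intro ip_nonneg) auto
  also have "\<dots> = ip v v * (ip u u * ip v v - (ip u v)\<^sup>2)"
    using assms by (simp add: ip_linear ip_sym[of v u] algebra_simps power2_eq_square)
  finally show ?thesis using pos by (simp add: zero_le_mult_iff)
qed

lemma ip_square_add_le: "\<lbrakk>u \<in> V; v \<in> V\<rbrakk> \<Longrightarrow> ip (u + v) (u + v) \<le> 2 * ip u u + 2 * ip v v"
  using ip_nonneg[of "u - v"] by (simp add: ip_square_add ip_square_diff)

lemma tendsto_ip:
  assumes X: "\<And>n. X n \<in> V" "l \<in> V" "(\<lambda>n. ip (X n - l) (X n - l)) \<longlonglongrightarrow> 0" and u: "u \<in> V"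
  shows "(\<lambda>n. ip (X n) u) \<longlonglongrightarrow> ip l u"
proof -
  have "(\<lambda>n. sqrt (ip (X n - l) (X n - l) * ip u u)) \<longlonglongrightarrow> sqrt (0 * ip u u)"
    by (intro tendsto_intros X)
  then have lim: "(\<lambda>n. sqrt (ip (X n - l) (X n - l) * ip u u)) \<longlonglongrightarrow> 0" by simp
  have "(\<lambda>n. ip (X n - l) u) \<longlonglongrightarrow> 0"
  proof (rule Lim_null_comparison[OF _ lim])
    show "\<forall>\<^sub>F n in sequentially. norm (ip (X n - l) u) \<le> sqrt (ip (X n - l) (X n - l) * ip u u)"
      using Cauchy_Schwarz[OF V_diff[OF X(1) X(2)] u]
      by (intro always_eventually allI real_le_rsqrt) simp
  qed
  then have "(\<lambda>n. ip (X n - l) u + ip l u) \<longlonglongrightarrow> 0 + ip l u"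
    by (intro tendsto_intros)
  then show ?thesis using X u by (simp add: ip_diff)
qed

lemma tendsto_ip_square:
  assumes X: "\<And>n. X n \<in> V" "l \<in> V" "(\<lambda>n. ip (X n - l) (X n - l)) \<longlonglongrightarrow> 0"
  shows "(\<lambda>n. ip (X n) (X n)) \<longlonglongrightarrow> ip l l"
proof -
  have "(\<lambda>n. ip (X n - l) (X n - l) + 2 * ip (X n) l - ip l l) \<longlonglongrightarrow> 0 + 2 * ip l l - ip l l"
    by (intro tendsto_intros tendsto_ip X)
  then show ?thesis using X by (simp add: ip_square_diff)
qed

end

locale semi_hilbert = semi_inner +
  assumes complete: "\<And>X. \<lbrakk>\<And>n. X n \<in> V;
      \<And>e. e > 0 \<Longrightarrow> \<exists>N. \<forall>m\<ge>N. \<forall>n\<ge>N. ip (X m - X n) (X m - X n) < e\<rbrakk>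
      \<Longrightarrow> \<exists>l\<in>V. (\<lambda>n::nat. ip (X n - l) (X n - l)) \<longlonglongrightarrow> 0"
begin

text \<open>Minimise \<open>ip c c - 2 * \<phi> c\<close> over \<open>C\<close>; by the parallelogram law minimising sequences are
  Cauchy. For \<open>C = V\<close> this is the Riesz representation theorem, for \<open>\<phi> = ip q\<close> the limit is the
  orthogonal projection of \<open>q\<close> to the closure of \<open>C\<close>.\<close>
lemma Riesz_subspace:
  assumes C: "subspace C" "C \<subseteq> V"
    and \<phi>_add: "\<And>c c'. \<lbrakk>c \<in> C; c' \<in> C\<rbrakk> \<Longrightarrow> \<phi> (c + c') = \<phi> c + \<phi> c'"
    and \<phi>_scale: "\<And>c r. c \<in> C \<Longrightarrow> \<phi> (r *\<^sub>R c) = r * \<phi> c"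
    and bdd: "\<And>c. c \<in> C \<Longrightarrow> (\<phi> c)\<^sup>2 \<le> K * ip c c" "0 \<le> K"
  shows "\<exists>w\<in>V. (\<forall>e>0. \<exists>c\<in>C. ip (c - w) (c - w) < e) \<and> (\<forall>c\<in>C. \<phi> c = ip c w)"
proof -
  define Q where "Q c = ip c c - 2 * \<phi> c" for c
  have CV: "c \<in> V" if "c \<in> C" for c using C that by auto
  have C_add: "c + c' \<in> C" if "c \<in> C" "c' \<in> C" for c c' using C that by (simp add: subspace_add)
  have C_scale: "r *\<^sub>R c \<in> C" if "c \<in> C" for c r using C that by (simp add: subspace_scale)
  have Q_lower: "- K \<le> Q c" if c: "c \<in> C" for c
  proof -
    have ic: "0 \<le> ip c c" using CV[OF c] by (rule ip_nonneg)
    \<comment> \<open>Boundedness below, from the inequality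
      \<open>4 * K * x \<le> (K + x)^2\<close>.\<close>
    have "(2 * \<phi> c)\<^sup>2 \<le> 4 * (K * ip c c)" using bdd(1)[OF c] by simp
    also have "\<dots> \<le> (K + ip c c)\<^sup>2"
      using sum_squares_bound[of K "ip c c"] by (simp add: power2_eq_square algebra_simps)
    finally have "2 * \<phi> c \<le> K + ip c c"
      by (rule power2_le_imp_le) (use bdd(2) ic in linarith)
    then show ?thesis by (simp add: Q_def)
  qed
  define m where "m = Inf (Q ` C)"
  have bb: "bdd_below (Q ` C)" using Q_lower by (intro bdd_belowI[of _ "- K"]) auto
  have m_le: "m \<le> Q c" if "c \<in> C" for c
    unfolding m_def using bb that by (intro cInf_lower) auto
  have "0 \<in> C" using C by (simp add: subspace_0)
  have "\<exists>c\<in>C. Q c < m + 1 / real (Suc n)" for n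
  proof -
    have "Inf (Q ` C) < m + 1 / real (Suc n)" by (simp add: m_def)
    then show ?thesis using \<open>0 \<in> C\<close> by (subst (asm) cInf_less_iff) (use bb in auto)
  qed
  then obtain X where X: "\<And>n. X n \<in> C" "\<And>n. Q (X n) < m + 1 / real (Suc n)" by metis
  have XV: "X n \<in> V" for n using X(1) CV by auto
  \<comment> \<open>The midpoint of \<open>a\<close> and \<open>b\<close> lies in \<open>C\<close>,
    so its value is at least \<open>m\<close>; the parallelogram law turns this into a bound for the
    distance.\<close>
  have par: "ip (a - b) (a - b) \<le> 2 * (Q a - m) + 2 * (Q b - m)" if ab: "a \<in> C" "b \<in> C" for a b
  proof -
    have "m \<le> Q ((1/2) *\<^sub>R (a + b))" using ab by (intro m_le C_scale C_add)
    also have "\<dots> = (Q a + Q b) / 2 - ip (a - b) (a - b) / 4"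
      using ab CV by (simp add: Q_def ip_linear \<phi>_add \<phi>_scale C_add C_scale scaleR_add_right ip_sym[of b a] field_simps)
    finally show ?thesis by (simp add: field_simps)
  qed
  have "\<exists>l\<in>V. (\<lambda>n::nat. ip (X n - l) (X n - l)) \<longlonglongrightarrow> 0"
  proof (rule complete[OF XV])
    fix e :: real assume "e > 0"
    then obtain N where N: "1 / real (Suc N) < e / 4" by (meson nat_approx_posE divide_pos_pos zero_less_numeral)
    have "ip (X i - X j) (X i - X j) < e" if "i \<ge> N" "j \<ge> N" for i j
    proof -
      have "1 / real (Suc i) \<le> 1 / real (Suc N)" "1 / real (Suc j) \<le> 1 / real (Suc N)"
        using that by (auto intro!: divide_left_mono)
      then show ?thesis using par[OF X(1) X(1), of i j] X(2)[of i] X(2)[of j] N by argo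
    qed
    then show "\<exists>N. \<forall>m\<ge>N. \<forall>n\<ge>N. ip (X m - X n) (X m - X n) < e" by blast
  qed
  then obtain w where w: "w \<in> V" "(\<lambda>n. ip (X n - w) (X n - w)) \<longlonglongrightarrow> 0" by blast
  have Qlim: "(\<lambda>n. Q (X n)) \<longlonglongrightarrow> m"
  proof (rule tendsto_sandwich)
    show "\<forall>\<^sub>F n in sequentially. m \<le> Q (X n)" using m_le X(1) by simp
    show "\<forall>\<^sub>F n in sequentially. Q (X n) \<le> m + 1 / real (Suc n)"
      using X(2) by (intro always_eventually allI less_imp_le)
    show "(\<lambda>n. m + 1 / real (Suc n)) \<longlonglongrightarrow> m"
      using tendsto_add[OF tendsto_const LIMSEQ_Suc[OF lim_1_over_n], of m] by simp
    show "(\<lambda>n. m) \<longlonglongrightarrow> m" by simp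
  qed
  have "\<phi> c = ip c w" if c: "c \<in> C" for c
  proof -
    have "0 \<le> 2 * t * (ip w c - \<phi> c) + t\<^sup>2 * ip c c" for t
    proof -
      \<comment> \<open>The variation is taken at \<open>X n\<close>, which lies in
        \<open>C\<close>; the limit \<open>w\<close> need not lie in \<open>C\<close>, so the
        inequality is passed to the limit afterwards.\<close>
      have "m \<le> Q (X n) + 2 * t * (ip (X n) c - \<phi> c) + t\<^sup>2 * ip c c" for n
      proof -
        have "m \<le> Q (X n + t *\<^sub>R c)" using c X by (intro m_le C_add C_scale)
        also have "\<dots> = Q (X n) + 2 * t * (ip (X n) c - \<phi> c) + t\<^sup>2 * ip c c"
          using c CV XV X by (simp add: Q_def ip_linear \<phi>_add \<phi>_scale C_scale ip_sym[of c "X n"] power2_eq_square algebra_simps)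
        finally show ?thesis .
      qed
      moreover have "(\<lambda>n. Q (X n) + 2 * t * (ip (X n) c - \<phi> c) + t\<^sup>2 * ip c c)
          \<longlonglongrightarrow> m + 2 * t * (ip w c - \<phi> c) + t\<^sup>2 * ip c c"
        by (intro tendsto_intros Qlim tendsto_ip XV w CV c)
      ultimately have "m \<le> m + 2 * t * (ip w c - \<phi> c) + t\<^sup>2 * ip c c"
        by (intro LIMSEQ_le_const) auto
      then show ?thesis by simp
    qed
    then have "ip w c - \<phi> c = 0"
      using ip_nonneg[OF CV[OF c]] by (rule quadratic_nonneg_imp_zero)
    then show ?thesis using CV[OF c] w by (simp add: ip_sym)
  qed
  moreover have "\<exists>c\<in>C. ip (c - w) (c - w) < e" if "e > 0" for e
  proof -
    have "\<forall>\<^sub>F n in sequentially. ip (X n - w) (X n - w) < e"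
      using w(2) that by (rule order_tendstoD)
    then obtain n where "ip (X n - w) (X n - w) < e"
      using eventually_happens' sequentially_bot by blast
    then show ?thesis using X by blast
  qed
  ultimately show ?thesis using w by blast
qed

lemma projection:
  assumes C: "subspace C" "C \<subseteq> V" and q: "q \<in> V"
  obtains p where "p \<in> V" "\<And>e. e > 0 \<Longrightarrow> \<exists>c\<in>C. ip (c - p) (c - p) < e" "\<And>c. c \<in> C \<Longrightarrow> ip (q - p) c = 0"
proof -
  have CV: "c \<in> V" if "c \<in> C" for c using C that by auto
  have "\<exists>w\<in>V. (\<forall>e>0. \<exists>c\<in>C. ip (c - w) (c - w) < e) \<and> (\<forall>c\<in>C. ip q c = ip c w)"
    using Cauchy_Schwarz[OF q CV] ip_nonneg[OF q]
    by (intro Riesz_subspace[OF C, where K = "ip q q"]) (simp_all add: ip_linear q CV)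
  then obtain p where "p \<in> V" "\<forall>e>0. \<exists>c\<in>C. ip (c - p) (c - p) < e" "\<forall>c\<in>C. ip q c = ip c p"
    by blast
  then show thesis
    using that CV q by (metis ip_diff ip_sym diff_self)
qed

end

context semi_hilbert
begin

text \<open>Orthogonality to \<open>s\<close> survives limits in the seminorm: by Cauchy--Schwarz
  the square of \<open>ip p s\<close> is at most the squared distance from \<open>c\<close> to
  \<open>p\<close> times \<open>ip s s\<close>.\<close>

lemma ip_approx_eq_zero:
  assumes p: "p \<in> V" and s: "s \<in> V"
    and approx: "\<And>e. e > 0 \<Longrightarrow> \<exists>c\<in>V. ip (c - p) (c - p) < e \<and> ip c s = 0"
  shows "ip p s = 0"
proof -
  have "(ip p s)\<^sup>2 \<le> e" if "e > 0" for e
  proof -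
    define e' where "e' = e / (ip s s + 1)"
    have pos: "0 < ip s s + 1" using ip_nonneg[OF s] by linarith
    then have "e' > 0" using that by (simp add: e'_def)
    then obtain c where c: "c \<in> V" "ip (c - p) (c - p) < e'" "ip c s = 0" using approx by blast
    have "(ip p s)\<^sup>2 = (ip (c - p) s)\<^sup>2" using c p s by (simp add: ip_diff)
    also have "\<dots> \<le> ip (c - p) (c - p) * ip s s" using c p s by (intro Cauchy_Schwarz) auto
    also have "\<dots> \<le> e' * (ip s s + 1)"
      using c(2) \<open>e' > 0\<close> ip_nonneg[OF s] by (intro mult_mono) auto
    also have "\<dots> = e" using pos by (simp add: e'_def)
    finally show ?thesis .
  qed
  then have "(ip p s)\<^sup>2 \<le> 0" by (rule field_le_epsilon) simp
  then show ?thesis by simp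
qed

end

section \<open>Orthogonal representations and Bessel vectors\<close>

text \<open>Multiplicativity and the unit law are required only against inner products: a
  measure-preserving action satisfies them on the points of the measure space, while functions are
  defined on the whole type.\<close>

locale hilbert_rep = semi_hilbert V ip + group G
  for V :: "'v::real_vector set" and ip and G :: "('g, 'm) monoid_scheme" (structure) +
  fixes tau :: "'g \<Rightarrow> 'v \<Rightarrow> 'v"
  assumes tau_V [simp]: "\<lbrakk>g \<in> carrier G; u \<in> V\<rbrakk> \<Longrightarrow> tau g u \<in> V"
    and tau_add: "\<lbrakk>g \<in> carrier G; u \<in> V; v \<in> V\<rbrakk> \<Longrightarrow> tau g (u + v) = tau g u + tau g v"
    and tau_scale: "\<lbrakk>g \<in> carrier G; u \<in> V\<rbrakk> \<Longrightarrow> tau g (r *\<^sub>R u) = r *\<^sub>R tau g u"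
    and tau_isometric: "\<lbrakk>g \<in> carrier G; u \<in> V; v \<in> V\<rbrakk> \<Longrightarrow> ip (tau g u) (tau g v) = ip u v"
    and tau_mult: "\<lbrakk>g \<in> carrier G; h \<in> carrier G; u \<in> V; v \<in> V\<rbrakk> \<Longrightarrow>
      ip (tau (g \<otimes> h) u) v = ip (tau g (tau h u)) v"
    and tau_one: "\<lbrakk>u \<in> V; v \<in> V\<rbrakk> \<Longrightarrow> ip (tau \<one> u) v = ip u v"
begin

lemma tau_diff: "\<lbrakk>g \<in> carrier G; u \<in> V; v \<in> V\<rbrakk> \<Longrightarrow> tau g (u - v) = tau g u - tau g v"
  using tau_add[of g "u - v" v] by (simp add: algebra_simps)

lemma tau_zero [simp]: "g \<in> carrier G \<Longrightarrow> tau g 0 = 0"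
  using tau_scale[of g 0 0] by simp

lemma tau_adjoint:
  assumes "g \<in> carrier G" "u \<in> V" "v \<in> V"
  shows "ip (tau g u) v = ip u (tau (inv g) v)"
proof -
  have "ip (tau g u) v = ip (tau (inv g) (tau g u)) (tau (inv g) v)"
    using assms by (simp add: tau_isometric)
  also have "\<dots> = ip (tau (inv g \<otimes> g) u) (tau (inv g) v)"
    using assms by (subst tau_mult) auto
  finally show ?thesis using assms by (simp add: tau_one)
qed

lemma tau_mult_right:
  "\<lbrakk>g \<in> carrier G; h \<in> carrier G; u \<in> V; v \<in> V\<rbrakk> \<Longrightarrow> ip v (tau (g \<otimes> h) u) = ip v (tau g (tau h u))"
  using tau_mult[of g h u v] by (simp add: ip_sym)

definition bessel :: "'v set" where
  "bessel = {z \<in> V. \<exists>K\<ge>0. \<forall>u\<in>V. \<forall>E. finite E \<longrightarrow> E \<subseteq> carrier G \<longrightarrow>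
     (\<Sum>g\<in>E. (ip u (tau g z))\<^sup>2) \<le> K * ip u u}"

lemma besselI:
  assumes "z \<in> V" "0 \<le> K"
    and "\<And>u E. \<lbrakk>u \<in> V; finite E; E \<subseteq> carrier G\<rbrakk> \<Longrightarrow> (\<Sum>g\<in>E. (ip u (tau g z))\<^sup>2) \<le> K * ip u u"
  shows "z \<in> bessel"
  unfolding bessel_def using assms by blast

lemma besselE:
  assumes "z \<in> bessel"
  obtains K where "z \<in> V" "0 \<le> K"
    "\<And>u E. \<lbrakk>u \<in> V; finite E; E \<subseteq> carrier G\<rbrakk> \<Longrightarrow> (\<Sum>g\<in>E. (ip u (tau g z))\<^sup>2) \<le> K * ip u u"
  using assms unfolding bessel_def by blast

lemma bessel_V: "z \<in> bessel \<Longrightarrow> z \<in> V"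
  by (simp add: bessel_def)

lemma subspace_bessel: "subspace bessel"
proof (rule subspaceI)
  show "0 \<in> bessel"
    by (rule besselI[of _ 0]) (auto simp: subset_iff intro!: sum_nonpos)
next
  fix x y assume xy: "x \<in> bessel" "y \<in> bessel"
  obtain K where x: "x \<in> V" "K \<ge> 0" "\<And>u E. \<lbrakk>u \<in> V; finite E; E \<subseteq> carrier G\<rbrakk> \<Longrightarrow> (\<Sum>g\<in>E. (ip u (tau g x))\<^sup>2) \<le> K * ip u u"
    using xy(1) by (rule besselE) blast
  obtain L where y: "y \<in> V" "L \<ge> 0" "\<And>u E. \<lbrakk>u \<in> V; finite E; E \<subseteq> carrier G\<rbrakk> \<Longrightarrow> (\<Sum>g\<in>E. (ip u (tau g y))\<^sup>2) \<le> L * ip u u"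
    using xy(2) by (rule besselE) blast
  have "(\<Sum>g\<in>E. (ip u (tau g (x + y)))\<^sup>2) \<le> (2 * K + 2 * L) * ip u u"
    if u: "u \<in> V" and E: "finite E" "E \<subseteq> carrier G" for u E
  proof -
    have "(\<Sum>g\<in>E. (ip u (tau g (x + y)))\<^sup>2) \<le> (\<Sum>g\<in>E. 2 * (ip u (tau g x))\<^sup>2 + 2 * (ip u (tau g y))\<^sup>2)"
    proof (rule sum_mono)
      fix g assume "g \<in> E"
      then have "g \<in> carrier G" using E by auto
      then have "ip u (tau g (x + y)) = ip u (tau g x) + ip u (tau g y)"
        using x y u by (simp add: tau_add ip_add_right)
      moreover have "(a + b)\<^sup>2 \<le> 2 * a\<^sup>2 + 2 * b\<^sup>2" for a b :: real
        using zero_le_power2[of "a - b"] by (simp add: power2_diff power2_sum)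
      ultimately show "(ip u (tau g (x + y)))\<^sup>2 \<le> 2 * (ip u (tau g x))\<^sup>2 + 2 * (ip u (tau g y))\<^sup>2" by simp
    qed
    also have "\<dots> = 2 * (\<Sum>g\<in>E. (ip u (tau g x))\<^sup>2) + 2 * (\<Sum>g\<in>E. (ip u (tau g y))\<^sup>2)"
      by (simp add: sum.distrib sum_distrib_left)
    also have "\<dots> \<le> 2 * (K * ip u u) + 2 * (L * ip u u)"
      using x(3)[OF u E] y(3)[OF u E] by simp
    finally show ?thesis by (simp add: algebra_simps)
  qed
  then show "x + y \<in> bessel"
    using x(1,2) y(1,2) by (intro besselI[of _ "2 * K + 2 * L"]) auto
next
  fix c x assume *: "x \<in> bessel"
  obtain K where x: "x \<in> V" "K \<ge> 0" "\<And>u E. \<lbrakk>u \<in> V; finite E; E \<subseteq> carrier G\<rbrakk> \<Longrightarrow> (\<Sum>g\<in>E. (ip u (tau g x))\<^sup>2) \<le> K * ip u u"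
    using * by (rule besselE) blast
  have "(\<Sum>g\<in>E. (ip u (tau g (c *\<^sub>R x)))\<^sup>2) \<le> (c\<^sup>2 * K) * ip u u"
    if u: "u \<in> V" and E: "finite E" "E \<subseteq> carrier G" for u E
  proof -
    have "(\<Sum>g\<in>E. (ip u (tau g (c *\<^sub>R x)))\<^sup>2) = (\<Sum>g\<in>E. c\<^sup>2 * (ip u (tau g x))\<^sup>2)"
    proof (rule sum.cong[OF refl])
      fix g assume "g \<in> E"
      then have "g \<in> carrier G" using E by auto
      then show "(ip u (tau g (c *\<^sub>R x)))\<^sup>2 = c\<^sup>2 * (ip u (tau g x))\<^sup>2"
        using x(1) u by (simp add: tau_scale ip_scale_right power_mult_distrib)
    qed
    then show ?thesis
      using mult_left_mono[OF x(3)[OF u E], of "c\<^sup>2"] by (simp add: sum_distrib_left mult.assoc)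
  qed
  then show "c *\<^sub>R x \<in> bessel"
    using x(1,2) by (intro besselI[of _ "c\<^sup>2 * K"]) auto
qed

text \<open>Right multiplication by \<open>k\<close> only reindexes the orbit, so the Bessel
  constant is unchanged.\<close>

lemma tau_bessel:
  assumes z: "z \<in> bessel" and k: "k \<in> carrier G"
  shows "tau k z \<in> bessel"
proof -
  obtain K where K: "z \<in> V" "K \<ge> 0" "\<And>u E. \<lbrakk>u \<in> V; finite E; E \<subseteq> carrier G\<rbrakk> \<Longrightarrow> (\<Sum>g\<in>E. (ip u (tau g z))\<^sup>2) \<le> K * ip u u"
    using z by (rule besselE) blast
  have "(\<Sum>g\<in>E. (ip u (tau g (tau k z)))\<^sup>2) \<le> K * ip u u"
    if u: "u \<in> V" and E: "finite E" "E \<subseteq> carrier G" for u E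
  proof -
    have "(\<Sum>g\<in>E. (ip u (tau g (tau k z)))\<^sup>2) = (\<Sum>g\<in>E. (ip u (tau (g \<otimes> k) z))\<^sup>2)"
      using E K(1) k u by (intro sum.cong) (auto simp: tau_mult_right)
    also have "\<dots> = (\<Sum>g\<in>(\<lambda>g. g \<otimes> k) ` E. (ip u (tau g z))\<^sup>2)"
      using E k by (subst sum.reindex) (auto simp: inj_on_def subset_iff)
    also have "\<dots> \<le> K * ip u u"
      using E k u by (intro K(3)) auto
    finally show ?thesis .
  qed
  then show ?thesis using K(1,2) k by (intro besselI[of _ K]) auto
qed

lemma bessel_orth_translate:
  assumes "f \<in> V" and "\<And>z. z \<in> bessel \<Longrightarrow> ip f z = 0" and "z \<in> bessel" "g \<in> carrier G"
  shows "ip (tau g f) z = 0"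
  using assms tau_bessel[OF assms(3), of "inv g"] by (simp add: tau_adjoint bessel_V)

text \<open>Analysis and synthesis are adjoint to each other, so a norm bound for one is a norm
  bound for the other. Synthesising the coefficients \<open>ip u (e j)\<close> of \<open>u\<close>
  itself gives \<open>s^2 \<le> ip u u * s\<close> for their square sum \<open>s\<close>.\<close>

lemma analysis_of_synthesis_bound:
  assumes e: "\<And>j. j \<in> J \<Longrightarrow> e j \<in> V" and u: "u \<in> V"
    and bound: "\<And>b. ip (\<Sum>j\<in>J. b j *\<^sub>R e j) (\<Sum>j\<in>J. b j *\<^sub>R e j) \<le> (\<Sum>j\<in>J. (b j)\<^sup>2)"
  shows "(\<Sum>j\<in>J. (ip u (e j))\<^sup>2) \<le> ip u u"
proof -
  define s where "s = (\<Sum>j\<in>J. (ip u (e j))\<^sup>2)"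
  define Y where "Y = (\<Sum>j\<in>J. ip u (e j) *\<^sub>R e j)"
  have YV: "Y \<in> V" unfolding Y_def using e by (intro V_sum) auto
  have "ip u Y = s"
    unfolding Y_def s_def using e u by (subst ip_sum_right) (auto simp: ip_scale_right power2_eq_square)
  moreover have "ip Y Y \<le> s" unfolding Y_def s_def by (rule bound)
  ultimately have "s * s \<le> ip u u * s"
    using Cauchy_Schwarz[OF u YV] mult_left_mono[of "ip Y Y" s "ip u u"] ip_nonneg[OF u]
    by (simp add: power2_eq_square)
  moreover have "s \<ge> 0" by (simp add: s_def sum_nonneg)
  ultimately have "s \<le> ip u u"
    using ip_nonneg[OF u] by (cases "s = 0") (auto simp: mult_le_cancel_right)
  then show ?thesis by (simp add: s_def)
qed

lemma span_orbit_explicit: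
  assumes "c \<in> span ((\<lambda>g. tau g c0) ` carrier G)"
  shows "\<exists>E a. finite E \<and> E \<subseteq> carrier G \<and> c = (\<Sum>g\<in>E. a g *\<^sub>R tau g c0)"
  using assms
proof (induction rule: span_induct_alt)
  case base
  show ?case by (rule exI[of _ "{}"]) auto
next
  case (step r x y)
  then obtain g E a where g: "g \<in> carrier G" "x = tau g c0"
    and E: "finite E" "E \<subseteq> carrier G" "y = (\<Sum>g\<in>E. a g *\<^sub>R tau g c0)" by blast
  \<comment> \<open>Coefficients are indexed by group elements; \<open>g\<close> may already occur
    in \<open>E\<close>, and then the two coefficients add up.\<close>
  define a' where "a' k = (if k = g then r else 0) + (if k \<in> E then a k else 0)" for k
  have "(\<Sum>k\<in>insert g E. a' k *\<^sub>R tau k c0) =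
      (\<Sum>k\<in>insert g E. if k = g then r *\<^sub>R tau k c0 else 0) + (\<Sum>k\<in>insert g E. if k \<in> E then a k *\<^sub>R tau k c0 else 0)"
    unfolding sum.distrib[symmetric] by (intro sum.cong) (auto simp: a'_def scaleR_add_left)
  also have "(\<Sum>k\<in>insert g E. if k \<in> E then a k *\<^sub>R tau k c0 else 0) = y"
    unfolding E(3) using E(1) by (intro sum.mono_neutral_cong_right) auto
  also have "(\<Sum>k\<in>insert g E. if k = g then r *\<^sub>R tau k c0 else 0) = r *\<^sub>R x"
    using E(1) g by (simp add: sum.delta)
  finally show ?case
    using E g by (intro exI[of _ "insert g E"] exI[of _ a']) auto
qed

text \<open>The closed span of an orbit is invariant, so projecting to it commutes with
  translations. The left-hand combination is the projection of the right-hand one, and projections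
  do not increase norms.\<close>

lemma projection_translates_le:
  assumes c0: "c0 \<in> V" and p: "p \<in> V" and q: "q \<in> V"
    and approx: "\<And>e. e > 0 \<Longrightarrow> \<exists>c\<in>span ((\<lambda>g. tau g c0) ` carrier G). ip (c - p) (c - p) < e"
    and orth: "\<And>c. c \<in> span ((\<lambda>g. tau g c0) ` carrier G) \<Longrightarrow> ip (q - p) c = 0"
    and E: "finite E" "E \<subseteq> carrier G"
  shows "ip (\<Sum>g\<in>E. b g *\<^sub>R tau g p) (\<Sum>g\<in>E. b g *\<^sub>R tau g p)
       \<le> ip (\<Sum>g\<in>E. b g *\<^sub>R tau g q) (\<Sum>g\<in>E. b g *\<^sub>R tau g q)"
proof -
  let ?C = "span ((\<lambda>g. tau g c0) ` carrier G)"
  have C: "?C \<subseteq> V" using c0 by (intro span_minimal subspace_V) auto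
  have r: "q - p \<in> V" using p q by simp
  have orth': "ip (tau g p) (tau h (q - p)) = 0" if g: "g \<in> carrier G" and h: "h \<in> carrier G" for g h
  proof -
    have s: "tau (inv g) (tau h (q - p)) \<in> V" using g h r by simp
    \<comment> \<open>On generators the claim is the orthogonality of \<open>q - p\<close> to
      another vector of the orbit; it extends to the span by linearity and to \<open>p\<close> by
      approximation.\<close>
    have "c \<in> V \<and> ip c (tau (inv g) (tau h (q - p))) = 0" if "c \<in> ?C" for c
      using that
    proof (induction rule: span_induct_alt)
      case base
      show ?case using s by simp
    next
      case (step t x y)
      then obtain k where k: "k \<in> carrier G" "x = tau k c0" by auto
      have y: "y \<in> V" using step by auto
      have "ip x (tau (inv g) (tau h (q - p))) = ip (tau g (tau k c0)) (tau h (q - p))"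
        using g h k c0 r by (simp add: tau_adjoint)
      also have "\<dots> = ip (tau h (q - p)) (tau (g \<otimes> k) c0)"
        using g h k c0 r by (simp add: tau_mult_right ip_sym)
      also have "\<dots> = ip (q - p) (tau (inv h) (tau (g \<otimes> k) c0))"
        using g h k c0 r by (simp add: tau_adjoint)
      also have "\<dots> = ip (q - p) (tau (inv h \<otimes> (g \<otimes> k)) c0)"
        using g h k c0 r by (simp only: tau_mult_right inv_closed m_closed)
      also have "\<dots> = 0"
        using g h k by (intro orth span_base) auto
      finally show ?case using y k s c0 step by (simp add: ip_add ip_scale)
    qed
    then have "ip p (tau (inv g) (tau h (q - p))) = 0"
      using approx by (intro ip_approx_eq_zero[OF p s]) blast
    then show ?thesis using g h p r by (simp add: tau_adjoint)
  qed
  define P R where "P = (\<Sum>g\<in>E. b g *\<^sub>R tau g p)" and "R = (\<Sum>g\<in>E. b g *\<^sub>R tau g (q - p))"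
  have gE: "g \<in> carrier G" if "g \<in> E" for g using that E by auto
  have PV: "P \<in> V" and RV: "R \<in> V" unfolding P_def R_def using gE p r by (auto intro!: V_sum)
  have "ip (\<Sum>g\<in>E. b g *\<^sub>R tau g p) R = (\<Sum>g\<in>E. ip (b g *\<^sub>R tau g p) R)"
    using RV gE p by (intro ip_sum) auto
  also have "\<dots> = (\<Sum>g\<in>E. b g * (\<Sum>h\<in>E. b h * ip (tau g p) (tau h (q - p))))"
  proof (intro sum.cong refl)
    fix g assume g: "g \<in> E"
    have "ip (b g *\<^sub>R tau g p) R = b g * ip (tau g p) R" using RV gE g p by (simp add: ip_scale)
    also have "ip (tau g p) R = (\<Sum>h\<in>E. ip (tau g p) (b h *\<^sub>R tau h (q - p)))"
      unfolding R_def using gE g p r by (intro ip_sum_right) auto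
    also have "\<dots> = (\<Sum>h\<in>E. b h * ip (tau g p) (tau h (q - p)))"
      using gE g p r by (intro sum.cong) (auto simp: ip_scale_right)
    finally show "ip (b g *\<^sub>R tau g p) R = b g * (\<Sum>h\<in>E. b h * ip (tau g p) (tau h (q - p)))" .
  qed
  also have "\<dots> = 0" using orth' gE by simp
  finally have PR: "ip P R = 0" by (simp add: P_def)
  have "(\<Sum>g\<in>E. b g *\<^sub>R tau g q) = (\<Sum>g\<in>E. b g *\<^sub>R tau g p + b g *\<^sub>R tau g (q - p))"
    using gE p q by (intro sum.cong) (auto simp: tau_diff algebra_simps)
  then have "(\<Sum>g\<in>E. b g *\<^sub>R tau g q) = P + R"
    by (simp add: P_def R_def sum.distrib)
  then show ?thesis
    using PR PV RV ip_nonneg[OF RV] by (simp add: ip_square_add flip: P_def)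
qed

end

section \<open>Products\<close>

definition prod_ip :: "('v \<Rightarrow> 'v \<Rightarrow> real) \<Rightarrow> ('w \<Rightarrow> 'w \<Rightarrow> real) \<Rightarrow> 'v \<times> 'w \<Rightarrow> 'v \<times> 'w \<Rightarrow> real" where
  "prod_ip ip ip' x y = ip (fst x) (fst y) + ip' (snd x) (snd y)"

lemma semi_hilbert_prod:
  assumes "semi_hilbert V ip" "semi_hilbert W ip'"
  shows "semi_hilbert (V \<times> W) (prod_ip ip ip')"
proof -
  interpret A: semi_hilbert V ip by fact
  interpret B: semi_hilbert W ip' by fact
  show ?thesis
  proof
    show "subspace (V \<times> W)" using A.subspace_V B.subspace_V by (rule subspace_Times)
    show "prod_ip ip ip' u v = prod_ip ip ip' v u" if "u \<in> V \<times> W" "v \<in> V \<times> W" for u v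
      using that A.ip_sym[of "fst u" "fst v"] B.ip_sym[of "snd u" "snd v"] by (auto simp: prod_ip_def)
  next
    fix X :: "nat \<Rightarrow> 'a \<times> 'b"
    assume X: "\<And>n. X n \<in> V \<times> W"
      and cau: "\<And>e. e > 0 \<Longrightarrow> \<exists>N. \<forall>m\<ge>N. \<forall>n\<ge>N. prod_ip ip ip' (X m - X n) (X m - X n) < e"
    have XV: "fst (X n) \<in> V" and XW: "snd (X n) \<in> W" for n using X[of n] by auto
    have "\<exists>l\<in>V. (\<lambda>n::nat. ip (fst (X n) - l) (fst (X n) - l)) \<longlonglongrightarrow> 0"
    proof (rule A.complete[OF XV])
      fix e :: real assume "e > 0"
      then obtain N where "\<forall>m\<ge>N. \<forall>n\<ge>N. prod_ip ip ip' (X m - X n) (X m - X n) < e" using cau by blast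
      moreover have "ip (fst (X m) - fst (X n)) (fst (X m) - fst (X n)) \<le> prod_ip ip ip' (X m - X n) (X m - X n)" for m n
        using B.ip_nonneg[of "snd (X m) - snd (X n)"] XW by (simp add: prod_ip_def)
      ultimately show "\<exists>N. \<forall>m\<ge>N. \<forall>n\<ge>N. ip (fst (X m) - fst (X n)) (fst (X m) - fst (X n)) < e"
        by (meson order_le_less_trans)
    qed
    moreover have "\<exists>l\<in>W. (\<lambda>n::nat. ip' (snd (X n) - l) (snd (X n) - l)) \<longlonglongrightarrow> 0"
    proof (rule B.complete[OF XW])
      fix e :: real assume "e > 0"
      then obtain N where "\<forall>m\<ge>N. \<forall>n\<ge>N. prod_ip ip ip' (X m - X n) (X m - X n) < e" using cau by blast
      moreover have "ip' (snd (X m) - snd (X n)) (snd (X m) - snd (X n)) \<le> prod_ip ip ip' (X m - X n) (X m - X n)" for m n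
        using A.ip_nonneg[of "fst (X m) - fst (X n)"] XV by (simp add: prod_ip_def)
      ultimately show "\<exists>N. \<forall>m\<ge>N. \<forall>n\<ge>N. ip' (snd (X m) - snd (X n)) (snd (X m) - snd (X n)) < e"
        by (meson order_le_less_trans)
    qed
    ultimately obtain l k where "l \<in> V" "k \<in> W" and
      lims: "(\<lambda>n::nat. ip (fst (X n) - l) (fst (X n) - l)) \<longlonglongrightarrow> 0"
        "(\<lambda>n::nat. ip' (snd (X n) - k) (snd (X n) - k)) \<longlonglongrightarrow> 0" by blast
    moreover have "(\<lambda>n. prod_ip ip ip' (X n - (l, k)) (X n - (l, k))) \<longlonglongrightarrow> 0"
      using tendsto_add[OF lims] by (simp add: prod_ip_def)
    ultimately show "\<exists>l\<in>V \<times> W. (\<lambda>n. prod_ip ip ip' (X n - l) (X n - l)) \<longlonglongrightarrow> 0"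
      by (intro bexI[of _ "(l, k)"]) auto
  qed (auto simp: prod_ip_def A.ip_linear B.ip_linear A.ip_nonneg B.ip_nonneg distrib_left
)
qed

lemma hilbert_rep_prod:
  assumes "hilbert_rep V ip G tau" "hilbert_rep W ip' G lam"
  shows "hilbert_rep (V \<times> W) (prod_ip ip ip') G (\<lambda>g. map_prod (tau g) (lam g))"
proof -
  interpret A: hilbert_rep V ip G tau by fact
  interpret B: hilbert_rep W ip' G lam by fact
  interpret semi_hilbert "V \<times> W" "prod_ip ip ip'"
    by (rule semi_hilbert_prod) (rule A.semi_hilbert_axioms B.semi_hilbert_axioms)+
  show ?thesis
    by unfold_locales
      (auto simp: prod_ip_def A.tau_add B.tau_add A.tau_scale B.tau_scale A.tau_isometric
        B.tau_isometric A.tau_mult B.tau_mult A.tau_one B.tau_one)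
qed

text \<open>Here \<open>lam\<close> plays the role of the regular representation with cyclic vector \<open>\<delta>\<close>. The
  \<open>V\<close>-component of the projection of \<open>(0, \<delta>)\<close> to the closed cyclic subspace of \<open>V \<times> W\<close> generated
  by \<open>(f, \<delta>)\<close> is a Bessel vector, so it is orthogonal to the orbit of \<open>f\<close>, and then the projection is
  \<open>(0, \<delta>)\<close> itself. Hence some finitely supported \<open>a\<close> satisfies \<open>\<Sum>g. a g \<cdot> tau g f \<approx> 0\<close> and
  \<open>a \<approx> \<delta>\<close>, and \<open>\<delta> - a\<close> is the required family.\<close>
lemma singular_approx:
  assumes "hilbert_rep V ip G tau" "hilbert_rep W ip' G lam"
    and \<delta>: "\<delta> \<in> W" "\<And>g h. \<lbrakk>g \<in> carrier G; h \<in> carrier G\<rbrakk> \<Longrightarrow> ip' (lam g \<delta>) (lam h \<delta>) = (if g = h then 1 else 0)"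
      "\<And>x. \<lbrakk>x \<in> W; \<And>g. g \<in> carrier G \<Longrightarrow> ip' x (lam g \<delta>) = 0\<rbrakk> \<Longrightarrow> ip' x x = 0"
    and f: "f \<in> V" "\<And>z. z \<in> hilbert_rep.bessel V ip G tau \<Longrightarrow> ip f z = 0"
    and "\<epsilon> > 0"
  shows "\<exists>E a. finite E \<and> E \<subseteq> carrier G \<and>
     ip (f - (\<Sum>g\<in>E. a g *\<^sub>R tau g f)) (f - (\<Sum>g\<in>E. a g *\<^sub>R tau g f)) < \<epsilon> \<and> (\<Sum>g\<in>E. (a g)\<^sup>2) < \<epsilon>"
proof -
  interpret A: hilbert_rep V ip G tau by fact
  interpret B: hilbert_rep W ip' G lam by fact
  let ?ip = "prod_ip ip ip'" and ?pi = "\<lambda>g. map_prod (tau g) (lam g)"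
  interpret P: hilbert_rep "V \<times> W" ?ip G ?pi
    by (rule hilbert_rep_prod) fact+
  define C where "C = span ((\<lambda>g. ?pi g (f, \<delta>)) ` carrier G)"
  have CV: "C \<subseteq> V \<times> W" unfolding C_def using f \<delta> by (intro span_minimal P.subspace_V) auto
  obtain p where p: "p \<in> V \<times> W" "\<And>e. e > 0 \<Longrightarrow> \<exists>c\<in>C. ?ip (c - p) (c - p) < e"
    "\<And>c. c \<in> C \<Longrightarrow> ?ip ((0, \<delta>) - p) c = 0"
    using P.projection[of C "(0, \<delta>)"] CV \<delta> by (auto simp: C_def)
  obtain z w where zw: "p = (z, w)" "z \<in> V" "w \<in> W" using p(1) by auto
  have sum_lam: "ip' (\<Sum>g\<in>E. b g *\<^sub>R lam g \<delta>) (\<Sum>g\<in>E. b g *\<^sub>R lam g \<delta>) = (\<Sum>g\<in>E. (b g)\<^sup>2)"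
    if E: "finite E" "E \<subseteq> carrier G" for E b
  proof -
    have lamW: "lam g \<delta> \<in> W" if "g \<in> E" for g using that E \<delta> by auto
    have "ip' (\<Sum>g\<in>E. b g *\<^sub>R lam g \<delta>) (\<Sum>g\<in>E. b g *\<^sub>R lam g \<delta>) = (\<Sum>g\<in>E. ip' (b g *\<^sub>R lam g \<delta>) (\<Sum>h\<in>E. b h *\<^sub>R lam h \<delta>))"
      using lamW by (intro B.ip_sum B.V_sum) auto
    also have "\<dots> = (\<Sum>g\<in>E. \<Sum>h\<in>E. b g * (b h * ip' (lam g \<delta>) (lam h \<delta>)))"
    proof (intro sum.cong refl)
      fix g assume g: "g \<in> E"
      have "ip' (b g *\<^sub>R lam g \<delta>) (\<Sum>h\<in>E. b h *\<^sub>R lam h \<delta>) = (\<Sum>h\<in>E. ip' (b g *\<^sub>R lam g \<delta>) (b h *\<^sub>R lam h \<delta>))"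
        using lamW g by (intro B.ip_sum_right) auto
      also have "\<dots> = (\<Sum>h\<in>E. b g * (b h * ip' (lam g \<delta>) (lam h \<delta>)))"
        using lamW g by (intro sum.cong) (auto simp: B.ip_scale B.ip_scale_right)
      finally show "ip' (b g *\<^sub>R lam g \<delta>) (\<Sum>h\<in>E. b h *\<^sub>R lam h \<delta>) = (\<Sum>h\<in>E. b g * (b h * ip' (lam g \<delta>) (lam h \<delta>)))" .
    qed
    also have "\<dots> = (\<Sum>g\<in>E. \<Sum>h\<in>E. if g = h then (b g)\<^sup>2 else 0)"
      using E \<delta>(2) by (intro sum.cong refl) (auto simp: subset_iff power2_eq_square)
    also have "\<dots> = (\<Sum>g\<in>E. (b g)\<^sup>2)"
      using E by (simp add: sum.delta')
    finally show ?thesis .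
  qed
  \<comment> \<open>The translates of \<open>\<delta>\<close> are orthonormal, so synthesis with
    \<open>(0, \<delta>)\<close> preserves the l2-norm of the coefficients. Projecting to
    \<open>p\<close> and dropping the second component only decreases norms, and duality gives the
    Bessel constant 1.\<close>
  have "z \<in> A.bessel"
  proof -
    have "(\<Sum>g\<in>E. (ip u (tau g z))\<^sup>2) \<le> 1 * ip u u"
      if u: "u \<in> V" and E: "finite E" "E \<subseteq> carrier G" for u E
    proof -
      have "ip (\<Sum>g\<in>E. b g *\<^sub>R tau g z) (\<Sum>g\<in>E. b g *\<^sub>R tau g z) \<le> (\<Sum>g\<in>E. (b g)\<^sup>2)" for b
      proof -
        have 1: "(\<Sum>g\<in>E. b g *\<^sub>R ?pi g p) = ((\<Sum>g\<in>E. b g *\<^sub>R tau g z), (\<Sum>g\<in>E. b g *\<^sub>R lam g w))"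
          by (simp add: zw sum_prod)
        have 2: "(\<Sum>g\<in>E. b g *\<^sub>R ?pi g (0, \<delta>)) = (0, (\<Sum>g\<in>E. b g *\<^sub>R lam g \<delta>))"
          using E by (auto simp: sum_prod intro!: sum.neutral)
        have "?ip (\<Sum>g\<in>E. b g *\<^sub>R ?pi g p) (\<Sum>g\<in>E. b g *\<^sub>R ?pi g p)
            \<le> ?ip (\<Sum>g\<in>E. b g *\<^sub>R ?pi g (0, \<delta>)) (\<Sum>g\<in>E. b g *\<^sub>R ?pi g (0, \<delta>))"
          using f \<delta> p E by (intro P.projection_translates_le[where ?c0.0 = "(f, \<delta>)"]) (auto simp: C_def)
        moreover have "0 \<le> ip' (\<Sum>g\<in>E. b g *\<^sub>R lam g w) (\<Sum>g\<in>E. b g *\<^sub>R lam g w)"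
          using E zw by (intro B.ip_nonneg B.V_sum) auto
        ultimately show ?thesis
          unfolding 1 2 using sum_lam[OF E, of b] by (simp add: prod_ip_def)
      qed
      then have "(\<Sum>g\<in>E. (ip u (tau g z))\<^sup>2) \<le> ip u u"
        using E u zw by (intro A.analysis_of_synthesis_bound) auto
      then show ?thesis by simp
    qed
    then show ?thesis using zw by (intro A.besselI[of _ 1]) auto
  qed
  then have orth_z: "ip (tau g f) z = 0" if "g \<in> carrier G" for g
    using A.bessel_orth_translate f that by blast
  \<comment> \<open>The first component of every element of \<open>C\<close> is a combination of
    translates of \<open>f\<close>, hence orthogonal to \<open>z\<close>, and \<open>z\<close> is a
    limit of such components.\<close>
  have zz: "ip z z = 0"
  proof (rule A.ip_approx_eq_zero[OF zw(2) zw(2)])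
    fix e :: real assume "e > 0"
    then obtain c where c: "c \<in> C" "?ip (c - p) (c - p) < e" using p(2) by blast
    obtain E a where E: "finite E" "E \<subseteq> carrier G" "c = (\<Sum>g\<in>E. a g *\<^sub>R ?pi g (f, \<delta>))"
      using P.span_orbit_explicit c(1) unfolding C_def by blast
    have c_eq: "fst c = (\<Sum>g\<in>E. a g *\<^sub>R tau g f)" by (simp add: E(3) fst_sum)
    have "ip (fst c) z = (\<Sum>g\<in>E. ip (a g *\<^sub>R tau g f) z)"
      unfolding c_eq using E zw f by (intro A.ip_sum) auto
    also have "\<dots> = 0"
      using E zw f orth_z by (intro sum.neutral) (auto simp: A.ip_scale subset_iff)
    finally have "ip (fst c) z = 0" .
    moreover have "c \<in> V \<times> W" using CV c by auto
    moreover have "ip (fst c - z) (fst c - z) < e"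
    proof -
      have "0 \<le> ip' (snd c - w) (snd c - w)" using \<open>c \<in> V \<times> W\<close> zw by (intro B.ip_nonneg) auto
      then show ?thesis using c(2) zw by (simp add: prod_ip_def)
    qed
    ultimately show "\<exists>c\<in>V. ip (c - z) (c - z) < e \<and> ip c z = 0" by (intro bexI[of _ "fst c"]) auto
  qed
  \<comment> \<open>The first components contribute 0, so orthogonality of
    \<open>(0, \<delta>) - p\<close> to the generators says that \<open>\<delta> - w\<close> is
    orthogonal to all translates of \<open>\<delta>\<close>.\<close>
  have ww: "ip' (\<delta> - w) (\<delta> - w) = 0"
  proof (rule \<delta>(3))
    show "\<delta> - w \<in> W" using \<delta> zw by simp
    fix g assume g: "g \<in> carrier G"
    have "?ip ((0, \<delta>) - p) (?pi g (f, \<delta>)) = 0" using g by (intro p(3)) (auto simp: C_def intro: span_base)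
    then have "ip (0 - z) (tau g f) + ip' (\<delta> - w) (lam g \<delta>) = 0" by (simp add: prod_ip_def zw)
    moreover have "ip (0 - z) (tau g f) = 0"
      using orth_z[OF g] zw f g by (simp only: A.ip_diff A.V_zero A.tau_V A.ip_zero A.ip_sym[of z])
    ultimately show "ip' (\<delta> - w) (lam g \<delta>) = 0" by simp
  qed
  \<comment> \<open>\<open>ip_square_add_le\<close> is applied twice in each component, so the final
    errors stay below \<open>4 * e\<close>.\<close>
  define e where "e = \<epsilon> / 8"
  have "e > 0" using \<open>\<epsilon> > 0\<close> by (simp add: e_def)
  then obtain c where c: "c \<in> C" "?ip (c - p) (c - p) < e" using p(2) by blast
  obtain E a where E: "finite E" "E \<subseteq> carrier G" "c = (\<Sum>g\<in>E. a g *\<^sub>R ?pi g (f, \<delta>))"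
    using P.span_orbit_explicit c(1) unfolding C_def by blast
  define S T where "S = (\<Sum>g\<in>E. a g *\<^sub>R tau g f)" and "T = (\<Sum>g\<in>E. a g *\<^sub>R lam g \<delta>)"
  have S: "S \<in> V" and T: "T \<in> W" unfolding S_def T_def using E f \<delta> by (auto intro!: A.V_sum B.V_sum)
  have c_eq: "c = (S, T)" by (simp add: E(3) S_def T_def sum_prod)
  have "ip (S - z) (S - z) + ip' (T - w) (T - w) < e"
    using c(2) by (simp add: c_eq zw prod_ip_def)
  moreover have "0 \<le> ip (S - z) (S - z)" "0 \<le> ip' (T - w) (T - w)"
    using S T zw by (auto intro!: A.ip_nonneg B.ip_nonneg)
  ultimately have lt: "ip (S - z) (S - z) < e" "ip' (T - w) (T - w) < e" by auto
  have "ip S S \<le> 2 * ip (S - z) (S - z) + 2 * ip z z"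
    using A.ip_square_add_le[of "S - z" z] S zw by simp
  then have SS: "ip S S < 2 * e" using lt zz by simp
  have "ip' (T - \<delta>) (T - \<delta>) \<le> 2 * ip' (T - w) (T - w) + 2 * ip' (w - \<delta>) (w - \<delta>)"
    using B.ip_square_add_le[of "T - w" "w - \<delta>"] T \<delta> zw by simp
  then have TT: "ip' (T - \<delta>) (T - \<delta>) < 2 * e" using lt ww B.ip_square_diff_commute[of w \<delta>] zw \<delta> by simp
  define E' where "E' = insert \<one>\<^bsub>G\<^esub> E"
  \<comment> \<open>The coefficients of \<open>\<delta> - a\<close>. The vector
    \<open>tau \<one> f\<close> may differ from \<open>f\<close> by a null vector, which accounts
    for the extra summands below.\<close>
  define b where "b g = (if g = \<one>\<^bsub>G\<^esub> then 1 else 0) - (if g \<in> E then a g else 0)" for g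
  have E': "finite E'" "E' \<subseteq> carrier G" using E by (auto simp: E'_def)
  have split: "(\<Sum>g\<in>E'. b g *\<^sub>R x g) = x \<one>\<^bsub>G\<^esub> - (\<Sum>g\<in>E. a g *\<^sub>R x g)" for x :: "'b \<Rightarrow> 'z::real_vector"
  proof -
    have "(\<Sum>g\<in>E'. b g *\<^sub>R x g) = (\<Sum>g\<in>E'. if g = \<one>\<^bsub>G\<^esub> then x g else 0) - (\<Sum>g\<in>E'. if g \<in> E then a g *\<^sub>R x g else 0)"
      unfolding sum_subtractf[symmetric] by (intro sum.cong) (auto simp: b_def scaleR_diff_left)
    also have "(\<Sum>g\<in>E'. if g \<in> E then a g *\<^sub>R x g else 0) = (\<Sum>g\<in>E. a g *\<^sub>R x g)"
      using E' by (intro sum.mono_neutral_cong_right) (auto simp: E'_def)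
    also have "(\<Sum>g\<in>E'. if g = \<one>\<^bsub>G\<^esub> then x g else 0) = x \<one>\<^bsub>G\<^esub>"
      using E' by (simp add: E'_def)
    finally show ?thesis .
  qed
  have one: "\<one>\<^bsub>G\<^esub> \<in> carrier G" by simp
  have one_f: "tau \<one>\<^bsub>G\<^esub> f \<in> V" and one_\<delta>: "lam \<one>\<^bsub>G\<^esub> \<delta> \<in> W" using f \<delta> by auto
  have "ip (f - tau \<one>\<^bsub>G\<^esub> f) (f - tau \<one>\<^bsub>G\<^esub> f) = 0"
    using f one_f by (simp add: A.ip_diff A.tau_one)
  then have "ip ((f - tau \<one>\<^bsub>G\<^esub> f) + S) ((f - tau \<one>\<^bsub>G\<^esub> f) + S) \<le> 2 * ip S S"
    using A.ip_square_add_le[of "f - tau \<one>\<^bsub>G\<^esub> f" S] f one_f S by simp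
  moreover have "f - (\<Sum>g\<in>E'. b g *\<^sub>R tau g f) = (f - tau \<one>\<^bsub>G\<^esub> f) + S"
    by (simp add: split S_def)
  ultimately have "ip (f - (\<Sum>g\<in>E'. b g *\<^sub>R tau g f)) (f - (\<Sum>g\<in>E'. b g *\<^sub>R tau g f)) \<le> 2 * ip S S"
    by (simp only:)
  moreover have "(\<Sum>g\<in>E'. (b g)\<^sup>2) \<le> 2 * ip' (\<delta> - T) (\<delta> - T)"
  proof -
    have "(\<Sum>g\<in>E'. b g *\<^sub>R lam g \<delta>) = (lam \<one>\<^bsub>G\<^esub> \<delta> - \<delta>) + (\<delta> - T)"
      by (simp add: split T_def)
    moreover have "ip' (lam \<one>\<^bsub>G\<^esub> \<delta> - \<delta>) (lam \<one>\<^bsub>G\<^esub> \<delta> - \<delta>) = 0"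
      using \<delta> one_\<delta> by (simp add: B.ip_diff B.tau_one)
    ultimately show ?thesis
      using B.ip_square_add_le[of "lam \<one>\<^bsub>G\<^esub> \<delta> - \<delta>" "\<delta> - T"] \<delta> one_\<delta> T sum_lam[OF E', of b] by simp
  qed
  ultimately show ?thesis
    using SS TT E' B.ip_square_diff_commute[OF \<delta>(1) T] \<open>\<epsilon> > 0\<close>
    by (intro exI[of _ E'] exI[of _ b]) (auto simp: e_def)
qed

section \<open>Parseval frames from Bessel systems\<close>

text \<open>The coefficients of the power series of \<open>(1 - x) powr (-1/2)\<close>.\<close>

definition rsqrt_coeff :: "nat \<Rightarrow> real" where
  "rsqrt_coeff k = (- 1) ^ k * ((- 1 / 2) gchoose k)"

text \<open>Each of the \<open>k\<close> signs turns a factor \<open>- 1 / 2 - i\<close> into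
  \<open>1 / 2 + i\<close>.\<close>

lemma rsqrt_coeff_nonneg: "0 \<le> rsqrt_coeff k"
proof -
  have "(- 1) ^ k * (\<Prod>i=0..<k. - 1 / 2 - real i) = (\<Prod>i=0..<k. 1 / 2 + real i)"
    by (induction k) (auto simp: algebra_simps)
  moreover have "0 \<le> (\<Prod>i=0..<k. 1 / 2 + real i)" by (intro prod_nonneg) auto
  moreover have "rsqrt_coeff k = ((- 1) ^ k * (\<Prod>i=0..<k. - 1 / 2 - real i)) / fact k"
    by (simp add: rsqrt_coeff_def gbinomial_prod_rev)
  ultimately show ?thesis by (simp only: divide_nonneg_pos fact_gt_zero)
qed

text \<open>The square of \<open>(1 - x) powr (-1/2)\<close> is the geometric series; in
  coefficients this is Vandermonde's identity for \<open>-1/2\<close> and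
  \<open>-1/2\<close>.\<close>

lemma rsqrt_coeff_convolution: "(\<Sum>k\<le>n. rsqrt_coeff k * rsqrt_coeff (n - k)) = 1"
proof -
  have "(\<Sum>k\<le>n. rsqrt_coeff k * rsqrt_coeff (n - k)) =
      (\<Sum>k=0..n. (- 1) ^ n * (((- 1 / 2) gchoose k) * ((- 1 / 2) gchoose (n - k))))"
    unfolding atLeast0AtMost
  proof (rule sum.cong[OF refl])
    fix k assume "k \<in> {..n}"
    then have "(- 1 :: real) ^ k * (- 1) ^ (n - k) = (- 1) ^ n" by (simp flip: power_add)
    then show "rsqrt_coeff k * rsqrt_coeff (n - k) = (- 1) ^ n * (((- 1 / 2) gchoose k) * ((- 1 / 2) gchoose (n - k)))"
      by (simp add: rsqrt_coeff_def mult.assoc mult.left_commute flip: \<open>_ = (- 1 :: real) ^ n\<close>)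
  qed
  also have "\<dots> = (- 1) ^ n * ((- 1) gchoose n)"
    unfolding sum_distrib_left[symmetric] gbinomial_Vandermonde by simp
  also have "(- 1 :: real) gchoose n = (- 1) ^ n"
    using gbinomial_minus[of "1::real" n] binomial_gbinomial[of n n, where 'a = real] by simp
  finally show ?thesis by (simp flip: power_mult_distrib)
qed

text \<open>Grouping the pairs by \<open>N = k + l\<close> leaves a part of the convolution sum as
  the weight of \<open>d N\<close>. Nonnegative coefficients keep this weight between 0 and 1, and
  it is 1 once all pairs with sum \<open>N\<close> are present.\<close>

lemma rsqrt_coeff_double_sum:
  fixes d :: "nat \<Rightarrow> real"
  assumes I: "finite I" "\<And>k. k \<in> I \<Longrightarrow> k < n" and d: "\<And>N. 0 \<le> d N"
  shows "(\<Sum>k\<in>I. \<Sum>l\<in>I. rsqrt_coeff k * rsqrt_coeff l * d (k + l)) =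
      (\<Sum>N<2*n. d N * (\<Sum>(k,l)\<in>{(k,l)\<in>I\<times>I. k + l = N}. rsqrt_coeff k * rsqrt_coeff l))"
    and "\<And>N. (\<Sum>(k,l)\<in>{(k,l)\<in>I\<times>I. k + l = N}. rsqrt_coeff k * rsqrt_coeff l) \<le> 1"
    and "\<And>N. 0 \<le> (\<Sum>(k,l)\<in>{(k,l)\<in>I\<times>I. k + l = N}. rsqrt_coeff k * rsqrt_coeff l)"
    and "\<And>N. {..N} \<subseteq> I \<Longrightarrow> (\<Sum>(k,l)\<in>{(k,l)\<in>I\<times>I. k + l = N}. rsqrt_coeff k * rsqrt_coeff l) = 1"
proof -
  have "(\<Sum>k\<in>I. \<Sum>l\<in>I. rsqrt_coeff k * rsqrt_coeff l * d (k + l)) =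
      (\<Sum>(k,l)\<in>I\<times>I. rsqrt_coeff k * rsqrt_coeff l * d (k + l))"
    by (simp add: sum.cartesian_product)
  also have "\<dots> = (\<Sum>N<2*n. \<Sum>x\<in>{x\<in>I\<times>I. (\<lambda>(k,l). k + l) x = N}. (\<lambda>(k,l). rsqrt_coeff k * rsqrt_coeff l * d (k + l)) x)"
    using I by (intro sum.group[symmetric]) (auto simp: image_subset_iff mult_2 add_strict_mono)
  also have "\<dots> = (\<Sum>N<2*n. d N * (\<Sum>(k,l)\<in>{(k,l)\<in>I\<times>I. k + l = N}. rsqrt_coeff k * rsqrt_coeff l))"
    unfolding sum_distrib_left by (intro sum.cong refl) (auto simp: split_beta)
  finally show "(\<Sum>k\<in>I. \<Sum>l\<in>I. rsqrt_coeff k * rsqrt_coeff l * d (k + l)) =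
      (\<Sum>N<2*n. d N * (\<Sum>(k,l)\<in>{(k,l)\<in>I\<times>I. k + l = N}. rsqrt_coeff k * rsqrt_coeff l))" .
  fix N
  have all: "(\<Sum>(k,l)\<in>(\<lambda>k. (k, N - k)) ` {..N}. rsqrt_coeff k * rsqrt_coeff l) = 1"
    by (subst sum.reindex) (auto simp: inj_on_def rsqrt_coeff_convolution)
  have sub: "{(k,l)\<in>I\<times>I. k + l = N} \<subseteq> (\<lambda>k. (k, N - k)) ` {..N}" by force
  have "(\<Sum>(k,l)\<in>{(k,l)\<in>I\<times>I. k + l = N}. rsqrt_coeff k * rsqrt_coeff l)
      \<le> (\<Sum>(k,l)\<in>(\<lambda>k. (k, N - k)) ` {..N}. rsqrt_coeff k * rsqrt_coeff l)"
    using sub by (intro sum_mono2) (auto simp: rsqrt_coeff_nonneg)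
  then show "(\<Sum>(k,l)\<in>{(k,l)\<in>I\<times>I. k + l = N}. rsqrt_coeff k * rsqrt_coeff l) \<le> 1"
    using all by simp
  show "0 \<le> (\<Sum>(k,l)\<in>{(k,l)\<in>I\<times>I. k + l = N}. rsqrt_coeff k * rsqrt_coeff l)"
    by (intro sum_nonneg) (auto simp: rsqrt_coeff_nonneg)
  assume N: "{..N} \<subseteq> I"
  have "{(k,l)\<in>I\<times>I. k + l = N} = (\<lambda>k. (k, N - k)) ` {..N}"
    using sub N by (auto simp: subset_iff)
  then show "(\<Sum>(k,l)\<in>{(k,l)\<in>I\<times>I. k + l = N}. rsqrt_coeff k * rsqrt_coeff l) = 1"
    using all by simp
qed

text \<open>Quadratic expressions in a piece of the series are compared with plain sums of
  \<open>d\<close>, without estimating single coefficients; indices in \<open>{m..<n}\<close> have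
  their sums in \<open>{2*m..<2*n}\<close>.\<close>

lemma rsqrt_coeff_double_sum_le:
  fixes d :: "nat \<Rightarrow> real"
  assumes d: "\<And>N. 0 \<le> d N"
  shows "(\<Sum>k\<in>{m..<n}. \<Sum>l\<in>{m..<n}. rsqrt_coeff k * rsqrt_coeff l * d (k + l)) \<le> (\<Sum>N\<in>{2*m..<2*n}. d N)"
proof -
  let ?W = "\<lambda>N. (\<Sum>(k,l)\<in>{(k,l)\<in>{m..<n}\<times>{m..<n}. k + l = N}. rsqrt_coeff k * rsqrt_coeff l)"
  have "(\<Sum>k\<in>{m..<n}. \<Sum>l\<in>{m..<n}. rsqrt_coeff k * rsqrt_coeff l * d (k + l)) = (\<Sum>N<2*n. d N * ?W N)"
    using d by (intro rsqrt_coeff_double_sum(1)) auto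
  also have "\<dots> = (\<Sum>N\<in>{2*m..<2*n}. d N * ?W N)"
  proof (rule sum.mono_neutral_right)
    show "\<forall>N\<in>{..<2*n} - {2*m..<2*n}. d N * ?W N = 0"
    proof
      fix N assume "N \<in> {..<2*n} - {2*m..<2*n}"
      then have "{(k,l)\<in>{m..<n}\<times>{m..<n}. k + l = N} = {}" by auto
      then show "d N * ?W N = 0" by (simp only: sum.empty mult_zero_right)
    qed
  qed auto
  also have "\<dots> \<le> (\<Sum>N\<in>{2*m..<2*n}. d N * 1)"
    using d by (intro sum_mono mult_left_mono rsqrt_coeff_double_sum(2)[of _ n d]) auto
  finally show ?thesis by simp
qed

lemma rsqrt_coeff_double_sum_ge:
  fixes d :: "nat \<Rightarrow> real"
  assumes d: "\<And>N. 0 \<le> d N"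
  shows "(\<Sum>N<n. d N) \<le> (\<Sum>k<n. \<Sum>l<n. rsqrt_coeff k * rsqrt_coeff l * d (k + l))"
proof -
  let ?W = "\<lambda>N. (\<Sum>(k,l)\<in>{(k,l)\<in>{..<n}\<times>{..<n}. k + l = N}. rsqrt_coeff k * rsqrt_coeff l)"
  have "(\<Sum>N<n. d N) = (\<Sum>N<n. d N * ?W N)"
    using d by (intro sum.cong refl) (subst rsqrt_coeff_double_sum(4)[of _ n d], auto)
  also have "\<dots> \<le> (\<Sum>N<2*n. d N * ?W N)"
    using d by (intro sum_mono2 mult_nonneg_nonneg rsqrt_coeff_double_sum(3)[of _ n d]) auto
  also have "\<dots> = (\<Sum>k<n. \<Sum>l<n. rsqrt_coeff k * rsqrt_coeff l * d (k + l))"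
    using d by (intro rsqrt_coeff_double_sum(1)[symmetric]) auto
  finally show ?thesis .
qed

text \<open>The canonical tight frame \<open>S\<^sup>-\<^sup>1\<^sup>/\<^sup>2 e\<close> of a total Bessel system \<open>e = (tau g (z n))\<close> with frame operator
  \<open>S\<close>. The power series of \<open>(1 - D)\<^sup>-\<^sup>1\<^sup>/\<^sup>2\<close> at \<open>D = 1 - S\<close> converges on the frame vectors, because
  its coefficients are nonnegative and their Cauchy square is the geometric series.\<close>

locale bessel_system = hilbert_rep +
  fixes z :: "nat \<Rightarrow> 'a"
  assumes zV [simp]: "\<And>n. z n \<in> V"
    and bessel_bound: "\<And>u J. \<lbrakk>u \<in> V; finite J; J \<subseteq> UNIV \<times> carrier G\<rbrakk> \<Longrightarrow>
        (\<Sum>j\<in>J. (ip u (tau (snd j) (z (fst j))))\<^sup>2) \<le> ip u u"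
    and total: "\<And>u. \<lbrakk>u \<in> V; \<And>n g. g \<in> carrier G \<Longrightarrow> ip u (tau g (z n)) = 0\<rbrakk> \<Longrightarrow> ip u u = 0"
begin

abbreviation J :: "(nat \<times> 'b) set" where "J \<equiv> UNIV \<times> carrier G"

definition c :: "'a \<Rightarrow> nat \<times> 'b \<Rightarrow> real" where
  "c u j = ip u (tau (snd j) (z (fst j)))"

text \<open>The bilinear form of the frame operator. It is a second semi-inner product, dominated by
  \<open>ip\<close>, so Cauchy--Schwarz is available for both.\<close>

definition B :: "'a \<Rightarrow> 'a \<Rightarrow> real" where
  "B u v = (\<Sum>\<^sub>\<infinity>j\<in>J. c u j * c v j)"

lemma c_add: "\<lbrakk>u \<in> V; v \<in> V; j \<in> J\<rbrakk> \<Longrightarrow> c (u + v) j = c u j + c v j"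
  by (auto simp: c_def ip_add)

lemma c_scale: "\<lbrakk>u \<in> V; j \<in> J\<rbrakk> \<Longrightarrow> c (r *\<^sub>R u) j = r * c u j"
  by (auto simp: c_def ip_scale)

lemma c_square_summable: "u \<in> V \<Longrightarrow> (\<lambda>j. (c u j)\<^sup>2) summable_on J"
  using bessel_bound by (intro nonneg_bdd_above_summable_on bdd_aboveI[of _ "ip u u"]) (auto simp: c_def)

lemma c_mult_summable:
  assumes "u \<in> V" "v \<in> V"
  shows "(\<lambda>j. c u j * c v j) summable_on J"
proof -
  have "(\<lambda>j. (c u j)\<^sup>2 + (c v j)\<^sup>2) summable_on J"
    using assms by (intro summable_on_add c_square_summable)
  moreover have "norm (c u j * c v j) \<le> (c u j)\<^sup>2 + (c v j)\<^sup>2" for j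
  proof -
    have "2 * (\<bar>c u j\<bar> * \<bar>c v j\<bar>) \<le> (c u j)\<^sup>2 + (c v j)\<^sup>2"
      using sum_squares_bound[of "\<bar>c u j\<bar>" "\<bar>c v j\<bar>"] by simp
    moreover have "0 \<le> \<bar>c u j\<bar> * \<bar>c v j\<bar>" by simp
    ultimately show ?thesis unfolding real_norm_def abs_mult by argo
  qed
  ultimately have "(\<lambda>j. norm (c u j * c v j)) summable_on J"
    by (rule summable_on_comparison_test) auto
  then show ?thesis by (rule abs_summable_summable)
qed

sublocale B: semi_inner V B
proof
  fix u v w assume [simp]: "u \<in> V" "v \<in> V" "w \<in> V"
  show "B (u + v) w = B u w + B v w"
    unfolding B_def by (subst infsum_add[symmetric])
      (auto intro!: c_mult_summable infsum_cong simp: c_add algebra_simps)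
  show "B (r *\<^sub>R u) w = r * B u w" for r
    unfolding B_def by (subst infsum_cmult_right'[symmetric]) (auto intro!: infsum_cong simp: c_scale)
  show "B u v = B v u" by (simp add: B_def mult.commute)
  show "0 \<le> B u u" unfolding B_def by (intro infsum_nonneg) auto
qed (rule subspace_V)

lemma B_eq: "B u u = (\<Sum>\<^sub>\<infinity>j\<in>J. (c u j)\<^sup>2)"
  by (simp add: B_def power2_eq_square)

lemma B_le: "u \<in> V \<Longrightarrow> B u u \<le> ip u u"
  unfolding B_eq using bessel_bound by (intro infsum_le_finite_sums c_square_summable) (auto simp: c_def)

lemma sum_c_le_B: "\<lbrakk>u \<in> V; finite F; F \<subseteq> J\<rbrakk> \<Longrightarrow> (\<Sum>j\<in>F. (c u j)\<^sup>2) \<le> B u u"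
  unfolding B_eq by (intro finite_sum_le_infsum c_square_summable) auto

text \<open>The Riesz vector is unique only up to null vectors and the choice need not be linear;
  all arguments go through \<open>B u v = ip v (S u)\<close>.\<close>

definition S :: "'a \<Rightarrow> 'a" where
  "S u = (SOME w. w \<in> V \<and> (\<forall>v\<in>V. B u v = ip v w))"

lemma S: "u \<in> V \<Longrightarrow> S u \<in> V" "\<lbrakk>u \<in> V; v \<in> V\<rbrakk> \<Longrightarrow> B u v = ip v (S u)"
proof -
  have "S u \<in> V \<and> (\<forall>v\<in>V. B u v = ip v (S u))" if u: "u \<in> V"
  proof -
    have "\<exists>w\<in>V. (\<forall>e>0. \<exists>c\<in>V. ip (c - w) (c - w) < e) \<and> (\<forall>c\<in>V. B u c = ip c w)"
    proof (rule Riesz_subspace[OF subspace_V order_refl, where K = "B u u"])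
      fix v assume v: "v \<in> V"
      have "(B u v)\<^sup>2 \<le> B u u * B v v" using u v by (rule B.Cauchy_Schwarz)
      also have "\<dots> \<le> B u u * ip v v" using u v by (intro mult_left_mono B_le B.ip_nonneg)
      finally show "(B u v)\<^sup>2 \<le> B u u * ip v v" .
    qed (use u in \<open>auto simp: B.ip_linear B.ip_nonneg\<close>)
    then show ?thesis
      unfolding S_def by (intro someI_ex[where P = "\<lambda>w. w \<in> V \<and> (\<forall>v\<in>V. B u v = ip v w)"]) blast
  qed
  then show "u \<in> V \<Longrightarrow> S u \<in> V" "\<lbrakk>u \<in> V; v \<in> V\<rbrakk> \<Longrightarrow> B u v = ip v (S u)" by auto
qed

definition D :: "'a \<Rightarrow> 'a" where "D u = u - S u"

lemma D_V [simp]: "u \<in> V \<Longrightarrow> D u \<in> V"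
  by (simp add: D_def S)

lemma ip_D: "\<lbrakk>u \<in> V; v \<in> V\<rbrakk> \<Longrightarrow> ip (D u) v = ip u v - B u v"
  using S[of u] by (simp add: D_def ip_diff ip_sym[of "S u" v])

lemma D_sym: "\<lbrakk>u \<in> V; v \<in> V\<rbrakk> \<Longrightarrow> ip (D u) v = ip u (D v)"
  using ip_D[of u v] ip_D[of v u] by (simp add: ip_sym B.ip_sym)

lemma Dk_V [simp]: "u \<in> V \<Longrightarrow> (D ^^ k) u \<in> V"
  by (induction k) auto

lemma Dk_ip: "\<lbrakk>u \<in> V; v \<in> V\<rbrakk> \<Longrightarrow> ip ((D ^^ m) u) ((D ^^ n) v) = ip ((D ^^ (m + n)) u) v"
proof (induction n arbitrary: m)
  case (Suc n)
  then have "ip ((D ^^ m) u) ((D ^^ Suc n) v) = ip ((D ^^ Suc m) u) ((D ^^ n) v)"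
    using D_sym[of "(D ^^ m) u" "(D ^^ n) v"] by simp
  also have "\<dots> = ip ((D ^^ (Suc m + n)) u) v" using Suc by blast
  finally show ?case by simp
qed auto

text \<open>The moments of the spectral measure of \<open>D\<close> at \<open>u\<close>. As
  \<open>0 \<le> D \<le> 1\<close>, they are nonnegative and decreasing, and their limit is the mass
  at the eigenvalue 1 of \<open>D\<close>, that is, at the kernel of the frame operator.\<close>

definition a :: "'a \<Rightarrow> nat \<Rightarrow> real" where "a u N = ip ((D ^^ N) u) u"

lemma a_0: "a u 0 = ip u u" by (simp add: a_def)

lemma ip_Dk: "u \<in> V \<Longrightarrow> ip ((D ^^ m) u) ((D ^^ n) u) = a u (m + n)"
  by (simp add: a_def Dk_ip)

lemma B_Dk: "u \<in> V \<Longrightarrow> B ((D ^^ m) u) ((D ^^ n) u) = a u (m + n) - a u (Suc (m + n))"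
  using ip_D[of "(D ^^ m) u" "(D ^^ n) u"] ip_Dk[of u "Suc m" n] by (simp add: ip_Dk)

text \<open>At \<open>x = (D ^^ k) u\<close> the operator inequalities
  \<open>D^2 \<le> D \<le> 1\<close> compare consecutive moments. Even moments are squared norms,
  and monotonicity carries their nonnegativity over to all moments.\<close>

lemma a_Suc_le_nonneg:
  assumes u: "u \<in> V"
  shows "a u (Suc N) \<le> a u N" "0 \<le> a u N"
proof -
  have main: "a u (2 * k) \<ge> a u (2 * k + 1) \<and> a u (2 * k + 1) \<ge> a u (2 * k + 2) \<and> a u (2 * k) \<ge> 0" for k
  proof -
    define x where "x = (D ^^ k) u"
    have x: "x \<in> V" using u by (simp add: x_def)
    have Sx: "S x \<in> V" using x by (rule S)
    have a1: "a u (2 * k) = ip x x" using ip_Dk[OF u, of k k] by (simp add: x_def mult_2)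
    have a2: "a u (2 * k + 1) = ip (D x) x" using ip_Dk[OF u, of "Suc k" k] by (simp add: x_def mult_2)
    have a3: "a u (2 * k + 2) = ip (D x) (D x)" using ip_Dk[OF u, of "Suc k" "Suc k"] by (simp add: x_def mult_2)
    \<comment> \<open>This yields \<open>S^2 \<le> S\<close>, from Cauchy--Schwarz for
      \<open>B\<close> and \<open>B \<le> ip\<close>; for \<open>D = 1 - S\<close> it is the same as
      \<open>D^2 \<le> D\<close>.\<close>
    have "(ip (S x) (S x))\<^sup>2 = (B x (S x))\<^sup>2" using x Sx by (simp add: S(2))
    also have "\<dots> \<le> B x x * B (S x) (S x)" using x Sx by (rule B.Cauchy_Schwarz)
    also have "\<dots> \<le> B x x * ip (S x) (S x)" using x Sx by (intro mult_left_mono B_le B.ip_nonneg)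
    finally have "ip (S x) (S x) * ip (S x) (S x) \<le> B x x * ip (S x) (S x)" by (simp add: power2_eq_square)
    then have SS: "ip (S x) (S x) \<le> B x x"
      using ip_nonneg[OF Sx] B.ip_nonneg[OF x] by (cases "ip (S x) (S x) = 0") (auto simp: mult_le_cancel_right)
    have "ip (D x) x - ip (D x) (D x) = B x (D x)"
      using ip_D[of x "D x"] ip_sym[of x "D x"] x by simp
    also have "\<dots> = B x x - ip (S x) (S x)"
      using x Sx by (simp add: S(2) D_def ip_diff ip_diff_right ip_sym)
    finally have "ip (D x) (D x) \<le> ip (D x) x" using SS by simp
    moreover have "ip (D x) x \<le> ip x x" using x B.ip_nonneg[OF x] by (simp add: ip_D)
    ultimately show ?thesis unfolding a1 a2 a3 using ip_nonneg[OF x] by simp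
  qed
  have le: "a u (Suc N) \<le> a u N" for N
  proof (cases "even N")
    case True
    then obtain k where "N = 2 * k" by (rule evenE)
    then show ?thesis using main[of k] by simp
  next
    case False
    then obtain k where "N = 2 * k + 1" by (rule oddE)
    then show ?thesis using main[of k] by simp
  qed
  show "a u (Suc N) \<le> a u N" by (rule le)
  have "a u (2 * N) \<le> a u N" using le by (rule lift_Suc_antimono_le[of "a u"]) simp
  then show "0 \<le> a u N" using main[of N] by simp
qed

lemma a_decseq: "u \<in> V \<Longrightarrow> decseq (a u)"
  by (intro decseq_SucI a_Suc_le_nonneg)

text \<open>The powers \<open>(D ^^ k) u\<close> form a Cauchy sequence because the moments
  converge. The value of \<open>B\<close> at a power is a difference of consecutive moments, so all
  frame coefficients of the limit are 0, and totality makes the limit null.\<close>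

lemma a_tendsto_0:
  assumes u: "u \<in> V"
  shows "a u \<longlonglongrightarrow> 0"
proof -
  obtain L where L: "a u \<longlonglongrightarrow> L" "\<And>n. L \<le> a u n"
    using decseq_convergent[OF a_decseq[OF u], of 0] a_Suc_le_nonneg(2)[OF u] by blast
  define X where "X k = (D ^^ k) u" for k
  have XV: "X k \<in> V" for k using u by (simp add: X_def)
  have "\<exists>l\<in>V. (\<lambda>n. ip (X n - l) (X n - l)) \<longlonglongrightarrow> 0"
  proof (rule complete[OF XV])
    fix e :: real assume "e > 0"
    then have "\<forall>\<^sub>F n in sequentially. a u n < L + e / 2"
      using L(1) by (intro order_tendstoD(2)[OF L(1)]) simp
    then obtain N where N: "a u n < L + e / 2" if "n \<ge> N" for n
      by (auto simp: eventually_sequentially)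
    have "ip (X k - X l) (X k - X l) < e" if "k \<ge> N" "l \<ge> N" for k l
    proof -
      have "ip (X k - X l) (X k - X l) = a u (k + k) - 2 * a u (k + l) + a u (l + l)"
        using XV u by (simp add: ip_square_diff X_def ip_Dk)
      then show ?thesis using N[of "k + k"] N[of "l + l"] L(2)[of "k + l"] that by simp
    qed
    then show "\<exists>N. \<forall>m\<ge>N. \<forall>n\<ge>N. ip (X m - X n) (X m - X n) < e" by blast
  qed
  then obtain l where l: "l \<in> V" "(\<lambda>n. ip (X n - l) (X n - l)) \<longlonglongrightarrow> 0" by blast
  have sub: "(\<lambda>k. a u (k + k)) \<longlonglongrightarrow> L" 
    by (rule filterlim_compose[OF L(1)]) (auto intro!: filterlim_subseq simp: strict_mono_def)
  have sub': "(\<lambda>k. a u (Suc (k + k))) \<longlonglongrightarrow> L" 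
    by (rule filterlim_compose[OF L(1)]) (auto intro!: filterlim_subseq simp: strict_mono_def)
  have "ip l l = 0"
  proof (rule total[OF l(1)])
    fix n g assume g: "g \<in> carrier G"
    have "(\<lambda>k. (ip (X k) (tau g (z n)))\<^sup>2) \<longlonglongrightarrow> (ip l (tau g (z n)))\<^sup>2"
      using g by (intro tendsto_intros tendsto_ip XV l) auto
    moreover have "(\<lambda>k. (ip (X k) (tau g (z n)))\<^sup>2) \<longlonglongrightarrow> 0"
    proof (rule tendsto_sandwich[OF _ _ tendsto_const])
      show "\<forall>\<^sub>F k in sequentially. (ip (X k) (tau g (z n)))\<^sup>2 \<le> a u (k + k) - a u (Suc (k + k))"
        using sum_c_le_B[OF XV, of "{(n, g)}"] g u B_Dk[OF u] by (auto simp: X_def c_def)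
      show "(\<lambda>k. a u (k + k) - a u (Suc (k + k))) \<longlonglongrightarrow> 0"
        using tendsto_diff[OF sub sub'] by simp
    qed auto
    ultimately have "(ip l (tau g (z n)))\<^sup>2 = 0" by (rule LIMSEQ_unique)
    then show "ip l (tau g (z n)) = 0" by simp
  qed
  moreover have "(\<lambda>k. ip (X k) (X k)) \<longlonglongrightarrow> ip l l"
    by (intro tendsto_ip_square XV l)
  moreover have "ip (X k) (X k) = a u (k + k)" for k using u by (simp add: X_def ip_Dk)
  ultimately have "L = 0" using sub LIMSEQ_unique by force
  then show ?thesis using L by simp
qed

text \<open>Partial sums of the series for the power -1/2 of the frame operator, applied to
  \<open>u\<close>.\<close>

definition p :: "nat \<Rightarrow> 'a \<Rightarrow> 'a" where
  "p m u = (\<Sum>k<m. rsqrt_coeff k *\<^sub>R (D ^^ k) u)"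

lemma p_V [simp]: "u \<in> V \<Longrightarrow> p m u \<in> V"
  by (auto simp: p_def intro!: V_sum)

lemma p_diff: "m \<le> n \<Longrightarrow> p n u - p m u = (\<Sum>k\<in>{m..<n}. rsqrt_coeff k *\<^sub>R (D ^^ k) u)"
  unfolding p_def by (simp add: sum_diff_nat_ivl lessThan_atLeast0)

lemma (in semi_inner) ip_double_sum:
  assumes "\<And>i. i \<in> I \<Longrightarrow> x i \<in> V"
  shows "ip (\<Sum>k\<in>I. r k *\<^sub>R x k) (\<Sum>l\<in>I. r l *\<^sub>R x l) = (\<Sum>k\<in>I. \<Sum>l\<in>I. r k * r l * ip (x k) (x l))"
proof -
  have "ip (\<Sum>k\<in>I. r k *\<^sub>R x k) (\<Sum>l\<in>I. r l *\<^sub>R x l) = (\<Sum>k\<in>I. ip (r k *\<^sub>R x k) (\<Sum>l\<in>I. r l *\<^sub>R x l))"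
    using assms by (intro ip_sum V_sum) auto
  also have "\<dots> = (\<Sum>k\<in>I. \<Sum>l\<in>I. ip (r k *\<^sub>R x k) (r l *\<^sub>R x l))"
    using assms by (intro sum.cong refl ip_sum_right) auto
  also have "\<dots> = (\<Sum>k\<in>I. \<Sum>l\<in>I. r k * r l * ip (x k) (x l))"
    using assms by (intro sum.cong refl) (simp add: ip_scale ip_scale_right)
  finally show ?thesis .
qed

text \<open>\<open>B\<close> turns moments into differences of consecutive moments, so the bound
  telescopes; it tends to 0 with \<open>m\<close> for every \<open>u\<close>, even where the series
  itself diverges in norm.\<close>

lemma B_p_diff_le:
  assumes u: "u \<in> V" and "m \<le> n"
  shows "B (p n u - p m u) (p n u - p m u) \<le> a u (2 * m)"
proof -
  define d where "d N = a u N - a u (Suc N)" for N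
  have d: "0 \<le> d N" for N using a_Suc_le_nonneg(1)[OF u] by (simp add: d_def)
  have "B (p n u - p m u) (p n u - p m u) =
      (\<Sum>k\<in>{m..<n}. \<Sum>l\<in>{m..<n}. rsqrt_coeff k * rsqrt_coeff l * d (k + l))"
    unfolding p_diff[OF assms(2)] using u by (subst B.ip_double_sum) (auto simp: B_Dk d_def)
  also have "\<dots> \<le> (\<Sum>N\<in>{2*m..<2*n}. d N)" using d by (rule rsqrt_coeff_double_sum_le)
  also have "\<dots> = a u (2 * m) - a u (2 * n)"
    using sum_Suc_diff'[of "2 * m" "2 * n" "\<lambda>N. - a u N"] assms(2) by (simp add: d_def)
  also have "\<dots> \<le> a u (2 * m)" using a_Suc_le_nonneg(2)[OF u] by simp
  finally show ?thesis .
qed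

lemma B_p_bounds:
  assumes u: "u \<in> V"
  shows "ip u u - a u n \<le> B (p n u) (p n u)" "B (p n u) (p n u) \<le> ip u u"
proof -
  define d where "d N = a u N - a u (Suc N)" for N
  have d: "0 \<le> d N" for N using a_Suc_le_nonneg(1)[OF u] by (simp add: d_def)
  show "B (p n u) (p n u) \<le> ip u u"
    using B_p_diff_le[OF u, of 0 n] by (simp add: p_def a_0)
  have "ip u u - a u n = (\<Sum>N<n. d N)"
    unfolding d_def by (simp add: sum_lessThan_telescope' a_0)
  also have "\<dots> \<le> (\<Sum>k<n. \<Sum>l<n. rsqrt_coeff k * rsqrt_coeff l * d (k + l))"
    using d by (rule rsqrt_coeff_double_sum_ge)
  also have "\<dots> = B (p n u) (p n u)"
    unfolding p_def using u by (subst B.ip_double_sum) (auto simp: B_Dk d_def)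
  finally show "ip u u - a u n \<le> B (p n u) (p n u)" .
qed

text \<open>The square root of the frame operator cancels its inverse, expressed through the form
  \<open>B\<close>.\<close>

lemma B_p_tendsto:
  assumes u: "u \<in> V"
  shows "(\<lambda>n. B (p n u) (p n u)) \<longlonglongrightarrow> ip u u"
proof (rule tendsto_sandwich[OF _ _ _ tendsto_const])
  show "(\<lambda>n. ip u u - a u n) \<longlonglongrightarrow> ip u u"
    using tendsto_diff[OF tendsto_const a_tendsto_0[OF u], of "ip u u"] by simp
qed (use B_p_bounds[OF u] in auto)

text \<open>A frame vector lies in the range of the square root of the frame operator, with a
  preimage of norm at most 1. For the partial Neumann sum \<open>q\<close> of the inverse of
  \<open>S\<close> at \<open>z i\<close> and \<open>t = ip q (z i)\<close>, telescoping gives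
  \<open>B q q \<le> t\<close>, while \<open>t^2\<close> is a single term of the sum defining
  \<open>B q q\<close>; hence \<open>t^2 \<le> t\<close>.\<close>

lemma sum_a_z_le: "(\<Sum>N<n. a (z i) N) \<le> 1"
proof -
  define q t where "q = (\<Sum>N<n. (D ^^ N) (z i))" and "t = (\<Sum>N<n. a (z i) N)"
  have q: "q \<in> V" by (auto simp: q_def intro!: V_sum)
  have t: "t = ip q (z i)" by (simp add: t_def q_def a_def ip_sum)
  have ip_q: "ip q v = (\<Sum>N<n. ip ((D ^^ N) (z i)) v)" if "v \<in> V" for v
    using that by (simp add: q_def ip_sum)
  have Bq: "B q q = ip (z i) q - ip ((D ^^ n) (z i)) q"
  proof -
    have "B q q = ip q q - ip (D q) q" using q by (simp add: ip_D)
    also have "\<dots> = ip q q - ip q (D q)" using q by (simp add: D_sym)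
    also have "\<dots> = (\<Sum>N<n. ip ((D ^^ N) (z i)) q - ip ((D ^^ N) (z i)) (D q))"
      using q by (simp add: ip_q sum_subtractf)
    also have "\<dots> = (\<Sum>N<n. ip ((D ^^ N) (z i)) q - ip ((D ^^ Suc N) (z i)) q)"
      using q by (simp add: D_sym)
    finally show ?thesis
      using sum_lessThan_telescope'[of "\<lambda>N. ip ((D ^^ N) (z i)) q" n] by simp
  qed
  moreover have "ip ((D ^^ n) (z i)) q = (\<Sum>M<n. a (z i) (n + M))"
    by (simp add: q_def ip_sum_right ip_Dk)
  then have "0 \<le> ip ((D ^^ n) (z i)) q" using a_Suc_le_nonneg(2) by (simp add: sum_nonneg)
  ultimately have "B q q \<le> t" using q by (simp add: t ip_sym)
  moreover have "t\<^sup>2 \<le> B q q"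
    using sum_c_le_B[OF q, of "{(i, \<one>)}"] q by (simp add: c_def t ip_sym[OF q] tau_one)
  ultimately have "t * t \<le> 1 * t" by (simp add: power2_eq_square)
  moreover have "0 \<le> t" using a_Suc_le_nonneg(2) by (simp add: t_def sum_nonneg)
  ultimately have "t \<le> 1" by (cases "t = 0") (auto simp: mult_le_cancel_right)
  then show ?thesis by (simp add: t_def)
qed

text \<open>Summable moments make the series converge in norm at the frame vectors; for a general
  \<open>u\<close> only the coefficients of \<open>p m u\<close> are controlled.\<close>

lemma p_z_convergent: "\<exists>w\<in>V. (\<lambda>m. ip (p m (z i) - w) (p m (z i) - w)) \<longlonglongrightarrow> 0"
proof (rule complete)
  fix e :: real assume "e > 0"
  have "sum (a (z i)) {..n} \<le> 1" for n
    using sum_a_z_le[of i "Suc n"] by (simp add: lessThan_Suc_atMost del: sum.lessThan_Suc)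
  then have "summable (a (z i))"
    using a_Suc_le_nonneg(2) by (intro bounded_imp_summable[where B = 1]) auto
  then obtain N where N: "\<And>m n. m \<ge> N \<Longrightarrow> norm (sum (a (z i)) {m..<n}) < e"
    using \<open>e > 0\<close> unfolding summable_Cauchy by blast
  have le: "ip (p n (z i) - p m (z i)) (p n (z i) - p m (z i)) < e" if "N \<le> m" "m \<le> n" for m n
  proof -
    have "ip (p n (z i) - p m (z i)) (p n (z i) - p m (z i)) =
        (\<Sum>k\<in>{m..<n}. \<Sum>l\<in>{m..<n}. rsqrt_coeff k * rsqrt_coeff l * a (z i) (k + l))"
      unfolding p_diff[OF that(2)] by (subst ip_double_sum) (auto simp: ip_Dk)
    also have "\<dots> \<le> (\<Sum>N\<in>{2*m..<2*n}. a (z i) N)"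
      using a_Suc_le_nonneg(2)[OF zV] by (rule rsqrt_coeff_double_sum_le)
    also have "\<dots> < e" using N[of "2 * m" "2 * n"] that by auto
    finally show ?thesis .
  qed
  have "ip (p m (z i) - p n (z i)) (p m (z i) - p n (z i)) < e" if "m \<ge> N" "n \<ge> N" for m n
    using le[of m n] le[of n m] that ip_square_diff_commute[of "p m (z i)" "p n (z i)"]
    by (cases "m \<le> n") auto
  then show "\<exists>N. \<forall>m\<ge>N. \<forall>n\<ge>N. ip (p m (z i) - p n (z i)) (p m (z i) - p n (z i)) < e" by blast
qed simp

text \<open>Left multiplication by \<open>inv h\<close> permutes the frame indices, so the frame
  operator commutes with translations.\<close>

lemma B_tau:
  assumes h: "h \<in> carrier G" and u: "u \<in> V" and v: "v \<in> V"
  shows "B (tau h u) v = B u (tau (inv h) v)"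
proof -
  have bij: "bij_betw (\<lambda>(n, g). (n, inv h \<otimes> g)) J J"
  proof (rule bij_betwI[where g = "\<lambda>(n, g). (n, h \<otimes> g)"])
    have "h \<otimes> (inv h \<otimes> g) = g" "inv h \<otimes> (h \<otimes> g) = g" if "g \<in> carrier G" for g
      using h that by (metis m_assoc inv_closed r_inv l_inv l_one)+
    then show "(case case j of (n, g) \<Rightarrow> (n, inv h \<otimes> g) of (n, g) \<Rightarrow> (n, h \<otimes> g)) = j"
        "(case case j of (n, g) \<Rightarrow> (n, h \<otimes> g) of (n, g) \<Rightarrow> (n, inv h \<otimes> g)) = j" if "j \<in> J" for j
      using that by auto
  qed (use h in auto)
  have "B u (tau (inv h) v) = (\<Sum>\<^sub>\<infinity>(n,g)\<in>J. c u (n, inv h \<otimes> g) * c (tau (inv h) v) (n, inv h \<otimes> g))"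
    unfolding B_def by (subst infsum_reindex_bij_betw[OF bij, symmetric]) (simp add: case_prod_unfold)
  also have "\<dots> = B (tau h u) v"
    unfolding B_def
  proof (intro infsum_cong, clarify)
    fix n g assume g: "g \<in> carrier G"
    have "c u (n, inv h \<otimes> g) = ip u (tau (inv h) (tau g (z n)))"
      using g h u by (simp add: c_def tau_mult_right)
    also have "\<dots> = c (tau h u) (n, g)" using g h u by (simp add: c_def tau_adjoint)
    finally have 1: "c u (n, inv h \<otimes> g) = c (tau h u) (n, g)" .
    have "c (tau (inv h) v) (n, inv h \<otimes> g) = ip (tau (inv h) v) (tau (inv h) (tau g (z n)))"
      using g h v by (simp add: c_def tau_mult_right)
    also have "\<dots> = c v (n, g)" using g h v by (simp add: c_def tau_isometric)
    finally show "c u (n, inv h \<otimes> g) * c (tau (inv h) v) (n, inv h \<otimes> g) = c (tau h u) (n, g) * c v (n, g)"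
      using 1 by simp
  qed
  finally show ?thesis by simp
qed

lemma Dk_tau:
  assumes h: "h \<in> carrier G" and u: "u \<in> V" and v: "v \<in> V"
  shows "ip ((D ^^ k) (tau h u)) v = ip ((D ^^ k) u) (tau (inv h) v)"
  using v
proof (induction k arbitrary: v)
  case 0
  then show ?case using h u by (simp add: tau_adjoint)
next
  case (Suc k)
  define Y where "Y = (D ^^ k) u"
  have Y: "Y \<in> V" using u by (simp add: Y_def)
  have "ip ((D ^^ Suc k) (tau h u)) v = ip ((D ^^ k) (tau h u)) (D v)"
    using h u Suc by (simp add: D_sym)
  also have "\<dots> = ip Y (tau (inv h) (D v))" using Suc by (simp add: Y_def)
  also have "\<dots> = ip (D (tau h Y)) v" using h Y Suc by (simp add: tau_adjoint D_sym)
  also have "\<dots> = ip (tau h Y) v - B (tau h Y) v" using h Y Suc by (simp add: ip_D)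
  also have "\<dots> = ip (D Y) (tau (inv h) v)" using h Y Suc by (simp add: ip_D tau_adjoint B_tau)
  finally show ?case by (simp add: Y_def)
qed

text \<open>\<open>p m\<close> is selfadjoint and equivariant, so testing a translate of
  \<open>p m (z n)\<close> against \<open>u\<close> reads off a frame coefficient of
  \<open>p m u\<close>. In the limit this describes the coefficients of \<open>u\<close> in the new
  frame.\<close>

lemma ip_p_tau:
  assumes g: "g \<in> carrier G" and u: "u \<in> V"
  shows "ip (p m (z n)) (tau (inv g) u) = c (p m u) (n, g)"
proof -
  have "ip (p m (z n)) (tau (inv g) u) = (\<Sum>k<m. rsqrt_coeff k * ip ((D ^^ k) (z n)) (tau (inv g) u))"
    unfolding p_def using g u by (subst ip_sum) (auto simp: ip_scale)
  also have "\<dots> = (\<Sum>k<m. rsqrt_coeff k * ip ((D ^^ k) u) (tau g (z n)))"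
  proof (intro sum.cong refl)
    fix k
    have "ip ((D ^^ k) (z n)) (tau (inv g) u) = ip ((D ^^ k) (tau g (z n))) u"
      using g u by (simp add: Dk_tau)
    also have "\<dots> = ip ((D ^^ k) u) (tau g (z n))"
      using g u Dk_ip[of u "tau g (z n)" 0 k] by (simp add: ip_sym)
    finally show "rsqrt_coeff k * ip ((D ^^ k) (z n)) (tau (inv g) u) = rsqrt_coeff k * ip ((D ^^ k) u) (tau g (z n))"
      by simp
  qed
  also have "\<dots> = ip (p m u) (tau g (z n))"
    unfolding p_def using g u by (subst ip_sum) (auto simp: ip_scale)
  finally show ?thesis by (simp add: c_def)
qed

theorem parseval_frame:
  "\<exists>w. (\<forall>n. w n \<in> V) \<and>
     (\<forall>u\<in>V. ((\<lambda>(n, g). (ip u (tau g (w n)))\<^sup>2) has_sum ip u u) J)"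
proof -
  obtain w where w: "\<And>n. w n \<in> V" "\<And>n. (\<lambda>m. ip (p m (z n) - w n) (p m (z n) - w n)) \<longlonglongrightarrow> 0"
    using p_z_convergent by metis
  have "((\<lambda>(n, g). (ip u (tau g (w n)))\<^sup>2) has_sum ip u u) J" if u: "u \<in> V" for u
  proof -
    define x where "x j = ip u (tau (snd j) (w (fst j)))" for j
    have lim: "(\<lambda>m. c (p m u) j) \<longlonglongrightarrow> x j" if j: "j \<in> J" for j
    proof -
      obtain n g where ng: "j = (n, g)" "g \<in> carrier G" using j by auto
      have "(\<lambda>m. ip (p m (z n)) (tau (inv g) u)) \<longlonglongrightarrow> ip (w n) (tau (inv g) u)"
        using ng u by (intro tendsto_ip w) auto
      moreover have "ip (w n) (tau (inv g) u) = x j"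
        using ng u w(1) by (simp add: x_def ip_sym[of u] tau_adjoint)
      ultimately show ?thesis using ng u by (simp add: ip_p_tau)
    qed
    have c_diff: "c (p n u - p m u) j = c (p n u) j - c (p m u) j" if "j \<in> J" for m n j
      using that u by (auto simp: c_def ip_diff)
    have upper: "(\<Sum>j\<in>F. (x j)\<^sup>2) \<le> ip u u" if F: "finite F" "F \<subseteq> J" for F
    proof (rule LIMSEQ_le_const2)
      show "(\<lambda>m. \<Sum>j\<in>F. (c (p m u) j)\<^sup>2) \<longlonglongrightarrow> (\<Sum>j\<in>F. (x j)\<^sup>2)"
        using F by (intro tendsto_intros lim) auto
      have "(\<Sum>j\<in>F. (c (p m u) j)\<^sup>2) \<le> ip u u" for m
        using sum_c_le_B[OF p_V[OF u] F] B_p_bounds(2)[OF u] by (rule order_trans)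
      then show "\<exists>N. \<forall>m\<ge>N. (\<Sum>j\<in>F. (c (p m u) j)\<^sup>2) \<le> ip u u" by blast
    qed
    \<comment> \<open>The bound is uniform in the finite set \<open>F\<close>: coefficients of
      differences are estimated by \<open>B\<close> first, and \<open>n\<close> tends to infinity
      afterwards.\<close>
    have tail: "(\<Sum>j\<in>F. (x j - c (p m u) j)\<^sup>2) \<le> a u (2 * m)" if F: "finite F" "F \<subseteq> J" for F m
    proof (rule LIMSEQ_le_const2)
      show "(\<lambda>n. \<Sum>j\<in>F. (c (p n u) j - c (p m u) j)\<^sup>2) \<longlonglongrightarrow> (\<Sum>j\<in>F. (x j - c (p m u) j)\<^sup>2)"
        using F by (intro tendsto_intros lim) auto
      have "(\<Sum>j\<in>F. (c (p n u) j - c (p m u) j)\<^sup>2) \<le> a u (2 * m)" if "n \<ge> m" for n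
      proof -
        have "(\<Sum>j\<in>F. (c (p n u) j - c (p m u) j)\<^sup>2) = (\<Sum>j\<in>F. (c (p n u - p m u) j)\<^sup>2)"
          using F by (intro sum.cong) (auto simp: c_diff subset_iff)
        also have "\<dots> \<le> B (p n u - p m u) (p n u - p m u)" using u F by (intro sum_c_le_B) auto
        also have "\<dots> \<le> a u (2 * m)" using u that by (rule B_p_diff_le)
        finally show ?thesis .
      qed
      then show "\<exists>N. \<forall>n\<ge>N. (\<Sum>j\<in>F. (c (p n u) j - c (p m u) j)\<^sup>2) \<le> a u (2 * m)" by blast
    qed
    have summable: "(\<lambda>j. (x j)\<^sup>2) summable_on J"
      using upper by (intro nonneg_bdd_above_summable_on bdd_aboveI[of _ "ip u u"]) auto
    define s where "s = (\<Sum>\<^sub>\<infinity>j\<in>J. (x j)\<^sup>2)"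
    have "s \<le> ip u u" unfolding s_def using summable upper by (intro infsum_le_finite_sums) auto
    moreover have "ip u u \<le> s"
    proof -
      have "ip u u \<le> (1 + t) * s" if t: "t > 0" for t
      proof -
        \<comment> \<open>The new coefficients are compared with those of \<open>p m u\<close> at
          the price of a factor \<open>1 + t\<close>. The error carries the factor
          \<open>1 + 1 / t\<close> but vanishes as \<open>m\<close> grows; \<open>t\<close> tends to
          0 last.\<close>
        have ineq: "r\<^sup>2 \<le> (1 + t) * y\<^sup>2 + (1 + 1 / t) * (y - r)\<^sup>2" for r y :: real
        proof -
          have "0 \<le> (t * y + (y - r))\<^sup>2 / t" using t by simp
          also have "\<dots> = (1 + t) * y\<^sup>2 + (1 + 1 / t) * (y - r)\<^sup>2 - r\<^sup>2"
            using t by (simp add: field_simps power2_eq_square)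
          finally show ?thesis by simp
        qed
        have "B (p m u) (p m u) \<le> (1 + t) * s + (1 + 1 / t) * a u (2 * m)" for m
          unfolding B_eq
        proof (rule infsum_le_finite_sums[OF c_square_summable[OF p_V[OF u]]])
          fix F assume F: "finite F" "F \<subseteq> J"
          have "(\<Sum>j\<in>F. (c (p m u) j)\<^sup>2) \<le> (\<Sum>j\<in>F. (1 + t) * (x j)\<^sup>2 + (1 + 1 / t) * (x j - c (p m u) j)\<^sup>2)"
            by (intro sum_mono ineq)
          also have "\<dots> = (1 + t) * (\<Sum>j\<in>F. (x j)\<^sup>2) + (1 + 1 / t) * (\<Sum>j\<in>F. (x j - c (p m u) j)\<^sup>2)"
            by (simp add: sum.distrib sum_distrib_left)
          also have "\<dots> \<le> (1 + t) * s + (1 + 1 / t) * a u (2 * m)"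
            using t F tail[OF F] finite_sum_le_infsum[OF summable F] unfolding s_def
            by (intro add_mono mult_left_mono) auto
          finally show "(\<Sum>j\<in>F. (c (p m u) j)\<^sup>2) \<le> (1 + t) * s + (1 + 1 / t) * a u (2 * m)" .
        qed
        moreover have "(\<lambda>m. (1 + t) * s + (1 + 1 / t) * a u (2 * m)) \<longlonglongrightarrow> (1 + t) * s + (1 + 1 / t) * 0"
          by (intro tendsto_intros filterlim_compose[OF a_tendsto_0[OF u]])
            (auto intro!: filterlim_subseq simp: strict_mono_def)
        ultimately show ?thesis
          using LIMSEQ_le[OF B_p_tendsto[OF u]] by auto
      qed
      note * = this
      have "((\<lambda>t. (1 + t) * s) \<longlongrightarrow> (1 + 0) * s) (at_right 0)"
        by (intro tendsto_intros)
      then have "ip u u \<le> (1 + 0) * s"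
        using * by (intro tendsto_lowerbound) (auto simp: eventually_at_filter)
      then show ?thesis by simp
    qed
    ultimately have "s = ip u u" by simp
    then have "((\<lambda>j. (x j)\<^sup>2) has_sum ip u u) J"
      using summable by (simp add: s_def has_sum_infsum flip: \<open>s = ip u u\<close>)
    then show ?thesis by (simp add: x_def case_prod_unfold)
  qed
  note has_sum = this
  show ?thesis by (rule exI[of _ w]) (use w(1) has_sum in simp)
qed

end

section \<open>Real L2-spaces, translation representations and separability\<close>

section \<open>Real square-integrable functions\<close>

definition l2 :: "'x measure \<Rightarrow> ('x \<Rightarrow> real) set" where
  "l2 M = {f \<in> borel_measurable M. integrable M (\<lambda>x. (f x)\<^sup>2)}"

definition l2_ip :: "'x measure \<Rightarrow> ('x \<Rightarrow> real) \<Rightarrow> ('x \<Rightarrow> real) \<Rightarrow> real" where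
  "l2_ip M f g = (LINT x|M. f x * g x)"

lemma l2_measurable: "f \<in> l2 M \<Longrightarrow> f \<in> borel_measurable M"
  by (simp add: l2_def)

lemma l2_mult_integrable:
  assumes "f \<in> l2 M" "g \<in> l2 M"
  shows "integrable M (\<lambda>x. f x * g x)"
proof (rule Bochner_Integration.integrable_bound)
  show "integrable M (\<lambda>x. (f x)\<^sup>2 + (g x)\<^sup>2)" using assms by (simp add: l2_def)
  show "(\<lambda>x. f x * g x) \<in> borel_measurable M" using assms by (auto simp: l2_def)
  have "norm (a * b) \<le> norm (a\<^sup>2 + b\<^sup>2)" for a b :: real
  proof -
    have "2 * (\<bar>a\<bar> * \<bar>b\<bar>) \<le> a\<^sup>2 + b\<^sup>2"
      using sum_squares_bound[of "\<bar>a\<bar>" "\<bar>b\<bar>"] by simp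
    moreover have "0 \<le> \<bar>a\<bar> * \<bar>b\<bar>" by simp
    ultimately have "\<bar>a\<bar> * \<bar>b\<bar> \<le> a\<^sup>2 + b\<^sup>2" by argo
    then show ?thesis by (simp add: abs_mult)
  qed
  then show "AE x in M. norm (f x * g x) \<le> norm ((f x)\<^sup>2 + (g x)\<^sup>2)" by simp
qed

lemma subspace_l2: "subspace (l2 M)"
proof (rule subspaceI)
  show "0 \<in> l2 M" by (simp add: l2_def zero_fun_def)
next
  fix f g assume fg: "f \<in> l2 M" "g \<in> l2 M"
  then have "integrable M (\<lambda>x. (f x)\<^sup>2 + 2 * (f x * g x) + (g x)\<^sup>2)"
    using l2_mult_integrable[OF fg] by (auto simp: l2_def)
  then show "f + g \<in> l2 M"
    using fg by (auto simp: l2_def plus_fun_def power2_sum algebra_simps)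
next
  fix c f assume "f \<in> l2 M"
  then show "c *\<^sub>R f \<in> l2 M" by (auto simp: l2_def scaleR_fun_def power_mult_distrib)
qed

lemma l2_diff_square_integrable:
  assumes "f \<in> l2 M" "g \<in> l2 M"
  shows "integrable M (\<lambda>x. (f x - g x)\<^sup>2)"
  using subspace_diff[OF subspace_l2 assms] by (simp add: l2_def)

lemma l2_ip_diff: "l2_ip M (f - g) (f - g) = (LINT x|M. (f x - g x)\<^sup>2)"
  by (simp add: l2_ip_def power2_eq_square)

text \<open>Along a subsequence with \<open>\<parallel>Y (k + 1) - Y k\<parallel>\<^sup>2 \<le> 4\<^sup>-\<^sup>k\<close> the integral of
  \<open>\<Sum>k. 2 ^ k * (Y (k + 1) - Y k)\<^sup>2\<close> is finite, which forces pointwise convergence almost everywhere.\<close>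

lemma l2_complete:
  assumes X: "\<And>n. X n \<in> l2 M"
    and cau: "\<And>e. e > 0 \<Longrightarrow> \<exists>N. \<forall>m\<ge>N. \<forall>n\<ge>N. l2_ip M (X m - X n) (X m - X n) < e"
  shows "\<exists>l\<in>l2 M. (\<lambda>n::nat. l2_ip M (X n - l) (X n - l)) \<longlonglongrightarrow> 0"
proof -
  have [measurable]: "X n \<in> borel_measurable M" for n using X by (simp add: l2_def)
  have "\<exists>N. \<forall>m\<ge>N. \<forall>n\<ge>N. l2_ip M (X m - X n) (X m - X n) < (1/4)^k" for k :: nat
    by (rule cau) simp
  then obtain N where N: "\<And>k m n. m \<ge> N k \<Longrightarrow> n \<ge> N k \<Longrightarrow> l2_ip M (X m - X n) (X m - X n) < (1/4)^k"
    by metis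
  \<comment> \<open>Partial sums of \<open>N\<close> give a nondecreasing sequence of indices with
    \<open>r k\<close> beyond \<open>N j\<close> for all \<open>j \<le> k\<close>.\<close>
  define r where "r k = (\<Sum>j\<le>k. N j)" for k
  have r_mono: "r j \<le> r k" if "j \<le> k" for j k
    unfolding r_def using that by (intro sum_mono2) auto
  have r: "r k \<ge> N k" "r (Suc k) \<ge> N k" for k
    using member_le_sum[of k "{..k}" N] r_mono[of k "Suc k"] by (auto simp: r_def)
  have N_le_r: "N j \<le> r k" if "j \<le> k" for j k using r(1)[of j] r_mono[OF that] by simp
  define Y where "Y k = X (r k)" for k
  have Y [measurable]: "Y k \<in> borel_measurable M" for k by (simp add: Y_def)
  define s where "s k x = 2 ^ k * (Y (Suc k) x - Y k x)\<^sup>2" for k x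
  have [measurable]: "s k \<in> borel_measurable M" for k unfolding s_def by measurable
  have s0: "0 \<le> s k x" for k x by (simp add: s_def)
  have "(\<integral>\<^sup>+x. (\<Sum>k. ennreal (s k x)) \<partial>M) = (\<Sum>k. \<integral>\<^sup>+x. ennreal (s k x) \<partial>M)"
    by (rule nn_integral_suminf) simp
  also have "\<dots> \<le> (\<Sum>k. ennreal ((1/2)^k))"
  proof (intro suminf_le summableI)
    fix k
    have int: "integrable M (\<lambda>x. (Y (Suc k) x - Y k x)\<^sup>2)"
      unfolding Y_def using X by (intro l2_diff_square_integrable)
    have "(\<integral>\<^sup>+x. ennreal (s k x) \<partial>M) = ennreal (LINT x|M. s k x)"
      using int s0 by (intro nn_integral_eq_integral) (auto simp: s_def)
    also have "(LINT x|M. s k x) = 2 ^ k * l2_ip M (Y (Suc k) - Y k) (Y (Suc k) - Y k)"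
      by (simp add: s_def l2_ip_diff)
    also have "\<dots> \<le> 2 ^ k * (1/4)^k"
      unfolding Y_def using N r by (intro mult_left_mono less_imp_le) auto
    also have "\<dots> = (1/2)^k" by (simp flip: power_mult_distrib)
    finally show "(\<integral>\<^sup>+x. ennreal (s k x) \<partial>M) \<le> ennreal ((1/2)^k)" by (simp add: ennreal_leI)
  qed
  also have "\<dots> = ennreal (\<Sum>k. (1/2)^k)"
    by (intro suminf_ennreal2 summable_geometric) auto
  finally have "(\<integral>\<^sup>+x. (\<Sum>k. ennreal (s k x)) \<partial>M) \<noteq> \<infinity>" by (auto simp: top_unique)
  then have "AE x in M. (\<Sum>k. ennreal (s k x)) \<noteq> \<infinity>"
    by (intro nn_integral_PInf_AE) auto
  then have AE_conv: "AE x in M. (\<lambda>k. Y k x) \<longlonglongrightarrow> lim (\<lambda>k. Y k x)"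
  proof eventually_elim
    case (elim x)
    have "summable (\<lambda>k. s k x)" using elim s0 by (intro summable_suminf_not_top) auto
    then have "summable (\<lambda>k. (1/2)^k + s k x)" by (intro summable_add summable_geometric) auto
    \<comment> \<open>The arithmetic-geometric mean inequality with weight \<open>2^k\<close>:
      finiteness of the weighted squares makes the increments absolutely summable.\<close>
    moreover have "norm (Y (Suc k) x - Y k x) \<le> (1/2)^k + s k x" for k
    proof -
      define t where "t = \<bar>Y (Suc k) x - Y k x\<bar>"
      define b where "b = (2::real) ^ k"
      have b: "b > 0" "(1/2)^k = 1 / b" by (auto simp: b_def power_one_over)
      have "0 \<le> (b * t - 1)\<^sup>2 / b" using b by simp
      also have "\<dots> = b * t\<^sup>2 - 2 * t + 1 / b" using b by (simp add: field_simps power2_eq_square)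
      finally have "2 * t \<le> 1 / b + b * t\<^sup>2" by simp
      moreover have "0 \<le> t" by (simp add: t_def)
      ultimately have "t \<le> 1 / b + b * t\<^sup>2" by argo
      then show ?thesis unfolding b(2) s_def by (simp add: t_def b_def)
    qed
    ultimately have "summable (\<lambda>k. Y (Suc k) x - Y k x)"
      by (rule summable_comparison_test'[where N = 0])
    then have "(\<lambda>n. \<Sum>k<n. Y (Suc k) x - Y k x) \<longlonglongrightarrow> (\<Sum>k. Y (Suc k) x - Y k x)"
      by (rule summable_LIMSEQ)
    then have "(\<lambda>n. (\<Sum>k<n. Y (Suc k) x - Y k x) + Y 0 x) \<longlonglongrightarrow> (\<Sum>k. Y (Suc k) x - Y k x) + Y 0 x"
      by (rule tendsto_add) (rule tendsto_const)
    moreover have "(\<Sum>k<n. Y (Suc k) x - Y k x) + Y 0 x = Y n x" for n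
      using sum_lessThan_telescope[of "\<lambda>k. Y k x" n] by simp
    ultimately have "(\<lambda>n. Y n x) \<longlonglongrightarrow> (\<Sum>k. Y (Suc k) x - Y k x) + Y 0 x" by simp
    then show ?case by (metis limI)
  qed
  define l where "l x = lim (\<lambda>k. Y k x)" for x
  have l [measurable]: "l \<in> borel_measurable M" unfolding l_def by (intro borel_measurable_lim_metric Y)
  \<comment> \<open>Fatou's lemma along the subsequence \<open>Y\<close>: the distance of
    \<open>X n\<close> to the pointwise limit is at most its distance to late members of the
    sequence.\<close>
  have bound: "(\<integral>\<^sup>+x. ennreal ((X n x - l x)\<^sup>2) \<partial>M) \<le> ennreal e"
    if "n \<ge> K" and K: "\<And>m n. m \<ge> K \<Longrightarrow> n \<ge> K \<Longrightarrow> l2_ip M (X m - X n) (X m - X n) < e" and ex_j: "\<exists>j. r j \<ge> K" for n K e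
  proof -
    obtain j where j: "r j \<ge> K" using ex_j by blast
    have "(\<integral>\<^sup>+x. ennreal ((X n x - l x)\<^sup>2) \<partial>M) = (\<integral>\<^sup>+x. liminf (\<lambda>k. ennreal ((X n x - Y k x)\<^sup>2)) \<partial>M)"
    proof (rule nn_integral_cong_AE)
      show "AE x in M. ennreal ((X n x - l x)\<^sup>2) = liminf (\<lambda>k. ennreal ((X n x - Y k x)\<^sup>2))"
        using AE_conv
      proof eventually_elim
        case (elim x)
        then have "(\<lambda>k. ennreal ((X n x - Y k x)\<^sup>2)) \<longlonglongrightarrow> ennreal ((X n x - l x)\<^sup>2)"
          unfolding l_def by (intro tendsto_intros tendsto_ennrealI)
        then show ?case by (intro lim_imp_Liminf[symmetric]) auto
      qed
    qed
    also have "\<dots> \<le> liminf (\<lambda>k. \<integral>\<^sup>+x. ennreal ((X n x - Y k x)\<^sup>2) \<partial>M)"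
      by (rule nn_integral_liminf) simp
    also have "\<dots> \<le> ennreal e"
    proof (rule Liminf_le)
      have "(\<integral>\<^sup>+x. ennreal ((X n x - Y k x)\<^sup>2) \<partial>M) \<le> ennreal e" if "k \<ge> j" for k
      proof -
        have "(\<integral>\<^sup>+x. ennreal ((X n x - Y k x)\<^sup>2) \<partial>M) = ennreal (LINT x|M. (X n x - Y k x)\<^sup>2)"
          unfolding Y_def using X by (intro nn_integral_eq_integral l2_diff_square_integrable) auto
        also have "\<dots> \<le> ennreal e"
          using K[of n "r k"] \<open>n \<ge> K\<close> r_mono[OF that] j by (intro ennreal_leI) (simp add: l2_ip_diff Y_def)
        finally show ?thesis .
      qed
      then show "\<forall>\<^sub>F k in sequentially. (\<integral>\<^sup>+x. ennreal ((X n x - Y k x)\<^sup>2) \<partial>M) \<le> ennreal e"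
        by (auto simp: eventually_sequentially)
    qed simp
    finally show ?thesis .
  qed
  have integrable: "integrable M (\<lambda>x. (X n x - l x)\<^sup>2)" and le: "l2_ip M (X n - l) (X n - l) \<le> e"
    if "n \<ge> K" and K: "\<And>m n. m \<ge> K \<Longrightarrow> n \<ge> K \<Longrightarrow> l2_ip M (X m - X n) (X m - X n) < e" and "\<exists>j. r j \<ge> K" and "e \<ge> 0" for n K e
  proof -
    have b: "(\<integral>\<^sup>+x. ennreal ((X n x - l x)\<^sup>2) \<partial>M) \<le> ennreal e"
      by (rule bound[of K, OF that(1) _ that(3)]) (rule that(2))
    then have fin: "(\<integral>\<^sup>+x. ennreal ((X n x - l x)\<^sup>2) \<partial>M) < \<infinity>"
      by (rule le_less_trans) simp
    show int: "integrable M (\<lambda>x. (X n x - l x)\<^sup>2)"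
      by (rule integrableI_nonneg) (use fin in auto)
    have "ennreal (LINT x|M. (X n x - l x)\<^sup>2) \<le> ennreal e"
      using b nn_integral_eq_integral[OF int] by simp
    then show "l2_ip M (X n - l) (X n - l) \<le> e"
      using \<open>e \<ge> 0\<close> by (simp add: l2_ip_diff)
  qed
  have "integrable M (\<lambda>x. (X (N 0) x - l x)\<^sup>2)"
    using N[of 0] r(1)[of 0] by (intro integrable[of "N 0" _ 1]) auto
  then have "X (N 0) - l \<in> l2 M" by (simp add: l2_def fun_diff_def)
  from subspace_diff[OF subspace_l2 X[of "N 0"] this]
  have "l \<in> l2 M" by simp
  moreover have "(\<lambda>n. l2_ip M (X n - l) (X n - l)) \<longlonglongrightarrow> 0"
  proof (rule LIMSEQ_I)
    fix e :: real assume "e > 0"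
    have "\<exists>k. (1/4::real)^k < e" using \<open>e > 0\<close> by (intro real_arch_pow_inv) auto
    then obtain k where k: "(1/4)^k < e" ..
    have "norm (l2_ip M (X n - l) (X n - l) - 0) < e" if "n \<ge> N k" for n
    proof -
      have "l2_ip M (X n - l) (X n - l) \<le> (1/4)^k"
      proof (rule le[OF that])
        show "l2_ip M (X i - X j) (X i - X j) < (1/4)^k" if "i \<ge> N k" "j \<ge> N k" for i j
          using that by (rule N)
        show "\<exists>j. r j \<ge> N k" using r(1) by blast
      qed simp
      moreover have "0 \<le> l2_ip M (X n - l) (X n - l)" by (simp add: l2_ip_diff)
      ultimately show ?thesis using k by simp
    qed
    then show "\<exists>no. \<forall>n\<ge>no. norm (l2_ip M (X n - l) (X n - l) - 0) < e" by blast
  qed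
  ultimately show ?thesis by blast
qed

lemma semi_hilbert_l2: "semi_hilbert (l2 M) (l2_ip M)"
proof
  fix u v w assume "u \<in> l2 M" "v \<in> l2 M" "w \<in> l2 M"
  then show "l2_ip M (u + v) w = l2_ip M u w + l2_ip M v w"
    by (simp add: l2_ip_def distrib_right l2_mult_integrable)
next
  show "l2_ip M (r *\<^sub>R u) w = r * l2_ip M u w" for r u w
    by (simp add: l2_ip_def scaleR_fun_def mult.assoc)
  show "l2_ip M u v = l2_ip M v u" for u v by (simp add: l2_ip_def mult.commute)
  show "0 \<le> l2_ip M u u" for u by (simp add: l2_ip_def)
  show "subspace (l2 M)" by (rule subspace_l2)
qed (rule l2_complete)

definition l2_mean0 :: "'x measure \<Rightarrow> ('x \<Rightarrow> real) set" where
  "l2_mean0 M = {f \<in> l2 M. (LINT x|M. f x) = 0}"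

lemma l2_mean0_l2: "f \<in> l2_mean0 M \<Longrightarrow> f \<in> l2 M"
  by (simp add: l2_mean0_def)

lemma l2_const: "finite_measure M \<Longrightarrow> (\<lambda>_. c) \<in> l2 M"
  by (simp add: l2_def finite_measure.integrable_const)

lemma l2_integrable: "finite_measure M \<Longrightarrow> f \<in> l2 M \<Longrightarrow> integrable M f"
  using l2_mult_integrable[of f M "\<lambda>_. 1"] by (simp add: l2_const)

text \<open>Completeness is inherited because the mean is the inner product with the constant 1,
  hence continuous.\<close>

lemma semi_hilbert_l2_mean0:
  assumes "finite_measure M"
  shows "semi_hilbert (l2_mean0 M) (l2_ip M)"
proof -
  interpret L: semi_hilbert "l2 M" "l2_ip M" by (rule semi_hilbert_l2)
  have one: "(\<lambda>_. 1) \<in> l2 M" using assms by (rule l2_const)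
  have eq: "l2_mean0 M = {f \<in> l2 M. l2_ip M f (\<lambda>_. 1) = 0}"
    by (simp add: l2_mean0_def l2_ip_def)
  show ?thesis
  proof
    show "subspace (l2_mean0 M)"
      unfolding eq using one by (intro subspaceI) (auto simp: L.ip_linear)
    fix X :: "nat \<Rightarrow> 'a \<Rightarrow> real"
    assume X: "\<And>n. X n \<in> l2_mean0 M"
      and cau: "\<And>e. e > 0 \<Longrightarrow> \<exists>N. \<forall>m\<ge>N. \<forall>n\<ge>N. l2_ip M (X m - X n) (X m - X n) < e"
    have XV: "X n \<in> l2 M" for n using X by (simp add: l2_mean0_def)
    obtain l where l: "l \<in> l2 M" "(\<lambda>n. l2_ip M (X n - l) (X n - l)) \<longlonglongrightarrow> 0"
      using L.complete[OF XV cau] by blast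
    have "(\<lambda>n. l2_ip M (X n) (\<lambda>_. 1)) \<longlonglongrightarrow> l2_ip M l (\<lambda>_. 1)"
      by (intro L.tendsto_ip XV l one)
    moreover have "l2_ip M (X n) (\<lambda>_. 1) = 0" for n using X by (simp add: eq)
    ultimately have "l2_ip M l (\<lambda>_. 1) = 0" by (simp add: LIMSEQ_const_iff)
    then show "\<exists>l\<in>l2_mean0 M. (\<lambda>n. l2_ip M (X n - l) (X n - l)) \<longlonglongrightarrow> 0"
      using l by (auto simp: eq)
  qed (auto simp: eq L.ip_linear L.ip_nonneg intro: L.ip_sym)
qed

lemma l2_ip_self_eq_0_iff:
  assumes "f \<in> l2 M"
  shows "l2_ip M f f = 0 \<longleftrightarrow> (AE x in M. f x = 0)"
proof -
  have "l2_ip M f f = (LINT x|M. (f x)\<^sup>2)" by (simp add: l2_ip_def power2_eq_square)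
  then show ?thesis
    using assms integral_nonneg_eq_0_iff_AE[of M "\<lambda>x. (f x)\<^sup>2"] by (simp add: l2_def)
qed

section \<open>Translation representations\<close>

text \<open>The measure may be infinite, so left multiplication on the counting measure of the group
  is an instance, besides the given action and its factor.\<close>

locale mp_action = group G for G :: "('g, 'm) monoid_scheme" (structure) +
  fixes M :: "'x measure" and act :: "'g \<Rightarrow> 'x \<Rightarrow> 'x"
  assumes act_measurable [measurable]: "g \<in> carrier G \<Longrightarrow> act g \<in> measurable M M"
    and act_distr: "g \<in> carrier G \<Longrightarrow> distr M M (act g) = M"
    and act_mult: "\<lbrakk>g \<in> carrier G; h \<in> carrier G; x \<in> space M\<rbrakk> \<Longrightarrow> act (g \<otimes> h) x = act g (act h x)"
    and act_one: "x \<in> space M \<Longrightarrow> act \<one> x = x"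
begin

definition translate :: "'g \<Rightarrow> ('x \<Rightarrow> real) \<Rightarrow> 'x \<Rightarrow> real" where
  "translate g f = (\<lambda>x. f (act (inv g) x))"

lemma act_space: "g \<in> carrier G \<Longrightarrow> x \<in> space M \<Longrightarrow> act g x \<in> space M"
  using act_measurable by (rule measurable_space)

lemma integral_act:
  fixes f :: "'x \<Rightarrow> 'b::{banach, second_countable_topology}"
  assumes "g \<in> carrier G" "f \<in> borel_measurable M"
  shows "(LINT x|M. f (act g x)) = (LINT x|M. f x)"
  using integral_distr[OF act_measurable[OF assms(1)] assms(2)] act_distr[OF assms(1)] by simp

lemma integrable_act:
  fixes f :: "'x \<Rightarrow> 'b::{banach, second_countable_topology}"
  assumes "g \<in> carrier G" "f \<in> borel_measurable M"
  shows "integrable M (\<lambda>x. f (act g x)) \<longleftrightarrow> integrable M f"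
  using integrable_distr_eq[OF act_measurable[OF assms(1)] assms(2)] act_distr[OF assms(1)] by simp

lemma translate_l2: "g \<in> carrier G \<Longrightarrow> f \<in> l2 M \<Longrightarrow> translate g f \<in> l2 M"
  unfolding l2_def translate_def
  using integrable_act[of "inv g" "\<lambda>x. (f x)\<^sup>2"] by (auto intro: measurable_compose[OF act_measurable])

lemma hilbert_rep_l2: "hilbert_rep (l2 M) (l2_ip M) G translate"
proof -
  interpret L: semi_hilbert "l2 M" "l2_ip M" by (rule semi_hilbert_l2)
  show ?thesis
  proof
    show "translate g u \<in> l2 M" if "g \<in> carrier G" "u \<in> l2 M" for g u
      using that by (rule translate_l2)
    show "translate g (u + v) = translate g u + translate g v" for g u v
      by (auto simp: translate_def)
    show "translate g (r *\<^sub>R u) = r *\<^sub>R translate g u" for g r u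
      by (auto simp: translate_def scaleR_fun_def)
    show "l2_ip M (translate g u) (translate g v) = l2_ip M u v"
      if "g \<in> carrier G" "u \<in> l2 M" "v \<in> l2 M" for g u v
      unfolding l2_ip_def translate_def using that
      by (intro integral_act[where f = "\<lambda>x. u x * v x"]) (auto simp: l2_def)
    show "l2_ip M (translate (g \<otimes> h) u) v = l2_ip M (translate g (translate h u)) v"
      if "g \<in> carrier G" "h \<in> carrier G" for g h u v
      unfolding l2_ip_def translate_def using that
      by (intro Bochner_Integration.integral_cong refl) (simp add: inv_mult_group act_mult)
    show "l2_ip M (translate \<one> u) v = l2_ip M u v" for u v
      unfolding l2_ip_def translate_def
      by (intro Bochner_Integration.integral_cong refl) (simp add: act_one)
  qed
qed

lemma hilbert_rep_l2_mean0:
  assumes "finite_measure M"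
  shows "hilbert_rep (l2_mean0 M) (l2_ip M) G translate"
proof -
  interpret L: hilbert_rep "l2 M" "l2_ip M" G translate by (rule hilbert_rep_l2)
  interpret semi_hilbert "l2_mean0 M" "l2_ip M" using assms by (rule semi_hilbert_l2_mean0)
  have "translate g f \<in> l2_mean0 M" if "g \<in> carrier G" "f \<in> l2_mean0 M" for g f
    using that integral_act[of "inv g" f] translate_l2[of g f]
    by (simp add: l2_mean0_def l2_measurable) (simp add: translate_def)
  then show ?thesis
    by unfold_locales
      (auto simp: L.tau_add L.tau_scale L.tau_isometric L.tau_mult L.tau_one l2_mean0_l2)
qed

end

lemma mp_action_of_pmp_action:
  assumes "group G" "pmp_action G M act"
  shows "mp_action G M act"
proof -
  interpret group G by fact
  interpret group_action G "space M" act using assms(2) by (simp add: pmp_action_def)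
  show ?thesis
  proof
    fix g h x assume gh: "g \<in> carrier G" "h \<in> carrier G" "x \<in> space M"
    show "act (g \<otimes>\<^bsub>G\<^esub> h) x = act g (act h x)" using gh by (simp add: composition_rule)
  next
    fix x assume "x \<in> space M"
    then show "act \<one>\<^bsub>G\<^esub> x = x" by (simp add: id_eq_one[symmetric])
  qed (use assms(2) in \<open>auto simp: pmp_action_def\<close>)
qed

lemma mp_action_left_mult:
  assumes "group G"
  shows "mp_action G (count_space (carrier G)) (\<lambda>g. \<lambda>x\<in>carrier G. g \<otimes>\<^bsub>G\<^esub> x)"
proof -
  interpret group G by fact
  show ?thesis
  proof
    fix g assume g: "g \<in> carrier G"
    then show "(\<lambda>x\<in>carrier G. g \<otimes>\<^bsub>G\<^esub> x) \<in> count_space (carrier G) \<rightarrow>\<^sub>M count_space (carrier G)" by auto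
    have "bij_betw (\<lambda>x\<in>carrier G. g \<otimes>\<^bsub>G\<^esub> x) (carrier G) (carrier G)"
    proof (rule bij_betwI[where g = "\<lambda>x. inv\<^bsub>G\<^esub> g \<otimes>\<^bsub>G\<^esub> x"])
      show "inv\<^bsub>G\<^esub> g \<otimes>\<^bsub>G\<^esub> (\<lambda>x\<in>carrier G. g \<otimes>\<^bsub>G\<^esub> x) x = x" if "x \<in> carrier G" for x
        using that g m_assoc[of "inv\<^bsub>G\<^esub> g" g x] by simp
      show "(\<lambda>x\<in>carrier G. g \<otimes>\<^bsub>G\<^esub> x) (inv\<^bsub>G\<^esub> g \<otimes>\<^bsub>G\<^esub> x) = x" if "x \<in> carrier G" for x
        using that g m_assoc[of g "inv\<^bsub>G\<^esub> g" x] by simp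
    qed (use g in auto)
    then show "distr (count_space (carrier G)) (count_space (carrier G)) (\<lambda>x\<in>carrier G. g \<otimes>\<^bsub>G\<^esub> x) = count_space (carrier G)"
      by (rule distr_bij_count_space)
  qed (auto simp: m_assoc)
qed

section \<open>Separability\<close>

text \<open>Finite intersections of members of a countable base form a countable generator that is
  stable under intersection, as the Dynkin argument for integrals over sets requires.\<close>

lemma standard_borel_countable_Int_stable:
  assumes "standard_borel M"
  obtains S where "countable S" "Int_stable S" "S \<subseteq> Pow (space M)" "space M \<in> S" "sets M = sigma_sets (space M) S"
proof -
  obtain T where T: "second_countable T" "topspace T = space M" "sets M = sigma_sets (topspace T) {U. openin T U}"
    using assms by (auto simp: standard_borel_def)
  obtain \<B> where \<B>0: "countable \<B>" "\<forall>V\<in>\<B>. openin T V"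
    "\<forall>U x. openin T U \<and> x \<in> U \<longrightarrow> (\<exists>V\<in>\<B>. x \<in> V \<and> V \<subseteq> U)"
    using T(1) unfolding second_countable_def by (elim exE conjE)
  have \<B>: "countable \<B>" "\<And>V. V \<in> \<B> \<Longrightarrow> openin T V"
    "\<And>U x. openin T U \<Longrightarrow> x \<in> U \<Longrightarrow> \<exists>V\<in>\<B>. x \<in> V \<and> V \<subseteq> U"
    using \<B>0(1) by (simp_all add: \<B>0(2,3))
  \<comment> \<open>The empty family has intersection \<open>UNIV\<close>; intersecting with
    \<open>space M\<close> makes it contribute the whole space.\<close>
  define S where "S = (\<lambda>F. space M \<inter> \<Inter>F) ` {F. finite F \<and> F \<subseteq> \<B>}"
  have "countable S" unfolding S_def using \<B>(1) by (intro countable_image countable_Collect_finite_subset)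
  moreover have "Int_stable S"
  proof (rule Int_stableI)
    fix A B assume "A \<in> S" "B \<in> S"
    then obtain F F' where "finite F" "F \<subseteq> \<B>" "A = space M \<inter> \<Inter>F" "finite F'" "F' \<subseteq> \<B>" "B = space M \<inter> \<Inter>F'"
      unfolding S_def by auto
    then show "A \<inter> B \<in> S" unfolding S_def by (intro image_eqI[of _ _ "F \<union> F'"]) auto
  qed
  moreover have "S \<subseteq> Pow (space M)" by (auto simp: S_def)
  moreover have "space M \<in> S" unfolding S_def by (intro image_eqI[of _ _ "{}"]) auto
  moreover have "sets M = sigma_sets (space M) S"
  proof (rule antisym)
    have "U \<in> sigma_sets (space M) S" if U: "openin T U" for U
    proof -
      have "U = \<Union>{V \<in> \<B>. V \<subseteq> U}" using \<B>(3)[OF U] by blast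
      moreover have "\<Union>{V \<in> \<B>. V \<subseteq> U} \<in> sigma_sets (space M) S"
      proof (rule sigma_sets_UNION)
        show "countable {V \<in> \<B>. V \<subseteq> U}" using \<B>(1) by auto
        fix V assume "V \<in> {V \<in> \<B>. V \<subseteq> U}"
        then have "V = space M \<inter> \<Inter>{V}" "V \<in> \<B>" using \<B>(2)[of V] openin_subset[of T V] T(2) by auto
        then show "V \<in> sigma_sets (space M) S"
          unfolding S_def by (intro sigma_sets.Basic image_eqI[of _ _ "{V}"]) auto
      qed
      ultimately show ?thesis by simp
    qed
    then show "sets M \<subseteq> sigma_sets (space M) S"
      unfolding T(3) T(2)[symmetric] by (intro sigma_sets_mono) auto
    have "A \<in> sets M" if "A \<in> S" for A
    proof -
      obtain F where F: "finite F" "F \<subseteq> \<B>" "A = space M \<inter> \<Inter>F" using \<open>A \<in> S\<close> unfolding S_def by blast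
      have "V \<in> sets M" if "V \<in> F" for V unfolding T(3) using that F \<B>(2) by (auto intro: sigma_sets.Basic)
      then show ?thesis unfolding F(3) using F(1)
        by (cases "F = {}") (auto intro!: sets.finite_INT[of F "\<lambda>x. x", simplified])
    qed
    then show "sigma_sets (space M) S \<subseteq> sets M" by (intro sets.sigma_sets_subset) auto
  qed
  ultimately show thesis by (rule that)
qed

text \<open>Separability by countably many test vectors, the centred indicators of a countable
  generator. A function of mean 0 orthogonal to them has integral 0 over the generator, hence over
  all measurable sets, hence vanishes almost everywhere.\<close>

lemma l2_mean0_countable_total:
  assumes "standard_prob_space M"
  obtains d :: "nat \<Rightarrow> 'x \<Rightarrow> real"
  where "\<And>k. d k \<in> l2_mean0 M"
    "\<And>u. \<lbrakk>u \<in> l2_mean0 M; \<And>k. l2_ip M u (d k) = 0\<rbrakk> \<Longrightarrow> l2_ip M u u = 0"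
proof -
  interpret prob_space M using assms by (simp add: standard_prob_space_def)
  have fin: "finite_measure M" by unfold_locales
  obtain S where S: "countable S" "Int_stable S" "S \<subseteq> Pow (space M)" "space M \<in> S" "sets M = sigma_sets (space M) S"
    using assms standard_borel_countable_Int_stable unfolding standard_prob_space_def by blast
  have S_sets: "A \<in> sets M" if "A \<in> S" for A using that S(5) by auto
  define d :: "nat \<Rightarrow> 'x \<Rightarrow> real" where
    "d k = (\<lambda>x. indicator (from_nat_into S k) x - prob (from_nat_into S k))" for k
  have dS: "from_nat_into S k \<in> S" for k using S(4) by (intro from_nat_into) auto
  have ind: "indicator A \<in> l2 M" if "A \<in> sets M" for A
  proof -
    have "(\<lambda>x. (indicator A x :: real)\<^sup>2) = indicator A" by (auto simp: indicator_def)
    then show ?thesis using that by (auto simp: l2_def emeasure_eq_measure intro!: integrable_real_indicator)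
  qed
  show thesis
  proof (rule that[of d])
    fix k
    have A: "from_nat_into S k \<in> sets M" using S_sets dS by blast
    have "indicator (from_nat_into S k) - (\<lambda>_. prob (from_nat_into S k)) \<in> l2 M"
      using ind[OF A] l2_const[OF fin] by (intro subspace_diff subspace_l2)
    moreover have "(LINT x|M. d k x) = 0"
      unfolding d_def using A
      by (subst Bochner_Integration.integral_diff)
        (auto intro!: integrable_real_indicator simp: prob_space emeasure_eq_measure)
    ultimately show "d k \<in> l2_mean0 M" by (simp add: l2_mean0_def d_def fun_diff_def)
  next
    fix u assume u: "u \<in> l2_mean0 M" and orth: "\<And>k. l2_ip M u (d k) = 0"
    have u2: "u \<in> l2 M" using u by (rule l2_mean0_l2)
    have [measurable]: "u \<in> borel_measurable M" using u2 by (rule l2_measurable)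
    have int_u: "integrable M u" using fin u2 by (rule l2_integrable)
    have int_uA: "integrable M (\<lambda>x. u x * indicator A x)" if "A \<in> sets M" for A
      using l2_mult_integrable[OF u2 ind[OF that]] .
    have u0: "(LINT x|M. u x) = 0" using u by (simp add: l2_mean0_def)
    have base: "(LINT x|M. u x * indicator A x) = 0" if A: "A \<in> S" for A
    proof -
      obtain k where k: "A = from_nat_into S k" using A S(1) by (metis from_nat_into_surj)
      have "0 = (LINT x|M. u x * indicator A x - prob A * u x)"
        using orth[of k] by (simp add: l2_ip_def d_def k algebra_simps)
      also have "\<dots> = (LINT x|M. u x * indicator A x)"
        using int_u int_uA[OF S_sets[OF A]] u0 by simp
      finally show ?thesis by simp
    qed
    have all: "(LINT x|M. u x * indicator A x) = 0" if "A \<in> sets M" for A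
      using S(2,3) that[unfolded S(5)]
    proof (induction rule: sigma_sets_induct_disjoint)
      case (basic A)
      then show ?case by (rule base)
    next
      case empty
      show ?case by simp
    next
      case (compl A)
      have A: "A \<in> sets M" using compl S(5) by simp
      have "(LINT x|M. u x * indicator (space M - A) x) = (LINT x|M. u x - u x * indicator A x)"
        by (intro Bochner_Integration.integral_cong refl) (auto simp: indicator_def)
      also have "\<dots> = 0" using int_u int_uA[OF A] u0 compl by simp
      finally show ?case .
    next
      case (union A)
      have A: "A i \<in> sets M" for i using union S(5) by auto
      have "(LINT x:(\<Union>i. A i)|M. u x) = (\<Sum>i. LINT x:(A i)|M. u x)"
        using A union int_uA[of "\<Union>i. A i"]
        by (intro lebesgue_integral_countable_add) (auto simp: disjoint_family_on_def set_integrable_def mult.commute)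
      then show ?case using union by (simp add: set_lebesgue_integral_def mult.commute)
    qed
    define P where "P = {x \<in> space M. u x > 0}"
    define Q where "Q = {x \<in> space M. u x < 0}"
    have P [measurable]: "P \<in> sets M" "Q \<in> sets M" unfolding P_def Q_def by measurable
    have nn: "AE x in M. 0 \<le> u x * indicator P x" "AE x in M. 0 \<le> - (u x * indicator Q x)"
      by (auto simp: P_def Q_def indicator_def)
    have "(LINT x|M. - (u x * indicator Q x)) = 0" using all[OF P(2)] by simp
    then have "AE x in M. - (u x * indicator Q x) = 0"
      using integral_nonneg_eq_0_iff_AE[OF integrable_minus[OF int_uA[OF P(2)]] nn(2)] by blast
    moreover have "AE x in M. u x * indicator P x = 0"
      using integral_nonneg_eq_0_iff_AE[OF int_uA[OF P(1)] nn(1)] all[OF P(1)] by blast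
    ultimately have "AE x in M. u x = 0"
      using AE_space by eventually_elim (auto simp: P_def Q_def indicator_def split: if_splits)
    then show "l2_ip M u u = 0" using u2 by (simp add: l2_ip_self_eq_0_iff)
  qed
qed

context hilbert_rep
begin

text \<open>The projection of \<open>d k\<close> to the closure of the Bessel vectors differs from
  \<open>d k\<close> by a null vector, so Bessel vectors approximate \<open>d k\<close> to every
  accuracy \<open>1 / (m + 1)\<close>. Coding the pairs \<open>(k, m)\<close> gives a sequence that
  is still total.\<close>

lemma exists_bessel_system:
  fixes d :: "nat \<Rightarrow> 'v"
  assumes d: "\<And>k. d k \<in> V" "\<And>u. \<lbrakk>u \<in> V; \<And>k. ip u (d k) = 0\<rbrakk> \<Longrightarrow> ip u u = 0"
    and bessel: "\<And>u. \<lbrakk>u \<in> V; \<And>z. z \<in> bessel \<Longrightarrow> ip u z = 0\<rbrakk> \<Longrightarrow> ip u u = 0"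
  shows "\<exists>z. bessel_system V ip G tau z"
proof -
  have "\<exists>z\<in>bessel. ip (z - d k) (z - d k) < 1 / real (Suc m)" for k m
  proof -
    have "bessel \<subseteq> V" using bessel_V by blast
    then obtain p where p: "p \<in> V" "\<And>e. e > 0 \<Longrightarrow> \<exists>c\<in>bessel. ip (c - p) (c - p) < e"
      "\<And>c. c \<in> bessel \<Longrightarrow> ip (d k - p) c = 0"
      using projection[OF subspace_bessel _ d(1)] by metis
    have null: "ip (p - d k) (p - d k) = 0"
      using bessel[of "d k - p"] p d(1)[of k] by (simp add: ip_square_diff_commute)
    obtain c where c: "c \<in> bessel" "ip (c - p) (c - p) < 1 / (2 * real (Suc m))"
      using p(2)[of "1 / (2 * real (Suc m))"] by auto
    have "ip ((c - p) + (p - d k)) ((c - p) + (p - d k)) \<le> 2 * ip (c - p) (c - p) + 2 * ip (p - d k) (p - d k)"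
      using p(1) d(1) bessel_V[OF c(1)] by (intro ip_square_add_le) auto
    then have "ip (c - d k) (c - d k) \<le> 2 * ip (c - p) (c - p)" using null by simp
    also have "\<dots> < 1 / real (Suc m)" using c(2) by (simp add: field_simps)
    finally show ?thesis using c(1) by blast
  qed
  then obtain y where y: "\<And>k m. y k m \<in> bessel" "\<And>k m. ip (y k m - d k) (y k m - d k) < 1 / real (Suc m)"
    by metis
  define x where "x n = (case prod_decode n of (k, m) \<Rightarrow> y k m)" for n
  have x: "x n \<in> bessel" for n using y(1) by (simp add: x_def split: prod.split)
  have "\<exists>K\<ge>0. \<forall>u E. u \<in> V \<longrightarrow> finite E \<longrightarrow> E \<subseteq> carrier G \<longrightarrow> (\<Sum>g\<in>E. (ip u (tau g (x n)))\<^sup>2) \<le> K * ip u u" for n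
    using x[of n] by (rule besselE) blast
  then obtain K where K: "\<And>n. K n \<ge> 0"
    "\<And>n u E. \<lbrakk>u \<in> V; finite E; E \<subseteq> carrier G\<rbrakk> \<Longrightarrow> (\<Sum>g\<in>E. (ip u (tau g (x n)))\<^sup>2) \<le> K n * ip u u"
    by metis
  \<comment> \<open>Scaled so that the \<open>n\<close>-th vector has Bessel constant at most
    \<open>2^-(n + 1)\<close>; these constants add up to at most 1. The summand 1 keeps the
    denominator positive when \<open>K n = 0\<close>.\<close>
  define r where "r n = 1 / sqrt (2 ^ Suc n * (K n + 1))" for n
  have r2: "(r n)\<^sup>2 = 1 / (2 ^ Suc n * (K n + 1))" and r0: "r n > 0" for n
    using K(1)[of n] by (auto simp: r_def power_divide add_nonneg_pos)
  define z where "z n = r n *\<^sub>R x n" for n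
  have zV: "z n \<in> V" for n using bessel_V[OF x] by (simp add: z_def)
  have "bessel_system V ip G tau z"
  proof unfold_locales
    show "z n \<in> V" for n by (rule zV)
  next
    fix u and J :: "(nat \<times> 'g) set" assume u: "u \<in> V" and J: "finite J" "J \<subseteq> UNIV \<times> carrier G"
    define E where "E = snd ` J"
    have E: "finite E" "E \<subseteq> carrier G" using J by (auto simp: E_def)
    obtain N where N: "fst ` J \<subseteq> {..<N}" using finite_nat_iff_bounded[of "fst ` J"] J(1) by auto
    have "(\<Sum>j\<in>J. (ip u (tau (snd j) (z (fst j))))\<^sup>2) \<le> (\<Sum>j\<in>{..<N}\<times>E. (ip u (tau (snd j) (z (fst j))))\<^sup>2)"
      using N E by (intro sum_mono2) (force simp: E_def)+
    also have "\<dots> = (\<Sum>n<N. \<Sum>g\<in>E. (ip u (tau g (z n)))\<^sup>2)"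
      by (simp add: sum.cartesian_product case_prod_unfold)
    also have "\<dots> \<le> (\<Sum>n<N. (1/2) ^ Suc n * ip u u)"
    proof (rule sum_mono)
      fix n
      have "(\<Sum>g\<in>E. (ip u (tau g (z n)))\<^sup>2) = (\<Sum>g\<in>E. (r n)\<^sup>2 * (ip u (tau g (x n)))\<^sup>2)"
        using E u bessel_V[OF x]
        by (intro sum.cong) (auto simp: z_def tau_scale ip_scale_right power_mult_distrib subset_iff)
      also have "\<dots> = (r n)\<^sup>2 * (\<Sum>g\<in>E. (ip u (tau g (x n)))\<^sup>2)" by (simp add: sum_distrib_left)
      also have "\<dots> \<le> (r n)\<^sup>2 * (K n * ip u u)" by (intro mult_left_mono K(2) u E) auto
      also have "\<dots> = (1/2) ^ Suc n * (K n / (K n + 1)) * ip u u"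
        by (simp add: r2 power_one_over)
      also have "\<dots> \<le> (1/2) ^ Suc n * 1 * ip u u"
        using K(1)[of n] ip_nonneg[OF u] by (intro mult_right_mono mult_left_mono) (auto simp: divide_le_eq_1)
      finally show "(\<Sum>g\<in>E. (ip u (tau g (z n)))\<^sup>2) \<le> (1/2) ^ Suc n * ip u u" by simp
    qed
    also have "\<dots> = (\<Sum>n<N. (1/2) ^ Suc n) * ip u u" by (simp add: sum_distrib_right)
    also have "(\<Sum>n<N. (1/2) ^ Suc n) = 1 - (1/2 :: real) ^ N" by (induction N) auto
    also have "(1 - (1/2) ^ N) * ip u u \<le> 1 * ip u u"
      using ip_nonneg[OF u] by (intro mult_right_mono) auto
    finally show "(\<Sum>j\<in>J. (ip u (tau (snd j) (z (fst j))))\<^sup>2) \<le> ip u u" by simp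
  next
    fix u assume u: "u \<in> V" and orth: "\<And>n g. g \<in> carrier G \<Longrightarrow> ip u (tau g (z n)) = 0"
    have ux: "ip u (x n) = 0" for n
    proof -
      have "ip u (z n) = 0"
        using orth[of \<one> n] u zV[of n] tau_one[of "z n" u] by (simp add: ip_sym[of u])
      then show ?thesis using u bessel_V[OF x] r0[of n] by (simp add: z_def ip_scale_right)
    qed
    have "ip (d k) u = 0" for k
    proof (rule ip_approx_eq_zero[OF d(1) u])
      fix e :: real assume "e > 0"
      then obtain m where m: "1 / real (Suc m) < e" by (rule nat_approx_posE)
      have "ip (y k m) u = 0"
        using ux[of "prod_encode (k, m)"] u bessel_V[OF y(1)] by (simp add: x_def ip_sym)
      then show "\<exists>c\<in>V. ip (c - d k) (c - d k) < e \<and> ip c u = 0"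
        using y(2)[of k m] m bessel_V[OF y(1)] by (intro bexI[of _ "y k m"]) auto
    qed
    then show "ip u u = 0" using u d by (simp add: ip_sym)
  qed
  then show ?thesis by blast
qed

end

section \<open>Counting microstates in sofic models\<close>

section \<open>Counting and rounding\<close>

text \<open>Chernoff bound: on the counted set \<open>exp (s * (W - weight))\<close> is at least 1,
  and its sum over the whole product factorises over the coordinates.\<close>

lemma card_weight_le:
  fixes w :: "'i \<Rightarrow> 'a \<Rightarrow> real"
  assumes I: "finite I" and S: "\<And>k. finite (S k)" and s: "0 \<le> s"
  shows "real (card {x \<in> PiE I S. (\<Sum>k\<in>I. w k (x k)) \<le> W}) \<le> exp (s * W) * (\<Prod>k\<in>I. \<Sum>a\<in>S k. exp (- s * w k a))"
proof -
  let ?X = "{x \<in> PiE I S. (\<Sum>k\<in>I. w k (x k)) \<le> W}"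
  have fin: "finite (PiE I S)" using I S by (intro finite_PiE)
  have "real (card ?X) = (\<Sum>x\<in>?X. 1)" by simp
  also have "\<dots> \<le> (\<Sum>x\<in>?X. exp (s * W) * (\<Prod>k\<in>I. exp (- s * w k (x k))))"
  proof (rule sum_mono)
    fix x assume x: "x \<in> ?X"
    have "exp (s * W) * (\<Prod>k\<in>I. exp (- s * w k (x k))) = exp (s * (W - (\<Sum>k\<in>I. w k (x k))))"
      using I by (simp add: exp_sum[symmetric] exp_add[symmetric] sum_negf sum_distrib_left algebra_simps)
    moreover have "0 \<le> s * (W - (\<Sum>k\<in>I. w k (x k)))" using x s by (intro mult_nonneg_nonneg) auto
    ultimately show "1 \<le> exp (s * W) * (\<Prod>k\<in>I. exp (- s * w k (x k)))" by simp
  qed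
  also have "\<dots> \<le> (\<Sum>x\<in>PiE I S. exp (s * W) * (\<Prod>k\<in>I. exp (- s * w k (x k))))"
    using fin by (intro sum_mono2) (auto intro!: mult_nonneg_nonneg prod_nonneg)
  also have "\<dots> = exp (s * W) * (\<Prod>k\<in>I. \<Sum>a\<in>S k. exp (- s * w k a))"
    using I S by (simp add: sum_distrib_left prod_sum_PiE)
  finally show ?thesis .
qed

text \<open>Rounding every coordinate of \<open>x\<close> at random to one of the two neighbours in \<open>L \<int>\<close>, with mean
  \<open>x k\<close>, adds independent centred errors of variance at most \<open>L\<^sup>2 / 4\<close> and keeps the mean of the
  absolute values. Choosing the better option in each coordinate derandomises this.\<close>

lemma rounding:
  fixes B :: "'j \<Rightarrow> 'i \<Rightarrow> real" and x :: "'i \<Rightarrow> real" and L t :: real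
  assumes "finite I" "finite J" and L: "0 < L" and t: "0 \<le> t"
  shows "\<exists>m :: 'i \<Rightarrow> int. (\<Sum>j\<in>J. (\<Sum>k\<in>I. B j k * (L * real_of_int (m k) - x k))\<^sup>2) + t * (\<Sum>k\<in>I. L * \<bar>real_of_int (m k)\<bar>)
      \<le> L\<^sup>2 / 4 * (\<Sum>k\<in>I. \<Sum>j\<in>J. (B j k)\<^sup>2) + t * (\<Sum>k\<in>I. \<bar>x k\<bar>)"
  using \<open>finite I\<close>
proof (induction I)
  case empty
  show ?case by simp
next
  case (insert k I)
  then obtain m :: "'i \<Rightarrow> int" where m:
    "(\<Sum>j\<in>J. (\<Sum>k\<in>I. B j k * (L * real_of_int (m k) - x k))\<^sup>2) + t * (\<Sum>k\<in>I. L * \<bar>real_of_int (m k)\<bar>)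
      \<le> L\<^sup>2 / 4 * (\<Sum>k\<in>I. \<Sum>j\<in>J. (B j k)\<^sup>2) + t * (\<Sum>k\<in>I. \<bar>x k\<bar>)" by blast
  define u where "u j = (\<Sum>k\<in>I. B j k * (L * real_of_int (m k) - x k))" for j
  define b where "b = (\<Sum>j\<in>J. (B j k)\<^sup>2)"
  define c where "c = (\<Sum>j\<in>J. u j * B j k)"
  define U where "U = (\<Sum>j\<in>J. (u j)\<^sup>2)"
  \<comment> \<open>The two candidates are \<open>L * n\<close> and \<open>L * (n + 1)\<close>,
    taken with weights \<open>1 - \<theta>\<close> and \<open>\<theta>\<close>, so that the mean is
    \<open>x k\<close>.\<close>
  define n where "n = \<lfloor>x k / L\<rfloor>"
  define \<theta> where "\<theta> = x k / L - n"
  define F where "F i = (\<Sum>j\<in>J. (u j + B j k * (L * real_of_int i - x k))\<^sup>2) + t * (L * \<bar>real_of_int i\<bar>)" for i :: int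
  have \<theta>: "0 \<le> \<theta>" "\<theta> \<le> 1" unfolding \<theta>_def n_def by linarith+
  have xk: "x k = L * (n + \<theta>)" using L by (simp add: \<theta>_def)
  have b0: "0 \<le> b" by (simp add: b_def sum_nonneg)
  have F_eq: "F i = U + 2 * (L * real_of_int i - x k) * c + (L * real_of_int i - x k)\<^sup>2 * b + t * (L * \<bar>real_of_int i\<bar>)" for i
    unfolding F_def U_def c_def b_def sum_distrib_left sum.distrib[symmetric]
    by (intro arg_cong2[where f = "(+)"] sum.cong refl) (simp add: power2_eq_square algebra_simps)
  \<comment> \<open>The absolute value is linear between consecutive integers, so the averaging
    preserves it exactly.\<close>
  have abs_eq: "(1 - \<theta>) * (L * \<bar>real_of_int n\<bar>) + \<theta> * (L * \<bar>real_of_int (n + 1)\<bar>) = \<bar>x k\<bar>"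
  proof (cases "n \<ge> 0")
    case True
    then have "0 \<le> x k" using xk L \<theta> by simp
    then show ?thesis using True by (simp add: xk algebra_simps)
  next
    case False
    then have n: "real_of_int n \<le> - 1" by linarith
    then have "x k \<le> 0" using xk L \<theta> by (simp add: mult_le_0_iff)
    then have "\<bar>x k\<bar> = - x k" by simp
    moreover have "\<bar>real_of_int n\<bar> = - real_of_int n" "\<bar>real_of_int (n + 1)\<bar> = - real_of_int n - 1" using n by auto
    ultimately show ?thesis by (simp add: xk algebra_simps)
  qed
  \<comment> \<open>The term linear in the error, with coefficient \<open>c\<close>, averages to 0;
    what remains is the variance \<open>L^2 * \<theta> * (1 - \<theta>)\<close> times
    \<open>b\<close>.\<close>
  have "(1 - \<theta>) * F n + \<theta> * F (n + 1)
      = U + L\<^sup>2 * (\<theta> * (1 - \<theta>)) * b + t * ((1 - \<theta>) * (L * \<bar>real_of_int n\<bar>) + \<theta> * (L * \<bar>real_of_int (n + 1)\<bar>))"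
    unfolding F_eq xk by (simp add: power2_eq_square algebra_simps)
  also have "\<dots> = U + L\<^sup>2 * (\<theta> * (1 - \<theta>)) * b + t * \<bar>x k\<bar>" unfolding abs_eq ..
  also have "\<dots> \<le> U + L\<^sup>2 * (1 / 4) * b + t * \<bar>x k\<bar>"
  proof -
    have "0 \<le> (\<theta> - 1 / 2)\<^sup>2" by simp
    then have "\<theta> * (1 - \<theta>) \<le> 1 / 4" by (simp add: power2_eq_square algebra_simps)
    then show ?thesis using b0 by (intro add_mono mult_right_mono mult_left_mono order_refl) auto
  qed
  finally have avg: "(1 - \<theta>) * F n + \<theta> * F (n + 1) \<le> U + L\<^sup>2 / 4 * b + t * \<bar>x k\<bar>" by simp
  have "\<exists>i. F i \<le> U + L\<^sup>2 / 4 * b + t * \<bar>x k\<bar>"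
  proof (rule ccontr)
    assume "\<not> ?thesis"
    then have gt: "F i > U + L\<^sup>2 / 4 * b + t * \<bar>x k\<bar>" for i by (simp add: not_le)
    define T where "T = U + L\<^sup>2 / 4 * b + t * \<bar>x k\<bar>"
    have pos: "0 < F n - T" "0 < F (n + 1) - T" using gt by (auto simp: T_def)
    have "0 < (1 - \<theta>) * (F n - T) + \<theta> * (F (n + 1) - T)"
    proof (cases "\<theta> = 1")
      case True
      then show ?thesis using pos by simp
    next
      case False
      then show ?thesis using pos \<theta> by (intro add_pos_nonneg mult_pos_pos mult_nonneg_nonneg) auto
    qed
    also have "\<dots> = (1 - \<theta>) * F n + \<theta> * F (n + 1) - T" by (simp add: algebra_simps)
    finally show False using avg by (simp add: T_def)
  qed
  then obtain i where i: "F i \<le> U + L\<^sup>2 / 4 * b + t * \<bar>x k\<bar>" by blast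
  define m' where "m' = m(k := i)"
  have on_I: "m' l = m l" if "l \<in> I" for l using that insert.hyps by (auto simp: m'_def)
  have m'k: "m' k = i" by (simp add: m'_def)
  have "(\<Sum>j\<in>J. (\<Sum>k\<in>insert k I. B j k * (L * real_of_int (m' k) - x k))\<^sup>2) + t * (\<Sum>k\<in>insert k I. L * \<bar>real_of_int (m' k)\<bar>)
      = (\<Sum>j\<in>J. (B j k * (L * real_of_int i - x k) + (\<Sum>k\<in>I. B j k * (L * real_of_int (m k) - x k)))\<^sup>2) + t * (L * \<bar>real_of_int i\<bar> + (\<Sum>k\<in>I. L * \<bar>real_of_int (m k)\<bar>))"
    using insert.hyps by (simp add: m'k on_I cong: sum.cong)
  also have "\<dots> = F i + t * (\<Sum>k\<in>I. L * \<bar>real_of_int (m k)\<bar>)"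
    by (simp add: F_def u_def algebra_simps)
  also have "\<dots> \<le> U + L\<^sup>2 / 4 * b + t * \<bar>x k\<bar> + t * (\<Sum>k\<in>I. L * \<bar>real_of_int (m k)\<bar>)" using i by simp
  also have "\<dots> \<le> L\<^sup>2 / 4 * (\<Sum>k\<in>I. \<Sum>j\<in>J. (B j k)\<^sup>2) + t * (\<Sum>k\<in>I. \<bar>x k\<bar>) + L\<^sup>2 / 4 * b + t * \<bar>x k\<bar>"
    using m by (simp add: U_def u_def)
  also have "\<dots> = L\<^sup>2 / 4 * (\<Sum>k\<in>insert k I. \<Sum>j\<in>J. (B j k)\<^sup>2) + t * (\<Sum>k\<in>insert k I. \<bar>x k\<bar>)"
    using insert.hyps by (simp add: b_def algebra_simps)
  finally show ?case by blast
qed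

lemma sum_exp_abs_le:
  fixes s :: real
  assumes "0 < s"
  shows "(\<Sum>m\<in>{- int N..int N}. exp (- s * \<bar>real_of_int m\<bar>)) \<le> 1 + 2 * (exp (- s) / (1 - exp (- s)))"
proof -
  define q where "q = exp (- s)"
  have q: "0 < q" "q < 1" using assms by (auto simp: q_def)
  have qn: "exp (- s * \<bar>real_of_int m\<bar>) = q ^ nat \<bar>m\<bar>" for m
    by (simp add: q_def exp_of_nat_mult[symmetric] mult.commute)
  have "(\<Sum>m\<in>{- int N..int N}. q ^ nat \<bar>m\<bar>) \<le> 1 + 2 * (q / (1 - q))"
  proof -
    have split: "{- int N..int N} = insert 0 ((\<lambda>n. int (Suc n)) ` {..<N} \<union> (\<lambda>n. - int (Suc n)) ` {..<N})"
    proof (intro equalityI subsetI)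
      fix m assume m: "m \<in> {- int N..int N}"
      consider "m = 0" | "m > 0" | "m < 0" by linarith
      then show "m \<in> insert 0 ((\<lambda>n. int (Suc n)) ` {..<N} \<union> (\<lambda>n. - int (Suc n)) ` {..<N})"
      proof cases
        case 2
        then have "m = int (Suc (nat (m - 1)))" "nat (m - 1) < N" using m by auto
        then show ?thesis by blast
      next
        case 3
        then have "m = - int (Suc (nat (- m - 1)))" "nat (- m - 1) < N" using m by auto
        then show ?thesis by blast
      qed auto
    qed auto
    have "(\<Sum>m\<in>{- int N..int N}. q ^ nat \<bar>m\<bar>)
        = 1 + ((\<Sum>m\<in>(\<lambda>n. int (Suc n)) ` {..<N}. q ^ nat \<bar>m\<bar>) + (\<Sum>m\<in>(\<lambda>n. - int (Suc n)) ` {..<N}. q ^ nat \<bar>m\<bar>))"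
      unfolding split by (subst sum.insert, simp, force, subst sum.union_disjoint) auto
    also have "(\<Sum>m\<in>(\<lambda>n. int (Suc n)) ` {..<N}. q ^ nat \<bar>m\<bar>) = (\<Sum>n<N. q * q ^ n)"
      by (subst sum.reindex) (auto simp: inj_on_def nat_add_distrib intro!: sum.cong)
    also have "(\<Sum>m\<in>(\<lambda>n. - int (Suc n)) ` {..<N}. q ^ nat \<bar>m\<bar>) = (\<Sum>n<N. q * q ^ n)"
      by (subst sum.reindex) (auto simp: inj_on_def nat_add_distrib abs_minus_commute[of "-1"] intro!: sum.cong)
    also have "(\<Sum>n<N. q * q ^ n) \<le> q / (1 - q)"
    proof -
      have "(\<Sum>n<N. q ^ n) \<le> (\<Sum>n. q ^ n)" using q by (intro sum_le_suminf summable_geometric) auto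
      also have "\<dots> = 1 / (1 - q)" using q by (intro suminf_geometric) auto
      finally have "q * (\<Sum>n<N. q ^ n) \<le> q * (1 / (1 - q))" using q by (intro mult_left_mono) auto
      then show ?thesis by (simp add: sum_distrib_left)
    qed
    finally show ?thesis by simp
  qed
  then show ?thesis unfolding qn unfolding q_def .
qed

lemma card_le_fibres:
  fixes F :: "'a \<Rightarrow> 'b"
  assumes "finite N" "finite Q" "F ` N \<subseteq> Q" and "\<And>q. real (card {x \<in> N. F x = q}) \<le> K"
  shows "real (card N) \<le> real (card Q) * K"
proof -
  have "card N = (\<Sum>q\<in>Q. card {x \<in> N. F x = q})"
    using sum.group[OF assms(1,2,3), of "\<lambda>_. 1::nat"] by simp
  then have "real (card N) = (\<Sum>q\<in>Q. real (card {x \<in> N. F x = q}))" by simp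
  also have "\<dots> \<le> (\<Sum>q\<in>Q. K)" by (intro sum_mono assms)
  finally show ?thesis by simp
qed

text \<open>If \<open>\<eta>\<close> is almost fixed by a matrix \<open>B\<close> of small Hilbert--Schmidt norm, then it is
  almost determined by a rounding \<open>L m\<close> of itself, because \<open>\<eta> \<approx> B \<eta> \<approx> B (L m)\<close>; there are
  few such \<open>m\<close> when the mesh \<open>L\<close> is large compared with the size \<open>R\<close> of \<open>\<eta>\<close>.\<close>

lemma covering_count:
  fixes \<epsilon> R :: real and A :: "nat set"
  assumes \<epsilon>: "\<epsilon> > 0" and R: "R > 0" and A: "finite A"
  obtains L \<theta> :: real where "L > 0" "\<theta> > 0"
    "\<And>(d::nat) (B :: nat \<Rightarrow> nat \<Rightarrow> real) N (\<eta> :: (nat \<Rightarrow> nat) \<Rightarrow> nat \<Rightarrow> real) (\<kappa> :: real) (\<kappa>' :: real).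
      \<lbrakk>1 \<le> d; N \<subseteq> {1..d} \<rightarrow>\<^sub>E A; \<kappa> > 0;
       (\<Sum>k\<in>{1..d}. \<Sum>j\<in>{1..d}. (B j k)\<^sup>2) \<le> \<kappa> * d;
       \<And>\<nu>. \<nu> \<in> N \<Longrightarrow> (\<Sum>j\<in>{1..d}. (\<eta> \<nu> j)\<^sup>2) \<le> R\<^sup>2 * d;
       \<And>\<nu>. \<nu> \<in> N \<Longrightarrow> (\<Sum>j\<in>{1..d}. (\<eta> \<nu> j - (\<Sum>k\<in>{1..d}. B j k * \<eta> \<nu> k))\<^sup>2) \<le> \<kappa>' * d;
       \<And>\<nu> \<nu>'. \<lbrakk>\<nu> \<in> N; \<nu>' \<in> N; (\<Sum>j\<in>{1..d}. (\<eta> \<nu> j - \<eta> \<nu>' j)\<^sup>2) \<le> (8 * \<kappa>' + 16 * L\<^sup>2 * \<kappa>) * d\<rbrakk>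
         \<Longrightarrow> real (card {j \<in> {1..d}. \<nu> j \<noteq> \<nu>' j}) \<le> \<theta> * d\<rbrakk>
      \<Longrightarrow> real (card N) \<le> exp (\<epsilon> * d)"
proof -
  \<comment> \<open>The count will be bounded by the number of roundings times the size of a fibre,
    each at most \<open>exp (2 * e * d)\<close>.\<close>
  define e where "e = \<epsilon> / 4"
  have e: "e > 0" using \<epsilon> by (simp add: e_def)
  \<comment> \<open>With this \<open>s\<close> the bound of \<open>sum_exp_abs_le\<close> is exactly
    \<open>1 + e\<close>, so each coordinate of a rounding costs a factor of at most
    \<open>exp e\<close>.\<close>
  define s where "s = ln (1 + 2 / e)"
  have s: "s > 0" unfolding s_def using e by (intro ln_gt_zero) auto
  have exps: "exp (- s) = e / (e + 2)" using e by (simp add: s_def exp_minus field_simps)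
  have geo: "2 * (exp (- s) / (1 - exp (- s))) = e" unfolding exps using e by (simp add: field_simps)
  \<comment> \<open>The analogous choice for Hamming balls: the deviating letters at one coordinate
    contribute at most \<open>card A * exp (- s') \<le> e\<close>.\<close>
  define s' where "s' = ln (1 + real (card A) / e)"
  have s': "s' \<ge> 0" unfolding s'_def using e by (intro ln_ge_zero) auto
  have "exp (- s') = e / (e + real (card A))" using e by (simp add: s'_def exp_minus field_simps)
  then have "e * exp (- s') + real (card A) * exp (- s') = e"
    using e by (simp add: field_simps)
  moreover have "0 \<le> e * exp (- s')" using e by simp
  ultimately have exps': "real (card A) * exp (- s') \<le> e" by argo
  \<comment> \<open>A mesh so coarse that the l1-budget \<open>W = 2 * R * d / L\<close> of the
    roundings satisfies \<open>s * W \<le> e * d\<close>. It depends on \<open>\<epsilon>\<close>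
    and \<open>R\<close> only, so \<open>\<kappa>\<close> can be chosen afterwards, small compared
    with \<open>1 / L^2\<close>.\<close>
  define L where "L = 2 * R * s / e"
  define \<theta> where "\<theta> = e / (s' + 1)"
  have L: "L > 0" using R s e by (simp add: L_def)
  have \<theta>: "\<theta> > 0" using e s' by (simp add: \<theta>_def)
  have sL: "s * (2 * R / L) \<le> e" using R s e by (simp add: L_def)
  have s\<theta>: "s' * \<theta> \<le> e" using s' e by (simp add: \<theta>_def field_simps)
  show thesis
  proof (rule that[OF L \<theta>])
    fix d :: nat and B :: "nat \<Rightarrow> nat \<Rightarrow> real" and N :: "(nat \<Rightarrow> nat) set" and \<eta> :: "(nat \<Rightarrow> nat) \<Rightarrow> nat \<Rightarrow> real" and \<kappa> \<kappa>' :: real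
    assume d: "1 \<le> d" and N: "N \<subseteq> {1..d} \<rightarrow>\<^sub>E A" and \<kappa>: "\<kappa> > 0"
      and HS: "(\<Sum>k\<in>{1..d}. \<Sum>j\<in>{1..d}. (B j k)\<^sup>2) \<le> \<kappa> * d"
      and bd: "\<And>\<nu>. \<nu> \<in> N \<Longrightarrow> (\<Sum>j\<in>{1..d}. (\<eta> \<nu> j)\<^sup>2) \<le> R\<^sup>2 * d"
      and fx: "\<And>\<nu>. \<nu> \<in> N \<Longrightarrow> (\<Sum>j\<in>{1..d}. (\<eta> \<nu> j - (\<Sum>k\<in>{1..d}. B j k * \<eta> \<nu> k))\<^sup>2) \<le> \<kappa>' * d"
      and det: "\<And>\<nu> \<nu>'. \<lbrakk>\<nu> \<in> N; \<nu>' \<in> N; (\<Sum>j\<in>{1..d}. (\<eta> \<nu> j - \<eta> \<nu>' j)\<^sup>2) \<le> (8 * \<kappa>' + 16 * L\<^sup>2 * \<kappa>) * d\<rbrakk>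
         \<Longrightarrow> real (card {j \<in> {1..d}. \<nu> j \<noteq> \<nu>' j}) \<le> \<theta> * d"
    let ?D = "{1..d}"
    have finN: "finite N" by (rule finite_subset[OF N]) (intro finite_PiE finite_atLeastAtMost A)
    define W where "W = 2 * R * d / L"
    define Q where "Q = {m \<in> ?D \<rightarrow>\<^sub>E {- int (nat \<lceil>W\<rceil>)..int (nat \<lceil>W\<rceil>)}. (\<Sum>k\<in>?D. \<bar>real_of_int (m k)\<bar>) \<le> W}"
    have finQ: "finite Q" unfolding Q_def by (rule finite_subset[of _ "?D \<rightarrow>\<^sub>E {- int (nat \<lceil>W\<rceil>)..int (nat \<lceil>W\<rceil>)}"]) (auto intro!: finite_PiE)
    have "\<exists>m. m \<in> Q \<and> (\<Sum>j\<in>?D. (\<Sum>k\<in>?D. B j k * (L * real_of_int (m k) - \<eta> \<nu> k))\<^sup>2) \<le> 2 * L\<^sup>2 * \<kappa> * d"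
      if \<nu>: "\<nu> \<in> N" for \<nu>
    proof -
      define x where "x = \<eta> \<nu>"
      \<comment> \<open>This weight gives \<open>t * R = L^2 * \<kappa>\<close>, so the two terms on
        the right of \<open>rounding\<close> are comparable, and one inequality bounds both the
        error seen through \<open>B\<close> and the l1-norm of \<open>m\<close>.\<close>
      define t where "t = L\<^sup>2 * \<kappa> / R"
      have t: "t > 0" using L \<kappa> R by (simp add: t_def)
      have "(\<Sum>k\<in>?D. \<bar>x k\<bar> * 1)\<^sup>2 \<le> (\<Sum>k\<in>?D. \<bar>x k\<bar>\<^sup>2) * (\<Sum>k\<in>?D. 1\<^sup>2)"
        by (rule Cauchy_Schwarz_ineq_sum)
      also have "\<dots> \<le> R\<^sup>2 * d * d" using bd[OF \<nu>] by (simp add: x_def mult_right_mono)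
      finally have "(\<Sum>k\<in>?D. \<bar>x k\<bar>)\<^sup>2 \<le> (R * d)\<^sup>2" by (simp add: power2_eq_square mult_ac)
      then have l1: "(\<Sum>k\<in>?D. \<bar>x k\<bar>) \<le> R * d"
        by (rule power2_le_imp_le) (use R in auto)
      obtain m :: "nat \<Rightarrow> int" where m: "(\<Sum>j\<in>?D. (\<Sum>k\<in>?D. B j k * (L * real_of_int (m k) - x k))\<^sup>2) + t * (\<Sum>k\<in>?D. L * \<bar>real_of_int (m k)\<bar>)
          \<le> L\<^sup>2 / 4 * (\<Sum>k\<in>?D. \<Sum>j\<in>?D. (B j k)\<^sup>2) + t * (\<Sum>k\<in>?D. \<bar>x k\<bar>)"
        using rounding[of ?D ?D L t B x] L t by auto
      also have "\<dots> \<le> L\<^sup>2 / 4 * (\<kappa> * d) + t * (R * d)"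
        using HS l1 t by (intro add_mono mult_left_mono) auto
      also have "\<dots> = 5 / 4 * (L\<^sup>2 * \<kappa> * d)" using R by (simp add: t_def)
      also have "\<dots> \<le> 2 * (L\<^sup>2 * \<kappa> * d)" using \<kappa> by (intro mult_right_mono) auto
      finally have tot: "(\<Sum>j\<in>?D. (\<Sum>k\<in>?D. B j k * (L * real_of_int (m k) - x k))\<^sup>2) + t * (\<Sum>k\<in>?D. L * \<bar>real_of_int (m k)\<bar>) \<le> 2 * (L\<^sup>2 * \<kappa> * d)" .
      have nn: "0 \<le> (\<Sum>j\<in>?D. (\<Sum>k\<in>?D. B j k * (L * real_of_int (m k) - x k))\<^sup>2)" by (intro sum_nonneg) auto
      have nn': "0 \<le> t * (\<Sum>k\<in>?D. L * \<bar>real_of_int (m k)\<bar>)" using t L by (intro mult_nonneg_nonneg sum_nonneg) auto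
      have "t * (\<Sum>k\<in>?D. L * \<bar>real_of_int (m k)\<bar>) \<le> t * (2 * R * d)"
        using tot nn R by (simp add: t_def)
      then have "(\<Sum>k\<in>?D. L * \<bar>real_of_int (m k)\<bar>) \<le> 2 * R * d"
        using t by (rule mult_left_le_imp_le)
      then have "L * (\<Sum>k\<in>?D. \<bar>real_of_int (m k)\<bar>) \<le> 2 * R * d"
        by (simp only: sum_distrib_left)
      then have mW: "(\<Sum>k\<in>?D. \<bar>real_of_int (m k)\<bar>) \<le> W"
        using L by (simp add: W_def field_simps)
      define m' where "m' = restrict m ?D"
      have "m' \<in> Q"
        unfolding Q_def
      proof (intro CollectI conjI)
        show "m' \<in> ?D \<rightarrow>\<^sub>E {- int (nat \<lceil>W\<rceil>)..int (nat \<lceil>W\<rceil>)}"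
        proof (rule PiE_I)
          fix k assume k: "k \<in> ?D"
          have "\<bar>real_of_int (m k)\<bar> \<le> (\<Sum>k\<in>?D. \<bar>real_of_int (m k)\<bar>)"
            using k by (intro member_le_sum) auto
          then have "\<bar>real_of_int (m k)\<bar> \<le> W" using mW by simp
          then have "\<bar>m k\<bar> \<le> \<lceil>W\<rceil>" by (simp add: le_ceiling_iff)
          moreover from this have "int (nat \<lceil>W\<rceil>) = \<lceil>W\<rceil>" by (metis abs_ge_zero order_trans nat_0_le)
          ultimately show "m' k \<in> {- int (nat \<lceil>W\<rceil>)..int (nat \<lceil>W\<rceil>)}"
            using k by (simp add: m'_def abs_le_iff)
        qed (auto simp: m'_def)
        show "(\<Sum>k\<in>?D. \<bar>real_of_int (m' k)\<bar>) \<le> W" using mW by (simp add: m'_def)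
      qed
      moreover have "(\<Sum>j\<in>?D. (\<Sum>k\<in>?D. B j k * (L * real_of_int (m' k) - \<eta> \<nu> k))\<^sup>2) \<le> 2 * L\<^sup>2 * \<kappa> * d"
        using tot nn' by (simp add: m'_def x_def)
      ultimately show ?thesis by blast
    qed
    then have "\<exists>F. \<forall>\<nu>\<in>N. F \<nu> \<in> Q \<and>
        (\<Sum>j\<in>?D. (\<Sum>k\<in>?D. B j k * (L * real_of_int (F \<nu> k) - \<eta> \<nu> k))\<^sup>2) \<le> 2 * L\<^sup>2 * \<kappa> * d"
      by (intro bchoice ballI)
    then obtain F where F0: "\<forall>\<nu>\<in>N. F \<nu> \<in> Q \<and>
        (\<Sum>j\<in>?D. (\<Sum>k\<in>?D. B j k * (L * real_of_int (F \<nu> k) - \<eta> \<nu> k))\<^sup>2) \<le> 2 * L\<^sup>2 * \<kappa> * d" ..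
    then have F: "\<And>\<nu>. \<nu> \<in> N \<Longrightarrow> F \<nu> \<in> Q"
      "\<And>\<nu>. \<nu> \<in> N \<Longrightarrow> (\<Sum>j\<in>?D. (\<Sum>k\<in>?D. B j k * (L * real_of_int (F \<nu> k) - \<eta> \<nu> k))\<^sup>2) \<le> 2 * L\<^sup>2 * \<kappa> * d"
      by simp_all
    have close: "real (card {j \<in> ?D. \<nu> j \<noteq> \<nu>' j}) \<le> \<theta> * d" if \<nu>: "\<nu> \<in> N" "\<nu>' \<in> N" and eq: "F \<nu> = F \<nu>'" for \<nu> \<nu>'
    proof (rule det[OF \<nu>])
      define y where "y \<nu> j = \<eta> \<nu> j - (\<Sum>k\<in>?D. B j k * \<eta> \<nu> k)" for \<nu> j
      define v where "v \<nu> j = (\<Sum>k\<in>?D. B j k * (L * real_of_int (F \<nu> k) - \<eta> \<nu> k))" for \<nu> j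
      \<comment> \<open>Since the roundings coincide, \<open>\<eta> \<nu> - \<eta> \<nu>'\<close>
        consists of two defects of being fixed and two rounding errors seen through
        \<open>B\<close>. The factor 4 produces the constant
        \<open>8 * \<kappa>' + 16 * L^2 * \<kappa>\<close>.\<close>
      have four: "(p - q - r + u)\<^sup>2 \<le> 4 * (p\<^sup>2 + q\<^sup>2 + r\<^sup>2 + u\<^sup>2)" for p q r u :: real
      proof -
        have eq: "4 * (p\<^sup>2 + q\<^sup>2 + r\<^sup>2 + u\<^sup>2) - (p - q - r + u)\<^sup>2 =
          (p + q)\<^sup>2 + (p + r)\<^sup>2 + (p - u)\<^sup>2 + (q - r)\<^sup>2 + (q + u)\<^sup>2 + (r + u)\<^sup>2"
          by (simp add: power2_eq_square algebra_simps)
        have "0 \<le> 4 * (p\<^sup>2 + q\<^sup>2 + r\<^sup>2 + u\<^sup>2) - (p - q - r + u)\<^sup>2"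
          unfolding eq by (intro add_nonneg_nonneg zero_le_power2)
        then show ?thesis by (simp only: diff_ge_0_iff_ge)
      qed
      have "(\<Sum>j\<in>?D. (\<eta> \<nu> j - \<eta> \<nu>' j)\<^sup>2) \<le> (\<Sum>j\<in>?D. 4 * ((y \<nu> j)\<^sup>2 + (y \<nu>' j)\<^sup>2 + (v \<nu> j)\<^sup>2 + (v \<nu>' j)\<^sup>2))"
      proof (rule sum_mono)
        fix j
        have "\<eta> \<nu> j - \<eta> \<nu>' j = y \<nu> j - y \<nu>' j - v \<nu> j + v \<nu>' j"
          using eq by (simp add: y_def v_def right_diff_distrib sum_subtractf)
        then show "(\<eta> \<nu> j - \<eta> \<nu>' j)\<^sup>2 \<le> 4 * ((y \<nu> j)\<^sup>2 + (y \<nu>' j)\<^sup>2 + (v \<nu> j)\<^sup>2 + (v \<nu>' j)\<^sup>2)"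
          using four by simp
      qed
      also have "\<dots> = 4 * ((\<Sum>j\<in>?D. (y \<nu> j)\<^sup>2) + (\<Sum>j\<in>?D. (y \<nu>' j)\<^sup>2) + (\<Sum>j\<in>?D. (v \<nu> j)\<^sup>2) + (\<Sum>j\<in>?D. (v \<nu>' j)\<^sup>2))"
        by (simp add: sum.distrib sum_distrib_left)
      also have "\<dots> \<le> 4 * (\<kappa>' * d + \<kappa>' * d + 2 * L\<^sup>2 * \<kappa> * d + 2 * L\<^sup>2 * \<kappa> * d)"
        unfolding y_def v_def using \<nu> fx F(2) by (intro mult_left_mono add_mono) auto
      also have "\<dots> = (8 * \<kappa>' + 16 * L\<^sup>2 * \<kappa>) * d" by (simp add: algebra_simps)
      finally show "(\<Sum>j\<in>?D. (\<eta> \<nu> j - \<eta> \<nu>' j)\<^sup>2) \<le> (8 * \<kappa>' + 16 * L\<^sup>2 * \<kappa>) * d" .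
    qed
    \<comment> \<open>A nonempty fibre lies in a Hamming ball of radius \<open>\<theta> * d\<close>
      around any of its members.\<close>
    have fibre: "real (card {\<nu> \<in> N. F \<nu> = q}) \<le> exp (2 * e * d)" for q
    proof (cases "{\<nu> \<in> N. F \<nu> = q} = {}")
      case True
      show ?thesis unfolding True by simp
    next
      case False
      then obtain \<nu>0 where \<nu>0: "\<nu>0 \<in> N" "F \<nu>0 = q" by blast
      define w :: "nat \<Rightarrow> nat \<Rightarrow> real" where "w k a = of_bool (\<nu>0 k \<noteq> a)" for k a
      have "{\<nu> \<in> N. F \<nu> = q} \<subseteq> {\<nu> \<in> ?D \<rightarrow>\<^sub>E A. (\<Sum>k\<in>?D. w k (\<nu> k)) \<le> \<theta> * d}"
      proof (rule subsetI)
        fix \<nu> assume "\<nu> \<in> {\<nu> \<in> N. F \<nu> = q}"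
        then have \<nu>: "\<nu> \<in> N" "q = F \<nu>" by auto
        have "(\<Sum>k\<in>?D. w k (\<nu> k)) = real (card {k \<in> ?D. \<nu>0 k \<noteq> \<nu> k})"
          by (simp add: w_def of_bool_def sum.If_cases Int_def)
        also have "\<dots> \<le> \<theta> * d" using \<nu> \<nu>0 by (intro close) auto
        finally show "\<nu> \<in> {\<nu> \<in> ?D \<rightarrow>\<^sub>E A. (\<Sum>k\<in>?D. w k (\<nu> k)) \<le> \<theta> * d}"
          using \<nu> N by auto
      qed
      then have "card {\<nu> \<in> N. F \<nu> = q} \<le> card {\<nu> \<in> ?D \<rightarrow>\<^sub>E A. (\<Sum>k\<in>?D. w k (\<nu> k)) \<le> \<theta> * d}"
        by (rule card_mono[rotated]) (rule finite_subset[of _ "?D \<rightarrow>\<^sub>E A"], auto intro!: finite_PiE A)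
      then have "real (card {\<nu> \<in> N. F \<nu> = q}) \<le> real (card {\<nu> \<in> ?D \<rightarrow>\<^sub>E A. (\<Sum>k\<in>?D. w k (\<nu> k)) \<le> \<theta> * d})" by simp
      also have "\<dots> \<le> exp (s' * (\<theta> * d)) * (\<Prod>k\<in>?D. \<Sum>a\<in>A. exp (- s' * w k a))"
        using s' A by (intro card_weight_le) auto
      also have "\<dots> \<le> exp (e * d) * (\<Prod>k\<in>?D. exp e)"
      proof (intro mult_mono prod_mono conjI)
        show "exp (s' * (\<theta> * d)) \<le> exp (e * d)" using s\<theta> by (simp add: mult.assoc[symmetric] mult_right_mono)
        fix k
        show "(\<Sum>a\<in>A. exp (- s' * w k a)) \<le> exp e"
        proof -
          have "(\<Sum>a\<in>A. exp (- s' * w k a)) \<le> (\<Sum>a\<in>A. of_bool (a = \<nu>0 k) + exp (- s'))"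
            by (intro sum_mono) (auto simp: w_def)
          also have "\<dots> \<le> 1 + real (card A) * exp (- s')"
            using A by (simp add: sum.distrib of_bool_def sum.delta)
          also have "\<dots> \<le> 1 + e" using exps' by simp
          also have "\<dots> \<le> exp e" by (rule exp_ge_add_one_self)
          finally show ?thesis .
        qed
      qed (auto intro!: prod_nonneg sum_nonneg)
      also have "\<dots> = exp (2 * e * d)" by (simp add: exp_of_nat_mult[symmetric] exp_add[symmetric] mult_ac)
      finally show ?thesis .
    qed
    have "real (card Q) \<le> exp (s * W) * (\<Prod>k\<in>?D. \<Sum>a\<in>{- int (nat \<lceil>W\<rceil>)..int (nat \<lceil>W\<rceil>)}. exp (- s * \<bar>real_of_int a\<bar>))"
      unfolding Q_def using s by (intro card_weight_le) auto
    also have "\<dots> \<le> exp (e * d) * (\<Prod>k\<in>?D. exp e)"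
    proof (intro mult_mono prod_mono conjI)
      have "s * W = s * (2 * R / L) * d" by (simp add: W_def)
      also have "\<dots> \<le> e * d" using sL by (intro mult_right_mono) auto
      finally show "exp (s * W) \<le> exp (e * d)" by simp
      fix k
      have "(\<Sum>a\<in>{- int (nat \<lceil>W\<rceil>)..int (nat \<lceil>W\<rceil>)}. exp (- s * \<bar>real_of_int a\<bar>)) \<le> 1 + e"
        using sum_exp_abs_le[OF s] unfolding geo .
      also have "\<dots> \<le> exp e" by (rule exp_ge_add_one_self)
      finally show "(\<Sum>a\<in>{- int (nat \<lceil>W\<rceil>)..int (nat \<lceil>W\<rceil>)}. exp (- s * \<bar>real_of_int a\<bar>)) \<le> exp e" .
    qed (auto intro!: prod_nonneg sum_nonneg zero_le_power)
    also have "\<dots> = exp (2 * e * d)" by (simp add: exp_of_nat_mult[symmetric] exp_add[symmetric] mult_ac)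
    finally have cQ: "real (card Q) \<le> exp (2 * e * d)" .
    have "real (card N) \<le> real (card Q) * exp (2 * e * d)"
      using F(1) by (intro card_le_fibres[OF finN finQ _ fibre]) auto
    also have "\<dots> \<le> exp (2 * e * d) * exp (2 * e * d)" using cQ by (intro mult_right_mono) auto
    also have "\<dots> = exp (\<epsilon> * d)" by (simp add: e_def exp_add[symmetric])
    finally show "real (card N) \<le> exp (\<epsilon> * d)" .
  qed
qed

section \<open>Averages over microstates\<close>

text \<open>Observables take values in \<^typ>\<open>nat\<close>, so a real number is clipped to \<open>[-K, K]\<close>, rounded down to a
  multiple of \<open>1 / K\<close>, and coded by a natural number.\<close>

definition clamp_round :: "nat \<Rightarrow> real \<Rightarrow> nat" where
  "clamp_round K x = nat (\<lfloor>real K * max (- real K) (min (real K) x)\<rfloor> + int (K * K))"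

definition round_value :: "nat \<Rightarrow> nat \<Rightarrow> real" where
  "round_value K n = (real n - real (K * K)) / real K"

lemma clamp_round_le: "clamp_round K x \<le> 2 * (K * K)"
proof -
  have "real K * max (- real K) (min (real K) x) \<le> real K * real K"
    by (intro mult_left_mono) auto
  then have "\<lfloor>real K * max (- real K) (min (real K) x)\<rfloor> \<le> int (K * K)"
    by (simp add: floor_le_iff) 
  then show ?thesis unfolding clamp_round_def nat_le_iff by simp
qed

lemma round_value_clamp_round:
  "round_value K (clamp_round K x) = real_of_int \<lfloor>real K * max (- real K) (min (real K) x)\<rfloor> / real K"
proof -
  have "real K * (- real K) \<le> real K * max (- real K) (min (real K) x)"
    by (intro mult_left_mono) auto
  then have "- int (K * K) \<le> \<lfloor>real K * max (- real K) (min (real K) x)\<rfloor>"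
    by (simp add: le_floor_iff)
  then show ?thesis by (simp add: round_value_def clamp_round_def)
qed

lemma round_value_bound: "n \<le> 2 * (K * K) \<Longrightarrow> \<bar>round_value K n\<bar> \<le> real K"
proof (cases "K = 0")
  case False
  assume "n \<le> 2 * (K * K)"
  then have "\<bar>real n - real (K * K)\<bar> \<le> real (K * K)" by (simp add: abs_le_iff flip: of_nat_mult)
  then show ?thesis using False by (simp add: round_value_def divide_le_eq)
qed (simp add: round_value_def)

lemma round_diff:
  assumes "K \<ge> 1"
  shows "\<bar>round_value K (clamp_round K x) - max (- real K) (min (real K) x)\<bar> \<le> 1 / real K"
proof -
  define y where "y = max (- real K) (min (real K) x)"
  have "\<bar>real_of_int \<lfloor>real K * y\<rfloor> - real K * y\<bar> \<le> 1" by linarith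
  moreover have "real_of_int \<lfloor>real K * y\<rfloor> / real K - y = (real_of_int \<lfloor>real K * y\<rfloor> - real K * y) / real K"
    using assms by (simp add: field_simps)
  ultimately show ?thesis
    using assms unfolding round_value_clamp_round y_def[symmetric] by (simp add: divide_right_mono)
qed

lemma round_abs_le:
  assumes "K \<ge> 1"
  shows "\<bar>round_value K (clamp_round K x)\<bar> \<le> \<bar>x\<bar> + 1"
proof -
  have "1 / real K \<le> 1" using assms by simp
  moreover have "\<bar>max (- real K) (min (real K) x)\<bar> \<le> \<bar>x\<bar>" by (auto simp: max_def min_def)
  ultimately show ?thesis using round_diff[OF assms, of x] by linarith
qed

lemma round_tendsto: "(\<lambda>n. round_value (Suc n) (clamp_round (Suc n) x)) \<longlonglongrightarrow> x"
proof (rule LIM_zero_cancel, rule Lim_null_comparison)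
  show "(\<lambda>n. 1 / real (Suc n)) \<longlonglongrightarrow> 0" using LIMSEQ_Suc[OF lim_1_over_n] by simp
  show "\<forall>\<^sub>F n in sequentially. norm (round_value (Suc n) (clamp_round (Suc n) x) - x) \<le> 1 / real (Suc n)"
  proof (rule eventually_sequentiallyI)
    fix n assume "nat \<lceil>\<bar>x\<bar>\<rceil> \<le> n"
    then have "\<bar>x\<bar> \<le> real (Suc n)" by linarith
    then have "max (- real (Suc n)) (min (real (Suc n)) x) = x" by (auto simp: max_def min_def)
    then show "norm (round_value (Suc n) (clamp_round (Suc n) x) - x) \<le> 1 / real (Suc n)"
      using round_diff[of "Suc n" x] by simp
  qed
qed

lemma clamp_round_measurable [measurable]: "clamp_round K \<in> borel \<rightarrow>\<^sub>M count_space UNIV"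
  unfolding clamp_round_def by measurable

lemma measure_unif:
  assumes "1 \<le> d" "X \<subseteq> {1..d}"
  shows "measure (unif d) X = real (card X) / real d"
  using assms by (subst measure_uniform_count_measure) auto

context mp_action
begin

lemma obs_name_PiE:
  assumes "\<beta> \<in> M \<rightarrow>\<^sub>M count_space B" "F \<subseteq> carrier G" "x \<in> space M"
  shows "obs_name G act \<beta> F x \<in> F \<rightarrow>\<^sub>E B"
proof -
  have "\<beta> y \<in> B" if "y \<in> space M" for y using measurable_space[OF assms(1) that] by simp
  then show ?thesis using assms by (auto simp: obs_name_def act_space subset_iff)
qed

lemma obs_name_sets:
  assumes \<beta>: "\<beta> \<in> M \<rightarrow>\<^sub>M count_space B" and F: "finite F" "F \<subseteq> carrier G" "F \<noteq> {}" and b: "b \<in> F \<rightarrow>\<^sub>E B"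
  shows "{x \<in> space M. obs_name G act \<beta> F x = b} \<in> sets M"
proof -
  have "{x \<in> space M. obs_name G act \<beta> F x = b} = (\<Inter>g\<in>F. {x \<in> space M. \<beta> (act (inv g) x) = b g})"
  proof (intro equalityI subsetI)
    fix x assume "x \<in> {x \<in> space M. obs_name G act \<beta> F x = b}"
    then show "x \<in> (\<Inter>g\<in>F. {x \<in> space M. \<beta> (act (inv g) x) = b g})"
      by (auto simp: obs_name_def)
  next
    fix x assume x: "x \<in> (\<Inter>g\<in>F. {x \<in> space M. \<beta> (act (inv g) x) = b g})"
    have "obs_name G act \<beta> F x g = b g" for g
      using x PiE_arb[OF b, of g] by (cases "g \<in> F") (auto simp: obs_name_def)
    then show "x \<in> {x \<in> space M. obs_name G act \<beta> F x = b}"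
      using x F(3) by auto
  qed
  moreover have "{x \<in> space M. \<beta> (act (inv g) x) = b g} \<in> sets M" if g: "g \<in> F" for g
  proof -
    have "(\<lambda>x. \<beta> (act (inv g) x)) \<in> M \<rightarrow>\<^sub>M count_space B"
      using g F by (intro measurable_compose[OF act_measurable \<beta>]) auto
    then have "(\<lambda>x. \<beta> (act (inv g) x)) -` {b g} \<inter> space M \<in> sets M"
      using b g by (intro measurable_sets) auto
    moreover have "(\<lambda>x. \<beta> (act (inv g) x)) -` {b g} \<inter> space M = {x \<in> space M. \<beta> (act (inv g) x) = b g}" by auto
    ultimately show ?thesis by simp
  qed
  ultimately show ?thesis using F by (auto intro!: sets.finite_INT)
qed

lemma obs_name_integral:
  fixes H :: "('g \<Rightarrow> nat) \<Rightarrow> real"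
  assumes "prob_space M" and B: "finite B" and \<beta>: "\<beta> \<in> M \<rightarrow>\<^sub>M count_space B" and F: "finite F" "F \<subseteq> carrier G" "F \<noteq> {}"
  shows "integrable M (\<lambda>x. H (obs_name G act \<beta> F x))"
    and "(LINT x|M. H (obs_name G act \<beta> F x)) = (\<Sum>b\<in>F \<rightarrow>\<^sub>E B. H b * measure M {x \<in> space M. obs_name G act \<beta> F x = b})"
proof -
  interpret prob_space M by fact
  let ?X = "\<lambda>b. {x \<in> space M. obs_name G act \<beta> F x = b}"
  have fin: "finite (F \<rightarrow>\<^sub>E B)" using B F by (intro finite_PiE)
  have eq: "H (obs_name G act \<beta> F x) = (\<Sum>b\<in>F \<rightarrow>\<^sub>E B. H b * indicator (?X b) x)" if x: "x \<in> space M" for x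
  proof -
    have "(\<Sum>b\<in>F \<rightarrow>\<^sub>E B. H b * indicator (?X b) x) = (\<Sum>b\<in>F \<rightarrow>\<^sub>E B. if obs_name G act \<beta> F x = b then H b else 0)"
      using x by (intro sum.cong) (auto simp: indicator_def)
    also have "\<dots> = H (obs_name G act \<beta> F x)"
      using obs_name_PiE[OF \<beta> F(2) x] fin by (simp add: sum.delta')
    finally show ?thesis by simp
  qed
  have int: "integrable M (\<lambda>x. H b * indicator (?X b) x)" if "b \<in> F \<rightarrow>\<^sub>E B" for b
    using obs_name_sets[OF \<beta> F that] by (intro integrable_mult_right integrable_real_indicator) (auto simp: emeasure_eq_measure)
  have "integrable M (\<lambda>x. \<Sum>b\<in>F \<rightarrow>\<^sub>E B. H b * indicator (?X b) x)"
    using int by (intro Bochner_Integration.integrable_sum)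
  then show "integrable M (\<lambda>x. H (obs_name G act \<beta> F x))"
    by (subst Bochner_Integration.integrable_cong[OF refl eq])
  have "(LINT x|M. H (obs_name G act \<beta> F x)) = (LINT x|M. (\<Sum>b\<in>F \<rightarrow>\<^sub>E B. H b * indicator (?X b) x))"
    by (intro Bochner_Integration.integral_cong refl eq)
  also have "\<dots> = (\<Sum>b\<in>F \<rightarrow>\<^sub>E B. (LINT x|M. H b * indicator (?X b) x))"
    using int by (intro Bochner_Integration.integral_sum)
  also have "\<dots> = (\<Sum>b\<in>F \<rightarrow>\<^sub>E B. H b * measure M (?X b))"
    using obs_name_sets[OF \<beta> F] by (intro sum.cong refl) simp
  finally show "(LINT x|M. H (obs_name G act \<beta> F x)) = (\<Sum>b\<in>F \<rightarrow>\<^sub>E B. H b * measure M (?X b))" .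
qed

text \<open>The empirical distribution of a microstate is \<open>\<delta>\<close>-close in l1 to the
  distribution of the names, so the average of a function bounded by \<open>C\<close> exceeds its
  integral by at most \<open>C * \<delta>\<close>.\<close>

lemma AP_average:
  fixes H :: "('g \<Rightarrow> nat) \<Rightarrow> real"
  assumes P: "prob_space M" and B: "finite B" and \<beta>: "\<beta> \<in> M \<rightarrow>\<^sub>M count_space B"
    and F: "finite F" "F \<subseteq> carrier G" "F \<noteq> {}"
    and d: "1 \<le> d" and \<phi>: "\<phi> \<in> AP G M act B \<beta> F \<delta> d \<sigma>"
    and H: "\<And>b. b \<in> F \<rightarrow>\<^sub>E B \<Longrightarrow> \<bar>H b\<bar> \<le> C"
  shows "(\<Sum>j\<in>{1..d}. H (\<phi> j)) \<le> ((LINT x|M. H (obs_name G act \<beta> F x)) + C * \<delta>) * d"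
proof -
  let ?D = "{1..d}"
  let ?m = "\<lambda>b. measure M {x \<in> space M. obs_name G act \<beta> F x = b}"
  let ?u = "\<lambda>b. measure (unif d) {j \<in> ?D. \<phi> j = b}"
  have fin: "finite (F \<rightarrow>\<^sub>E B)" using B F by (intro finite_PiE)
  have \<phi>': "\<phi> \<in> ?D \<rightarrow>\<^sub>E (F \<rightarrow>\<^sub>E B)" "(\<Sum>b\<in>F \<rightarrow>\<^sub>E B. \<bar>?u b - ?m b\<bar>) < \<delta>" using \<phi> by (auto simp: AP_def)
  have "(\<phi> 1) \<in> F \<rightarrow>\<^sub>E B" using \<phi>'(1) d by (auto simp: PiE_iff)
  then have C: "0 \<le> C" using H[of "\<phi> 1"] by linarith
  have "(\<Sum>j\<in>?D. H (\<phi> j)) = (\<Sum>b\<in>F \<rightarrow>\<^sub>E B. \<Sum>j\<in>{j \<in> ?D. \<phi> j = b}. H (\<phi> j))"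
    using fin \<phi>'(1) by (intro sum.group[symmetric]) (auto dest: PiE_mem)
  also have "\<dots> = (\<Sum>b\<in>F \<rightarrow>\<^sub>E B. H b * (?u b * d))"
  proof (intro sum.cong refl)
    fix b
    have "(\<Sum>j\<in>{j \<in> ?D. \<phi> j = b}. H (\<phi> j)) = (\<Sum>j\<in>{j \<in> ?D. \<phi> j = b}. H b)"
      by (intro sum.cong) auto
    also have "\<dots> = H b * real (card {j \<in> ?D. \<phi> j = b})" by (simp only: sum_constant mult.commute)
    also have "real (card {j \<in> ?D. \<phi> j = b}) = ?u b * d"
      using d by (subst measure_unif[OF d]) auto
    finally show "(\<Sum>j\<in>{j \<in> ?D. \<phi> j = b}. H (\<phi> j)) = H b * (?u b * d)" .
  qed
  also have "\<dots> = (\<Sum>b\<in>F \<rightarrow>\<^sub>E B. H b * ?u b) * d" by (simp add: sum_distrib_right mult.assoc)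
  also have "\<dots> \<le> ((LINT x|M. H (obs_name G act \<beta> F x)) + C * \<delta>) * d"
  proof (rule mult_right_mono)
    have "(\<Sum>b\<in>F \<rightarrow>\<^sub>E B. H b * ?u b) - (LINT x|M. H (obs_name G act \<beta> F x)) = (\<Sum>b\<in>F \<rightarrow>\<^sub>E B. H b * (?u b - ?m b))"
      unfolding obs_name_integral(2)[OF P B \<beta> F] by (simp add: sum_subtractf right_diff_distrib)
    also have "\<dots> \<le> (\<Sum>b\<in>F \<rightarrow>\<^sub>E B. C * \<bar>?u b - ?m b\<bar>)"
    proof (rule sum_mono)
      fix b assume b: "b \<in> F \<rightarrow>\<^sub>E B"
      have "H b * (?u b - ?m b) \<le> \<bar>H b\<bar> * \<bar>?u b - ?m b\<bar>" using abs_ge_self[of "H b * (?u b - ?m b)"] by (simp only: abs_mult)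
      also have "\<dots> \<le> C * \<bar>?u b - ?m b\<bar>" using H[OF b] by (intro mult_right_mono) auto
      finally show "H b * (?u b - ?m b) \<le> C * \<bar>?u b - ?m b\<bar>" .
    qed
    also have "\<dots> = C * (\<Sum>b\<in>F \<rightarrow>\<^sub>E B. \<bar>?u b - ?m b\<bar>)" by (simp add: sum_distrib_left)
    also have "\<dots> \<le> C * \<delta>" using C \<phi>'(2) by (intro mult_left_mono) auto
    finally show "(\<Sum>b\<in>F \<rightarrow>\<^sub>E B. H b * ?u b) \<le> (LINT x|M. H (obs_name G act \<beta> F x)) + C * \<delta>" by simp
  qed simp
  finally show ?thesis .
qed

lemma AP_equivariant:
  assumes "\<phi> \<in> AP G M act B \<beta> F \<delta> d \<sigma>" "g \<in> F" "1 \<le> d"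
  shows "real (card {j \<in> {1..d}. \<phi> j g \<noteq> \<phi> (inv_into UNIV (\<sigma> g) j) \<one>}) \<le> \<delta> * d"
proof -
  have "measure (unif d) {j \<in> {1..d}. \<phi> j g \<noteq> \<phi> (inv_into UNIV (\<sigma> g) j) \<one>} < \<delta>"
    using assms(1,2) unfolding AP_def by blast
  then show ?thesis using assms(3) by (subst (asm) measure_unif) (auto simp: field_simps)
qed

end

lemma sum_fun_apply: "(sum u I) x = (\<Sum>i\<in>I. u i x)"
  by (induction I rule: infinite_finite_induct) auto

text \<open>Test functions of finitely many coordinates. The Lipschitz bound in l1 is what survives
  in the models, where the values of \<open>f\<close> are known only up to an error that is small on
  average over the points.\<close>

definition lip_fun :: "'g set \<Rightarrow> (('g \<Rightarrow> real) \<Rightarrow> real) \<Rightarrow> real \<Rightarrow> bool" where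
  "lip_fun E h K \<longleftrightarrow> finite E \<and> 0 \<le> K \<and> (\<forall>z. 0 \<le> h z \<and> h z \<le> 1) \<and>
     (\<forall>z z'. \<bar>h z - h z'\<bar> \<le> K * (\<Sum>g\<in>E. \<bar>z g - z' g\<bar>))"

lemma lip_fun_cong: "lip_fun E h K \<Longrightarrow> (\<And>g. g \<in> E \<Longrightarrow> z g = z' g) \<Longrightarrow> h z = h z'"
  unfolding lip_fun_def by (metis (no_types, lifting) abs_le_zero_iff diff_self abs_zero eq_iff_diff_eq_0 mult_zero_right sum.neutral)

lemma lip_fun_tendsto:
  assumes h: "lip_fun E h K" and z: "\<And>g. g \<in> E \<Longrightarrow> (\<lambda>n. z n g) \<longlonglongrightarrow> w g"
  shows "(\<lambda>n. h (z n)) \<longlonglongrightarrow> h w"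
proof (rule LIM_zero_cancel, rule Lim_null_comparison)
  show "\<forall>\<^sub>F n in sequentially. norm (h (z n) - h w) \<le> K * (\<Sum>g\<in>E. \<bar>z n g - w g\<bar>)"
    using h by (simp add: lip_fun_def)
  have "(\<lambda>n. K * (\<Sum>g\<in>E. \<bar>z n g - w g\<bar>)) \<longlonglongrightarrow> K * (\<Sum>g\<in>E. \<bar>w g - w g\<bar>)"
    by (intro tendsto_intros z)
  then show "(\<lambda>n. K * (\<Sum>g\<in>E. \<bar>z n g - w g\<bar>)) \<longlonglongrightarrow> 0" by simp
qed

text \<open>The inverse of \<open>\<sigma> i g\<close> maps the points where the two inverse
  permutations agree injectively to points where \<open>\<sigma> i g\<close> and
  \<open>\<sigma> i h\<close> agree, and these are rare by the second sofic condition.\<close>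

lemma sofic_coincidence_tendsto_0:
  assumes "sofic_approximation G d \<sigma>" "g \<in> carrier G" "h \<in> carrier G" "g \<noteq> h"
  shows "(\<lambda>i. real (card {j \<in> {1..d i}. inv_into UNIV (\<sigma> i g) j = inv_into UNIV (\<sigma> i h) j}) / real (d i)) \<longlonglongrightarrow> 0"
proof (rule tendsto_sandwich[OF _ _ tendsto_const])
  let ?m = "\<lambda>i. measure (unif (d i)) {k \<in> {1..d i}. \<sigma> i g k \<noteq> \<sigma> i h k}"
  have d: "1 \<le> d i" and perm: "\<sigma> i g permutes {1..d i}" "\<sigma> i h permutes {1..d i}" for i
    using assms by (auto simp: sofic_approximation_def)
  have "?m \<longlonglongrightarrow> 1" using assms by (simp add: sofic_approximation_def)
  then have "(\<lambda>i. 1 - ?m i) \<longlonglongrightarrow> 1 - 1" by (intro tendsto_intros)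
  then show "(\<lambda>i. 1 - ?m i) \<longlonglongrightarrow> 0" by simp
  show "\<forall>\<^sub>F i in sequentially. real (card {j \<in> {1..d i}. inv_into UNIV (\<sigma> i g) j = inv_into UNIV (\<sigma> i h) j}) / real (d i) \<le> 1 - ?m i"
  proof (intro always_eventually allI)
    fix i
    let ?D = "{1..d i}" and ?p = "inv_into UNIV (\<sigma> i g)" and ?q = "inv_into UNIV (\<sigma> i h)"
    let ?X = "{j \<in> ?D. ?p j = ?q j}" and ?Y = "{k \<in> ?D. \<sigma> i g k = \<sigma> i h k}" and ?Z = "{k \<in> ?D. \<sigma> i g k \<noteq> \<sigma> i h k}"
    have pp: "?p permutes ?D" by (rule permutes_inv[OF perm(1)])
    have "card ?X = card (?p ` ?X)"
      by (rule card_image[symmetric], rule inj_on_subset[OF permutes_inj[OF pp]]) simp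
    also have "\<dots> \<le> card ?Y"
    proof (rule card_mono)
      show "?p ` ?X \<subseteq> ?Y"
      proof
        fix k assume "k \<in> ?p ` ?X"
        then obtain j where j: "j \<in> ?D" "?p j = ?q j" "k = ?p j" by auto
        have "\<sigma> i g k = j" using j(3) permutes_inverses(1)[OF perm(1)] by simp
        moreover have "\<sigma> i h k = j" using j(2,3) permutes_inverses(1)[OF perm(2)] by simp
        moreover have "k \<in> ?D" unfolding j(3) permutes_in_image[OF pp] by (rule j(1))
        ultimately show "k \<in> ?Y" by simp
      qed
    qed simp
    finally have 1: "card ?X \<le> card ?Y" .
    have "card ?Y + card ?Z = card (?Y \<union> ?Z)" by (intro card_Un_disjoint[symmetric]) auto
    also have "?Y \<union> ?Z = ?D" by auto
    finally have "real (card ?Y) + real (card ?Z) = real (d i)" by (simp flip: of_nat_add)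
    then have "real (card ?X) \<le> real (d i) - real (card ?Z)" using 1 by linarith
    moreover have "?m i = real (card ?Z) / real (d i)" using d[of i] by (intro measure_unif) auto
    ultimately show "real (card ?X) / real (d i) \<le> 1 - ?m i"
      using d[of i] by (simp add: field_simps)
  qed
  show "\<forall>\<^sub>F i in sequentially. 0 \<le> real (card {j \<in> {1..d i}. inv_into UNIV (\<sigma> i g) j = inv_into UNIV (\<sigma> i h) j}) / real (d i)"
    by simp
qed

text \<open>The Hilbert--Schmidt inner product of the 0-1 matrices of two maps counts the points
  where the maps agree. Along a sofic approximation only the diagonal \<open>g = h\<close> will
  survive.\<close>

lemma Hilbert_Schmidt_permutations:
  fixes a :: "'g \<Rightarrow> real" and \<tau> :: "'g \<Rightarrow> nat \<Rightarrow> nat"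
  assumes \<tau>: "\<And>g j. g \<in> E \<Longrightarrow> j \<in> D \<Longrightarrow> \<tau> g j \<in> D" and fin: "finite D" "finite E"
  shows "(\<Sum>k\<in>D. \<Sum>j\<in>D. (\<Sum>g\<in>E. a g * of_bool (\<tau> g j = k))\<^sup>2)
    = (\<Sum>g\<in>E. \<Sum>h\<in>E. a g * a h * real (card {j \<in> D. \<tau> g j = \<tau> h j}))"
proof -
  have "(\<Sum>k\<in>D. \<Sum>j\<in>D. (\<Sum>g\<in>E. a g * of_bool (\<tau> g j = k))\<^sup>2)
      = (\<Sum>k\<in>D. \<Sum>j\<in>D. \<Sum>g\<in>E. \<Sum>h\<in>E. a g * a h * of_bool (\<tau> g j = k \<and> \<tau> h j = k))"
    by (simp add: power2_eq_square sum_product of_bool_conj mult_ac)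
  also have "\<dots> = (\<Sum>j\<in>D. \<Sum>k\<in>D. \<Sum>g\<in>E. \<Sum>h\<in>E. a g * a h * of_bool (\<tau> g j = k \<and> \<tau> h j = k))"
    by (rule sum.swap)
  also have "\<dots> = (\<Sum>j\<in>D. \<Sum>g\<in>E. \<Sum>k\<in>D. \<Sum>h\<in>E. a g * a h * of_bool (\<tau> g j = k \<and> \<tau> h j = k))"
    by (rule sum.cong[OF refl], rule sum.swap)
  also have "\<dots> = (\<Sum>g\<in>E. \<Sum>j\<in>D. \<Sum>k\<in>D. \<Sum>h\<in>E. a g * a h * of_bool (\<tau> g j = k \<and> \<tau> h j = k))"
    by (rule sum.swap)
  also have "\<dots> = (\<Sum>g\<in>E. \<Sum>j\<in>D. \<Sum>h\<in>E. \<Sum>k\<in>D. a g * a h * of_bool (\<tau> g j = k \<and> \<tau> h j = k))"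
    by (rule sum.cong[OF refl], rule sum.cong[OF refl], rule sum.swap)
  also have "\<dots> = (\<Sum>g\<in>E. \<Sum>h\<in>E. \<Sum>j\<in>D. \<Sum>k\<in>D. a g * a h * of_bool (\<tau> g j = k \<and> \<tau> h j = k))"
    by (rule sum.cong[OF refl], rule sum.swap)
  also have "\<dots> = (\<Sum>g\<in>E. \<Sum>h\<in>E. \<Sum>j\<in>D. a g * a h * of_bool (\<tau> g j = \<tau> h j))"
  proof (intro sum.cong refl)
    fix g h j assume "g \<in> E" "j \<in> D"
    then have "\<tau> g j \<in> D" by (rule \<tau>)
    have "(\<Sum>k\<in>D. a g * a h * of_bool (\<tau> g j = k \<and> \<tau> h j = k))
        = (\<Sum>k\<in>D. if \<tau> g j = k then a g * a h * of_bool (\<tau> g j = \<tau> h j) else 0)"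
      by (intro sum.cong) (auto simp: of_bool_def)
    then show "(\<Sum>k\<in>D. a g * a h * of_bool (\<tau> g j = k \<and> \<tau> h j = k)) = a g * a h * of_bool (\<tau> g j = \<tau> h j)"
      using fin \<open>\<tau> g j \<in> D\<close> by (simp add: sum.delta')
  qed
  also have "\<dots> = (\<Sum>g\<in>E. \<Sum>h\<in>E. a g * a h * real (card {j \<in> D. \<tau> g j = \<tau> h j}))"
    using fin by (simp add: sum_distrib_left[symmetric] of_bool_def sum.If_cases Int_def)
  finally show ?thesis .
qed

context mp_action
begin

lemma AP_PiE:
  assumes "\<phi> \<in> AP G M act B \<beta> F \<delta> d \<sigma>" "j \<in> {1..d}" "g \<in> F"
  shows "\<phi> j g \<in> B" "\<phi> j \<in> F \<rightarrow>\<^sub>E B"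
  using assms unfolding AP_def by (blast dest: PiE_mem)+

lemma AP_bad_card:
  assumes \<phi>: "\<phi> \<in> AP G M act B \<beta> F \<delta> d \<sigma>" and d: "1 \<le> d" and E: "finite E" "E \<subseteq> F"
  shows "(\<Sum>j\<in>{1..d}. of_bool (\<exists>g\<in>E. \<phi> j g \<noteq> \<phi> (inv_into UNIV (\<sigma> g) j) \<one>)) \<le> real (card E) * \<delta> * d"
proof -
  have "(\<Sum>j\<in>{1..d}. of_bool (\<exists>g\<in>E. \<phi> j g \<noteq> \<phi> (inv_into UNIV (\<sigma> g) j) \<one>))
      \<le> (\<Sum>j\<in>{1..d}. \<Sum>g\<in>E. of_bool (\<phi> j g \<noteq> \<phi> (inv_into UNIV (\<sigma> g) j) \<one>) :: real)"
  proof (rule sum_mono)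
    fix j
    show "of_bool (\<exists>g\<in>E. \<phi> j g \<noteq> \<phi> (inv_into UNIV (\<sigma> g) j) \<one>)
        \<le> (\<Sum>g\<in>E. of_bool (\<phi> j g \<noteq> \<phi> (inv_into UNIV (\<sigma> g) j) \<one>) :: real)"
    proof (cases "\<exists>g\<in>E. \<phi> j g \<noteq> \<phi> (inv_into UNIV (\<sigma> g) j) \<one>")
      case True
      then obtain g where g: "g \<in> E" "\<phi> j g \<noteq> \<phi> (inv_into UNIV (\<sigma> g) j) \<one>" by blast
      have "of_bool (\<phi> j g \<noteq> \<phi> (inv_into UNIV (\<sigma> g) j) \<one>) \<le> (\<Sum>g\<in>E. of_bool (\<phi> j g \<noteq> \<phi> (inv_into UNIV (\<sigma> g) j) \<one>) :: real)"
        using g(1) E by (intro member_le_sum) auto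
      then show ?thesis using True g(2) by simp
    next
      case False
      then show ?thesis by (simp only: of_bool_eq) (simp add: sum_nonneg)
    qed
  qed
  also have "\<dots> = (\<Sum>g\<in>E. real (card {j \<in> {1..d}. \<phi> j g \<noteq> \<phi> (inv_into UNIV (\<sigma> g) j) \<one>}))"
    by (subst sum.swap) (simp add: of_bool_def sum.If_cases Int_def)
  also have "\<dots> \<le> (\<Sum>g\<in>E. \<delta> * d)"
    using E d by (intro sum_mono AP_equivariant[OF \<phi>]) auto
  finally show ?thesis by (simp add: mult.assoc)
qed

text \<open>Where the name at \<open>j\<close> agrees with the values at the translated points, the
  defect is a function of the name, and \<open>AP_average\<close> compares its mean with an
  integral. The few other points are handled by crude bounds on coefficients and values, which is
  harmless because their proportion is of order \<open>\<delta>\<close>.\<close>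

lemma AP_fixed:
  fixes c :: "nat \<Rightarrow> real"
  assumes P: "prob_space M" and B: "finite B" and \<beta>: "\<beta> \<in> M \<rightarrow>\<^sub>M count_space B"
    and F: "finite F" "F \<subseteq> carrier G" "\<one> \<in> F"
    and d: "1 \<le> d" and \<phi>: "\<phi> \<in> AP G M act B \<beta> F \<delta> d \<sigma>"
    and c: "\<And>b. b \<in> B \<Longrightarrow> \<bar>c b\<bar> \<le> K" and E: "E \<subseteq> F"
    and perm: "\<And>g. g \<in> E \<Longrightarrow> \<sigma> g permutes {1..d}"
  shows "(\<Sum>j\<in>{1..d}. (c (\<phi> j \<one>) - (\<Sum>g\<in>E. a g * c (\<phi> (inv_into UNIV (\<sigma> g) j) \<one>)))\<^sup>2)
    \<le> (2 * (LINT x|M. (c (obs_name G act \<beta> F x \<one>) - (\<Sum>g\<in>E. a g * c (obs_name G act \<beta> F x g)))\<^sup>2)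
       + (2 * (K + (\<Sum>g\<in>E. \<bar>a g\<bar>) * K)\<^sup>2 + 2 * ((\<Sum>g\<in>E. \<bar>a g\<bar>) * (2 * K))\<^sup>2 * real (card E)) * \<delta>) * d"
proof -
  let ?D = "{1..d}" and ?a = "\<Sum>g\<in>E. \<bar>a g\<bar>"
  let ?\<tau> = "\<lambda>g. inv_into UNIV (\<sigma> g)"
  have finE: "finite E" using E F(1) by (rule finite_subset)
  have \<tau>: "?\<tau> g j \<in> ?D" if "g \<in> E" "j \<in> ?D" for g j
    using permutes_inv[OF perm[OF that(1)]] that(2) by (simp only: permutes_in_image)
  define H where "H b = (c (b \<one>) - (\<Sum>g\<in>E. a g * c (b g)))\<^sup>2" for b
  have "b0 \<in> B \<Longrightarrow> 0 \<le> K" for b0 using c[of b0] by linarith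
  then have K: "0 \<le> K" using AP_PiE(1)[OF \<phi>, of 1 \<one>] d F by auto
  have Hb: "\<bar>H b\<bar> \<le> (K + ?a * K)\<^sup>2" if b: "b \<in> F \<rightarrow>\<^sub>E B" for b
  proof -
    have "\<bar>c (b \<one>) - (\<Sum>g\<in>E. a g * c (b g))\<bar> \<le> \<bar>c (b \<one>)\<bar> + \<bar>\<Sum>g\<in>E. a g * c (b g)\<bar>" by (rule abs_triangle_ineq4)
    also have "\<bar>\<Sum>g\<in>E. a g * c (b g)\<bar> \<le> (\<Sum>g\<in>E. \<bar>a g * c (b g)\<bar>)" by (rule sum_abs)
    also have "\<dots> \<le> (\<Sum>g\<in>E. \<bar>a g\<bar> * K)"
      using b E by (intro sum_mono) (auto simp: abs_mult intro!: mult_left_mono c)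
    also have "\<bar>c (b \<one>)\<bar> \<le> K" using b F by (intro c) auto
    finally have "\<bar>c (b \<one>) - (\<Sum>g\<in>E. a g * c (b g))\<bar> \<le> K + ?a * K" by (simp add: sum_distrib_right)
    then have "\<bar>c (b \<one>) - (\<Sum>g\<in>E. a g * c (b g))\<bar>\<^sup>2 \<le> (K + ?a * K)\<^sup>2" by (rule power_mono) simp
    then show ?thesis by (simp add: H_def)
  qed
  have avg: "(\<Sum>j\<in>?D. H (\<phi> j)) \<le> ((LINT x|M. H (obs_name G act \<beta> F x)) + (K + ?a * K)\<^sup>2 * \<delta>) * d"
    using F by (intro AP_average[OF P B \<beta> _ _ _ d \<phi> Hb]) auto
  define bad where "bad j = (of_bool (\<exists>g\<in>E. \<phi> j g \<noteq> \<phi> (?\<tau> g j) \<one>) :: real)" for j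
  have pt: "(c (\<phi> j \<one>) - (\<Sum>g\<in>E. a g * c (\<phi> (?\<tau> g j) \<one>)))\<^sup>2 \<le> 2 * H (\<phi> j) + 2 * (?a * (2 * K))\<^sup>2 * bad j"
    if j: "j \<in> ?D" for j
  proof -
    define u where "u = c (\<phi> j \<one>) - (\<Sum>g\<in>E. a g * c (\<phi> j g))"
    define v where "v = (\<Sum>g\<in>E. a g * (c (\<phi> j g) - c (\<phi> (?\<tau> g j) \<one>)))"
    have eq: "c (\<phi> j \<one>) - (\<Sum>g\<in>E. a g * c (\<phi> (?\<tau> g j) \<one>)) = u + v"
      by (simp add: u_def v_def right_diff_distrib sum_subtractf)
    have "v\<^sup>2 \<le> (?a * (2 * K))\<^sup>2 * bad j"
    proof (cases "\<exists>g\<in>E. \<phi> j g \<noteq> \<phi> (?\<tau> g j) \<one>")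
      case True
      have "\<bar>v\<bar> \<le> (\<Sum>g\<in>E. \<bar>a g * (c (\<phi> j g) - c (\<phi> (?\<tau> g j) \<one>))\<bar>)" unfolding v_def by (rule sum_abs)
      also have "\<dots> \<le> (\<Sum>g\<in>E. \<bar>a g\<bar> * (2 * K))"
      proof (rule sum_mono)
        fix g assume g: "g \<in> E"
        have "\<bar>c (\<phi> j g)\<bar> \<le> K" "\<bar>c (\<phi> (?\<tau> g j) \<one>)\<bar> \<le> K"
          using g j E F \<tau> by (auto intro!: c AP_PiE(1)[OF \<phi>])
        then have "\<bar>c (\<phi> j g) - c (\<phi> (?\<tau> g j) \<one>)\<bar> \<le> 2 * K" by linarith
        then show "\<bar>a g * (c (\<phi> j g) - c (\<phi> (?\<tau> g j) \<one>))\<bar> \<le> \<bar>a g\<bar> * (2 * K)"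
          unfolding abs_mult by (rule mult_left_mono) simp
      qed
      also have "\<dots> = ?a * (2 * K)" by (simp add: sum_distrib_right)
      finally have "\<bar>v\<bar>\<^sup>2 \<le> (?a * (2 * K))\<^sup>2" by (rule power_mono) simp
      then show ?thesis using True by (simp add: bad_def)
    next
      case False
      then have "v = 0" unfolding v_def by (intro sum.neutral) auto
      then show ?thesis by (simp add: bad_def)
    qed
    moreover have "(u + v)\<^sup>2 \<le> 2 * u\<^sup>2 + 2 * v\<^sup>2"
      using zero_le_power2[of "u - v"] by (simp add: power2_diff power2_sum)
    ultimately show ?thesis unfolding eq by (simp add: H_def u_def)
  qed
  have "(\<Sum>j\<in>?D. (c (\<phi> j \<one>) - (\<Sum>g\<in>E. a g * c (\<phi> (?\<tau> g j) \<one>)))\<^sup>2)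
      \<le> (\<Sum>j\<in>?D. 2 * H (\<phi> j) + 2 * (?a * (2 * K))\<^sup>2 * bad j)"
    by (intro sum_mono pt)
  also have "\<dots> = 2 * (\<Sum>j\<in>?D. H (\<phi> j)) + 2 * (?a * (2 * K))\<^sup>2 * (\<Sum>j\<in>?D. bad j)"
    by (simp add: sum.distrib sum_distrib_left)
  also have "\<dots> \<le> 2 * (((LINT x|M. H (obs_name G act \<beta> F x)) + (K + ?a * K)\<^sup>2 * \<delta>) * d)
      + 2 * (?a * (2 * K))\<^sup>2 * (real (card E) * \<delta> * d)"
    unfolding bad_def using avg AP_bad_card[OF \<phi> d finE E] by (intro add_mono mult_left_mono) auto
  also have "\<dots> = (2 * (LINT x|M. H (obs_name G act \<beta> F x))
       + (2 * (K + ?a * K)\<^sup>2 + 2 * (?a * (2 * K))\<^sup>2 * real (card E)) * \<delta>) * d"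
    by (simp add: algebra_simps)
  finally show ?thesis by (simp only: H_def)
qed

text \<open>The same splitting as in \<open>AP_fixed\<close>; at the exceptional points the
  difference is at most 1, since indicator and \<open>h\<close> both take values between 0 and
  1.\<close>

lemma AP_lip:
  fixes c :: "nat \<Rightarrow> real"
  assumes P: "prob_space M" and B: "finite B" and \<beta>: "\<beta> \<in> M \<rightarrow>\<^sub>M count_space B"
    and F: "finite F" "F \<subseteq> carrier G" "\<one> \<in> F"
    and d: "1 \<le> d" and \<phi>: "\<phi> \<in> AP G M act B \<beta> F \<delta> d \<sigma>" and E: "E \<subseteq> F" and h: "lip_fun E h L"
  shows "(\<Sum>j\<in>{1..d}. \<bar>of_bool (\<pi> (\<phi> j \<one>) = s) - h (\<lambda>g. c (\<phi> (inv_into UNIV (\<sigma> g) j) \<one>))\<bar>)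
    \<le> ((LINT x|M. \<bar>of_bool (\<pi> (obs_name G act \<beta> F x \<one>) = s) - h (\<lambda>g. c (obs_name G act \<beta> F x g))\<bar>)
       + (1 + real (card E)) * \<delta>) * d"
proof -
  let ?D = "{1..d}"
  let ?\<tau> = "\<lambda>g. inv_into UNIV (\<sigma> g)"
  have finE: "finite E" using E F(1) by (rule finite_subset)
  have h01: "0 \<le> h z" "h z \<le> 1" for z using h by (auto simp: lip_fun_def)
  define H where "H b = \<bar>of_bool (\<pi> (b \<one>) = s) - h (\<lambda>g. c (b g))\<bar>" for b
  have Hb: "\<bar>H b\<bar> \<le> 1" for b
    using h01[of "\<lambda>g. c (b g)"] by (auto simp: H_def abs_le_iff of_bool_def)
  have avg: "(\<Sum>j\<in>?D. H (\<phi> j)) \<le> ((LINT x|M. H (obs_name G act \<beta> F x)) + 1 * \<delta>) * d"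
    using F by (intro AP_average[OF P B \<beta> _ _ _ d \<phi> Hb]) auto
  define bad where "bad j = (of_bool (\<exists>g\<in>E. \<phi> j g \<noteq> \<phi> (?\<tau> g j) \<one>) :: real)" for j
  have pt: "\<bar>of_bool (\<pi> (\<phi> j \<one>) = s) - h (\<lambda>g. c (\<phi> (?\<tau> g j) \<one>))\<bar> \<le> H (\<phi> j) + bad j" for j
  proof (cases "\<exists>g\<in>E. \<phi> j g \<noteq> \<phi> (?\<tau> g j) \<one>")
    case True
    have "\<bar>of_bool (\<pi> (\<phi> j \<one>) = s) - h (\<lambda>g. c (\<phi> (?\<tau> g j) \<one>))\<bar> \<le> 1"
      using h01[of "\<lambda>g. c (\<phi> (?\<tau> g j) \<one>)"] by (auto simp: abs_le_iff of_bool_def)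
    moreover have "0 \<le> H (\<phi> j)" by (simp add: H_def)
    ultimately show ?thesis using True by (simp add: bad_def)
  next
    case False
    then have "h (\<lambda>g. c (\<phi> (?\<tau> g j) \<one>)) = h (\<lambda>g. c (\<phi> j g))"
      by (intro lip_fun_cong[OF h]) auto
    then show ?thesis by (simp add: H_def bad_def)
  qed
  have "(\<Sum>j\<in>?D. \<bar>of_bool (\<pi> (\<phi> j \<one>) = s) - h (\<lambda>g. c (\<phi> (?\<tau> g j) \<one>))\<bar>) \<le> (\<Sum>j\<in>?D. H (\<phi> j) + bad j)"
    by (intro sum_mono pt)
  also have "\<dots> \<le> ((LINT x|M. H (obs_name G act \<beta> F x)) + 1 * \<delta>) * d + real (card E) * \<delta> * d"
    unfolding sum.distrib bad_def using avg AP_bad_card[OF \<phi> d finE E] by (intro add_mono)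
  also have "\<dots> = ((LINT x|M. H (obs_name G act \<beta> F x)) + (1 + real (card E)) * \<delta>) * d"
    by (simp add: algebra_simps)
  finally show ?thesis by (simp only: H_def)
qed

end

section \<open>Vanishing of sofic entropy\<close>

context mp_action
begin

text \<open>The observable \<open>\<alpha>\<close> is refined by its join with a rounding of \<open>f\<close>. In every microstate the rounded
  values are almost fixed by the matrix of \<open>a\<close> and determine \<open>\<alpha>\<close> up to a small error through the
  Lipschitz functions \<open>h\<close>, so \<open>covering_count\<close> applies with \<open>\<eta>\<close> the rounded values.\<close>

lemma sofic_entropy_le_0:
  assumes P: "prob_space M" and sof: "sofic_approximation G d \<sigma>" and f: "f \<in> l2 M"
    and gen: "\<And>S e. \<lbrakk>S \<in> sets M; e > 0\<rbrakk> \<Longrightarrow> \<exists>E h L. lip_fun E h L \<and> E \<subseteq> carrier G \<and>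
        (LINT x|M. \<bar>indicator S x - h (\<lambda>g. translate g f x)\<bar>) < e"
    and sing: "\<And>e. e > 0 \<Longrightarrow> \<exists>E a. finite E \<and> E \<subseteq> carrier G \<and>
        l2_ip M (f - (\<Sum>g\<in>E. a g *\<^sub>R translate g f)) (f - (\<Sum>g\<in>E. a g *\<^sub>R translate g f)) < e \<and>
        (\<Sum>g\<in>E. (a g)\<^sup>2) < e"
  shows "sofic_entropy G d \<sigma> M act \<le> 0"
proof -
  interpret prob_space M by fact
  have f_meas [measurable]: "f \<in> borel_measurable M" using f by (rule l2_measurable)
  have d1: "1 \<le> d i" for i using sof by (simp add: sofic_approximation_def)
  have perm: "\<sigma> i g permutes {1..d i}" if "g \<in> carrier G" for i g
    using sof that by (simp add: sofic_approximation_def)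
  have main: "\<exists>B \<beta> \<pi> F \<delta>. finite_observable M B \<beta> \<and> refines_via M A \<alpha> B \<beta> \<pi> \<and>
      finite F \<and> F \<subseteq> carrier G \<and> \<one> \<in> F \<and> 0 < \<delta> \<and> entropy_local G d \<sigma> M act B \<beta> \<pi> F \<delta> \<le> ereal \<epsilon>"
    if obs: "finite_observable M A \<alpha>" and \<epsilon>: "\<epsilon> > 0" for A \<alpha> and \<epsilon> :: real
  proof -
    have A: "finite A" and \<alpha>: "\<alpha> \<in> M \<rightarrow>\<^sub>M count_space A" using obs by (auto simp: finite_observable_def)
    \<comment> \<open>The two units of slack absorb the rounding of \<open>f\<close> and the
      sampling error of a microstate.\<close>
    define R where "R = sqrt ((LINT x|M. (f x)\<^sup>2) + 2)"
    have If: "0 \<le> (LINT x|M. (f x)\<^sup>2)" by simp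
    then have "0 < (LINT x|M. (f x)\<^sup>2) + 2" by linarith
    then have R: "R > 0" "R\<^sup>2 = (LINT x|M. (f x)\<^sup>2) + 2" by (auto simp: R_def)
    show ?thesis
    proof (rule covering_count[OF \<epsilon> R(1) A])
    fix L \<theta> :: real
    assume L: "L > 0" and \<theta>: "\<theta> > 0" and
      cov: "\<And>(d::nat) (B :: nat \<Rightarrow> nat \<Rightarrow> real) N (\<eta> :: (nat \<Rightarrow> nat) \<Rightarrow> nat \<Rightarrow> real) (\<kappa> :: real) (\<kappa>' :: real).
      \<lbrakk>1 \<le> d; N \<subseteq> {1..d} \<rightarrow>\<^sub>E A; \<kappa> > 0;
       (\<Sum>k\<in>{1..d}. \<Sum>j\<in>{1..d}. (B j k)\<^sup>2) \<le> \<kappa> * d;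
       \<And>\<nu>. \<nu> \<in> N \<Longrightarrow> (\<Sum>j\<in>{1..d}. (\<eta> \<nu> j)\<^sup>2) \<le> R\<^sup>2 * d;
       \<And>\<nu>. \<nu> \<in> N \<Longrightarrow> (\<Sum>j\<in>{1..d}. (\<eta> \<nu> j - (\<Sum>k\<in>{1..d}. B j k * \<eta> \<nu> k))\<^sup>2) \<le> \<kappa>' * d;
       \<And>\<nu> \<nu>'. \<lbrakk>\<nu> \<in> N; \<nu>' \<in> N; (\<Sum>j\<in>{1..d}. (\<eta> \<nu> j - \<eta> \<nu>' j)\<^sup>2) \<le> (8 * \<kappa>' + 16 * L\<^sup>2 * \<kappa>) * d\<rbrakk>
         \<Longrightarrow> real (card {j \<in> {1..d}. \<nu> j \<noteq> \<nu>' j}) \<le> \<theta> * d\<rbrakk>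
      \<Longrightarrow> real (card N) \<le> exp (\<epsilon> * d)"
    define N0 where "N0 = real (card A) + 1"
    have N0: "N0 > 0" by (simp add: N0_def)
    \<comment> \<open>Half of the budget \<open>\<theta>\<close> goes to approximating indicators:
      two microstates, fewer than \<open>N0\<close> letters, and for each letter an integral error
      and a sampling error of \<open>\<theta> / (8 * N0)\<close>.\<close>
    define e0 where "e0 = \<theta> / (8 * N0)"
    have e0: "e0 > 0" using \<theta> N0 by (simp add: e0_def)
    define S where "S a = {x \<in> space M. \<alpha> x = a}" for a
    have S: "S a \<in> sets M" for a
    proof -
      have "\<alpha> -` ({a} \<inter> A) \<inter> space M \<in> sets M" by (rule measurable_sets[OF \<alpha>]) simp
      moreover have "\<alpha> -` ({a} \<inter> A) \<inter> space M = S a"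
        using measurable_space[OF \<alpha>] by (auto simp: S_def)
      ultimately show ?thesis by simp
    qed
    have "\<forall>a. \<exists>E h L. lip_fun E h L \<and> E \<subseteq> carrier G \<and> (LINT x|M. \<bar>indicator (S a) x - h (\<lambda>g. translate g f x)\<bar>) < e0"
      by (intro allI gen[OF S e0])
    then obtain E h Lc where Eh: "\<forall>a. lip_fun (E a) (h a) (Lc a) \<and> E a \<subseteq> carrier G \<and>
        (LINT x|M. \<bar>indicator (S a) x - h a (\<lambda>g. translate g f x)\<bar>) < e0"
      unfolding choice_iff by (elim exE) (rule that)
    have lip: "lip_fun (E a) (h a) (Lc a)" and E: "E a \<subseteq> carrier G" "finite (E a)" and Lc: "0 \<le> Lc a"
      and app: "(LINT x|M. \<bar>indicator (S a) x - h a (\<lambda>g. translate g f x)\<bar>) < e0" for a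
      using Eh by (auto simp: lip_fun_def)
    define Lsum where "Lsum = (\<Sum>a\<in>A. Lc a * card (E a))"
    have Lsum: "0 \<le> Lsum" unfolding Lsum_def using Lc by (intro sum_nonneg) auto
    \<comment> \<open>The other half of \<open>\<theta>\<close> is for the Lipschitz functions at
      two vectors of mean distance \<open>\<tau>\<close>. By Cauchy--Schwarz this distance follows
      from a mean square of \<open>\<tau>^2\<close>, which determines \<open>\<kappa>\<close> and
      \<open>\<kappa>'\<close>.\<close>
    define \<tau> where "\<tau> = \<theta> / (2 * (Lsum + 1))"
    have \<tau>: "\<tau> > 0" using \<theta> Lsum by (simp add: \<tau>_def)
    have \<tau>L: "Lsum * \<tau> \<le> \<theta> / 2" using \<theta> Lsum by (simp add: \<tau>_def field_simps)
    define \<kappa>' where "\<kappa>' = \<tau>\<^sup>2 / 16"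
    define \<kappa> where "\<kappa> = \<tau>\<^sup>2 / (32 * (L\<^sup>2 + 1))"
    have L1: "0 < L\<^sup>2 + 1" using zero_le_power2[of L] by linarith
    have \<kappa>: "\<kappa>' > 0" "\<kappa> > 0" using \<tau> L1 by (auto simp: \<kappa>'_def \<kappa>_def)
    have "16 * L\<^sup>2 * \<kappa> = \<tau>\<^sup>2 / 2 * (L\<^sup>2 / (L\<^sup>2 + 1))" using L1 by (simp add: \<kappa>_def field_simps)
    also have "\<dots> \<le> \<tau>\<^sup>2 / 2 * 1" using L1 by (intro mult_left_mono) (auto simp: divide_le_eq)
    finally have \<kappa>\<tau>: "8 * \<kappa>' + 16 * L\<^sup>2 * \<kappa> \<le> \<tau>\<^sup>2" by (simp add: \<kappa>'_def)
    \<comment> \<open>One bound for both properties of \<open>a\<close>: \<open>\<kappa>\<close> for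
      the Hilbert--Schmidt norm, and \<open>\<kappa>' / 8\<close> for the defect of
      \<open>f\<close>, which enters \<open>AP_fixed\<close> with a factor 2 next to the sampling
      error.\<close>
    define e3 where "e3 = min \<kappa> (\<kappa>' / 8)"
    have "e3 > 0" using \<kappa> by (simp add: e3_def)
    then obtain Es a where Es: "finite Es" "Es \<subseteq> carrier G"
      and fix3: "l2_ip M (f - (\<Sum>g\<in>Es. a g *\<^sub>R translate g f)) (f - (\<Sum>g\<in>Es. a g *\<^sub>R translate g f)) < e3"
      and a2: "(\<Sum>g\<in>Es. (a g)\<^sup>2) < e3"
      using sing[of e3] by blast
    define F where "F = insert \<one> (Es \<union> (\<Union>a\<in>A. E a))"
    have F: "finite F" "F \<subseteq> carrier G" "\<one> \<in> F" "F \<noteq> {}" and EsF: "Es \<subseteq> F" and EF: "\<And>a. a \<in> A \<Longrightarrow> E a \<subseteq> F"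
      using Es E A by (auto simp: F_def)
    \<comment> \<open>\<open>q n\<close> rounds \<open>f\<close> with increasing precision.
      \<open>E\<close>, \<open>Es\<close> and hence the window \<open>F\<close> were found for
      \<open>f\<close> itself and do not depend on \<open>n\<close>, so the integrals for
      \<open>q n\<close> converge to those for \<open>f\<close>, and a large \<open>n\<close>
      inherits all strict inequalities.\<close>
    define q where "q n x = round_value (Suc n) (clamp_round (Suc n) (f x))" for n x
    define c where "c n b = round_value (Suc n) (snd (prod_decode b))" for n b
    define \<beta> where "\<beta> n x = prod_encode (\<alpha> x, clamp_round (Suc n) (f x))" for n x
    define B where "B n = prod_encode ` (A \<times> {..2 * (Suc n * Suc n)})" for n
    define \<pi> where "\<pi> b = fst (prod_decode b)" for b
    have B: "finite (B n)" for n using A by (simp add: B_def)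
    have \<beta>: "\<beta> n \<in> M \<rightarrow>\<^sub>M count_space (B n)" for n
    proof (rule measurable_count_space_eq2[OF B, THEN iffD2], intro conjI ballI)
      show "\<beta> n \<in> space M \<rightarrow> B n"
        using measurable_space[OF \<alpha>] clamp_round_le by (auto simp: \<beta>_def B_def simp del: mult_Suc mult_Suc_right)
      fix b assume "b \<in> B n"
      have cl: "(\<lambda>x. clamp_round (Suc n) (f x)) \<in> M \<rightarrow>\<^sub>M count_space UNIV" by measurable
      have "S (\<pi> b) \<inter> ((\<lambda>x. clamp_round (Suc n) (f x)) -` {snd (prod_decode b)} \<inter> space M) \<in> sets M"
        using measurable_sets[OF cl, of "{snd (prod_decode b)}"] S by auto
      moreover have "\<beta> n -` {b} \<inter> space M = S (\<pi> b) \<inter> ((\<lambda>x. clamp_round (Suc n) (f x)) -` {snd (prod_decode b)} \<inter> space M)"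
      proof (intro equalityI subsetI)
        fix x assume "x \<in> \<beta> n -` {b} \<inter> space M"
        then show "x \<in> S (\<pi> b) \<inter> ((\<lambda>x. clamp_round (Suc n) (f x)) -` {snd (prod_decode b)} \<inter> space M)"
          by (auto simp: \<beta>_def \<pi>_def S_def)
      next
        fix x assume "x \<in> S (\<pi> b) \<inter> ((\<lambda>x. clamp_round (Suc n) (f x)) -` {snd (prod_decode b)} \<inter> space M)"
        then have "x \<in> space M" "\<alpha> x = fst (prod_decode b)" "clamp_round (Suc n) (f x) = snd (prod_decode b)"
          by (auto simp: S_def \<pi>_def)
        then show "x \<in> \<beta> n -` {b} \<inter> space M" by (simp add: \<beta>_def)
      qed
      ultimately show "\<beta> n -` {b} \<inter> space M \<in> sets M" by simp
    qed
    have c\<beta>: "c n (\<beta> n x) = q n x" for n x by (simp add: c_def \<beta>_def q_def)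
    have \<pi>\<beta>: "\<pi> (\<beta> n x) = \<alpha> x" for n x by (simp add: \<pi>_def \<beta>_def)
    have c_le: "\<bar>c n b\<bar> \<le> real (Suc n)" if "b \<in> B n" for n b
      using that unfolding c_def B_def by (intro round_value_bound) auto
    let ?o = "\<lambda>n x. obs_name G act (\<beta> n) F x"
    have o_c: "c n (?o n x g) = q n (act (inv g) x)" if "g \<in> F" for n x g
      using that by (simp add: obs_name_def c\<beta>)
    have o_\<pi>: "\<pi> (?o n x \<one>) = \<alpha> x" if "x \<in> space M" for n x
      using that F by (simp add: obs_name_def \<pi>\<beta> act_one)
    have q_lim: "(\<lambda>n. q n x) \<longlonglongrightarrow> f x" for x unfolding q_def by (rule round_tendsto)
    have q_le: "\<bar>q n x\<bar> \<le> \<bar>f x\<bar> + 1" for n x unfolding q_def by (rule round_abs_le) simp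
    have q_meas [measurable]: "q n \<in> borel_measurable M" for n
    proof -
      have "(\<lambda>x. clamp_round (Suc n) (f x)) \<in> M \<rightarrow>\<^sub>M count_space UNIV" by measurable
      then have "(\<lambda>x. round_value (Suc n) (clamp_round (Suc n) (f x))) \<in> borel_measurable M"
        by (rule measurable_compose) simp
      then show ?thesis by (simp add: q_def[abs_def])
    qed
    define F1 where "F1 x = \<bar>f x\<bar> + 1" for x
    have F1: "F1 \<in> l2 M"
    proof -
      have "(\<lambda>x. \<bar>f x\<bar>) \<in> l2 M" using f by (auto simp: l2_def)
      from subspace_add[OF subspace_l2 this l2_const[OF finite_measure_axioms, of 1]]
      show ?thesis by (simp add: F1_def[abs_def] plus_fun_def)
    qed
    \<comment> \<open>\<open>W\<close> dominates the defect of every \<open>q n\<close> and is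
      square-integrable, so dominated convergence applies to the squared defects.\<close>
    define W where "W = F1 + (\<Sum>g\<in>Es. \<bar>a g\<bar> *\<^sub>R translate g F1)"
    have W: "W \<in> l2 M"
      unfolding W_def using Es F1
      by (intro subspace_add[OF subspace_l2] subspace_sum[OF subspace_l2] subspace_scale[OF subspace_l2] translate_l2) auto
    have W_eq: "W x = F1 x + (\<Sum>g\<in>Es. \<bar>a g\<bar> * F1 (act (inv g) x))" for x
      by (simp add: W_def sum_fun_apply scaleR_fun_def translate_def)
    have act_meas: "(\<lambda>x. u (act (inv g) x)) \<in> borel_measurable M" if "u \<in> borel_measurable M" "g \<in> carrier G" for u :: "'x \<Rightarrow> real" and g
      using that by (intro measurable_compose[OF act_measurable]) auto
    have comb_meas: "(\<lambda>x. (u x - (\<Sum>g\<in>Es. a g * u (act (inv g) x)))\<^sup>2) \<in> borel_measurable M"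
      if u: "u \<in> borel_measurable M" for u
    proof -
      have "(\<lambda>x. a g * u (act (inv g) x)) \<in> borel_measurable M" if "g \<in> Es" for g
        using act_meas[OF u, of g] that Es by auto
      then have "(\<lambda>x. \<Sum>g\<in>Es. a g * u (act (inv g) x)) \<in> borel_measurable M"
        by (rule borel_measurable_sum)
      from borel_measurable_power[OF borel_measurable_diff[OF u this]] show ?thesis .
    qed
    have lim1: "(\<lambda>n. LINT x|M. (q n x)\<^sup>2) \<longlonglongrightarrow> (LINT x|M. (f x)\<^sup>2)"
    proof (rule integral_dominated_convergence[where w = "\<lambda>x. (F1 x)\<^sup>2"])
      show "integrable M (\<lambda>x. (F1 x)\<^sup>2)" using F1 by (simp add: l2_def)
      show "AE x in M. (\<lambda>n. (q n x)\<^sup>2) \<longlonglongrightarrow> (f x)\<^sup>2" by (intro AE_I2 tendsto_intros q_lim)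
      have "\<bar>q n x\<bar>\<^sup>2 \<le> (F1 x)\<^sup>2" for n x unfolding F1_def by (intro power_mono q_le) auto
      then show "AE x in M. norm ((q n x)\<^sup>2) \<le> (F1 x)\<^sup>2" for n by simp
    qed measurable
    have lim2: "(\<lambda>n. LINT x|M. (q n x - (\<Sum>g\<in>Es. a g * q n (act (inv g) x)))\<^sup>2)
        \<longlonglongrightarrow> (LINT x|M. (f x - (\<Sum>g\<in>Es. a g * f (act (inv g) x)))\<^sup>2)"
    proof (rule integral_dominated_convergence[where w = "\<lambda>x. (W x)\<^sup>2"])
      show "integrable M (\<lambda>x. (W x)\<^sup>2)" using W by (simp add: l2_def)
      show "AE x in M. (\<lambda>n. (q n x - (\<Sum>g\<in>Es. a g * q n (act (inv g) x)))\<^sup>2) \<longlonglongrightarrow> (f x - (\<Sum>g\<in>Es. a g * f (act (inv g) x)))\<^sup>2"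
        by (intro AE_I2 tendsto_intros q_lim)
      show "(\<lambda>x. (f x - (\<Sum>g\<in>Es. a g * f (act (inv g) x)))\<^sup>2) \<in> borel_measurable M"
        by (rule comb_meas[OF f_meas])
      show "(\<lambda>x. (q n x - (\<Sum>g\<in>Es. a g * q n (act (inv g) x)))\<^sup>2) \<in> borel_measurable M" for n
        by (rule comb_meas[OF q_meas])
      have "\<bar>q n x - (\<Sum>g\<in>Es. a g * q n (act (inv g) x))\<bar> \<le> W x" for n x
      proof -
        have "\<bar>q n x - (\<Sum>g\<in>Es. a g * q n (act (inv g) x))\<bar> \<le> \<bar>q n x\<bar> + \<bar>\<Sum>g\<in>Es. a g * q n (act (inv g) x)\<bar>" by (rule abs_triangle_ineq4)
        also have "\<bar>\<Sum>g\<in>Es. a g * q n (act (inv g) x)\<bar> \<le> (\<Sum>g\<in>Es. \<bar>a g * q n (act (inv g) x)\<bar>)" by (rule sum_abs)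
        also have "\<dots> \<le> (\<Sum>g\<in>Es. \<bar>a g\<bar> * F1 (act (inv g) x))"
          unfolding abs_mult F1_def by (intro sum_mono mult_left_mono q_le) auto
        also have "\<bar>q n x\<bar> \<le> F1 x" unfolding F1_def by (rule q_le)
        finally show ?thesis by (simp add: W_eq)
      qed
      then have "\<bar>q n x - (\<Sum>g\<in>Es. a g * q n (act (inv g) x))\<bar>\<^sup>2 \<le> (W x)\<^sup>2" for n x by (intro power_mono) auto
      then show "AE x in M. norm ((q n x - (\<Sum>g\<in>Es. a g * q n (act (inv g) x)))\<^sup>2) \<le> (W x)\<^sup>2" for n by simp
    qed
    have lim2_val: "(LINT x|M. (f x - (\<Sum>g\<in>Es. a g * f (act (inv g) x)))\<^sup>2) < e3"
    proof -
      have "(f - (\<Sum>g\<in>Es. a g *\<^sub>R translate g f)) x = f x - (\<Sum>g\<in>Es. a g * f (act (inv g) x))" for x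
        by (simp add: sum_fun_apply scaleR_fun_def translate_def)
      then show ?thesis using fix3 unfolding l2_ip_def by (simp only: power2_eq_square)
    qed
    have h_obs: "h b (\<lambda>g. c n (?o n x g)) = h b (\<lambda>g. q n (act (inv g) x))" if "b \<in> A" for b n x
      using EF[OF that] o_c by (intro lip_fun_cong[OF lip]) auto
    \<comment> \<open>Measurability comes from the name taking finitely many values; for
      \<open>f\<close> in place of \<open>q n\<close> it follows by passing to the limit.\<close>
    have h_meas: "(\<lambda>x. h b (\<lambda>g. q n (act (inv g) x))) \<in> borel_measurable M" if "b \<in> A" for b n
    proof -
      have "integrable M (\<lambda>x. h b (\<lambda>g. c n (?o n x g)))"
        using obs_name_integral(1)[OF P B \<beta> F(1,2,4), where H = "\<lambda>y. h b (\<lambda>g. c n (y g))"] .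
      then show ?thesis unfolding h_obs[OF that] by (rule borel_measurable_integrable)
    qed
    have h_lim: "(\<lambda>n. h b (\<lambda>g. q n (act (inv g) x))) \<longlonglongrightarrow> h b (\<lambda>g. translate g f x)" for b x
      unfolding translate_def by (rule lip_fun_tendsto[OF lip]) (rule q_lim)
    have lim3: "(\<lambda>n. LINT x|M. \<bar>indicator (S b) x - h b (\<lambda>g. q n (act (inv g) x))\<bar>)
        \<longlonglongrightarrow> (LINT x|M. \<bar>indicator (S b) x - h b (\<lambda>g. translate g f x)\<bar>)" if b: "b \<in> A" for b
    proof (rule integral_dominated_convergence[where w = "\<lambda>x. 1"])
      have ind: "(indicator (S b) :: 'x \<Rightarrow> real) \<in> borel_measurable M" using S by simp
      show "(\<lambda>x. \<bar>indicator (S b) x - h b (\<lambda>g. q n (act (inv g) x))\<bar>) \<in> borel_measurable M" for n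
        using ind h_meas[OF b] by (intro borel_measurable_abs borel_measurable_diff)
      have "(\<lambda>x. h b (\<lambda>g. translate g f x)) \<in> borel_measurable M"
        by (rule borel_measurable_LIMSEQ_real[OF h_lim h_meas[OF b]])
      then show "(\<lambda>x. \<bar>indicator (S b) x - h b (\<lambda>g. translate g f x)\<bar>) \<in> borel_measurable M"
        using ind by (intro borel_measurable_abs borel_measurable_diff)
      show "AE x in M. (\<lambda>n. \<bar>indicator (S b) x - h b (\<lambda>g. q n (act (inv g) x))\<bar>) \<longlonglongrightarrow> \<bar>indicator (S b) x - h b (\<lambda>g. translate g f x)\<bar>"
        by (intro AE_I2 tendsto_intros h_lim)
      have "\<bar>indicator (S b) x - h b z\<bar> \<le> 1" for x z
      proof -
        have "0 \<le> h b z" "h b z \<le> 1" using lip[of b] by (auto simp: lip_fun_def)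
        then show ?thesis by (cases "x \<in> S b") auto
      qed
      then show "AE x in M. norm \<bar>indicator (S b) x - h b (\<lambda>g. q n (act (inv g) x))\<bar> \<le> 1" for n by simp
    qed simp
    have "\<forall>\<^sub>F n in sequentially. (LINT x|M. (q n x)\<^sup>2) < (LINT x|M. (f x)\<^sup>2) + 1"
      by (rule order_tendstoD(2)[OF lim1]) simp
    moreover have "\<forall>\<^sub>F n in sequentially. (LINT x|M. (q n x - (\<Sum>g\<in>Es. a g * q n (act (inv g) x)))\<^sup>2) < e3"
      by (rule order_tendstoD(2)[OF lim2 lim2_val])
    moreover have "\<forall>\<^sub>F n in sequentially. \<forall>b\<in>A. (LINT x|M. \<bar>indicator (S b) x - h b (\<lambda>g. q n (act (inv g) x))\<bar>) < e0"
      using A by (intro eventually_ball_finite ballI order_tendstoD(2)[OF lim3 app])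
    ultimately have "\<forall>\<^sub>F n in sequentially. (LINT x|M. (q n x)\<^sup>2) < (LINT x|M. (f x)\<^sup>2) + 1 \<and>
        (LINT x|M. (q n x - (\<Sum>g\<in>Es. a g * q n (act (inv g) x)))\<^sup>2) < e3 \<and>
        (\<forall>b\<in>A. (LINT x|M. \<bar>indicator (S b) x - h b (\<lambda>g. q n (act (inv g) x))\<bar>) < e0)"
      by eventually_elim simp
    then obtain n where n1: "(LINT x|M. (q n x)\<^sup>2) < (LINT x|M. (f x)\<^sup>2) + 1"
      and n2: "(LINT x|M. (q n x - (\<Sum>g\<in>Es. a g * q n (act (inv g) x)))\<^sup>2) < e3"
      and n3: "\<And>b. b \<in> A \<Longrightarrow> (LINT x|M. \<bar>indicator (S b) x - h b (\<lambda>g. q n (act (inv g) x))\<bar>) < e0"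
      by (auto simp: eventually_sequentially)
    define K where "K = real (Suc n)"
    have K: "K > 0" by (simp add: K_def)
    define a1 where "a1 = (\<Sum>g\<in>Es. \<bar>a g\<bar>)"
    define C2 where "C2 = 2 * (K + a1 * K)\<^sup>2 + 2 * (a1 * (2 * K))\<^sup>2 * real (card Es)"
    have C2: "0 \<le> C2" by (simp add: C2_def)
    \<comment> \<open>Three demands: the norm bound \<open>R\<close>, half of
      \<open>\<kappa>'\<close> in the defect, and the sampling share of the indicator errors. It
      comes after \<open>n\<close>, because the values of \<open>q n\<close> are bounded only by
      \<open>K\<close>.\<close>
    define \<delta> where "\<delta> = min (1 / K\<^sup>2) (min (\<kappa>' / (2 * (C2 + 1))) (\<theta> / (8 * N0 * (1 + real (card F)))))"
    have \<delta>: "\<delta> > 0" using K C2 \<kappa> \<theta> N0 by (auto simp: \<delta>_def intro!: divide_pos_pos mult_pos_pos)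
    have \<delta>1: "K\<^sup>2 * \<delta> \<le> 1"
    proof -
      have "K\<^sup>2 * \<delta> \<le> K\<^sup>2 * (1 / K\<^sup>2)" by (intro mult_left_mono) (auto simp: \<delta>_def)
      then show ?thesis using K by simp
    qed
    have \<delta>2: "C2 * \<delta> \<le> \<kappa>' / 2"
    proof -
      have "C2 * \<delta> \<le> (C2 + 1) * (\<kappa>' / (2 * (C2 + 1)))"
        using C2 \<delta> by (intro mult_mono) (auto simp: \<delta>_def)
      also have "\<dots> = \<kappa>' / 2" using C2 by (simp add: field_simps)
      finally show ?thesis .
    qed
    have \<delta>3: "(1 + real (card (E b))) * \<delta> \<le> \<theta> / (8 * N0)" if "b \<in> A" for b
    proof -
      have "card (E b) \<le> card F" using EF[OF that] F(1) by (intro card_mono)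
      then have "(1 + real (card (E b))) * \<delta> \<le> (1 + real (card F)) * (\<theta> / (8 * N0 * (1 + real (card F))))"
        using \<delta> by (intro mult_mono) (auto simp: \<delta>_def)
      moreover have "y * (t / (m * y)) = t / m" if "y \<noteq> 0" for y t m :: real using that by simp
      then have "(1 + real (card F)) * (\<theta> / (8 * N0 * (1 + real (card F)))) = \<theta> / (8 * N0)"
        by (metis add_nonneg_eq_0_iff of_nat_0_le_iff zero_le_one zero_neq_one)
      ultimately show ?thesis by (simp only:)
    qed
    have obsB: "finite_observable M (B n) (\<beta> n)" using B \<beta> by (simp add: finite_observable_def)
    have ref: "refines_via M A \<alpha> (B n) (\<beta> n) \<pi>"
      by (auto simp: refines_via_def B_def \<pi>_def \<beta>_def)
    have \<pi>A: "\<pi> b \<in> A" if "b \<in> B n" for b using that by (auto simp: B_def \<pi>_def)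
    have count: "real (card ((\<lambda>\<phi>. \<lambda>j\<in>{1..d i}. \<pi> (\<phi> j \<one>)) ` AP G M act (B n) (\<beta> n) F \<delta> (d i) (\<sigma> i))) \<le> exp (\<epsilon> * d i)"
      if HS: "(\<Sum>g\<in>Es. \<Sum>h\<in>Es. a g * a h * (real (card {j \<in> {1..d i}. inv_into UNIV (\<sigma> i g) j = inv_into UNIV (\<sigma> i h) j}) / real (d i))) < \<kappa>"
      for i
    proof -
      let ?D = "{1..d i}" and ?\<tau> = "\<lambda>g. inv_into UNIV (\<sigma> i g)"
      let ?AP = "AP G M act (B n) (\<beta> n) F \<delta> (d i) (\<sigma> i)"
      define N where "N = (\<lambda>\<phi>. \<lambda>j\<in>?D. \<pi> (\<phi> j \<one>)) ` ?AP"
      \<comment> \<open>A word may come from several microstates; one of them is fixed, and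
        \<open>\<eta>\<close> is read off from it. The words are counted, not the
        microstates.\<close>
      define \<Phi> where "\<Phi> \<nu> = (SOME \<phi>. \<phi> \<in> ?AP \<and> \<nu> = (\<lambda>j\<in>?D. \<pi> (\<phi> j \<one>)))" for \<nu>
      have \<Phi>: "\<Phi> \<nu> \<in> ?AP" "\<nu> = (\<lambda>j\<in>?D. \<pi> (\<Phi> \<nu> j \<one>))" if "\<nu> \<in> N" for \<nu>
      proof -
        have "\<exists>\<phi>. \<phi> \<in> ?AP \<and> \<nu> = (\<lambda>j\<in>?D. \<pi> (\<phi> j \<one>))" using that by (auto simp: N_def)
        from someI_ex[OF this] show "\<Phi> \<nu> \<in> ?AP" "\<nu> = (\<lambda>j\<in>?D. \<pi> (\<Phi> \<nu> j \<one>))" by (auto simp: \<Phi>_def)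
      qed
      have \<tau>perm: "?\<tau> g permutes ?D" if "g \<in> carrier G" for g by (rule permutes_inv[OF perm[OF that]])
      have \<tau>D: "?\<tau> g j \<in> ?D" if "g \<in> carrier G" "j \<in> ?D" for g j
        unfolding permutes_in_image[OF \<tau>perm[OF that(1)]] by (rule that(2))
      define \<eta> where "\<eta> \<nu> j = c n (\<Phi> \<nu> j \<one>)" for \<nu> j
      \<comment> \<open>The matrix by which \<open>a\<close> acts in the model: row \<open>j\<close>
        collects the values at the points \<open>inv_into UNIV (\<sigma> i g) j\<close>.\<close>
      define Bm where "Bm j k = (\<Sum>g\<in>Es. a g * of_bool (?\<tau> g j = k))" for j k
      have Bm\<eta>: "(\<Sum>k\<in>?D. Bm j k * y k) = (\<Sum>g\<in>Es. a g * y (?\<tau> g j))" if "j \<in> ?D" for j y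
      proof -
        have "(\<Sum>k\<in>?D. Bm j k * y k) = (\<Sum>g\<in>Es. \<Sum>k\<in>?D. a g * of_bool (?\<tau> g j = k) * y k)"
          unfolding Bm_def sum_distrib_right by (rule sum.swap)
        also have "\<dots> = (\<Sum>g\<in>Es. a g * y (?\<tau> g j))"
        proof (rule sum.cong[OF refl])
          fix g assume g: "g \<in> Es"
          then have "?\<tau> g j \<in> ?D" using Es that by (intro \<tau>D) auto
          have "(\<Sum>k\<in>?D. a g * of_bool (?\<tau> g j = k) * y k) = (\<Sum>k\<in>?D. if ?\<tau> g j = k then a g * y k else 0)"
            by (intro sum.cong) auto
          then show "(\<Sum>k\<in>?D. a g * of_bool (?\<tau> g j = k) * y k) = a g * y (?\<tau> g j)"
            using \<open>?\<tau> g j \<in> ?D\<close> by (simp add: sum.delta')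
        qed
        finally show ?thesis .
      qed
      have di: "0 < real (d i)" using d1[of i] by simp
      have "real (card N) \<le> exp (\<epsilon> * d i)"
      proof (rule cov[of "d i" N \<kappa> Bm \<eta> \<kappa>'])
        show "1 \<le> d i" by (rule d1)
        show "\<kappa> > 0" by (rule \<kappa>)
        show "N \<subseteq> ?D \<rightarrow>\<^sub>E A"
        proof
          fix \<nu> assume \<nu>: "\<nu> \<in> N"
          have "\<pi> (\<Phi> \<nu> j \<one>) \<in> A" if "j \<in> ?D" for j
            using AP_PiE(1)[OF \<Phi>(1)[OF \<nu>] that F(3)] by (rule \<pi>A)
          then show "\<nu> \<in> ?D \<rightarrow>\<^sub>E A" by (subst \<Phi>(2)[OF \<nu>]) auto
        qed
        have "(\<Sum>k\<in>?D. \<Sum>j\<in>?D. (Bm j k)\<^sup>2) = (\<Sum>g\<in>Es. \<Sum>h\<in>Es. a g * a h * real (card {j \<in> ?D. ?\<tau> g j = ?\<tau> h j}))"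
          unfolding Bm_def using Es by (intro Hilbert_Schmidt_permutations \<tau>D) auto
        also have "\<dots> = (\<Sum>g\<in>Es. \<Sum>h\<in>Es. a g * a h * (real (card {j \<in> ?D. ?\<tau> g j = ?\<tau> h j}) / real (d i))) * d i"
          unfolding sum_distrib_right using di by (intro sum.cong refl) simp
        also have "\<dots> \<le> \<kappa> * d i" using HS by (intro mult_right_mono) auto
        finally show "(\<Sum>k\<in>?D. \<Sum>j\<in>?D. (Bm j k)\<^sup>2) \<le> \<kappa> * d i" .
      next
        fix \<nu> assume \<nu>: "\<nu> \<in> N"
        have "(\<Sum>j\<in>?D. (\<eta> \<nu> j)\<^sup>2) \<le> ((LINT x|M. (c n (?o n x \<one>))\<^sup>2) + K\<^sup>2 * \<delta>) * d i"
          unfolding \<eta>_def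
        proof (rule AP_average[OF P B \<beta> F(1,2,4) d1 \<Phi>(1)[OF \<nu>], where H = "\<lambda>b. (c n (b \<one>))\<^sup>2"])
          fix b assume "b \<in> F \<rightarrow>\<^sub>E B n"
          then have "\<bar>c n (b \<one>)\<bar> \<le> K" unfolding K_def using F(3) by (intro c_le) auto
          then have "\<bar>c n (b \<one>)\<bar>\<^sup>2 \<le> K\<^sup>2" by (rule power_mono) simp
          then show "\<bar>(c n (b \<one>))\<^sup>2\<bar> \<le> K\<^sup>2" by simp
        qed
        also have "(LINT x|M. (c n (?o n x \<one>))\<^sup>2) = (LINT x|M. (q n x)\<^sup>2)"
          using F(3) by (intro Bochner_Integration.integral_cong refl) (simp add: o_c act_one)
        also have "((LINT x|M. (q n x)\<^sup>2) + K\<^sup>2 * \<delta>) * d i \<le> R\<^sup>2 * d i"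
          using n1 \<delta>1 R(2) by (intro mult_right_mono) auto
        finally show "(\<Sum>j\<in>?D. (\<eta> \<nu> j)\<^sup>2) \<le> R\<^sup>2 * d i" .
        have "(\<Sum>j\<in>?D. (\<eta> \<nu> j - (\<Sum>k\<in>?D. Bm j k * \<eta> \<nu> k))\<^sup>2) = (\<Sum>j\<in>?D. (c n (\<Phi> \<nu> j \<one>) - (\<Sum>g\<in>Es. a g * c n (\<Phi> \<nu> (?\<tau> g j) \<one>)))\<^sup>2)"
          by (intro sum.cong refl) (simp only: Bm\<eta>, simp only: \<eta>_def)
        also have "\<dots> \<le> (2 * (LINT x|M. (c n (?o n x \<one>) - (\<Sum>g\<in>Es. a g * c n (?o n x g)))\<^sup>2)
            + (2 * (K + a1 * K)\<^sup>2 + 2 * (a1 * (2 * K))\<^sup>2 * real (card Es)) * \<delta>) * d i"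
          unfolding a1_def K_def using Es
          by (intro AP_fixed[OF P B \<beta> F(1,2,3) d1 \<Phi>(1)[OF \<nu>] c_le EsF perm]) auto
        also have "(LINT x|M. (c n (?o n x \<one>) - (\<Sum>g\<in>Es. a g * c n (?o n x g)))\<^sup>2) = (LINT x|M. (q n x - (\<Sum>g\<in>Es. a g * q n (act (inv g) x)))\<^sup>2)"
        proof (intro Bochner_Integration.integral_cong refl)
          fix x assume x: "x \<in> space M"
          have "c n (?o n x \<one>) = q n x" using x F(3) by (simp add: o_c act_one)
          moreover have "(\<Sum>g\<in>Es. a g * c n (?o n x g)) = (\<Sum>g\<in>Es. a g * q n (act (inv g) x))"
            using EsF by (intro sum.cong refl) (auto simp: o_c)
          ultimately show "(c n (?o n x \<one>) - (\<Sum>g\<in>Es. a g * c n (?o n x g)))\<^sup>2 = (q n x - (\<Sum>g\<in>Es. a g * q n (act (inv g) x)))\<^sup>2" by simp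
        qed
        also have "(2 * (LINT x|M. (q n x - (\<Sum>g\<in>Es. a g * q n (act (inv g) x)))\<^sup>2)
            + (2 * (K + a1 * K)\<^sup>2 + 2 * (a1 * (2 * K))\<^sup>2 * real (card Es)) * \<delta>) * d i \<le> \<kappa>' * d i"
        proof (rule mult_right_mono)
          have "(LINT x|M. (q n x - (\<Sum>g\<in>Es. a g * q n (act (inv g) x)))\<^sup>2) \<le> \<kappa>' / 8" using n2 by (simp add: e3_def)
          then show "2 * (LINT x|M. (q n x - (\<Sum>g\<in>Es. a g * q n (act (inv g) x)))\<^sup>2)
            + (2 * (K + a1 * K)\<^sup>2 + 2 * (a1 * (2 * K))\<^sup>2 * real (card Es)) * \<delta> \<le> \<kappa>'"
            unfolding C2_def[symmetric] using \<delta>2 \<kappa>(1) by argo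
        qed simp
        finally show "(\<Sum>j\<in>?D. (\<eta> \<nu> j - (\<Sum>k\<in>?D. Bm j k * \<eta> \<nu> k))\<^sup>2) \<le> \<kappa>' * d i" .
      next
        fix \<nu> \<nu>' assume \<nu>: "\<nu> \<in> N" "\<nu>' \<in> N"
          and close: "(\<Sum>j\<in>?D. (\<eta> \<nu> j - \<eta> \<nu>' j)\<^sup>2) \<le> (8 * \<kappa>' + 16 * L\<^sup>2 * \<kappa>) * d i"
        have l1: "(\<Sum>j\<in>?D. \<bar>\<eta> \<nu> j - \<eta> \<nu>' j\<bar>) \<le> \<tau> * d i"
        proof (rule power2_le_imp_le)
          have "(\<Sum>j\<in>?D. \<bar>\<eta> \<nu> j - \<eta> \<nu>' j\<bar> * 1)\<^sup>2 \<le> (\<Sum>j\<in>?D. \<bar>\<eta> \<nu> j - \<eta> \<nu>' j\<bar>\<^sup>2) * (\<Sum>j\<in>?D. 1\<^sup>2)"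
            by (rule Cauchy_Schwarz_ineq_sum)
          also have "\<dots> = (\<Sum>j\<in>?D. (\<eta> \<nu> j - \<eta> \<nu>' j)\<^sup>2) * d i" by simp
          also have "\<dots> \<le> ((8 * \<kappa>' + 16 * L\<^sup>2 * \<kappa>) * d i) * d i" using close by (intro mult_right_mono) auto
          also have "\<dots> \<le> (\<tau>\<^sup>2 * d i) * d i" using \<kappa>\<tau> by (intro mult_right_mono) auto
          finally show "(\<Sum>j\<in>?D. \<bar>\<eta> \<nu> j - \<eta> \<nu>' j\<bar>)\<^sup>2 \<le> (\<tau> * d i)\<^sup>2" by (simp add: power2_eq_square mult_ac)
        qed (use \<tau> in auto)
        define X where "X \<nu> b j = of_bool (\<pi> (\<Phi> \<nu> j \<one>) = b) - h b (\<lambda>g. \<eta> \<nu> (?\<tau> g j))" for \<nu> b j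
        have X: "(\<Sum>j\<in>?D. \<bar>X \<nu> b j\<bar>) \<le> \<theta> / (4 * N0) * d i" if b: "b \<in> A" and \<nu>: "\<nu> \<in> N" for b \<nu>
        proof -
          have "(\<Sum>j\<in>?D. \<bar>X \<nu> b j\<bar>) \<le> ((LINT x|M. \<bar>of_bool (\<pi> (?o n x \<one>) = b) - h b (\<lambda>g. c n (?o n x g))\<bar>)
              + (1 + real (card (E b))) * \<delta>) * d i"
            unfolding X_def \<eta>_def by (rule AP_lip[OF P B \<beta> F(1,2,3) d1 \<Phi>(1)[OF \<nu>] EF[OF b] lip])
          also have "(LINT x|M. \<bar>of_bool (\<pi> (?o n x \<one>) = b) - h b (\<lambda>g. c n (?o n x g))\<bar>)
              = (LINT x|M. \<bar>indicator (S b) x - h b (\<lambda>g. q n (act (inv g) x))\<bar>)"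
          proof (intro Bochner_Integration.integral_cong refl)
            fix x assume x: "x \<in> space M"
            have "of_bool (\<pi> (?o n x \<one>) = b) = (indicator (S b) x :: real)"
              using x by (simp add: o_\<pi> S_def indicator_def)
            then show "\<bar>of_bool (\<pi> (?o n x \<one>) = b) - h b (\<lambda>g. c n (?o n x g))\<bar> = \<bar>indicator (S b) x - h b (\<lambda>g. q n (act (inv g) x))\<bar>"
              by (simp only: h_obs[OF b])
          qed
          also have "((LINT x|M. \<bar>indicator (S b) x - h b (\<lambda>g. q n (act (inv g) x))\<bar>) + (1 + real (card (E b))) * \<delta>) * d i
              \<le> (\<theta> / (8 * N0) + \<theta> / (8 * N0)) * d i"
            using n3[OF b] \<delta>3[OF b] by (intro mult_right_mono add_mono) (auto simp: e0_def)
          also have "\<dots> = \<theta> / (4 * N0) * d i" by simp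
          finally show ?thesis .
        qed
        have Y: "(\<Sum>j\<in>?D. \<bar>h b (\<lambda>g. \<eta> \<nu> (?\<tau> g j)) - h b (\<lambda>g. \<eta> \<nu>' (?\<tau> g j))\<bar>) \<le> Lc b * card (E b) * (\<tau> * d i)" if b: "b \<in> A" for b
        proof -
          have "(\<Sum>j\<in>?D. \<bar>h b (\<lambda>g. \<eta> \<nu> (?\<tau> g j)) - h b (\<lambda>g. \<eta> \<nu>' (?\<tau> g j))\<bar>)
              \<le> (\<Sum>j\<in>?D. Lc b * (\<Sum>g\<in>E b. \<bar>\<eta> \<nu> (?\<tau> g j) - \<eta> \<nu>' (?\<tau> g j)\<bar>))"
            using lip[of b] unfolding lip_fun_def by (intro sum_mono) blast
          also have "\<dots> = Lc b * (\<Sum>g\<in>E b. \<Sum>j\<in>?D. \<bar>\<eta> \<nu> (?\<tau> g j) - \<eta> \<nu>' (?\<tau> g j)\<bar>)"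
            unfolding sum_distrib_left[symmetric] by (subst sum.swap) (rule refl)
          also have "(\<Sum>g\<in>E b. \<Sum>j\<in>?D. \<bar>\<eta> \<nu> (?\<tau> g j) - \<eta> \<nu>' (?\<tau> g j)\<bar>) = (\<Sum>g\<in>E b. \<Sum>j\<in>?D. \<bar>\<eta> \<nu> j - \<eta> \<nu>' j\<bar>)"
          proof (rule sum.cong[OF refl])
            fix g assume "g \<in> E b"
            then have "g \<in> carrier G" using E by auto
            from permutes_imp_bij[OF \<tau>perm[OF this]]
            show "(\<Sum>j\<in>?D. \<bar>\<eta> \<nu> (?\<tau> g j) - \<eta> \<nu>' (?\<tau> g j)\<bar>) = (\<Sum>j\<in>?D. \<bar>\<eta> \<nu> j - \<eta> \<nu>' j\<bar>)"
              by (rule sum.reindex_bij_betw)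
          qed
          also have "Lc b * (\<Sum>g\<in>E b. \<Sum>j\<in>?D. \<bar>\<eta> \<nu> j - \<eta> \<nu>' j\<bar>) \<le> Lc b * (\<Sum>g\<in>E b. \<tau> * d i)"
            by (intro mult_left_mono sum_mono l1 Lc)
          finally show ?thesis by (simp add: mult.assoc)
        qed
        have "real (card {j \<in> ?D. \<nu> j \<noteq> \<nu>' j}) = (\<Sum>j\<in>?D. of_bool (\<nu> j \<noteq> \<nu>' j))"
          by (simp add: of_bool_def sum.If_cases Int_def)
        also have "\<dots> \<le> (\<Sum>j\<in>?D. \<Sum>b\<in>A. \<bar>X \<nu> b j\<bar> + \<bar>X \<nu>' b j\<bar> + \<bar>h b (\<lambda>g. \<eta> \<nu> (?\<tau> g j)) - h b (\<lambda>g. \<eta> \<nu>' (?\<tau> g j))\<bar>)"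
        proof (rule sum_mono)
          fix j assume j: "j \<in> ?D"
          let ?T = "\<lambda>b. \<bar>X \<nu> b j\<bar> + \<bar>X \<nu>' b j\<bar> + \<bar>h b (\<lambda>g. \<eta> \<nu> (?\<tau> g j)) - h b (\<lambda>g. \<eta> \<nu>' (?\<tau> g j))\<bar>"
          have T0: "0 \<le> ?T b" for b by simp
          have \<nu>j: "\<nu> j = \<pi> (\<Phi> \<nu> j \<one>)" "\<nu>' j = \<pi> (\<Phi> \<nu>' j \<one>)"
            using fun_cong[OF \<Phi>(2)[OF \<nu>(1)], of j] fun_cong[OF \<Phi>(2)[OF \<nu>(2)], of j] j by auto
          show "of_bool (\<nu> j \<noteq> \<nu>' j) \<le> (\<Sum>b\<in>A. ?T b)"
          proof (cases "\<nu> j = \<nu>' j")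
            case True
            then show ?thesis using T0 by (simp add: sum_nonneg)
          next
            case False
            \<comment> \<open>A disagreement at \<open>j\<close> is detected by the letter
              \<open>\<nu> j\<close>: its indicator is 1 for one word and 0 for the other.\<close>
            have bA: "\<nu> j \<in> A" unfolding \<nu>j(1) using AP_PiE(1)[OF \<Phi>(1)[OF \<nu>(1)] j F(3)] by (rule \<pi>A)
            have "1 = \<bar>(of_bool (\<pi> (\<Phi> \<nu> j \<one>) = \<nu> j) - of_bool (\<pi> (\<Phi> \<nu>' j \<one>) = \<nu> j) :: real)\<bar>"
              using False \<nu>j by auto
            also have "\<dots> = \<bar>X \<nu> (\<nu> j) j - X \<nu>' (\<nu> j) j + (h (\<nu> j) (\<lambda>g. \<eta> \<nu> (?\<tau> g j)) - h (\<nu> j) (\<lambda>g. \<eta> \<nu>' (?\<tau> g j)))\<bar>"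
              by (simp add: X_def)
            also have "\<dots> \<le> ?T (\<nu> j)" by (smt (verit))
            also have "\<dots> \<le> (\<Sum>b\<in>A. ?T b)" using bA A T0 by (intro member_le_sum) auto
            finally show ?thesis using False by simp
          qed
        qed
        also have "\<dots> = (\<Sum>b\<in>A. (\<Sum>j\<in>?D. \<bar>X \<nu> b j\<bar>) + (\<Sum>j\<in>?D. \<bar>X \<nu>' b j\<bar>) + (\<Sum>j\<in>?D. \<bar>h b (\<lambda>g. \<eta> \<nu> (?\<tau> g j)) - h b (\<lambda>g. \<eta> \<nu>' (?\<tau> g j))\<bar>))"
          by (subst sum.swap) (simp only: sum.distrib)
        also have "\<dots> \<le> (\<Sum>b\<in>A. \<theta> / (4 * N0) * d i + \<theta> / (4 * N0) * d i + Lc b * card (E b) * (\<tau> * d i))"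
          using X \<nu> Y by (intro sum_mono add_mono) auto
        also have "\<dots> = (real (card A) / N0 * (\<theta> / 2) + Lsum * \<tau>) * d i"
        proof -
          have "(\<Sum>b\<in>A. Lc b * card (E b) * (\<tau> * d i)) = Lsum * (\<tau> * d i)"
            unfolding Lsum_def sum_distrib_right ..
          then show ?thesis by (simp add: sum.distrib algebra_simps)
        qed
        also have "\<dots> \<le> (1 * (\<theta> / 2) + \<theta> / 2) * d i"
          using \<tau>L \<theta> N0 by (intro mult_right_mono add_mono) (auto simp: N0_def)
        finally show "real (card {j \<in> ?D. \<nu> j \<noteq> \<nu>' j}) \<le> \<theta> * d i" by simp
      qed
      then show ?thesis by (simp only: N_def)
    qed
    \<comment> \<open>In the limit distinct group elements have no coincidences, so the normalised
      squared Hilbert--Schmidt norm of the matrix tends to the squared l2-norm of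
      \<open>a\<close>.\<close>
    have "(\<lambda>i. \<Sum>g\<in>Es. \<Sum>h\<in>Es. a g * a h * (real (card {j \<in> {1..d i}. inv_into UNIV (\<sigma> i g) j = inv_into UNIV (\<sigma> i h) j}) / real (d i)))
        \<longlonglongrightarrow> (\<Sum>g\<in>Es. \<Sum>h\<in>Es. a g * a h * of_bool (g = h))"
    proof (intro tendsto_sum tendsto_mult_left)
      fix g h assume gh: "g \<in> Es" "h \<in> Es"
      show "(\<lambda>i. real (card {j \<in> {1..d i}. inv_into UNIV (\<sigma> i g) j = inv_into UNIV (\<sigma> i h) j}) / real (d i)) \<longlonglongrightarrow> of_bool (g = h)"
      proof (cases "g = h")
        case True
        have "real (d i) \<noteq> 0" for i using d1[of i] by simp
        then have "real (card {j \<in> {1..d i}. inv_into UNIV (\<sigma> i g) j = inv_into UNIV (\<sigma> i h) j}) / real (d i) = 1" for i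
          using True by (simp del: atLeastAtMost_iff)
        then have eq1: "(\<lambda>i. real (card {j \<in> {1..d i}. inv_into UNIV (\<sigma> i g) j = inv_into UNIV (\<sigma> i h) j}) / real (d i)) = (\<lambda>_. 1)"
          by (rule ext)
        show ?thesis unfolding eq1 using True by simp
      next
        case False
        then show ?thesis using sofic_coincidence_tendsto_0[OF sof, of g h] gh Es by auto
      qed
    qed
    moreover have "(\<Sum>g\<in>Es. \<Sum>h\<in>Es. a g * a h * of_bool (g = h)) < \<kappa>"
    proof -
      have "(\<Sum>g\<in>Es. \<Sum>h\<in>Es. a g * a h * of_bool (g = h)) = (\<Sum>g\<in>Es. \<Sum>h\<in>Es. if g = h then (a g)\<^sup>2 else 0)"
        by (intro sum.cong refl) (auto simp: power2_eq_square)
      also have "\<dots> = (\<Sum>g\<in>Es. (a g)\<^sup>2)" using Es by (simp add: sum.delta')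
      finally show ?thesis using a2 by (simp add: e3_def)
    qed
    ultimately have ev: "\<forall>\<^sub>F i in sequentially. (\<Sum>g\<in>Es. \<Sum>h\<in>Es. a g * a h * (real (card {j \<in> {1..d i}. inv_into UNIV (\<sigma> i g) j = inv_into UNIV (\<sigma> i h) j}) / real (d i))) < \<kappa>"
      by (rule order_tendstoD(2))
    have "entropy_local G d \<sigma> M act (B n) (\<beta> n) \<pi> F \<delta> \<le> ereal \<epsilon>"
      unfolding entropy_local_def
    proof (rule Limsup_bounded)
      show "\<forall>\<^sub>F i in sequentially. ereal (1 / real (d i)) *
          log_card ((\<lambda>\<phi>. \<lambda>j\<in>{1..d i}. \<pi> (\<phi> j \<one>)) ` AP G M act (B n) (\<beta> n) F \<delta> (d i) (\<sigma> i)) \<le> ereal \<epsilon>"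
        using ev
      proof eventually_elim
        case (elim i)
        let ?N = "(\<lambda>\<phi>. \<lambda>j\<in>{1..d i}. \<pi> (\<phi> j \<one>)) ` AP G M act (B n) (\<beta> n) F \<delta> (d i) (\<sigma> i)"
        have di: "0 < real (d i)" using d1[of i] by simp
        show "ereal (1 / real (d i)) * log_card ?N \<le> ereal \<epsilon>"
        proof (cases "card ?N = 0")
          case True
          then show ?thesis using di by (simp add: log_card_def)
        next
          case False
          then have pos: "0 < real (card ?N)" by simp
          have "ln (real (card ?N)) \<le> ln (exp (\<epsilon> * d i))" using pos count[OF elim] by (intro ln_mono) auto
          then have "1 / real (d i) * ln (real (card ?N)) \<le> \<epsilon>" using di by (simp add: field_simps)
          moreover have "ereal (1 / real (d i)) * log_card ?N = ereal (1 / real (d i) * ln (real (card ?N)))"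
            using False by (simp add: log_card_def)
          ultimately show ?thesis by simp
        qed
      qed
    qed
    then show ?thesis using obsB ref F \<delta>
      by (intro exI[of _ "B n"] exI[of _ "\<beta> n"] exI[of _ \<pi>] exI[of _ F] exI[of _ \<delta>] conjI)
    qed
  qed
  show ?thesis
    unfolding sofic_entropy_def
  proof (rule SUP_least, clarify)
    fix A \<alpha> assume obs: "finite_observable M A \<alpha>"
    show "(INF (B, \<beta>, \<pi>)\<in>{(B, \<beta>, \<pi>). finite_observable M B \<beta> \<and> refines_via M A \<alpha> B \<beta> \<pi>}. entropy_rel G d \<sigma> M act B \<beta> \<pi>) \<le> 0"
    proof (rule ereal_le_epsilon2)
      fix \<epsilon> :: real assume "0 < \<epsilon>"
      then obtain B \<beta> \<pi> F \<delta> where *: "finite_observable M B \<beta>" "refines_via M A \<alpha> B \<beta> \<pi>"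
        "finite F" "F \<subseteq> carrier G" "\<one> \<in> F" "0 < \<delta>" "entropy_local G d \<sigma> M act B \<beta> \<pi> F \<delta> \<le> ereal \<epsilon>"
        using main[OF obs] by blast
      have "(INF (B, \<beta>, \<pi>)\<in>{(B, \<beta>, \<pi>). finite_observable M B \<beta> \<and> refines_via M A \<alpha> B \<beta> \<pi>}. entropy_rel G d \<sigma> M act B \<beta> \<pi>)
          \<le> entropy_rel G d \<sigma> M act B \<beta> \<pi>"
        using * by (intro INF_lower2[of "(B, \<beta>, \<pi>)"]) auto
      also have "\<dots> \<le> entropy_local G d \<sigma> M act B \<beta> \<pi> F \<delta>"
        unfolding entropy_rel_def using * by (intro INF_lower2[of "(F, \<delta>)"]) auto
      also have "\<dots> \<le> 0 + ereal \<epsilon>" using * by simp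
      finally show "(INF (B, \<beta>, \<pi>)\<in>{(B, \<beta>, \<pi>). finite_observable M B \<beta> \<and> refines_via M A \<alpha> B \<beta> \<pi>}. entropy_rel G d \<sigma> M act B \<beta> \<pi>) \<le> 0 + ereal \<epsilon>" .
    qed
  qed
qed

end

section \<open>Approximable sets and the factor generated by one function\<close>

section \<open>Approximation by Lipschitz functions of translates\<close>

lemma lip_fun_const: "0 \<le> r \<Longrightarrow> r \<le> 1 \<Longrightarrow> lip_fun {} (\<lambda>_. r) 0"
  by (simp add: lip_fun_def)

lemma lip_fun_compl: "lip_fun E h L \<Longrightarrow> lip_fun E (\<lambda>z. 1 - h z) L"
  by (auto simp: lip_fun_def abs_minus_commute)

lemma lip_fun_mono:
  assumes "lip_fun E h L" "finite E'" "E \<subseteq> E'" "L \<le> L'"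
  shows "lip_fun E' h L'"
proof -
  have "\<bar>h z - h z'\<bar> \<le> L' * (\<Sum>g\<in>E'. \<bar>z g - z' g\<bar>)" for z z'
  proof -
    have "\<bar>h z - h z'\<bar> \<le> L * (\<Sum>g\<in>E. \<bar>z g - z' g\<bar>)" using assms by (simp add: lip_fun_def)
    also have "\<dots> \<le> L' * (\<Sum>g\<in>E'. \<bar>z g - z' g\<bar>)"
      using assms by (intro mult_mono sum_mono2 sum_nonneg) (auto simp: lip_fun_def)
    finally show ?thesis .
  qed
  then show ?thesis using assms by (auto simp: lip_fun_def)
qed

lemma lip_fun_max:
  assumes "lip_fun E h L" "lip_fun E' h' L'"
  shows "lip_fun (E \<union> E') (\<lambda>z. max (h z) (h' z)) (max L L')"
proof -
  have 1: "lip_fun (E \<union> E') h (max L L')" "lip_fun (E \<union> E') h' (max L L')"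
  proof -
    have "finite (E \<union> E')" using assms by (simp add: lip_fun_def)
    then show "lip_fun (E \<union> E') h (max L L')" "lip_fun (E \<union> E') h' (max L L')"
      using lip_fun_mono[OF assms(1), of "E \<union> E'" "max L L'"] lip_fun_mono[OF assms(2), of "E \<union> E'" "max L L'"] by auto
  qed
  have "\<bar>max (h z) (h' z) - max (h z') (h' z')\<bar> \<le> max \<bar>h z - h z'\<bar> \<bar>h' z - h' z'\<bar>" for z z'
    by (auto simp: max_def abs_if)
  moreover have "max \<bar>h z - h z'\<bar> \<bar>h' z - h' z'\<bar> \<le> max L L' * (\<Sum>g\<in>E \<union> E'. \<bar>z g - z' g\<bar>)" for z z'
    using 1 by (simp add: lip_fun_def)
  ultimately have "\<bar>max (h z) (h' z) - max (h z') (h' z')\<bar> \<le> max L L' * (\<Sum>g\<in>E \<union> E'. \<bar>z g - z' g\<bar>)" for z z'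
    by (rule order_trans)
  then show ?thesis using 1 unfolding lip_fun_def by (simp add: le_max_iff_disj)
qed

lemma lip_fun_ramp: "lip_fun {g} (\<lambda>z. min 1 (max 0 (real n * (z g - a)))) (real n)"
proof -
  have "\<bar>min 1 (max 0 s) - min 1 (max 0 t)\<bar> \<le> \<bar>s - t\<bar>" for s t :: real by (auto simp: min_def max_def abs_if)
  note this[of "real n * (z g - a)" "real n * (z' g - a)" for z z']
  moreover have "\<bar>real n * (z g - a) - real n * (z' g - a)\<bar> = real n * \<bar>z g - z' g\<bar>" for z z' :: "_ \<Rightarrow> real"
    by (simp add: abs_mult flip: right_diff_distrib)
  ultimately show ?thesis by (simp add: lip_fun_def)
qed

context mp_action
begin

text \<open>The approximable sets will form a sigma-algebra. Measurability is included because the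
  integral of a non-integrable function is 0 by convention, which would make the inequality
  void.\<close>

definition lip_approximable :: "('x \<Rightarrow> real) \<Rightarrow> 'x set \<Rightarrow> bool" where
  "lip_approximable f S \<longleftrightarrow> S \<in> sets M \<and> (\<forall>e>0. \<exists>E h L. lip_fun E h L \<and> E \<subseteq> carrier G \<and>
     (\<lambda>x. h (\<lambda>g. translate g f x)) \<in> borel_measurable M \<and>
     (LINT x|M. \<bar>indicator S x - h (\<lambda>g. translate g f x)\<bar>) < e)"

lemma lip_approximableE:
  assumes "lip_approximable f S" "e > 0"
  obtains E h L where "lip_fun E h L" "E \<subseteq> carrier G" "(\<lambda>x. h (\<lambda>g. translate g f x)) \<in> borel_measurable M"
    "(LINT x|M. \<bar>indicator S x - h (\<lambda>g. translate g f x)\<bar>) < e"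
  using assms unfolding lip_approximable_def by blast

lemma lip_approximable_compl:
  assumes "lip_approximable f S"
  shows "lip_approximable f (space M - S)"
  unfolding lip_approximable_def
proof (intro conjI allI impI)
  show "space M - S \<in> sets M" using assms by (auto simp: lip_approximable_def)
  fix e :: real assume "e > 0"
  with assms obtain E h L where h: "lip_fun E h L" "E \<subseteq> carrier G" "(\<lambda>x. h (\<lambda>g. translate g f x)) \<in> borel_measurable M"
    "(LINT x|M. \<bar>indicator S x - h (\<lambda>g. translate g f x)\<bar>) < e" by (rule lip_approximableE)
  have "(LINT x|M. \<bar>indicator (space M - S) x - (1 - h (\<lambda>g. translate g f x))\<bar>)
      = (LINT x|M. \<bar>indicator S x - h (\<lambda>g. translate g f x)\<bar>)"
    by (intro Bochner_Integration.integral_cong refl) (auto simp: indicator_def abs_minus_commute)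
  then show "\<exists>E h L. lip_fun E h L \<and> E \<subseteq> carrier G \<and> (\<lambda>x. h (\<lambda>g. translate g f x)) \<in> borel_measurable M \<and>
      (LINT x|M. \<bar>indicator (space M - S) x - h (\<lambda>g. translate g f x)\<bar>) < e"
    using h lip_fun_compl[OF h(1)]
    by (intro exI[of _ E] exI[of _ "\<lambda>z. 1 - h z"] exI[of _ L]) auto
qed

lemma lip_approximable_const:
  assumes "S = {} \<or> S = space M"
  shows "lip_approximable f S"
  unfolding lip_approximable_def
proof (intro conjI allI impI)
  show "S \<in> sets M" using assms by auto
  fix e :: real assume "e > 0"
  define r :: real where "r = of_bool (S = space M)"
  have "(LINT x|M. \<bar>indicator S x - r\<bar>) = (LINT x|M. 0)"
    using assms by (intro Bochner_Integration.integral_cong refl) (auto simp: r_def)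
  then show "\<exists>E h L. lip_fun E h L \<and> E \<subseteq> carrier G \<and> (\<lambda>x. h (\<lambda>g. translate g f x)) \<in> borel_measurable M \<and>
      (LINT x|M. \<bar>indicator S x - h (\<lambda>g. translate g f x)\<bar>) < e"
    using \<open>e > 0\<close> lip_fun_const[of r]
    by (intro exI[of _ "{}"] exI[of _ "\<lambda>_. r"] exI[of _ 0]) (auto simp: r_def)
qed

lemma lip_fun_indicator_integrable:
  assumes "prob_space M" "S \<in> sets M" "lip_fun E h L" "(\<lambda>x. h (\<lambda>g. translate g f x)) \<in> borel_measurable M"
  shows "integrable M (\<lambda>x. \<bar>indicator S x - h (\<lambda>g. translate g f x)\<bar>)"
proof -
  interpret prob_space M by fact
  have "\<bar>indicator S x - h z\<bar> \<le> 1" for x z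
  proof -
    have "0 \<le> h z" "h z \<le> 1" using assms(3) by (auto simp: lip_fun_def)
    then show ?thesis by (cases "x \<in> S") auto
  qed
  then show ?thesis using assms(2,4) by (intro integrable_const_bound[of _ 1]) auto
qed

text \<open>The indicator of a union is the maximum of the indicators, and taking maxima of the
  approximating functions at most adds the errors.\<close>

lemma lip_approximable_Un:
  assumes P: "prob_space M" and S: "lip_approximable f S" and T: "lip_approximable f T"
  shows "lip_approximable f (S \<union> T)"
  unfolding lip_approximable_def
proof (intro conjI allI impI)
  have sets: "S \<in> sets M" "T \<in> sets M" using S T by (auto simp: lip_approximable_def)
  then show "S \<union> T \<in> sets M" by auto
  fix e :: real assume "e > 0"
  then have e2: "e / 2 > 0" by simp
  obtain E h L where h: "lip_fun E h L" "E \<subseteq> carrier G" "(\<lambda>x. h (\<lambda>g. translate g f x)) \<in> borel_measurable M"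
    "(LINT x|M. \<bar>indicator S x - h (\<lambda>g. translate g f x)\<bar>) < e / 2" using S e2 by (rule lip_approximableE)
  obtain E' h' L' where h': "lip_fun E' h' L'" "E' \<subseteq> carrier G" "(\<lambda>x. h' (\<lambda>g. translate g f x)) \<in> borel_measurable M"
    "(LINT x|M. \<bar>indicator T x - h' (\<lambda>g. translate g f x)\<bar>) < e / 2" using T e2 by (rule lip_approximableE)
  have m: "lip_fun (E \<union> E') (\<lambda>z. max (h z) (h' z)) (max L L')" using h(1) h'(1) by (rule lip_fun_max)
  have meas: "(\<lambda>x. max (h (\<lambda>g. translate g f x)) (h' (\<lambda>g. translate g f x))) \<in> borel_measurable M"
    using h(3) h'(3) by measurable
  have "(LINT x|M. \<bar>indicator (S \<union> T) x - max (h (\<lambda>g. translate g f x)) (h' (\<lambda>g. translate g f x))\<bar>)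
      \<le> (LINT x|M. \<bar>indicator S x - h (\<lambda>g. translate g f x)\<bar> + \<bar>indicator T x - h' (\<lambda>g. translate g f x)\<bar>)"
  proof (rule integral_mono)
    show "integrable M (\<lambda>x. \<bar>indicator (S \<union> T) x - max (h (\<lambda>g. translate g f x)) (h' (\<lambda>g. translate g f x))\<bar>)"
      using lip_fun_indicator_integrable[OF P _ m meas] sets by auto
    show "integrable M (\<lambda>x. \<bar>indicator S x - h (\<lambda>g. translate g f x)\<bar> + \<bar>indicator T x - h' (\<lambda>g. translate g f x)\<bar>)"
      using lip_fun_indicator_integrable[OF P sets(1) h(1,3)] lip_fun_indicator_integrable[OF P sets(2) h'(1,3)]
      by (rule Bochner_Integration.integrable_add)
    fix x
    have "indicator (S \<union> T) x = (max (indicator S x) (indicator T x) :: real)" by (auto simp: indicator_def)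
    moreover have "\<bar>max s t - max u v\<bar> \<le> \<bar>s - u\<bar> + \<bar>t - v\<bar>" for s t u v :: real by (auto simp: max_def abs_if)
    ultimately show "\<bar>indicator (S \<union> T) x - max (h (\<lambda>g. translate g f x)) (h' (\<lambda>g. translate g f x))\<bar>
        \<le> \<bar>indicator S x - h (\<lambda>g. translate g f x)\<bar> + \<bar>indicator T x - h' (\<lambda>g. translate g f x)\<bar>" by simp
  qed
  also have "\<dots> < e"
    using h(4) h'(4) lip_fun_indicator_integrable[OF P sets(1) h(1,3)] lip_fun_indicator_integrable[OF P sets(2) h'(1,3)]
    by (subst Bochner_Integration.integral_add) auto
  finally show "\<exists>E h L. lip_fun E h L \<and> E \<subseteq> carrier G \<and> (\<lambda>x. h (\<lambda>g. translate g f x)) \<in> borel_measurable M \<and>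
      (LINT x|M. \<bar>indicator (S \<union> T) x - h (\<lambda>g. translate g f x)\<bar>) < e"
    using m h(2) h'(2) meas by (intro exI[of _ "E \<union> E'"] exI[of _ "\<lambda>z. max (h z) (h' z)"] exI[of _ "max L L'"]) auto
qed

text \<open>Finite unions exhaust the countable one in measure; half of the error is spent on the
  missing mass.\<close>

lemma lip_approximable_UN:
  fixes A :: "nat \<Rightarrow> 'x set"
  assumes P: "prob_space M" and A: "\<And>i. lip_approximable f (A i)"
  shows "lip_approximable f (\<Union>i. A i)"
  unfolding lip_approximable_def
proof (intro conjI allI impI)
  interpret prob_space M by fact
  have sets: "A i \<in> sets M" for i using A by (auto simp: lip_approximable_def)
  then show Un: "(\<Union>i. A i) \<in> sets M" by auto
  define U where "U m = (\<Union>i<m. A i)" for m :: nat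
  have U: "lip_approximable f (U m)" for m
  proof (induction m)
    case 0
    show ?case by (rule lip_approximable_const) (simp add: U_def)
  next
    case (Suc m)
    have "U (Suc m) = U m \<union> A m" by (auto simp: U_def less_Suc_eq)
    then show ?case using lip_approximable_Un[OF P Suc A] by simp
  qed
  have Us: "U m \<in> sets M" for m using U by (auto simp: lip_approximable_def)
  fix e :: real assume "e > 0"
  have "(\<lambda>m. measure M (U m)) \<longlonglongrightarrow> measure M (\<Union>m. U m)"
    using Us by (intro finite_Lim_measure_incseq) (auto simp: U_def incseq_def intro: less_le_trans)
  also have "(\<Union>m. U m) = (\<Union>i. A i)" by (auto simp: U_def)
  finally have "\<forall>\<^sub>F m in sequentially. measure M (\<Union>i. A i) - e / 2 < measure M (U m)"
    using \<open>e > 0\<close> by (intro order_tendstoD) auto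
  from eventually_happens'[OF sequentially_bot this]
  obtain m where "measure M (\<Union>i. A i) - e / 2 < measure M (U m)" by blast
  then have m: "measure M (\<Union>i. A i) - measure M (U m) < e / 2" by argo
  obtain E h L where h: "lip_fun E h L" "E \<subseteq> carrier G" "(\<lambda>x. h (\<lambda>g. translate g f x)) \<in> borel_measurable M"
    "(LINT x|M. \<bar>indicator (U m) x - h (\<lambda>g. translate g f x)\<bar>) < e / 2"
    using U[of m] half_gt_zero[OF \<open>e > 0\<close>] by (rule lip_approximableE)
  have i1: "integrable M (\<lambda>x. indicator (\<Union>i. A i) x - indicator (U m) x :: real)"
    using Un Us by (intro Bochner_Integration.integrable_diff integrable_real_indicator) (auto simp: emeasure_eq_measure)
  have i2: "integrable M (\<lambda>x. \<bar>indicator (U m) x - h (\<lambda>g. translate g f x)\<bar>)"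
    by (rule lip_fun_indicator_integrable[OF P Us h(1,3)])
  have "(LINT x|M. \<bar>indicator (\<Union>i. A i) x - h (\<lambda>g. translate g f x)\<bar>)
      \<le> (LINT x|M. (indicator (\<Union>i. A i) x - indicator (U m) x) + \<bar>indicator (U m) x - h (\<lambda>g. translate g f x)\<bar>)"
  proof (rule integral_mono)
    show "integrable M (\<lambda>x. \<bar>indicator (\<Union>i. A i) x - h (\<lambda>g. translate g f x)\<bar>)"
      by (rule lip_fun_indicator_integrable[OF P Un h(1,3)])
    show "integrable M (\<lambda>x. (indicator (\<Union>i. A i) x - indicator (U m) x) + \<bar>indicator (U m) x - h (\<lambda>g. translate g f x)\<bar>)"
      using i1 i2 by (rule Bochner_Integration.integrable_add)
    fix x
    have "(indicator (U m) x :: real) \<le> indicator (\<Union>i. A i) x" by (auto simp: U_def indicator_def)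
    then show "\<bar>indicator (\<Union>i. A i) x - h (\<lambda>g. translate g f x)\<bar>
        \<le> (indicator (\<Union>i. A i) x - indicator (U m) x) + \<bar>indicator (U m) x - h (\<lambda>g. translate g f x)\<bar>" by arith
  qed
  also have "\<dots> = (measure M (\<Union>i. A i) - measure M (U m)) + (LINT x|M. \<bar>indicator (U m) x - h (\<lambda>g. translate g f x)\<bar>)"
  proof -
    have "(LINT x|M. indicator (\<Union>i. A i) x - indicator (U m) x) = measure M (\<Union>i. A i) - measure M (U m)"
      using Un Us by (subst Bochner_Integration.integral_diff) (auto simp: emeasure_eq_measure intro!: integrable_real_indicator)
    then show ?thesis using Bochner_Integration.integral_add[OF i1 i2] by simp
  qed
  also have "\<dots> < e" using m h(4) by simp
  finally show "\<exists>E h L. lip_fun E h L \<and> E \<subseteq> carrier G \<and> (\<lambda>x. h (\<lambda>g. translate g f x)) \<in> borel_measurable M \<and>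
      (LINT x|M. \<bar>indicator (\<Union>i. A i) x - h (\<lambda>g. translate g f x)\<bar>) < e"
    using h by blast
qed

text \<open>Ramps of slope \<open>n\<close> starting at \<open>a\<close> converge pointwise to the
  indicator of the open half-line, including the value 0 at \<open>a\<close> itself.\<close>

lemma lip_approximable_halfspace:
  assumes P: "prob_space M" and f: "f \<in> borel_measurable M" and g: "g \<in> carrier G"
  shows "lip_approximable f {x \<in> space M. a < translate g f x}"
  unfolding lip_approximable_def
proof (intro conjI allI impI)
  interpret prob_space M by fact
  have t [measurable]: "translate g f \<in> borel_measurable M"
    unfolding translate_def using g by (intro measurable_compose[OF act_measurable f]) auto
  let ?S = "{x \<in> space M. a < translate g f x}"
  show S: "?S \<in> sets M" by measurable
  define H where "H n t = min 1 (max 0 (real n * (t - a)))" for n :: nat and t :: real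
  have H_meas: "(\<lambda>x. H n (translate g f x)) \<in> borel_measurable M" for n unfolding H_def by measurable
  have H_lim: "(\<lambda>n. H n t) \<longlonglongrightarrow> of_bool (a < t)" for t
  proof (cases "a < t")
    case True
    then obtain N :: nat where N: "1 / (t - a) < real N" using reals_Archimedean2 by blast
    have "H n t = 1" if "n \<ge> N" for n
    proof -
      have "1 / (t - a) \<le> real n" using N that by linarith
      then have "1 \<le> real n * (t - a)" using True by (simp add: field_simps)
      then show ?thesis by (simp add: H_def)
    qed
    then have "\<forall>\<^sub>F n in sequentially. H n t = 1" by (auto simp: eventually_sequentially)
    then show ?thesis using True by (simp add: tendsto_eventually)
  next
    case False
    then have "real n * (t - a) \<le> 0" for n by (simp add: mult_nonneg_nonpos)
    then have "H n t = 0" for n by (simp add: H_def)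
    then show ?thesis using False by simp
  qed
  have "(\<lambda>n. LINT x|M. \<bar>indicator ?S x - H n (translate g f x)\<bar>) \<longlonglongrightarrow> (LINT x|M. 0)"
  proof (rule integral_dominated_convergence[where w = "\<lambda>x. 1"])
    show "(\<lambda>x. \<bar>indicator ?S x - H n (translate g f x)\<bar>) \<in> borel_measurable M" for n
      using S H_meas[of n] by (intro borel_measurable_abs borel_measurable_diff borel_measurable_indicator)
    show "AE x in M. (\<lambda>n. \<bar>indicator ?S x - H n (translate g f x)\<bar>) \<longlonglongrightarrow> 0"
    proof (rule AE_I2)
      fix x assume x: "x \<in> space M"
      have "(\<lambda>n. \<bar>indicator ?S x - H n (translate g f x)\<bar>) \<longlonglongrightarrow> \<bar>indicator ?S x - of_bool (a < translate g f x)\<bar>"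
        by (intro tendsto_intros H_lim)
      then show "(\<lambda>n. \<bar>indicator ?S x - H n (translate g f x)\<bar>) \<longlonglongrightarrow> 0" using x by (simp add: indicator_def)
    qed
    have "\<bar>indicator ?S x - H n t\<bar> \<le> 1" for x n t
    proof -
      have "0 \<le> H n t" "H n t \<le> 1" by (auto simp: H_def)
      then show ?thesis by (cases "x \<in> ?S") auto
    qed
    then show "AE x in M. norm \<bar>indicator ?S x - H n (translate g f x)\<bar> \<le> 1" for n by simp
  qed auto
  then have lim: "(\<lambda>n. LINT x|M. \<bar>indicator ?S x - H n (translate g f x)\<bar>) \<longlonglongrightarrow> 0" by simp
  fix e :: real assume "e > 0"
  from order_tendstoD(2)[OF lim this] obtain n where n: "(LINT x|M. \<bar>indicator ?S x - H n (translate g f x)\<bar>) < e"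
    by (auto simp: eventually_sequentially)
  show "\<exists>E h L. lip_fun E h L \<and> E \<subseteq> carrier G \<and> (\<lambda>x. h (\<lambda>g. translate g f x)) \<in> borel_measurable M \<and>
      (LINT x|M. \<bar>indicator ?S x - h (\<lambda>g. translate g f x)\<bar>) < e"
    using lip_fun_ramp[of g n a] n g H_meas[of n]
    by (intro exI[of _ "{g}"] exI[of _ "\<lambda>z. H n (z g)"] exI[of _ "real n"]) (auto simp: H_def)
qed

end

section \<open>Transport to the real line\<close>

lemma second_countable_euclidean: "second_countable (euclidean :: 'a::second_countable_topology topology)"
proof -
  obtain \<B> :: "'a set set" where \<B>: "countable \<B>" "\<And>C. C \<in> \<B> \<Longrightarrow> open C"
    "\<And>S. open S \<Longrightarrow> \<exists>U. U \<subseteq> \<B> \<and> S = \<Union>U"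
    using univ_second_countable by blast
  have "\<exists>V\<in>\<B>. x \<in> V \<and> V \<subseteq> U" if U: "open U" "x \<in> U" for U x
  proof -
    obtain W where W: "W \<subseteq> \<B>" "U = \<Union>W" using \<B>(3)[OF U(1)] by blast
    then obtain V where "V \<in> W" "x \<in> V" using U(2) by blast
    then show ?thesis using W by blast
  qed
  then show ?thesis using \<B>(1,2) unfolding second_countable_def by (intro exI[of _ \<B>]) auto
qed

text \<open>The topology is transported along the injection, which makes \<open>\<iota>\<close> a
  homeomorphism onto its range. The range does not carry a subspace topology of the target, so
  \<open>\<iota>\<close> may be an arbitrary injection.\<close>

lemma standard_borel_embed:
  fixes \<iota> :: "'a::polish_space \<Rightarrow> 'b"
  assumes \<iota>: "inj \<iota>" and N: "space N = range \<iota>" "sets N = sets (embed_measure borel \<iota>)"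
  shows "standard_borel N"
proof -
  define T where "T = pullback_topology (range \<iota>) (inv_into UNIV \<iota>) euclidean"
  have inv: "inv_into UNIV \<iota> (\<iota> y) = y" for y using \<iota> by simp
  have top: "topspace T = range \<iota>" by (auto simp: T_def topspace_pullback_topology)
  have "continuous_map euclidean T \<iota>"
    unfolding T_def using inv by (intro continuous_map_pullback') (auto simp: comp_def)
  moreover have "continuous_map T euclidean (id \<circ> inv_into UNIV \<iota>)"
    unfolding T_def by (intro continuous_map_pullback continuous_map_id)
  ultimately have "homeomorphic_maps euclidean T \<iota> (inv_into UNIV \<iota>)"
    using inv by (auto simp: homeomorphic_maps_def top)
  then have hom: "(euclidean :: 'a topology) homeomorphic_space T" by (auto simp: homeomorphic_space_def)
  have open_T: "openin T U \<longleftrightarrow> (\<exists>V. open V \<and> U = \<iota> ` V)" for U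
  proof -
    have "inv_into UNIV \<iota> -` V \<inter> range \<iota> = \<iota> ` V" for V using inv by force
    then show ?thesis by (simp add: T_def openin_pullback_topology)
  qed
  have sets_N: "sets N = {\<iota> ` A |A. A \<in> sets borel}" unfolding N(2) using \<iota> by (rule sets_embed_measure)
  have "sets N = sigma_sets (topspace T) {U. openin T U}"
  proof (rule antisym)
    show "sigma_sets (topspace T) {U. openin T U} \<subseteq> sets N"
      unfolding top N(1)[symmetric] by (intro sets.sigma_sets_subset) (auto simp: open_T sets_N)
    have "\<iota> ` A \<in> sigma_sets (topspace T) {U. openin T U}" if "A \<in> sigma_sets UNIV {V. open V}" for A
      using that
    proof (induction rule: sigma_sets.induct)
      case (Basic V)
      then show ?case by (intro sigma_sets.Basic) (auto simp: open_T)
    next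
      case Empty
      show ?case by (simp add: sigma_sets.Empty)
    next
      case (Compl A)
      have "\<iota> ` (UNIV - A) = topspace T - \<iota> ` A" using \<iota> by (simp add: top image_set_diff)
      then show ?case using Compl by (simp add: sigma_sets.Compl)
    next
      case (Union A)
      then show ?case unfolding image_UN by (intro sigma_sets.Union)
    qed
    then show "sets N \<subseteq> sigma_sets (topspace T) {U. openin T U}"
      by (auto simp: sets_N borel_def)
  qed
  then show ?thesis
    using hom homeomorphic_completely_metrizable_space[OF hom] homeomorphic_space_second_countability[OF hom]
      completely_metrizable_space_euclidean second_countable_euclidean
    unfolding standard_borel_def by (intro exI[of _ T]) (auto simp: top N(1))
qed

text \<open>By cardinality: reals correspond to sets of naturals, and a sequence of sets of naturals
  is one set of pairs.\<close>

lemma inj_seq_real: "\<exists>\<iota> :: (nat \<Rightarrow> real) \<Rightarrow> real. inj \<iota>"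
proof -
  obtain u :: "real \<Rightarrow> nat set" where u: "inj u"
    using nat_sets_eqpoll_reals[THEN eqpoll_sym] by (auto simp: eqpoll_def bij_betw_def)
  obtain v :: "nat set \<Rightarrow> real" where v: "inj v"
    using nat_sets_eqpoll_reals by (auto simp: eqpoll_def bij_betw_def)
  define w :: "(nat \<Rightarrow> real) \<Rightarrow> nat set" where "w y = {k. snd (prod_decode k) \<in> u (y (fst (prod_decode k)))}" for y
  have "inj w"
  proof (rule injI, rule ext)
    fix y z :: "nat \<Rightarrow> real" and n assume eq: "w y = w z"
    have "k \<in> u (y n) \<longleftrightarrow> prod_encode (n, k) \<in> w y" "k \<in> u (z n) \<longleftrightarrow> prod_encode (n, k) \<in> w z" for k
      by (auto simp: w_def)
    then have "u (y n) = u (z n)" using eq by auto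
    then show "y n = z n" using u by (simp add: inj_eq)
  qed
  then have "inj (v \<circ> w)" using v by (rule inj_compose[rotated])
  then show ?thesis by blast
qed

section \<open>The factor generated by a function\<close>

context mp_action
begin

text \<open>For the coordinates that are not codes of group elements, where the law of the factor is
  concentrated at 0.\<close>

lemma lip_approximable_AE_const:
  assumes S: "S \<in> sets M" and AE: "AE x in M. x \<in> S \<longleftrightarrow> c"
  shows "lip_approximable f S"
  unfolding lip_approximable_def
proof (intro conjI allI impI S)
  fix e :: real assume "e > 0"
  define r :: real where "r = of_bool c"
  have "(LINT x|M. \<bar>indicator S x - r\<bar>) = (LINT x|M. 0)"
    using AE S by (intro integral_cong_AE) (auto simp: r_def)
  then show "\<exists>E h L. lip_fun E h L \<and> E \<subseteq> carrier G \<and> (\<lambda>x. h (\<lambda>g. translate g f x)) \<in> borel_measurable M \<and>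
      (LINT x|M. \<bar>indicator S x - h (\<lambda>g. translate g f x)\<bar>) < e"
    using \<open>e > 0\<close> lip_fun_const[of r]
    by (intro exI[of _ "{}"] exI[of _ "\<lambda>_. r"] exI[of _ 0]) (auto simp: r_def)
qed

text \<open>The factor is the law of \<open>x \<mapsto> (f (g\<^sup>-\<^sup>1 x))\<^sub>g\<close>, with coordinates indexed by the codes of group
  elements; the coordinates that are not codes are filled with 0.\<close>

lemma exists_factor:
  assumes cnt: "countable (carrier G)" and P: "prob_space M" and f: "f \<in> borel_measurable M"
  obtains N :: "real measure" and act' p F0 where
    "standard_prob_space N" "pmp_action G N act'" "factor_map G M act N act' p"
    "F0 \<in> borel_measurable N" "\<And>x. x \<in> space M \<Longrightarrow> F0 (p x) = f x" "p \<in> M \<rightarrow>\<^sub>M N" "distr M N p = N"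
    "\<And>g x. g \<in> carrier G \<Longrightarrow> x \<in> space M \<Longrightarrow> p (act g x) = act' g (p x)"
    "\<And>S. S \<in> sets N \<Longrightarrow> mp_action.lip_approximable G N act' F0 S"
proof -
  interpret prob_space M by fact
  obtain \<iota> :: "(nat \<Rightarrow> real) \<Rightarrow> real" where \<iota>: "inj \<iota>" using inj_seq_real by blast
  define idx where "idx = to_nat_on (carrier G)"
  define el where "el = inv_into (carrier G) idx"
  define I where "I = idx ` carrier G"
  have inj_idx: "inj_on idx (carrier G)" unfolding idx_def using cnt by (rule inj_on_to_nat_on)
  have el_idx: "el (idx g) = g" if "g \<in> carrier G" for g unfolding el_def using inj_idx that by (rule inv_into_f_f)
  have el: "el n \<in> carrier G" if "n \<in> I" for n using that el_idx by (auto simp: I_def)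
  have idx_I: "idx g \<in> I" if "g \<in> carrier G" for g using that by (auto simp: I_def)
  \<comment> \<open>The left shift read through the codes of group elements. On the other indices it
    is the identity, which keeps it a bijection of all sequences.\<close>
  define shift where "shift g y n = (if n \<in> I then y (idx (inv g \<otimes> el n)) else y n)" for g and y :: "nat \<Rightarrow> real" and n
  define code where "code x n = (if n \<in> I then f (act (inv (el n)) x) else 0)" for x n
  have shift_one: "shift \<one> y = y" for y
  proof
    fix n
    show "shift \<one> y n = y n"
    proof (cases "n \<in> I")
      case True
      then obtain g where "g \<in> carrier G" "n = idx g" by (auto simp: I_def)
      then show ?thesis by (simp add: shift_def el_idx)
    qed (simp add: shift_def)
  qed
  have shift_mult: "shift (g \<otimes> h) y = shift g (shift h y)" if "g \<in> carrier G" "h \<in> carrier G" for g h y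
  proof
    fix n
    show "shift (g \<otimes> h) y n = shift g (shift h y) n"
      using that el[of n] by (simp add: shift_def idx_I el_idx inv_mult_group m_assoc)
  qed
  have shift_code: "code (act g x) = shift g (code x)" if "g \<in> carrier G" "x \<in> space M" for g x
  proof
    fix n
    show "code (act g x) n = shift g (code x) n"
      using that el[of n] by (simp add: shift_def code_def idx_I el_idx inv_mult_group act_mult)
  qed
  have shift_meas: "shift g \<in> borel \<rightarrow>\<^sub>M borel" if "g \<in> carrier G" for g
  proof (rule borel_measurable_continuous_onI, rule continuous_on_coordinatewise_then_product)
    fix n
    show "continuous_on UNIV (\<lambda>y. shift g y n)"
      by (cases "n \<in> I") (simp_all add: shift_def continuous_on_product_coordinates)
  qed
  have code_meas: "code \<in> M \<rightarrow>\<^sub>M borel"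
  proof (rule measurable_coordinatewise_then_product)
    fix n
    show "(\<lambda>x. code x n) \<in> borel_measurable M"
      using el[of n] f by (cases "n \<in> I") (auto simp: code_def intro: measurable_compose[OF act_measurable])
  qed
  define N0 where "N0 = embed_measure (borel :: (nat \<Rightarrow> real) measure) \<iota>"
  define p where "p = \<iota> \<circ> code"
  define N where "N = distr M N0 p"
  define j where "j = inv_into UNIV \<iota>"
  have j: "j (\<iota> y) = y" for y using \<iota> by (simp add: j_def)
  have \<iota>_meas: "\<iota> \<in> borel \<rightarrow>\<^sub>M N0" unfolding N0_def using \<iota> by (rule measurable_embed_measure2)
  have p_meas0: "p \<in> M \<rightarrow>\<^sub>M N0" unfolding p_def using code_meas \<iota>_meas by (rule measurable_comp)
  have sets_N: "sets N = sets N0" by (simp add: N_def)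
  have space_N: "space N = range \<iota>" by (simp add: N_def N0_def space_embed_measure)
  have p_meas: "p \<in> M \<rightarrow>\<^sub>M N" using p_meas0 by (simp add: N_def)
  have p_distr: "distr M N p = N" unfolding N_def by (rule distr_cong) simp_all
  have j_meas: "j \<in> N \<rightarrow>\<^sub>M borel"
  proof -
    have "j \<in> N0 \<rightarrow>\<^sub>M borel" unfolding N0_def by (rule measurable_embed_measure1) (simp add: j)
    then show ?thesis using measurable_cong_sets[OF sets_N refl] by blast
  qed
  \<comment> \<open>Restricted to the range, since \<open>Bij\<close> asks for extensional
    functions.\<close>
  define act' where "act' g = (\<lambda>r\<in>range \<iota>. \<iota> (shift g (j r)))" for g
  have act'_\<iota>: "act' g (\<iota> y) = \<iota> (shift g y)" for g y by (simp add: act'_def j)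
  have prob_N: "prob_space N" unfolding N_def using p_meas0 by (rule prob_space_distr)
  have std: "standard_prob_space N"
    unfolding standard_prob_space_def using prob_N standard_borel_embed[OF \<iota> space_N] sets_N by (simp add: N0_def)
  have equiv: "p (act g x) = act' g (p x)" if "g \<in> carrier G" "x \<in> space M" for g x
    using that by (simp add: p_def act'_\<iota> shift_code)
  have act'_meas: "act' g \<in> N \<rightarrow>\<^sub>M N" if g: "g \<in> carrier G" for g
  proof -
    have "(\<lambda>y. act' g (\<iota> y)) \<in> borel \<rightarrow>\<^sub>M N0"
      unfolding act'_\<iota> using shift_meas[OF g] \<iota>_meas by (rule measurable_compose)
    then have "act' g \<in> N0 \<rightarrow>\<^sub>M N0" unfolding N0_def by (rule measurable_embed_measure1)
    then show ?thesis using measurable_cong_sets[OF sets_N sets_N] by blast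
  qed
  have act'_distr: "distr N N (act' g) = N" if g: "g \<in> carrier G" for g
  proof -
    have "distr N N (act' g) = distr (distr M N p) N (act' g)" by (simp only: p_distr)
    also have "\<dots> = distr M N (act' g \<circ> p)" using act'_meas[OF g] p_meas by (rule distr_distr)
    also have "\<dots> = distr M N (p \<circ> act g)" using equiv[OF g] by (intro distr_cong) auto
    also have "\<dots> = distr (distr M M (act g)) N p" using p_meas act_measurable[OF g] by (rule distr_distr[symmetric])
    also have "\<dots> = N" using act_distr[OF g] p_distr by simp
    finally show ?thesis .
  qed
  have bij: "act' g \<in> Bij (range \<iota>)" if g: "g \<in> carrier G" for g
  proof -
    have "bij_betw (act' g) (range \<iota>) (range \<iota>)"
    proof (rule bij_betwI[where g = "act' (inv g)"])
      have "shift (inv g) (shift g y) = y" "shift g (shift (inv g) y) = y" for y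
        using g shift_mult[of "inv g" g y] shift_mult[of g "inv g" y] by (simp_all add: shift_one)
      then show "act' (inv g) (act' g r) = r" "act' g (act' (inv g) r) = r" if "r \<in> range \<iota>" for r
        using that by (auto simp: act'_\<iota>)
    qed (auto simp: act'_\<iota>)
    then show ?thesis by (simp add: Bij_def act'_def)
  qed
  have "group_action G (space N) act'"
    unfolding group_action_def group_hom_def group_hom_axioms_def space_N
  proof (intro conjI homI)
    show "group G" by (rule is_group)
    show "group (BijGroup (range \<iota>))" by (rule group_BijGroup)
    show "act' g \<in> carrier (BijGroup (range \<iota>))" if "g \<in> carrier G" for g
      using bij[OF that] by (simp add: BijGroup_def)
    show "act' (g \<otimes> h) = act' g \<otimes>\<^bsub>BijGroup (range \<iota>)\<^esub> act' h" if "g \<in> carrier G" "h \<in> carrier G" for g h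
    proof -
      have "act' (g \<otimes> h) r = compose (range \<iota>) (act' g) (act' h) r" for r
        using that by (cases "r \<in> range \<iota>") (auto simp: compose_def act'_\<iota> shift_mult act'_def j)
      then show ?thesis using bij that by (auto simp: BijGroup_def)
    qed
  qed
  then have pmp: "pmp_action G N act'"
    using act'_meas act'_distr by (simp add: pmp_action_def)
  interpret N: mp_action G N act' using is_group pmp by (rule mp_action_of_pmp_action)
  have fac: "factor_map G M act N act' p"
    using p_meas p_distr equiv by (auto simp: factor_map_def)
  \<comment> \<open>The coordinate at the identity is \<open>f\<close> seen on the factor; its
    translates are the other group coordinates.\<close>
  define F0 where "F0 r = j r (idx \<one>)" for r
  have F0_meas: "F0 \<in> borel_measurable N"
    unfolding F0_def[abs_def] by (rule measurable_compose[OF j_meas]) (rule borel_measurable_continuous_onI, rule continuous_on_product_coordinates)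
  have F0_p: "F0 (p x) = f x" if "x \<in> space M" for x
    using that by (simp add: F0_def p_def j code_def idx_I el_idx act_one)
  have F0_translate: "N.translate g F0 (\<iota> y) = y (idx g)" if "g \<in> carrier G" for g y
    using that by (simp add: N.translate_def F0_def act'_\<iota> j shift_def idx_I el_idx)
  \<comment> \<open>Good sets: \<open>\<K>\<close> is a sigma-algebra for which every coordinate is
    measurable, so it contains all Borel sets of sequences.\<close>
  define \<K> where "\<K> = {A :: (nat \<Rightarrow> real) set. N.lip_approximable F0 (\<iota> ` A)}"
  have "sigma_algebra UNIV \<K>"
  proof (rule sigma_algebra_iff2[THEN iffD2], intro conjI ballI allI impI)
    show "\<K> \<subseteq> Pow UNIV" by simp
    show "{} \<in> \<K>" by (simp add: \<K>_def N.lip_approximable_const)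
    show "UNIV - A \<in> \<K>" if "A \<in> \<K>" for A
      using N.lip_approximable_compl[of F0 "\<iota> ` A"] that \<iota> by (simp add: \<K>_def space_N image_set_diff)
    show "(\<Union>i. A i) \<in> \<K>" if "range A \<subseteq> \<K>" for A :: "nat \<Rightarrow> _"
    proof -
      have "N.lip_approximable F0 (\<Union>i. \<iota> ` A i)" using that by (intro N.lip_approximable_UN prob_N) (auto simp: \<K>_def)
      then show ?thesis by (simp add: \<K>_def image_UN)
    qed
  qed
  then have sets_K: "sets (sigma UNIV \<K>) = \<K>" by (simp add: sigma_algebra.sigma_sets_eq)
  have "(\<lambda>y :: nat \<Rightarrow> real. y n) \<in> borel_measurable (sigma UNIV \<K>)" for n
  proof (rule borel_measurableI_greater)
    fix a :: real
    have "{y :: nat \<Rightarrow> real. a < y n} \<in> \<K>"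
    proof (cases "n \<in> I")
      case True
      then obtain g where g: "g \<in> carrier G" "n = idx g" by (auto simp: I_def)
      have "\<iota> ` {y. a < y n} = {r \<in> space N. a < N.translate g F0 r}"
        using g by (auto simp: space_N F0_translate)
      then show ?thesis using N.lip_approximable_halfspace[OF prob_N F0_meas g(1), of a] by (simp add: \<K>_def)
    next
      case False
      have S: "\<iota> ` {y. a < y n} \<in> sets N"
      proof -
        have "{y :: nat \<Rightarrow> real. a < y n} \<in> sets borel"
          by (intro borel_open open_Collect_less continuous_on_const continuous_on_product_coordinates)
        then show ?thesis unfolding sets_N N0_def by (rule in_sets_embed_measure)
      qed
      have "p x \<in> \<iota> ` {y. a < y n} \<longleftrightarrow> a < 0" for x
      proof -
        have "p x \<in> \<iota> ` {y. a < y n} \<longleftrightarrow> a < code x n" using \<iota> by (auto simp: p_def inj_eq)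
        then show ?thesis using False by (simp add: code_def)
      qed
      then have "AE r in distr M N p. r \<in> \<iota> ` {y. a < y n} \<longleftrightarrow> a < 0"
        using S by (subst AE_distr_iff[OF p_meas]) (auto simp: Collect_conj_eq2)
      then have "N.lip_approximable F0 (\<iota> ` {y. a < y n})"
        unfolding p_distr by (rule N.lip_approximable_AE_const[OF S])
      then show ?thesis by (simp add: \<K>_def)
    qed
    then show "{y \<in> space (sigma UNIV \<K>). a < y n} \<in> sets (sigma UNIV \<K>)"
      unfolding sets_K by (simp add: space_measure_of_conv)
  qed
  then have "(\<lambda>y. y) \<in> sigma UNIV \<K> \<rightarrow>\<^sub>M (borel :: (nat \<Rightarrow> real) measure)"
    by (rule measurable_coordinatewise_then_product)
  then have borel_K: "A \<in> \<K>" if "A \<in> sets (borel :: (nat \<Rightarrow> real) measure)" for A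
    using measurable_sets[of "\<lambda>y. y" "sigma UNIV \<K>" borel A] that by (simp add: sets_K space_measure_of_conv)
  have gen: "N.lip_approximable F0 S" if "S \<in> sets N" for S
    using that borel_K \<iota> unfolding sets_N N0_def sets_embed_measure[OF \<iota>] by (auto simp: \<K>_def)
  show thesis
    using std pmp fac F0_meas F0_p p_meas p_distr equiv gen by (rule that)
qed

end

section \<open>Totality of the Bessel vectors and the equivariant isometry\<close>

section \<open>Bessel vectors under completely positive entropy\<close>

lemma l2_count_space_indicator:
  assumes "g \<in> C"
  shows "indicator {g} \<in> l2 (count_space C)"
    and "\<And>x. l2_ip (count_space C) x (indicator {g}) = x g"
proof -
  have int: "integrable (count_space C) (indicator {g} :: 'a \<Rightarrow> real)"
    using assms by (intro integrable_real_indicator) auto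
  moreover have "(\<lambda>h. (indicator {g} h :: real)\<^sup>2) = indicator {g}" by (auto simp: indicator_def)
  ultimately show "indicator {g} \<in> l2 (count_space C)" by (simp add: l2_def)
  fix x :: "'a \<Rightarrow> real"
  have "l2_ip (count_space C) x (indicator {g}) = (LINT h|count_space C. x g * indicator {g} h)"
    unfolding l2_ip_def by (intro Bochner_Integration.integral_cong refl) (auto simp: indicator_def)
  also have "\<dots> = x g * measure (count_space C) ({g} \<inter> C)" by simp
  also have "measure (count_space C) ({g} \<inter> C) = 1" using assms by (simp add: measure_count_space)
  finally show "l2_ip (count_space C) x (indicator {g}) = x g" by simp
qed

text \<open>If \<open>f\<close> were not null, its factor would be nontrivial and so have positive
  entropy, whereas orthogonality to the Bessel vectors supplies the elements \<open>a\<close> that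
  force this entropy to be at most 0.\<close>

lemma cpe_bessel_total:
  assumes G: "group G" "countable (carrier G)" and sof: "sofic_approximation G d \<sigma>"
    and M: "standard_prob_space M" and act: "pmp_action G M act"
    and cpe: "completely_positive_entropy G d \<sigma> M act"
    and f: "f \<in> l2_mean0 M"
    and orth: "\<And>z. z \<in> hilbert_rep.bessel (l2_mean0 M) (l2_ip M) G (mp_action.translate G act) \<Longrightarrow> l2_ip M f z = 0"
  shows "l2_ip M f f = 0"
proof (rule ccontr)
  assume ff: "l2_ip M f f \<noteq> 0"
  interpret prob_space M using M by (simp add: standard_prob_space_def)
  have fin: "finite_measure M" by unfold_locales
  interpret A: mp_action G M act using G(1) act by (rule mp_action_of_pmp_action)
  \<comment> \<open>The left regular representation is the second summand in
    \<open>singular_approx\<close>, with the point mass at the identity as cyclic vector.\<close>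
  let ?C = "count_space (carrier G)" and ?left = "\<lambda>g. \<lambda>x\<in>carrier G. g \<otimes>\<^bsub>G\<^esub> x"
  interpret B: mp_action G ?C ?left using G(1) by (rule mp_action_left_mult)
  have f2: "f \<in> l2 M" using f by (rule l2_mean0_l2)
  have f_meas: "f \<in> borel_measurable M" using f2 by (rule l2_measurable)
  define \<delta> where "\<delta> = (indicator {\<one>\<^bsub>G\<^esub>} :: 'a \<Rightarrow> real)"
  have lam: "l2_ip ?C x (B.translate g \<delta>) = x g" if g: "g \<in> carrier G" for g and x :: "'a \<Rightarrow> real"
  proof -
    have "l2_ip ?C x (B.translate g \<delta>) = l2_ip ?C x (indicator {g})"
      unfolding l2_ip_def
    proof (intro Bochner_Integration.integral_cong refl)
      fix h assume "h \<in> space ?C"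
      then have h: "h \<in> carrier G" by simp
      have "inv\<^bsub>G\<^esub> g \<otimes>\<^bsub>G\<^esub> h = \<one>\<^bsub>G\<^esub> \<longleftrightarrow> h = g"
        using g h by (metis A.inv_closed A.inv_equality A.inv_inv A.l_inv)
      then show "x h * B.translate g \<delta> h = x h * indicator {g} h"
        using h by (simp add: B.translate_def \<delta>_def indicator_def)
    qed
    then show ?thesis using l2_count_space_indicator(2)[OF g] by simp
  qed
  have sing0: "\<exists>E a. finite E \<and> E \<subseteq> carrier G \<and>
      l2_ip M (f - (\<Sum>g\<in>E. a g *\<^sub>R A.translate g f)) (f - (\<Sum>g\<in>E. a g *\<^sub>R A.translate g f)) < \<epsilon> \<and> (\<Sum>g\<in>E. (a g)\<^sup>2) < \<epsilon>"
    if "\<epsilon> > 0" for \<epsilon>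
  proof (rule singular_approx[OF A.hilbert_rep_l2_mean0[OF fin] B.hilbert_rep_l2])
    show "f \<in> l2_mean0 M" by (rule f)
    show "l2_ip M f z = 0" if "z \<in> hilbert_rep.bessel (l2_mean0 M) (l2_ip M) G A.translate" for z
      using that by (rule orth)
    show "\<epsilon> > 0" by (rule that)
    show "\<delta> \<in> l2 ?C" unfolding \<delta>_def by (rule l2_count_space_indicator) simp
    show "l2_ip ?C (B.translate g \<delta>) (B.translate h \<delta>) = (if g = h then 1 else 0)"
      if "g \<in> carrier G" "h \<in> carrier G" for g h
    proof -
      have "inv\<^bsub>G\<^esub> g \<otimes>\<^bsub>G\<^esub> h = \<one>\<^bsub>G\<^esub> \<longleftrightarrow> g = h"
        using that by (metis A.inv_closed A.inv_equality A.inv_inv A.l_inv)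
      then show ?thesis using that by (simp add: lam) (simp add: B.translate_def \<delta>_def)
    qed
    show "l2_ip ?C x x = 0" if x: "\<And>g. g \<in> carrier G \<Longrightarrow> l2_ip ?C x (B.translate g \<delta>) = 0" for x
    proof -
      have "l2_ip ?C x x = (LINT h|?C. 0)"
        unfolding l2_ip_def using x by (intro Bochner_Integration.integral_cong refl) (simp add: lam)
      then show ?thesis by simp
    qed
  qed
  obtain N :: "real measure" and act' p F0 where N: "standard_prob_space N" "pmp_action G N act'" "factor_map G M act N act' p"
    and F0: "F0 \<in> borel_measurable N" "\<And>x. x \<in> space M \<Longrightarrow> F0 (p x) = f x"
    and p: "p \<in> M \<rightarrow>\<^sub>M N" "distr M N p = N"
    and equiv: "\<And>g x. g \<in> carrier G \<Longrightarrow> x \<in> space M \<Longrightarrow> p (act g x) = act' g (p x)"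
    and gen: "\<And>S. S \<in> sets N \<Longrightarrow> mp_action.lip_approximable G N act' F0 S"
    using A.exists_factor[OF G(2) prob_space_axioms f_meas] by blast
  interpret N: mp_action G N act' using G(1) N(2) by (rule mp_action_of_pmp_action)
  interpret PN: prob_space N using N(1) by (simp add: standard_prob_space_def)
  have intN: "(LINT r|N. u r) = (LINT x|M. u (p x))" if "u \<in> borel_measurable N" for u :: "real \<Rightarrow> real"
    using integral_distr[OF p(1) that] p(2) by simp
  have integrableN: "integrable N u \<longleftrightarrow> integrable M (\<lambda>x. u (p x))" if "u \<in> borel_measurable N" for u :: "real \<Rightarrow> real"
    using integrable_distr_eq[OF p(1) that] p(2) by simp
  have F0_l2: "F0 \<in> l2 N"
  proof -
    have "integrable M (\<lambda>x. (F0 (p x))\<^sup>2) \<longleftrightarrow> integrable M (\<lambda>x. (f x)\<^sup>2)"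
      by (intro Bochner_Integration.integrable_cong refl) (simp add: F0(2))
    then have "integrable M (\<lambda>x. (F0 (p x))\<^sup>2)" using f2 by (simp add: l2_def)
    then show ?thesis using F0(1) integrableN[of "\<lambda>r. (F0 r)\<^sup>2"] by (simp add: l2_def)
  qed
  have "\<not> one_atom N"
  proof
    assume "one_atom N"
    then obtain r where r: "measure N {r} = 1" by (auto simp: one_atom_def)
    then have "{r} \<in> sets N" using measure_notin_sets[of "{r}" N] by fastforce
    then have "AE s in N. s \<in> {r}" using r PN.AE_in_set_eq_1 by blast
    then have "AE s in distr M N p. s = r" unfolding p(2) by simp
    then have "AE x in M. p x = r" by (rule AE_distrD[OF p(1)])
    then have c: "AE x in M. f x = F0 r" using AE_space by eventually_elim (metis F0(2))
    \<comment> \<open>A one-atom factor makes \<open>f\<close> almost everywhere constant, and the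
      only constant of mean 0 is 0.\<close>
    have "(LINT x|M. f x) = (LINT x|M. F0 r)" using f_meas c by (intro integral_cong_AE) auto
    then have "F0 r = 0" using f by (simp add: l2_mean0_def prob_space)
    then show False using c ff f2 by (simp add: l2_ip_self_eq_0_iff)
  qed
  then have pos: "0 < sofic_entropy G d \<sigma> N act'"
    using cpe N unfolding completely_positive_entropy_def by blast
  \<comment> \<open>The entropy estimate is applied on the factor, where translates of
    \<open>F0\<close> generate all measurable sets. The elements \<open>a\<close> found for
    \<open>f\<close> work there too: composition with \<open>p\<close> preserves integrals and
    intertwines the translations.\<close>
  have sing: "\<exists>E a. finite E \<and> E \<subseteq> carrier G \<and>
      l2_ip N (F0 - (\<Sum>g\<in>E. a g *\<^sub>R N.translate g F0)) (F0 - (\<Sum>g\<in>E. a g *\<^sub>R N.translate g F0)) < \<epsilon> \<and> (\<Sum>g\<in>E. (a g)\<^sup>2) < \<epsilon>"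
    if eps: "\<epsilon> > 0" for \<epsilon>
  proof -
    obtain E a where E: "finite E" "E \<subseteq> carrier G"
      "l2_ip M (f - (\<Sum>g\<in>E. a g *\<^sub>R A.translate g f)) (f - (\<Sum>g\<in>E. a g *\<^sub>R A.translate g f)) < \<epsilon>" "(\<Sum>g\<in>E. (a g)\<^sup>2) < \<epsilon>"
      using sing0[OF eps] by blast
    let ?u = "F0 - (\<Sum>g\<in>E. a g *\<^sub>R N.translate g F0)"
    have "?u \<in> l2 N"
      using E F0_l2 by (intro subspace_diff[OF subspace_l2] subspace_sum[OF subspace_l2] subspace_scale[OF subspace_l2] N.translate_l2) auto
    then have meas: "(\<lambda>r. ?u r * ?u r) \<in> borel_measurable N" by (intro borel_measurable_times l2_measurable)
    have "?u (p x) = (f - (\<Sum>g\<in>E. a g *\<^sub>R A.translate g f)) x" if x: "x \<in> space M" for x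
    proof -
      have "N.translate g F0 (p x) = A.translate g f x" if "g \<in> E" for g
        using that E x A.act_space[of "inv\<^bsub>G\<^esub> g" x] equiv[of "inv\<^bsub>G\<^esub> g" x] F0(2)[of "act (inv\<^bsub>G\<^esub> g) x"]
        by (auto simp: N.translate_def A.translate_def)
      then show ?thesis using x by (simp add: sum_fun_apply scaleR_fun_def F0(2))
    qed
    then have "l2_ip N ?u ?u = l2_ip M (f - (\<Sum>g\<in>E. a g *\<^sub>R A.translate g f)) (f - (\<Sum>g\<in>E. a g *\<^sub>R A.translate g f))"
      unfolding l2_ip_def intN[OF meas] by (intro Bochner_Integration.integral_cong refl) simp
    with E(3) have "l2_ip N ?u ?u < \<epsilon>" by (simp only:)
    with E(1,2,4) show ?thesis by (intro exI[of _ E] exI[of _ a] conjI)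
  qed
  have "sofic_entropy G d \<sigma> N act' \<le> 0"
  proof (rule N.sofic_entropy_le_0[OF PN.prob_space_axioms sof F0_l2 _ sing])
    fix S and e :: real assume "S \<in> sets N" "e > 0"
    from N.lip_approximableE[OF gen[OF this(1)] this(2)]
    show "\<exists>E h L. lip_fun E h L \<and> E \<subseteq> carrier G \<and> (LINT x|N. \<bar>indicator S x - h (\<lambda>g. N.translate g F0 x)\<bar>) < e"
      by metis
  qed
  then show False using pos by simp
qed

section \<open>The embedding\<close>

lemma L2_class_rep:
  assumes "\<xi> \<in> L2 M"
  shows "L2_rep \<xi> \<in> L2_fun M" "L2_class M (L2_rep \<xi>) = \<xi>"
proof -
  obtain f where f: "f \<in> L2_fun M" "\<xi> = L2_class M f" using assms by (auto simp: L2_def)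
  show "L2_rep \<xi> \<in> L2_fun M" unfolding f(2) using f(1) by (rule L2_rep_class)
  show "L2_class M (L2_rep \<xi>) = \<xi>"
    unfolding f(2) by (rule L2_class_cong) (rule L2_rep_class(2)[OF f(1)])
qed

lemma L2_fun_iff_l2: "f \<in> L2_fun M \<longleftrightarrow> (\<lambda>x. Re (f x)) \<in> l2 M \<and> (\<lambda>x. Im (f x)) \<in> l2 M"
proof
  assume f: "f \<in> L2_fun M"
  then have [measurable]: "f \<in> borel_measurable M" by (simp add: L2_fun_def)
  have int: "integrable M (\<lambda>x. (cmod (f x))\<^sup>2)" using f by (simp add: L2_fun_def)
  have "integrable M (\<lambda>x. (Re (f x))\<^sup>2)" "integrable M (\<lambda>x. (Im (f x))\<^sup>2)"
    by (rule Bochner_Integration.integrable_bound[OF int]; simp add: cmod_power2)+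
  then show "(\<lambda>x. Re (f x)) \<in> l2 M \<and> (\<lambda>x. Im (f x)) \<in> l2 M" by (simp add: l2_def)
next
  assume *: "(\<lambda>x. Re (f x)) \<in> l2 M \<and> (\<lambda>x. Im (f x)) \<in> l2 M"
  then have "f \<in> borel_measurable M" by (subst borel_measurable_complex_iff) (simp add: l2_def)
  moreover have "integrable M (\<lambda>x. (cmod (f x))\<^sup>2)"
    using * unfolding cmod_power2 l2_def by (intro Bochner_Integration.integrable_add) auto
  ultimately show "f \<in> L2_fun M" by (simp add: L2_fun_def)
qed

lemma L2_inner_l2:
  assumes f: "f \<in> L2_fun M" and g: "g \<in> L2_fun M"
  shows "(LINT x|M. f x * cnj (g x)) =
    of_real (l2_ip M (\<lambda>x. Re (f x)) (\<lambda>x. Re (g x)) + l2_ip M (\<lambda>x. Im (f x)) (\<lambda>x. Im (g x)))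
    + \<i> * of_real (l2_ip M (\<lambda>x. Im (f x)) (\<lambda>x. Re (g x)) - l2_ip M (\<lambda>x. Re (f x)) (\<lambda>x. Im (g x)))"
proof -
  note fg = f[unfolded L2_fun_iff_l2] g[unfolded L2_fun_iff_l2]
  have int: "integrable M (\<lambda>x. Re (f x) * Re (g x))" "integrable M (\<lambda>x. Im (f x) * Im (g x))"
    "integrable M (\<lambda>x. Im (f x) * Re (g x))" "integrable M (\<lambda>x. Re (f x) * Im (g x))"
    using fg by (auto intro: l2_mult_integrable)
  have "(LINT x|M. f x * cnj (g x)) =
      (LINT x|M. complex_of_real (Re (f x) * Re (g x) + Im (f x) * Im (g x))
        + \<i> * complex_of_real (Im (f x) * Re (g x) - Re (f x) * Im (g x)))"
    by (intro Bochner_Integration.integral_cong refl) (simp add: complex_eq_iff)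
  also have "\<dots> = (LINT x|M. complex_of_real (Re (f x) * Re (g x) + Im (f x) * Im (g x)))
        + (LINT x|M. \<i> * complex_of_real (Im (f x) * Re (g x) - Re (f x) * Im (g x)))"
    using int by (intro Bochner_Integration.integral_add integrable_mult_right integrable_of_real
        Bochner_Integration.integrable_add Bochner_Integration.integrable_diff)
  also have "\<dots> = of_real (LINT x|M. Re (f x) * Re (g x) + Im (f x) * Im (g x))
        + \<i> * of_real (LINT x|M. Im (f x) * Re (g x) - Re (f x) * Im (g x))"
    by (simp only: integral_mult_right_zero integral_complex_of_real)
  finally show ?thesis using int by (simp add: l2_ip_def)
qed

text \<open>The coefficient map is isometric by the Parseval identity, and equivariant because
  moving a translation to the other side of the inner product multiplies the group index from the
  left. Real and imaginary parts can be treated separately since the frame vectors are real.\<close>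

lemma embeddable_of_parseval_frame:
  fixes M :: "'x measure" and w :: "nat \<Rightarrow> 'x \<Rightarrow> real"
  assumes G: "group G" and M: "prob_space M" and act: "pmp_action G M act"
    and w: "\<And>n. w n \<in> l2_mean0 M"
    and frame: "\<And>u. u \<in> l2_mean0 M \<Longrightarrow>
      ((\<lambda>(n, g). (l2_ip M u (mp_action.translate G act g (w n)))\<^sup>2) has_sum l2_ip M u u) (UNIV \<times> carrier G)"
  shows "embeddable G (koopman_rep G M act) (infinite_multiple (left_regular_rep G))"
proof -
  interpret prob_space M by fact
  have fin: "finite_measure M" by unfold_locales
  interpret A: mp_action G M act using G act by (rule mp_action_of_pmp_action)
  interpret H: hilbert_rep "l2_mean0 M" "l2_ip M" G A.translate using fin by (rule A.hilbert_rep_l2_mean0)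
  let ?C = "count_space (carrier G)" and ?left = "\<lambda>g. \<lambda>x\<in>carrier G. g \<otimes>\<^bsub>G\<^esub> x"
  interpret B: mp_action G ?C ?left using G by (rule mp_action_left_mult)
  let ?V = "l2_mean0 M"
  define T where "T u n g = l2_ip M u (A.translate g (w n))" for u and n :: nat and g
  have T_add: "T (u + v) n g = T u n g + T v n g" if "u \<in> ?V" "v \<in> ?V" "g \<in> carrier G" for u v n g
    using that w by (simp add: T_def H.ip_add)
  have T_scale: "T (r *\<^sub>R u) n g = r * T u n g" if "u \<in> ?V" "g \<in> carrier G" for r u n g
    using that w by (simp add: T_def H.ip_scale)
  have norm: "T u n \<in> l2 ?C" "(\<lambda>n. l2_ip ?C (T u n) (T u n)) sums l2_ip M u u" if u: "u \<in> ?V" for u n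
  proof -
    have hs: "((\<lambda>(n, g). (T u n g)\<^sup>2) has_sum l2_ip M u u) (UNIV \<times> carrier G)"
      using frame[OF u] by (simp add: T_def)
    then have sm: "(\<lambda>(n, g). (T u n g)\<^sup>2) summable_on (UNIV \<times> carrier G)" by (rule has_sum_imp_summable)
    have slice: "(\<lambda>g. (T u n g)\<^sup>2) summable_on carrier G" for n
      using summable_on_SigmaD1[OF sm] by simp
    have abs: "Infinite_Set_Sum.abs_summable_on (\<lambda>g. (T u n g)\<^sup>2) (carrier G)" for n
      unfolding abs_summable_equivalent[symmetric] using slice[of n] by simp
    have int: "integrable ?C (\<lambda>g. (T u n g)\<^sup>2)" for n
      using abs[of n] by (simp only: abs_summable_on_def)
    show "T u n \<in> l2 ?C" using int by (simp add: l2_def)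
    have LINT: "l2_ip ?C (T u n) (T u n) = (\<Sum>\<^sub>\<infinity>g\<in>carrier G. (T u n g)\<^sup>2)" for n
      using infsetsum_infsum[OF abs[of n]] by (simp add: l2_ip_def infsetsum_def power2_eq_square)
    have "((\<lambda>n. \<Sum>\<^sub>\<infinity>g\<in>carrier G. (T u n g)\<^sup>2) has_sum l2_ip M u u) UNIV"
      using hs by (rule has_sum_SigmaD) (simp add: slice)
    then show "(\<lambda>n. l2_ip ?C (T u n) (T u n)) sums l2_ip M u u"
      unfolding LINT by (rule has_sum_imp_sums)
  qed
  interpret C: semi_hilbert "l2 ?C" "l2_ip ?C" by (rule semi_hilbert_l2)
  have polar: "(\<lambda>n. l2_ip ?C (T u n) (T v n)) sums l2_ip M u v" if u: "u \<in> ?V" and v: "v \<in> ?V" for u v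
  proof -
    have uv: "u + v \<in> ?V" using u v by simp
    \<comment> \<open>Polarisation. \<open>T (u + v) n\<close> and \<open>T u n + T v n\<close> are
      compared under the integral because additivity is available on \<open>carrier G\<close>
      only.\<close>
    have "l2_ip ?C (T (u + v) n) (T (u + v) n) = l2_ip ?C (T u n + T v n) (T u n + T v n)" for n
      unfolding l2_ip_def using u v by (intro Bochner_Integration.integral_cong refl) (simp add: T_add)
    then have eq: "l2_ip ?C (T u n) (T v n) = (l2_ip ?C (T (u + v) n) (T (u + v) n) - l2_ip ?C (T u n) (T u n) - l2_ip ?C (T v n) (T v n)) / 2" for n
      using norm(1)[OF u] norm(1)[OF v] by (simp add: C.ip_square_add)
    have lim: "(\<lambda>n. (l2_ip ?C (T (u + v) n) (T (u + v) n) - l2_ip ?C (T u n) (T u n) - l2_ip ?C (T v n) (T v n)) / 2)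
        sums ((l2_ip M (u + v) (u + v) - l2_ip M u u - l2_ip M v v) / 2)"
      using norm(2)[OF uv] norm(2)[OF u] norm(2)[OF v] by (intro sums_divide sums_diff)
    have val: "(l2_ip M (u + v) (u + v) - l2_ip M u u - l2_ip M v v) / 2 = l2_ip M u v"
      using u v by (simp add: H.ip_square_add)
    show ?thesis using lim unfolding eq val .
  qed
  define re where "re f = (\<lambda>x. Re (f x))" for f :: "'x \<Rightarrow> complex"
  define im where "im f = (\<lambda>x. Im (f x))" for f :: "'x \<Rightarrow> complex"
  define TC where "TC f n g = Complex (T (re f) n g) (T (im f) n g)" for f n g
  define K where "K = {f \<in> L2_fun M. re f \<in> ?V \<and> im f \<in> ?V}"
  have re_TC: "(\<lambda>g. Re (TC f n g)) = T (re f) n" "(\<lambda>g. Im (TC f n g)) = T (im f) n" for f n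
    by (auto simp: TC_def)
  have TC_L2: "TC f n \<in> L2_fun ?C" if "f \<in> K" for f n
    using that norm(1) unfolding L2_fun_iff_l2 re_TC by (auto simp: K_def)
  have w_meas: "A.translate g (w n) \<in> borel_measurable M" if "g \<in> carrier G" for g n
    using l2_measurable[OF A.translate_l2[OF that l2_mean0_l2[OF w]]] .
  \<comment> \<open>Coefficients do not see null sets, so the map descends to classes, whichever
    representative \<open>L2_rep\<close> picks.\<close>
  have TC_cong: "TC f n g = TC f' n g" if f: "f \<in> L2_fun M" "f' \<in> L2_fun M" and eq: "AE x in M. f x = f' x" and g: "g \<in> carrier G" for f f' n g
  proof -
    have meas: "f \<in> borel_measurable M" "f' \<in> borel_measurable M" using f by (auto simp: L2_fun_def)
    have "T (re f) n g = T (re f') n g" unfolding T_def l2_ip_def re_def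
      using meas w_meas[OF g, of n] eq by (intro integral_cong_AE) auto
    moreover have "T (im f) n g = T (im f') n g" unfolding T_def l2_ip_def im_def
      using meas w_meas[OF g, of n] eq by (intro integral_cong_AE) auto
    ultimately show ?thesis by (simp add: TC_def)
  qed
  have class_cong: "L2_class ?C F = L2_class ?C F'" if "\<And>g. g \<in> carrier G \<Longrightarrow> F g = F' g" for F F' :: "_ \<Rightarrow> complex"
    using that by (intro L2_class_cong) (simp add: AE_count_space)
  define U where "U \<xi> n = L2_class ?C (TC (L2_rep \<xi>) n)" for \<xi> n
  let ?W = "{\<xi> \<in> L2 M. L2_inner M \<xi> (L2_class M (\<lambda>_. 1)) = 0}"
  have one: "(\<lambda>_. 1) \<in> L2_fun M" by (simp add: L2_fun_def)
  have rep_K: "L2_rep \<xi> \<in> K" if \<xi>: "\<xi> \<in> ?W" for \<xi>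
  proof -
    have f: "L2_rep \<xi> \<in> L2_fun M" "L2_class M (L2_rep \<xi>) = \<xi>" using L2_class_rep[of \<xi> M] \<xi> by simp_all
    have "0 = (LINT x|M. L2_rep \<xi> x * cnj 1)"
      using \<xi> L2_inner_class[OF f(1) one] by (simp add: f(2))
    also have "\<dots> = of_real (l2_ip M (re (L2_rep \<xi>)) (\<lambda>_. 1)) + \<i> * of_real (l2_ip M (im (L2_rep \<xi>)) (\<lambda>_. 1))"
      using L2_inner_l2[OF f(1) one] by (simp add: re_def im_def l2_ip_def)
    finally have "l2_ip M (re (L2_rep \<xi>)) (\<lambda>_. 1) = 0" "l2_ip M (im (L2_rep \<xi>)) (\<lambda>_. 1) = 0"
      by (simp_all add: complex_eq_iff)
    then show ?thesis
      using f(1) f(1)[unfolded L2_fun_iff_l2] by (simp add: K_def l2_mean0_def re_def im_def l2_ip_def)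
  qed
  have rep_W: "L2_rep \<xi> \<in> L2_fun M" if "\<xi> \<in> ?W" for \<xi> using rep_K[OF that] by (simp add: K_def)
  have U_class: "U (L2_class M f) n = L2_class ?C (TC f n)" if f: "f \<in> L2_fun M" for f n
    unfolding U_def using L2_rep_class[OF f] f by (intro class_cong TC_cong) auto
  have inner: "(\<lambda>n. L2_inner ?C (U v n) (U u n)) sums L2_inner M v u" if v: "v \<in> ?W" and u: "u \<in> ?W" for v u
  proof -
    define f f' where "f = L2_rep v" and "f' = L2_rep u"
    have f: "f \<in> K" "f' \<in> K" using rep_K v u by (auto simp: f_def f'_def)
    then have V: "re f \<in> ?V" "im f \<in> ?V" "re f' \<in> ?V" "im f' \<in> ?V" and L: "f \<in> L2_fun M" "f' \<in> L2_fun M" by (auto simp: K_def)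
    have "L2_inner ?C (U v n) (U u n) =
        of_real (l2_ip ?C (T (re f) n) (T (re f') n) + l2_ip ?C (T (im f) n) (T (im f') n))
        + \<i> * of_real (l2_ip ?C (T (im f) n) (T (re f') n) - l2_ip ?C (T (re f) n) (T (im f') n))" for n
      unfolding U_def f_def[symmetric] f'_def[symmetric] L2_inner_class[OF TC_L2[OF f(1)] TC_L2[OF f(2)]]
        L2_inner_l2[OF TC_L2[OF f(1)] TC_L2[OF f(2)]] re_TC ..
    moreover have "L2_inner M v u = of_real (l2_ip M (re f) (re f') + l2_ip M (im f) (im f'))
        + \<i> * of_real (l2_ip M (im f) (re f') - l2_ip M (re f) (im f'))"
      unfolding L2_inner_def f_def[symmetric] f'_def[symmetric] L2_inner_l2[OF L] re_def im_def ..
    moreover have "(\<lambda>n. complex_of_real (l2_ip ?C (T (re f) n) (T (re f') n) + l2_ip ?C (T (im f) n) (T (im f') n))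
        + \<i> * of_real (l2_ip ?C (T (im f) n) (T (re f') n) - l2_ip ?C (T (re f) n) (T (im f') n)))
        sums (of_real (l2_ip M (re f) (re f') + l2_ip M (im f) (im f'))
        + \<i> * of_real (l2_ip M (im f) (re f') - l2_ip M (re f) (im f')))"
      using V by (intro sums_add sums_mult sums_of_real sums_diff polar)
    ultimately show ?thesis by simp
  qed
  have vec_K: "vectors (koopman_rep G M act) = ?W" by (simp add: koopman_rep_def)
  have vec_S: "vectors (infinite_multiple (left_regular_rep G)) =
      {v. (\<forall>n. v n \<in> L2 ?C) \<and> summable (\<lambda>n. Re (L2_inner ?C (v n) (v n)))}"
    by (simp add: infinite_multiple_def left_regular_rep_def translation_rep_def)
  show ?thesis
    unfolding embeddable_def
  proof (intro exI[of _ U] conjI ballI allI)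
    show "U \<in> vectors (koopman_rep G M act) \<rightarrow> vectors (infinite_multiple (left_regular_rep G))"
    proof
      fix v assume "v \<in> vectors (koopman_rep G M act)"
      then have v: "v \<in> ?W" by (simp add: vec_K)
      have "U v n \<in> L2 ?C" for n unfolding U_def L2_def using TC_L2[OF rep_K[OF v]] by (rule imageI)
      moreover have "summable (\<lambda>n. Re (L2_inner ?C (U v n) (U v n)))"
        using sums_Re[OF inner[OF v v]] by (rule sums_summable)
      ultimately show "U v \<in> vectors (infinite_multiple (left_regular_rep G))" by (simp add: vec_S)
    qed
  next
    fix v u assume "v \<in> vectors (koopman_rep G M act)" "u \<in> vectors (koopman_rep G M act)"
    then have v: "v \<in> ?W" and u: "u \<in> ?W" by (simp_all add: vec_K)
    let ?f = "L2_rep v" and ?f' = "L2_rep u"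
    have f: "?f \<in> K" "?f' \<in> K" using rep_K v u by auto
    have sum_L2: "(\<lambda>x. ?f x + ?f' x) \<in> L2_fun M"
    proof -
      have "re ?f + re ?f' \<in> l2 M" "im ?f + im ?f' \<in> l2 M"
        using f by (auto simp: K_def intro!: subspace_add[OF subspace_l2] l2_mean0_l2)
      then show ?thesis unfolding L2_fun_iff_l2 by (simp add: re_def im_def plus_fun_def)
    qed
    show "U (vadd (koopman_rep G M act) v u) = vadd (infinite_multiple (left_regular_rep G)) (U v) (U u)"
    proof
      fix n
      have "U (vadd (koopman_rep G M act) v u) n = U (L2_class M (\<lambda>x. ?f x + ?f' x)) n"
        by (simp add: koopman_rep_def translation_rep_def L2_add_def)
      also have "\<dots> = L2_class ?C (TC (\<lambda>x. ?f x + ?f' x) n)" by (rule U_class[OF sum_L2])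
      also have "\<dots> = L2_class ?C (\<lambda>g. TC ?f n g + TC ?f' n g)"
      proof (rule class_cong)
        fix g assume g: "g \<in> carrier G"
        have "re (\<lambda>x. ?f x + ?f' x) = re ?f + re ?f'" "im (\<lambda>x. ?f x + ?f' x) = im ?f + im ?f'"
          by (auto simp: re_def im_def)
        then show "TC (\<lambda>x. ?f x + ?f' x) n g = TC ?f n g + TC ?f' n g"
          using f g by (simp add: TC_def K_def T_add complex_eq_iff)
      qed
      also have "\<dots> = L2_add ?C (U v n) (U u n)"
        unfolding U_def by (rule L2_add_class[OF TC_L2[OF f(1)] TC_L2[OF f(2)], symmetric])
      finally show "U (vadd (koopman_rep G M act) v u) n = vadd (infinite_multiple (left_regular_rep G)) (U v) (U u) n"
        by (simp add: infinite_multiple_def left_regular_rep_def translation_rep_def)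
    qed
    show "vinner (infinite_multiple (left_regular_rep G)) (U v) (U u) = vinner (koopman_rep G M act) v u"
      using sums_unique[OF inner[OF v u]]
      by (simp add: infinite_multiple_def left_regular_rep_def koopman_rep_def translation_rep_def)
  next
    fix c v assume "v \<in> vectors (koopman_rep G M act)"
    then have v: "v \<in> ?W" by (simp add: vec_K)
    let ?f = "L2_rep v"
    have f: "?f \<in> K" using rep_K v by auto
    have re_c: "re (\<lambda>x. c * ?f x) = Re c *\<^sub>R re ?f + (- Im c) *\<^sub>R im ?f"
      and im_c: "im (\<lambda>x. c * ?f x) = Re c *\<^sub>R im ?f + Im c *\<^sub>R re ?f"
      by (auto simp: re_def im_def scaleR_fun_def)
    have c_L2: "(\<lambda>x. c * ?f x) \<in> L2_fun M"
    proof -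
      have "re (\<lambda>x. c * ?f x) \<in> l2 M" "im (\<lambda>x. c * ?f x) \<in> l2 M"
        unfolding re_c im_c using f
        by (auto simp: K_def intro!: subspace_add[OF subspace_l2] subspace_scale[OF subspace_l2] l2_mean0_l2)
      then show ?thesis unfolding L2_fun_iff_l2 by (simp add: re_def im_def)
    qed
    show "U (vscale (koopman_rep G M act) c v) = vscale (infinite_multiple (left_regular_rep G)) c (U v)"
    proof
      fix n
      have "U (vscale (koopman_rep G M act) c v) n = U (L2_class M (\<lambda>x. c * ?f x)) n"
        by (simp add: koopman_rep_def translation_rep_def L2_scale_def)
      also have "\<dots> = L2_class ?C (TC (\<lambda>x. c * ?f x) n)" by (rule U_class[OF c_L2])
      also have "\<dots> = L2_class ?C (\<lambda>g. c * TC ?f n g)"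
      proof (rule class_cong)
        fix g assume g: "g \<in> carrier G"
        have V: "re ?f \<in> ?V" "im ?f \<in> ?V" using f by (auto simp: K_def)
        then have "T (re (\<lambda>x. c * ?f x)) n g = Re c * T (re ?f) n g - Im c * T (im ?f) n g"
          "T (im (\<lambda>x. c * ?f x)) n g = Re c * T (im ?f) n g + Im c * T (re ?f) n g"
          unfolding re_c im_c using g by (simp_all only: T_add T_scale H.V_scale)
        then show "TC (\<lambda>x. c * ?f x) n g = c * TC ?f n g" by (simp add: TC_def complex_eq_iff)
      qed
      also have "\<dots> = L2_scale ?C c (U v n)"
        unfolding U_def by (rule L2_scale_class[OF TC_L2[OF f], symmetric])
      finally show "U (vscale (koopman_rep G M act) c v) n = vscale (infinite_multiple (left_regular_rep G)) c (U v) n"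
        by (simp add: infinite_multiple_def left_regular_rep_def translation_rep_def)
    qed
  next
    fix g v assume g: "g \<in> carrier G" and "v \<in> vectors (koopman_rep G M act)"
    then have v: "v \<in> ?W" by (simp add: vec_K)
    let ?f = "L2_rep v"
    have f: "?f \<in> K" using rep_K v by auto
    have re_t: "re (\<lambda>x. ?f (act (inv\<^bsub>G\<^esub> g) x)) = A.translate g (re ?f)"
      and im_t: "im (\<lambda>x. ?f (act (inv\<^bsub>G\<^esub> g) x)) = A.translate g (im ?f)"
      by (auto simp: re_def im_def A.translate_def)
    have t_L2: "(\<lambda>x. ?f (act (inv\<^bsub>G\<^esub> g) x)) \<in> L2_fun M"
    proof -
      have "A.translate g (re ?f) \<in> l2 M" "A.translate g (im ?f) \<in> l2 M"
        using f g by (auto simp: K_def intro!: A.translate_l2 l2_mean0_l2)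
      then show ?thesis unfolding L2_fun_iff_l2 by (simp add: re_def im_def A.translate_def)
    qed
    show "U (rho (koopman_rep G M act) g v) = rho (infinite_multiple (left_regular_rep G)) g (U v)"
    proof
      fix n
      have "U (rho (koopman_rep G M act) g v) n = U (L2_class M (\<lambda>x. ?f (act (inv\<^bsub>G\<^esub> g) x))) n"
        by (simp add: koopman_rep_def translation_rep_def L2_translate_def)
      also have "\<dots> = L2_class ?C (TC (\<lambda>x. ?f (act (inv\<^bsub>G\<^esub> g) x)) n)" by (rule U_class[OF t_L2])
      also have "\<dots> = L2_class ?C (\<lambda>h. TC ?f n (?left (inv\<^bsub>G\<^esub> g) h))"
      proof (rule class_cong)
        fix h assume h: "h \<in> carrier G"
        have "T (A.translate g y) n h = T y n (inv\<^bsub>G\<^esub> g \<otimes>\<^bsub>G\<^esub> h)" if y: "y \<in> ?V" for y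
          using y g h w[of n] by (simp add: T_def H.tau_adjoint H.tau_mult_right)
        then show "TC (\<lambda>x. ?f (act (inv\<^bsub>G\<^esub> g) x)) n h = TC ?f n (?left (inv\<^bsub>G\<^esub> g) h)"
          using f h by (simp add: TC_def re_t im_t K_def)
      qed
      also have "\<dots> = L2_translate G ?C ?left g (U v n)"
        unfolding U_def
        by (rule L2_translate_class[OF TC_L2[OF f] g G, symmetric]) (intro conjI B.act_measurable B.act_distr)
      finally show "U (rho (koopman_rep G M act) g v) n = rho (infinite_multiple (left_regular_rep G)) g (U v) n"
        by (simp add: infinite_multiple_def left_regular_rep_def translation_rep_def)
    qed
  qed
qed

theorem corollary1p2:
  fixes G :: "('g, 'm) monoid_scheme"
    and d :: "nat \<Rightarrow> nat"
    and \<sigma> :: "nat \<Rightarrow> 'g \<Rightarrow> nat \<Rightarrow> nat"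
    and M :: "'x measure"
    and act :: "'g \<Rightarrow> 'x \<Rightarrow> 'x"
  assumes "group G"
    and "countable (carrier G)"
    and "sofic_approximation G d \<sigma>"
    and "standard_prob_space M"
    and "pmp_action G M act"
    and "completely_positive_entropy G d \<sigma> M act"
  shows "embeddable G (koopman_rep G M act) (infinite_multiple (left_regular_rep G))"
proof -
  interpret prob_space M using assms(4) by (simp add: standard_prob_space_def)
  have fin: "finite_measure M" by unfold_locales
  interpret A: mp_action G M act using assms(1,5) by (rule mp_action_of_pmp_action)
  interpret H: hilbert_rep "l2_mean0 M" "l2_ip M" G A.translate using fin by (rule A.hilbert_rep_l2_mean0)
  have "\<exists>z. bessel_system (l2_mean0 M) (l2_ip M) G A.translate z"
  proof (rule l2_mean0_countable_total[OF assms(4)])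
    fix e :: "nat \<Rightarrow> 'x \<Rightarrow> real"
    assume e: "\<And>k. e k \<in> l2_mean0 M"
      "\<And>u. \<lbrakk>u \<in> l2_mean0 M; \<And>k. l2_ip M u (e k) = 0\<rbrakk> \<Longrightarrow> l2_ip M u u = 0"
    show ?thesis
      using e cpe_bessel_total[OF assms] by (rule H.exists_bessel_system)
  qed
  then obtain z where "bessel_system (l2_mean0 M) (l2_ip M) G A.translate z" ..
  then interpret Z: bessel_system "l2_mean0 M" "l2_ip M" G A.translate z .
  obtain w :: "nat \<Rightarrow> 'x \<Rightarrow> real" where w: "\<forall>n. w n \<in> l2_mean0 M"
    "\<forall>u\<in>l2_mean0 M. ((\<lambda>(n, g). (l2_ip M u (A.translate g (w n)))\<^sup>2) has_sum l2_ip M u u) (UNIV \<times> carrier G)"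
    using Z.parseval_frame by blast
  show ?thesis
    using assms(1) prob_space_axioms assms(5) w(1)[THEN spec] w(2)[THEN bspec] by (rule embeddable_of_parseval_frame)
qed

end
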